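(* Let $\epsilon\in(0,1)$. For any finite set $\mathcal{Q}$ and distributions $(p_Q,p_{X_1|Q},p_{X_2|Q})$ with $\mathrm{rank}(\mathbf{V})\ge1$, define $\mathscr{R}(n,\epsilon;p_Q,p_{X_1|Q},p_{X_2|Q})$ as the set of rate pairs $(R_1,R_2)$ whose rate vector $\mathbf{R}=(R_1,R_2,R_1+R_2)^T$ satisfies $$\mathbf{R}\in\mathbf{I}-\frac{1}{\sqrt n}\mathscr{S}(\mathbf{V},\epsilon)-\frac{\nu\log n}{n}\mathbf{1},\qquad \nu:=|\mathcal{Q}||\mathcal{X}_1||\mathcal{X}_2||\mathcal{Y}|+\kappa+\tfrac32.$$ Then for all $n$ sufficiently large, $$\bigcup_{p_Q,p_{X_1|Q},p_{X_2|Q}}\mathscr{R}(n,\epsilon;p_Q,p_{X_1|Q},p_{X_2|Q})\subset\mathscr{C}^*_{\mathrm{MAC}}(n,\epsilon).$$ Moreover, for every such triple there exists a triple with $|\mathcal{Q}|\le 9$ having the same $\mathbf{I}$ and $\mathbf{V}$, so the union may be restricted to $|\mathcal{Q}|\le9$.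
   Context: A discrete memoryless MAC is given by finite sets $\mathcal{X}_1,\mathcal{X}_2,\mathcal{Y}$ and a stochastic matrix $W:\mathcal{X}_1\times\mathcal{X}_2\to\mathcal{Y}$, used memorylessly: $W^n(y^n|x_1^n,x_2^n)=\prod_{k=1}^nW(y_k|x_{1k},x_{2k})$. Logarithms are base 2; $[2^{nR}]:=\{1,\dots,\lceil2^{nR}\rceil\}$. An $(n,2^{nR_1},2^{nR_2},\epsilon)$-code consists of encoders $f_j:[2^{nR_j}]\to\mathcal{X}_j^n$, $j=1,2$, and a decoder $\varphi:\mathcal{Y}^n\to[2^{nR_1}]\times[2^{nR_2}]$ such that, with $M_1,M_2$ independent and uniform on their message sets and $Y^n$ the channel output for inputs $f_1(M_1),f_2(M_2)$, $\mathsf{P}(\varphi(Y^n)\ne(M_1,M_2))\le\epsilon$. $\mathscr{C}^*_{\mathrm{MAC}}(n,\epsilon)$ is the set of $(R_1,R_2)$ for which such a code exists. Given $(p_Q,p_{X_1|Q},p_{X_2|Q})$ on a finite set $\mathcal{Q}$, let $(Q,X_1,X_2,Y)\sim p:=p_Qp_{X_1|Q}p_{X_2|Q}W$, and define $p_{Y|X_2,Q}(y|x_2,q):=\sum_{x_1}p_{X_1|Q}(x_1|q)W(y|x_1,x_2)$, $p_{Y|X_1,Q}$ analogously, and $p_{Y|Q}(y|q):=\sum_{x_1,x_2}p_{X_1|Q}(x_1|q)p_{X_2|Q}(x_2|q)W(y|x_1,x_2)$. The information density vector is $\mathbf{i}(Q,X_1,X_2,Y):=(\log\frac{W(Y|X_1,X_2)}{p_{Y|X_2,Q}(Y|X_2,Q)},\log\frac{W(Y|X_1,X_2)}{p_{Y|X_1,Q}(Y|X_1,Q)},\log\frac{W(Y|X_1,X_2)}{p_{Y|Q}(Y|Q)})^T$;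 $\mathbf{I}:=\mathsf{E}[\mathbf{i}]=(I(X_1;Y|X_2,Q),I(X_2;Y|X_1,Q),I(X_1,X_2;Y|Q))^T$ with entries $I_t$, and $\mathbf{V}:=\mathrm{Cov}(\mathbf{i}(Q,X_1,X_2,Y))$. $\kappa:=\max_{1\le t\le3}\|\nabla_p^2I_t(p)\|_2$, the maximal spectral norm of the Hessian of $I_t$ viewed as a function of the joint distribution vector $p$. For positive semidefinite $\mathbf{V}\in\mathbb{R}^{3\times3}$, $\mathbf{Z}\sim\mathcal{N}(\mathbf{0},\mathbf{V})$ and $\mathscr{S}(\mathbf{V},\epsilon):=\{\mathbf{z}\in\mathbb{R}^3:\mathsf{P}(\mathbf{Z}\le\mathbf{z})\ge1-\epsilon\}$ (componentwise inequality); $\mathbf{1}$ is the all-ones vector.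
   Formalization: Where the Hessian defining κ does not exist (the joint distribution p has zero entries, e.g. channels with zero transition probabilities or inputs without full support), κ is undefined; there κ is read as infinite and the region R(n,ε;·) is taken to be empty. *)

theory Defs
  imports "HOL-Probability.Probability"
begin

definition stochastic_MAC :: "('x1::finite \<Rightarrow> 'x2::finite \<Rightarrow> 'y::finite \<Rightarrow> real) \<Rightarrow> bool" where
  "stochastic_MAC W \<longleftrightarrow> (\<forall>x1 x2 y. 0 \<le> W x1 x2 y) \<and> (\<forall>x1 x2. (\<Sum>y\<in>UNIV. W x1 x2 y) = 1)"

definition Wn :: "('x1 \<Rightarrow> 'x2 \<Rightarrow> 'y \<Rightarrow> real) \<Rightarrow> nat \<Rightarrow> 'x1 list \<Rightarrow> 'x2 list \<Rightarrow> 'y list \<Rightarrow> real" where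
  "Wn W n xs1 xs2 ys = (\<Prod>k<n. W (xs1 ! k) (xs2 ! k) (ys ! k))"

definition msg_size :: "nat \<Rightarrow> real \<Rightarrow> nat" where
  "msg_size n R = nat \<lceil>2 powr (real n * R)\<rceil>"

definition msg_set :: "nat \<Rightarrow> real \<Rightarrow> nat set" where
  "msg_set n R = {1..msg_size n R}"

definition error_prob ::
  "('x1 \<Rightarrow> 'x2 \<Rightarrow> 'y::finite \<Rightarrow> real) \<Rightarrow> nat \<Rightarrow> real \<Rightarrow> real \<Rightarrow>
   (nat \<Rightarrow> 'x1 list) \<Rightarrow> (nat \<Rightarrow> 'x2 list) \<Rightarrow> ('y list \<Rightarrow> nat \<times> nat) \<Rightarrow> real" where
  "error_prob W n R1 R2 f1 f2 dec =
     1 - (\<Sum>m1\<in>msg_set n R1. \<Sum>m2\<in>msg_set n R2.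
            (\<Sum>ys\<in>{ys. length ys = n}. (if dec ys = (m1, m2) then Wn W n (f1 m1) (f2 m2) ys else 0)))
         / (real (msg_size n R1) * real (msg_size n R2))"

definition is_MAC_code ::
  "('x1 \<Rightarrow> 'x2 \<Rightarrow> 'y::finite \<Rightarrow> real) \<Rightarrow> nat \<Rightarrow> real \<Rightarrow> real \<Rightarrow> real \<Rightarrow>
   (nat \<Rightarrow> 'x1 list) \<Rightarrow> (nat \<Rightarrow> 'x2 list) \<Rightarrow> ('y list \<Rightarrow> nat \<times> nat) \<Rightarrow> bool" where
  "is_MAC_code W n R1 R2 eps f1 f2 dec \<longleftrightarrow>
     (\<forall>m\<in>msg_set n R1. length (f1 m) = n) \<and>
     (\<forall>m\<in>msg_set n R2. length (f2 m) = n) \<and>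
     (\<forall>ys. length ys = n \<longrightarrow> dec ys \<in> msg_set n R1 \<times> msg_set n R2) \<and>
     error_prob W n R1 R2 f1 f2 dec \<le> eps"

definition C_MAC :: "('x1 \<Rightarrow> 'x2 \<Rightarrow> 'y::finite \<Rightarrow> real) \<Rightarrow> nat \<Rightarrow> real \<Rightarrow> (real \<times> real) set" where
  "C_MAC W n eps = {(R1, R2). \<exists>f1 f2 dec. is_MAC_code W n R1 R2 eps f1 f2 dec}"

definition valid_input ::
  "nat set \<Rightarrow> (nat \<Rightarrow> real) \<Rightarrow> (nat \<Rightarrow> 'x1::finite \<Rightarrow> real) \<Rightarrow> (nat \<Rightarrow> 'x2::finite \<Rightarrow> real) \<Rightarrow> bool" where
  "valid_input Q pQ p1 p2 \<longleftrightarrow> finite Q \<and> Q \<noteq> {} \<and>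
     (\<forall>q\<in>Q. 0 \<le> pQ q) \<and> (\<Sum>q\<in>Q. pQ q) = 1 \<and>
     (\<forall>q\<in>Q. (\<forall>x. 0 \<le> p1 q x) \<and> (\<Sum>x\<in>UNIV. p1 q x) = 1) \<and>
     (\<forall>q\<in>Q. (\<forall>x. 0 \<le> p2 q x) \<and> (\<Sum>x\<in>UNIV. p2 q x) = 1)"

definition jdom :: "nat set \<Rightarrow> (nat \<times> 'x1 \<times> 'x2 \<times> 'y) set" where
  "jdom Q = Q \<times> UNIV"

definition joint ::
  "('x1 \<Rightarrow> 'x2 \<Rightarrow> 'y \<Rightarrow> real) \<Rightarrow> (nat \<Rightarrow> real) \<Rightarrow> (nat \<Rightarrow> 'x1 \<Rightarrow> real) \<Rightarrow> (nat \<Rightarrow> 'x2 \<Rightarrow> real)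
   \<Rightarrow> nat \<times> 'x1 \<times> 'x2 \<times> 'y \<Rightarrow> real" where
  "joint W pQ p1 p2 = (\<lambda>(q, x1, x2, y). pQ q * p1 q x1 * p2 q x2 * W x1 x2 y)"

definition info_density ::
  "('x1::finite \<Rightarrow> 'x2::finite \<Rightarrow> 'y \<Rightarrow> real) \<Rightarrow> (nat \<Rightarrow> 'x1 \<Rightarrow> real) \<Rightarrow> (nat \<Rightarrow> 'x2 \<Rightarrow> real)
   \<Rightarrow> nat \<times> 'x1 \<times> 'x2 \<times> 'y \<Rightarrow> real^3" where
  "info_density W p1 p2 = (\<lambda>(q, x1, x2, y).
     (let pY_X2Q = (\<Sum>a\<in>UNIV. p1 q a * W a x2 y);
          pY_X1Q = (\<Sum>b\<in>UNIV. p2 q b * W x1 b y);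
          pY_Q   = (\<Sum>a\<in>UNIV. \<Sum>b\<in>UNIV. p1 q a * p2 q b * W a b y)
      in vector [log 2 (W x1 x2 y / pY_X2Q), log 2 (W x1 x2 y / pY_X1Q), log 2 (W x1 x2 y / pY_Q)]))"

definition Ivec ::
  "('x1::finite \<Rightarrow> 'x2::finite \<Rightarrow> 'y::finite \<Rightarrow> real) \<Rightarrow> nat set \<Rightarrow> (nat \<Rightarrow> real) \<Rightarrow> (nat \<Rightarrow> 'x1 \<Rightarrow> real)
   \<Rightarrow> (nat \<Rightarrow> 'x2 \<Rightarrow> real) \<Rightarrow> real^3" where
  "Ivec W Q pQ p1 p2 = (\<Sum>a\<in>jdom Q. joint W pQ p1 p2 a *\<^sub>R info_density W p1 p2 a)"

definition Vmat ::
  "('x1::finite \<Rightarrow> 'x2::finite \<Rightarrow> 'y::finite \<Rightarrow> real) \<Rightarrow> nat set \<Rightarrow> (nat \<Rightarrow> real) \<Rightarrow> (nat \<Rightarrow> 'x1 \<Rightarrow> real)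
   \<Rightarrow> (nat \<Rightarrow> 'x2 \<Rightarrow> real) \<Rightarrow> real^3^3" where
  "Vmat W Q pQ p1 p2 = (\<chi> s t. \<Sum>a\<in>jdom Q. joint W pQ p1 p2 a *
       (info_density W p1 p2 a $ s - Ivec W Q pQ p1 p2 $ s) *
       (info_density W p1 p2 a $ t - Ivec W Q pQ p1 p2 $ t))"

definition MI_fun :: "nat set \<Rightarrow> nat \<Rightarrow> (nat \<times> 'x1::finite \<times> 'x2::finite \<times> 'y::finite \<Rightarrow> real) \<Rightarrow> real" where
  "MI_fun Q t r = (\<Sum>(q, x1, x2, y)\<in>jdom Q. r (q, x1, x2, y) * log 2
     (let rq   = (\<Sum>a\<in>UNIV. \<Sum>b\<in>UNIV. \<Sum>c\<in>UNIV. r (q, a, b, c));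
          rq1  = (\<Sum>b\<in>UNIV. \<Sum>c\<in>UNIV. r (q, x1, b, c));
          rq2  = (\<Sum>a\<in>UNIV. \<Sum>c\<in>UNIV. r (q, a, x2, c));
          rq12 = (\<Sum>c\<in>UNIV. r (q, x1, x2, c));
          rq1y = (\<Sum>b\<in>UNIV. r (q, x1, b, y));
          rq2y = (\<Sum>a\<in>UNIV. r (q, a, x2, y));
          rqy  = (\<Sum>a\<in>UNIV. \<Sum>b\<in>UNIV. r (q, a, b, y))
      in if t = 1 then r (q, x1, x2, y) * rq2 / (rq12 * rq2y)
         else if t = 2 then r (q, x1, x2, y) * rq1 / (rq12 * rq1y)
         else r (q, x1, x2, y) * rq / (rq12 * rqy)))"

definition second_partial :: "(('i \<Rightarrow> real) \<Rightarrow> real) \<Rightarrow> ('i \<Rightarrow> real) \<Rightarrow> 'i \<Rightarrow> 'i \<Rightarrow> real \<Rightarrow> bool" where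
  "second_partial f p a b h \<longleftrightarrow> (\<exists>g. eventually (\<lambda>s.
      ((\<lambda>t. f (\<lambda>i. p i + t * indicator {a} i + s * indicator {b} i)) has_real_derivative g s) (at 0)) (nhds 0)
     \<and> (g has_real_derivative h) (at 0))"

definition hessian_exists :: "(('i \<Rightarrow> real) \<Rightarrow> real) \<Rightarrow> 'i set \<Rightarrow> ('i \<Rightarrow> real) \<Rightarrow> bool" where
  "hessian_exists f D p \<longleftrightarrow> (\<forall>a\<in>D. \<forall>b\<in>D. \<exists>h. second_partial f p a b h)"

definition hessian :: "(('i \<Rightarrow> real) \<Rightarrow> real) \<Rightarrow> ('i \<Rightarrow> real) \<Rightarrow> 'i \<Rightarrow> 'i \<Rightarrow> real" where
  "hessian f p a b = (THE h. second_partial f p a b h)"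

definition spec_norm :: "'i set \<Rightarrow> ('i \<Rightarrow> 'i \<Rightarrow> real) \<Rightarrow> real" where
  "spec_norm D H = Sup {sqrt (\<Sum>a\<in>D. (\<Sum>b\<in>D. H a b * v b)\<^sup>2) | v. (\<Sum>b\<in>D. (v b)\<^sup>2) = 1}"

definition kappa_ok ::
  "('x1::finite \<Rightarrow> 'x2::finite \<Rightarrow> 'y::finite \<Rightarrow> real) \<Rightarrow> nat set \<Rightarrow> (nat \<Rightarrow> real) \<Rightarrow> (nat \<Rightarrow> 'x1 \<Rightarrow> real)
   \<Rightarrow> (nat \<Rightarrow> 'x2 \<Rightarrow> real) \<Rightarrow> bool" where
  "kappa_ok W Q pQ p1 p2 \<longleftrightarrow> (\<forall>t\<in>{1,2,3}. hessian_exists (MI_fun Q t) (jdom Q) (joint W pQ p1 p2))"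

definition kappa ::
  "('x1::finite \<Rightarrow> 'x2::finite \<Rightarrow> 'y::finite \<Rightarrow> real) \<Rightarrow> nat set \<Rightarrow> (nat \<Rightarrow> real) \<Rightarrow> (nat \<Rightarrow> 'x1 \<Rightarrow> real)
   \<Rightarrow> (nat \<Rightarrow> 'x2 \<Rightarrow> real) \<Rightarrow> real" where
  "kappa W Q pQ p1 p2 = Max ((\<lambda>t. spec_norm (jdom Q) (hessian (MI_fun Q t) (joint W pQ p1 p2))) ` {1,2,3})"

definition std_normal3 :: "(real^3) measure" where
  "std_normal3 = density lborel (\<lambda>g. ennreal (\<Prod>i\<in>UNIV. std_normal_density (g $ i)))"

text \<open>P(Z <= z) for Z ~ N(0,V), realised as Z = A g with A A^T = V, g standard normal.\<close>
definition gauss_cdf :: "real^3^3 \<Rightarrow> real^3 \<Rightarrow> real" where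
  "gauss_cdf V z = measure std_normal3
      {g. \<forall>i. ((SOME A :: real^3^3. A ** transpose A = V) *v g) $ i \<le> z $ i}"

definition S_set :: "real^3^3 \<Rightarrow> real \<Rightarrow> (real^3) set" where
  "S_set V eps = {z. gauss_cdf V z \<ge> 1 - eps}"

definition nu ::
  "('x1::finite \<Rightarrow> 'x2::finite \<Rightarrow> 'y::finite \<Rightarrow> real) \<Rightarrow> nat set \<Rightarrow> (nat \<Rightarrow> real) \<Rightarrow> (nat \<Rightarrow> 'x1 \<Rightarrow> real)
   \<Rightarrow> (nat \<Rightarrow> 'x2 \<Rightarrow> real) \<Rightarrow> real" where
  "nu W Q pQ p1 p2 = real (card Q * CARD('x1) * CARD('x2) * CARD('y)) + kappa W Q pQ p1 p2 + 3 / 2"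

text \<open>If some Hessian does not exist, kappa (hence nu) is +infinity and the region is empty.\<close>
definition region ::
  "('x1::finite \<Rightarrow> 'x2::finite \<Rightarrow> 'y::finite \<Rightarrow> real) \<Rightarrow> nat \<Rightarrow> real \<Rightarrow> nat set \<Rightarrow> (nat \<Rightarrow> real)
   \<Rightarrow> (nat \<Rightarrow> 'x1 \<Rightarrow> real) \<Rightarrow> (nat \<Rightarrow> 'x2 \<Rightarrow> real) \<Rightarrow> (real \<times> real) set" where
  "region W n eps Q pQ p1 p2 =
     (if kappa_ok W Q pQ p1 p2 then
       {(R1, R2). \<exists>z\<in>S_set (Vmat W Q pQ p1 p2) eps.
          vector [R1, R2, R1 + R2] = Ivec W Q pQ p1 p2 - (1 / sqrt (real n)) *\<^sub>R z
             - (nu W Q pQ p1 p2 * log 2 (real n) / real n) *\<^sub>R (1 :: real^3)}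
      else {})"

end

theory Submission
  imports Defs
begin

text \<open>
  Random coding with a threshold decoder, over codebooks drawn according to a fixed time-sharing
  sequence, has error probability at most the probability that some component of the normalised
  information density falls below its threshold, plus \<open>3 / n\<close>. Averaged over the time-sharing
  sequence this is a question about sums of independent vectors, answered by a Berry--Esseen bound
  for orthants with error of order \<open>1 / sqrt (n * p_min)\<close>, where \<open>p_min\<close> is the smallest positive
  value of the joint distribution. The covariance may be singular or nearly so, hence the bound is
  proved for standardised vectors (Lindeberg replacement and induction on \<open>n\<close>), the orthant being
  mapped by a factor of the covariance.

  The threshold \<open>n\<close> has to be uniform in the input distribution, and this is what \<open>kappa\<close> is good for:
  existence of the Hessian forces full support, and then \<open>kappa\<close> is at least a constant times
  \<open>1 / p_min\<close>. So the backoff \<open>nu * log n / n\<close> either makes the rates nonpositive or buys, by an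
  anti-concentration estimate for Gaussian orthants of measure bounded away from 0 and 1, more
  probability than the Berry--Esseen error costs.

  For the cardinality bound, mean and covariance are determined by nine functionals averaged over
  the time-sharing variable. These are continuous on the connected set of pairs of input
  distributions, so nine points suffice by the Fenchel--Bunt refinement of Caratheodory's theorem.
\<close>

section \<open>Isotropic Gaussian densities\<close>

text \<open>The threshold on n precedes the choice of the input distributions, so constants may
  depend on \<open>W\<close> and \<open>eps\<close> only, while the smallest eigenvalue of the
  covariance and the smallest probability are uncontrolled. Two features remove the eigenvalues. A
  summand standardised on the range of the covariance has squared norm at most 1/p(a), a leverage
  bound blind to eigenvalues; and shells of orthants are measured in units of the row norms of the
  factor \<open>A\<close>, which turns them into translations of isotropic Gaussians. The loss is
  then M gamma / sqrt n with gamma^2 of order 1 + kappa. As gamma \<le> gamma^2 and gamma^2 is at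
  most a constant times nu - 1, the shift (nu - 1) log n / sqrt n of the argument beats it by a
  factor log n; the remaining unit of nu log n pays for three confusion events of probability at
  most 1/n each. Anti-concentration saturates for large shifts, so gamma / sqrt n has to be small as
  well: this holds when n exceeds a constant times nu log n, which is the source of the case
  distinction on the rates. The rank assumption enters as the existence of two input pairs and of
  two possible outputs.\<close>

lemma Basis_vec_axis: "(Basis :: (real^'n) set) = range (\<lambda>i. axis i 1)"
  by (auto simp: Basis_vec_def)

lemma nn_integral_lborel_prod_vec:
  fixes f :: "'n::finite \<Rightarrow> real \<Rightarrow> real"
  assumes [measurable]: "\<And>i. f i \<in> borel_measurable borel"
    and nn: "\<And>i x. 0 \<le> f i x"
  shows "(\<integral>\<^sup>+x. ennreal (\<Prod>i\<in>UNIV. f i ((x::real^'n) $ i)) \<partial>lborel) = (\<Prod>i\<in>UNIV. \<integral>\<^sup>+x. ennreal (f i x) \<partial>lborel)"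
proof -
  have inj: "inj (\<lambda>i::'n. axis i (1::real))"
    by (auto simp: inj_def axis_eq_axis)
  define g where "g b = f (the_inv (\<lambda>i::'n. axis i (1::real)) b)" for b
  have g: "g (axis i 1) = f i" for i
    unfolding g_def by (simp add: the_inv_f_f[OF inj])
  have pr: "(\<Prod>b\<in>Basis. h b) = (\<Prod>i\<in>UNIV. h (axis i 1))" for h :: "real^'n \<Rightarrow> 'b::comm_monoid_mult"
    unfolding Basis_vec_axis by (simp add: prod.reindex[OF inj])
  have "(\<integral>\<^sup>+x. (\<Prod>b\<in>Basis. ennreal (g b (x \<bullet> b))) \<partial>lborel) = (\<Prod>b\<in>Basis. (\<integral>\<^sup>+x. ennreal (g b x) \<partial>lborel))"
    by (rule nn_integral_lborel_prod) (auto simp: g_def)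
  then show ?thesis
    unfolding pr g by (simp add: prod_ennreal nn cart_eq_inner_axis)
qed

text \<open>The density of N(0, s^2 Id). All smoothing is isotropic and takes place in the
  standardised space; the factor \<open>A\<close> is applied only inside the orthant, which is what
  allows it to be singular.\<close>

definition gd :: "real \<Rightarrow> real^'n \<Rightarrow> real" where
  "gd s y = (\<Prod>i\<in>UNIV. normal_density 0 s (y $ i))"

lemma gd_measurable[measurable]: "gd s \<in> borel_measurable borel"
  unfolding gd_def by measurable

lemma gd_nonneg[simp]: "0 \<le> gd s y"
  unfolding gd_def by (intro prod_nonneg) simp

lemma gd_eq: "gd s (y::real^'n) = (1 / sqrt (2 * pi * s\<^sup>2)) ^ CARD('n) * exp (- (y \<bullet> y) / (2 * s\<^sup>2))"
proof -
  have "gd s y = (\<Prod>i\<in>(UNIV::'n set). 1 / sqrt (2 * pi * s\<^sup>2)) * (\<Prod>i\<in>UNIV. exp (- (y $ i * y $ i) / (2 * s\<^sup>2)))"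
    unfolding gd_def normal_density_def prod.distrib[symmetric] by (simp add: power2_eq_square)
  also have "(\<Prod>i\<in>UNIV. exp (- (y $ i * y $ i) / (2 * s\<^sup>2))) = exp (- (y \<bullet> y) / (2 * s\<^sup>2))"
    by (simp add: exp_sum[symmetric] inner_vec_def sum_negf sum_divide_distrib)
  finally show ?thesis by (simp add: power_one_over)
qed

lemma nn_integral_gd: "s > 0 \<Longrightarrow> (\<integral>\<^sup>+y. ennreal (gd s (y::real^'n)) \<partial>lborel) = 1"
  unfolding gd_def
  by (subst nn_integral_lborel_prod_vec) (auto simp: nn_integral_eq_integral)

lemma has_bochner_integral_gd: "s > 0 \<Longrightarrow> has_bochner_integral lborel (gd s :: real^'n \<Rightarrow> real) 1"
  by (intro has_bochner_integral_nn_integral) (auto simp: nn_integral_gd)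

lemma integrable_gd[simp]: "s > 0 \<Longrightarrow> integrable lborel (gd s :: real^'n \<Rightarrow> real)"
  and integral_gd[simp]: "s > 0 \<Longrightarrow> (\<integral>y. gd s (y::real^'n) \<partial>lborel) = 1"
  using has_bochner_integral_gd has_bochner_integral_iff by blast+

text \<open>Coordinates separate, so the one-dimensional convolution identity suffices.\<close>

lemma nn_integral_gd_conv:
  assumes "0 < s" "0 < t"
  shows "(\<integral>\<^sup>+y. ennreal (gd s (x - y) * gd t y) \<partial>lborel) = ennreal (gd (sqrt (s\<^sup>2 + t\<^sup>2)) (x::real^'n))"
proof -
  have "(\<integral>\<^sup>+y. ennreal (gd s (x - y) * gd t y) \<partial>lborel)
    = (\<integral>\<^sup>+y. ennreal (\<Prod>i\<in>UNIV. normal_density 0 s (x $ i - y $ i) * normal_density 0 t (y $ i)) \<partial>lborel)"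
    by (simp add: gd_def prod.distrib)
  also have "\<dots> = (\<Prod>i\<in>UNIV. \<integral>\<^sup>+y. ennreal (normal_density 0 s (x $ i - y) * normal_density 0 t y) \<partial>lborel)"
    by (subst nn_integral_lborel_prod_vec[of "\<lambda>i v. normal_density 0 s (x $ i - v) * normal_density 0 t v"]) auto
  also have "\<dots> = (\<Prod>i\<in>UNIV. ennreal (normal_density 0 (sqrt (s\<^sup>2 + t\<^sup>2)) (x $ i)))"
    using conv_normal_density_zero_mean[OF assms] by (auto simp: fun_eq_iff intro!: prod.cong)
  also have "\<dots> = ennreal (gd (sqrt (s\<^sup>2 + t\<^sup>2)) x)"
    by (simp add: gd_def prod_ennreal)
  finally show ?thesis .
qed

lemma lborel_shift: "distr lborel borel (\<lambda>x. x + c) = (lborel :: (real^'n) measure)"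
  using lborel_affine[of 1 c] by (simp add: density_1 add.commute)

lemma integral_shift:
  fixes f :: "real^'n \<Rightarrow> real"
  assumes "f \<in> borel_measurable borel"
  shows "(\<integral>x. f (x + c) \<partial>lborel) = (\<integral>x. f x \<partial>lborel)"
  by (subst (2) lborel_shift[of c, symmetric], subst integral_distr) (use assms in auto)

lemma integrable_shift:
  fixes f :: "real^'n \<Rightarrow> real"
  assumes "integrable lborel f"
  shows "integrable lborel (\<lambda>x. f (x + c))"
proof -
  have "f \<in> borel_measurable borel" using assms by (auto dest: borel_measurable_integrable)
  then show ?thesis
    using assms integrable_distr_eq[of "\<lambda>x. x + c" lborel borel f] unfolding lborel_shift[of c] by auto
qed

section \<open>Taylor expansion of the Gaussian density in shift and variance\<close>

lemma one_plus_pow4_le_exp: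
  fixes x :: real assumes "0 \<le> x" shows "(1 + x) ^ 4 \<le> 64 ^ 4 * exp (x\<^sup>2 / 8)"
proof -
  have "1 + x \<le> 2 + x\<^sup>2" using assms sum_squares_bound[of x 1] by (simp add: power2_eq_square) 
  also have "\<dots> \<le> 64 * (1 + x\<^sup>2 / 32)" by simp
  also have "\<dots> \<le> 64 * exp (x\<^sup>2 / 32)" by (rule mult_left_mono[OF exp_ge_add_one_self]) simp
  finally have "(1 + x) ^ 4 \<le> (64 * exp (x\<^sup>2 / 32)) ^ 4" using assms by (intro power_mono) auto
  also have "\<dots> = 64 ^ 4 * exp (x\<^sup>2 / 8)" unfolding power_mult_distrib by (simp add: exp_of_nat_mult[symmetric])
  finally show ?thesis .
qed

text \<open>The factor exp(-|y|^2 / (4 s^2)) is what survives of the density after a shift by at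
  most s or a variance increase from s^2 to at most 2 s^2. With x = |y| / s, half of the exponent
  x^2/4 is spent on the polynomial; the other half is exactly the exponent of a Gaussian of
  deviation 2 s, and 2 ^ CARD('n) is the ratio of the normalisations. Degree 4 covers every
  polynomial in the Taylor remainders.\<close>

lemma gd_double_le:
  fixes y :: "real^'n" assumes s: "0 < s"
  shows "(1 / sqrt (2 * pi * s\<^sup>2)) ^ CARD('n) * exp (- (y \<bullet> y) / (4 * s\<^sup>2)) * (1 + norm y / s) ^ 4
     \<le> 64 ^ 4 * 2 ^ CARD('n) * gd (2 * s) y"
proof -
  let ?n = "CARD('n)"
  let ?x = "norm y / s"
  have yy: "y \<bullet> y / s\<^sup>2 = ?x\<^sup>2" by (simp add: power_divide power2_norm_eq_inner)
  let ?c = "(1 / sqrt (2 * pi * s\<^sup>2)) ^ ?n"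
  have e4: "exp (- (y \<bullet> y) / (4 * s\<^sup>2)) = exp (- ?x\<^sup>2 / 4)" unfolding yy[symmetric] by (simp add: field_simps)
  have e8: "exp (- (y \<bullet> y) / (2 * (2 * s)\<^sup>2)) = exp (- ?x\<^sup>2 / 8)"
    unfolding yy[symmetric] by (simp add: field_simps)
  have "2 * pi * (2 * s)\<^sup>2 = 2\<^sup>2 * (2 * pi * s\<^sup>2)" by (simp add: power_mult_distrib)
  then have "sqrt (2 * pi * (2 * s)\<^sup>2) = 2 * sqrt (2 * pi * s\<^sup>2)" by (simp only: real_sqrt_mult) simp
  then have c: "?c = 2 ^ ?n * (1 / sqrt (2 * pi * (2 * s)\<^sup>2)) ^ ?n" by (simp add: power_mult_distrib[symmetric])
  have "?c * exp (- ?x\<^sup>2 / 4) * (1 + ?x) ^ 4 \<le> ?c * exp (- ?x\<^sup>2 / 4) * (64 ^ 4 * exp (?x\<^sup>2 / 8))"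
    using s by (intro mult_left_mono one_plus_pow4_le_exp) auto
  also have "\<dots> = 64 ^ 4 * ?c * exp (- ?x\<^sup>2 / 8)"
    by (simp add: mult_exp_exp)
  also have "\<dots> = 64 ^ 4 * 2 ^ ?n * gd (2 * s) y" unfolding gd_eq e8 c by (simp only: mult_ac)
  finally show ?thesis unfolding e4 .
qed

text \<open>From |y|^2 \<le> 2 |y - t h|^2 + 2 |t h|^2 the exponent loses a factor two, and the part
  |t h| \<le> s costs the constant exp(1/2).\<close>

lemma gd_shift_bound:
  fixes y h :: "real^'n" assumes s: "0 < s" and h: "norm h \<le> s" and t: "0 \<le> t" "t \<le> 1"
  shows "gd s (y - t *\<^sub>R h) * (1 + norm y / s) ^ 4 \<le> 64 ^ 4 * exp (1/2) * 2 ^ CARD('n) * gd (2 * s) y"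
proof -
  let ?w = "y - t *\<^sub>R h" and ?c = "(1 / sqrt (2 * pi * s\<^sup>2)) ^ CARD('n)"
  have "norm (t *\<^sub>R h) \<le> 1 * s" unfolding norm_scaleR using assms by (intro mult_mono) auto
  then have th: "(norm (t *\<^sub>R h))\<^sup>2 \<le> s\<^sup>2" by (simp add: power_mono)
  have "norm y \<le> norm ?w + norm (t *\<^sub>R h)" using norm_triangle_ineq[of ?w "t *\<^sub>R h"] by simp
  then have "(norm y)\<^sup>2 \<le> (norm ?w + norm (t *\<^sub>R h))\<^sup>2" by (simp add: power_mono)
  also have "\<dots> \<le> 2 * (norm ?w)\<^sup>2 + 2 * (norm (t *\<^sub>R h))\<^sup>2"
    using sum_squares_bound[of "norm ?w" "norm (t *\<^sub>R h)"] by (simp add: power2_sum)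
  finally have "y \<bullet> y / 2 - s\<^sup>2 \<le> ?w \<bullet> ?w" using th by (simp add: power2_norm_eq_inner)
  then have "- (?w \<bullet> ?w) / (2 * s\<^sup>2) \<le> - (y \<bullet> y) / (4 * s\<^sup>2) + 1/2"
    using s by (simp add: field_simps)
  then have "gd s ?w \<le> ?c * exp (- (y \<bullet> y) / (4 * s\<^sup>2) + 1/2)"
    unfolding gd_eq using s by (intro mult_left_mono) auto
  also have "\<dots> = exp (1/2) * (?c * exp (- (y \<bullet> y) / (4 * s\<^sup>2)))" by (simp only: exp_add mult_ac)
  finally have "gd s ?w * (1 + norm y / s) ^ 4 \<le> exp (1/2) * (?c * exp (- (y \<bullet> y) / (4 * s\<^sup>2)) * (1 + norm y / s) ^ 4)"
    using s by (simp add: mult_right_mono mult.assoc[symmetric])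
  also have "\<dots> \<le> exp (1/2) * (64 ^ 4 * 2 ^ CARD('n) * gd (2 * s) y)"
    using gd_double_le[OF s, of y] by simp
  finally show ?thesis by (simp add: mult_ac)
qed

text \<open>On a line the density is the exponential of a quadratic in \<open>t\<close>, so its
  derivatives are Hermite polynomials times the density.\<close>

lemma gd_line:
  fixes y h :: "real^'n" assumes s: "s \<noteq> 0"
  shows "gd s (y - t *\<^sub>R h) = gd s y * exp (t * (y \<bullet> h / s\<^sup>2) - t\<^sup>2 / 2 * (h \<bullet> h / s\<^sup>2))"
proof -
  have "- ((y - t *\<^sub>R h) \<bullet> (y - t *\<^sub>R h)) / (2 * s\<^sup>2) = - (y \<bullet> y) / (2 * s\<^sup>2) + (t * (y \<bullet> h / s\<^sup>2) - t\<^sup>2 / 2 * (h \<bullet> h / s\<^sup>2))"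
    using s by (simp add: inner_diff_left inner_diff_right inner_commute power2_eq_square field_simps)
  then show ?thesis unfolding gd_eq by (simp only: exp_add mult.assoc)
qed

text \<open>No constant may depend on the distribution of the summands; this one sees only the
  dimension, which the type argument carries.\<close>

definition gdK :: "'n::finite itself \<Rightarrow> real" where
  "gdK _ = 64 ^ 4 * exp (1/2) * 2 ^ CARD('n)"

lemma gd_poly_bound:
  fixes y :: "real^'n" assumes s: "0 < s"
  shows "gd s y * (1 + norm y / s) ^ 4 \<le> gdK TYPE('n) * gd (2 * s) y"
  using gd_shift_bound[of s 0 0 y] s by (simp add: gdK_def)

lemma gdK_pos: "gdK TYPE('n::finite) > 0" by (simp add: gdK_def)

text \<open>Bounds for the Taylor polynomial 1 + a + (a^2 - b) / 2, with \<open>q\<close> for a^2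
  and \<open>r\<close> for b. The products with 1 match the shape in which monotonicity of
  multiplication delivers the hypotheses.\<close>

lemma
  fixes a m P q r :: real
  assumes "\<bar>a\<bar> \<le> m" "m \<le> P" "q \<le> P" "1 * r \<le> P" "0 \<le> q" "0 \<le> r"
  shows abs_taylor2_le1: "\<bar>a + (q - r) / 2\<bar> \<le> 2 * P"
    and abs_taylor2_le2: "1 * 1 \<le> P \<Longrightarrow> \<bar>1 + a + (q - r) / 2\<bar> \<le> 4 * P"
proof -
  have "0 \<le> P" "- P \<le> a" "a \<le> P" using assms(1,2) by linarith+
  moreover have "(q - r) / 2 \<le> P / 2" "- (P / 2) \<le> (q - r) / 2" using assms(3-6) by (auto simp: field_simps)
  ultimately show *: "\<bar>a + (q - r) / 2\<bar> \<le> 2 * P" by linarith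
  show "\<bar>1 + a + (q - r) / 2\<bar> \<le> 4 * P" if "1 * 1 \<le> P" using * that unfolding add.assoc by simp
qed

text \<open>Lagrange remainder on the segment from y to y - h. The restriction on
  \<open>norm h\<close> keeps the density at the intermediate point comparable to the wider Gaussian
  at y.\<close>

lemma gd_taylor3_pointwise:
  fixes y h :: "real^'n" assumes s: "0 < s" and h: "norm h \<le> s"
  shows "\<bar>gd s (y - h) - gd s y * (1 + y \<bullet> h / s\<^sup>2 + ((y \<bullet> h / s\<^sup>2)\<^sup>2 - h \<bullet> h / s\<^sup>2) / 2)\<bar>
     \<le> 4 * gdK TYPE('n) * (norm h / s) ^ 3 * gd (2 * s) y"
proof -
  define a b where "a = y \<bullet> h / s\<^sup>2" and "b = h \<bullet> h / s\<^sup>2"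
  define u where "u t = gd s y * exp (t * a - t\<^sup>2 / 2 * b)" for t :: real
  have u: "gd s (y - t *\<^sub>R h) = u t" for t
    using gd_line[of s y t h] s by (simp add: u_def a_def b_def)
  \<comment> \<open>\<open>D m\<close> is the m-th derivative of \<open>u\<close>: with x = a - b t
    the factors are x, x^2 - b and x^3 - 3 b x.\<close>
  define D where "D m t = (if m = 0 then u t else if m = 1 then u t * (a - b * t)
     else if m = 2 then u t * ((a - b * t)\<^sup>2 - b) else u t * ((a - b * t) ^ 3 - 3 * b * (a - b * t)))" for m :: nat and t
  have du: "(u has_real_derivative u t * (a - b * t)) (at t)" for t
    unfolding u_def by (auto intro!: derivative_eq_intros)
  have "DERIV (D m) t :> D (Suc m) t" if "m < 3" for m t
  proof -
    have "m = 0 \<or> m = 1 \<or> m = 2" using that by linarith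
    then show ?thesis
      unfolding D_def
      by (elim disjE; clarsimp; auto intro!: derivative_eq_intros du[THEN DERIV_cong] simp: field_simps power2_eq_square power3_eq_cube)
  qed
  moreover have D0: "D 0 = u" by (simp add: D_def fun_eq_iff)
  ultimately obtain t where t: "0 < t" "t < 1" and eq: "u 1 = (\<Sum>m<3. D m 0 / fact m * 1 ^ m) + D 3 t / fact 3 * 1 ^ 3"
    using Maclaurin[of 1 3 D u] D0 by auto
  have eq': "u 1 = u 0 * (1 + a + (a\<^sup>2 - b) / 2) + D 3 t / 6"
    using eq by (simp add: D_def numeral_3_eq_3 field_simps)
  define w where "w = y - t *\<^sub>R h"
  let ?x = "1 + norm y / s" and ?b = "norm h / s"
  have ab: "a - b * t = w \<bullet> h / s\<^sup>2" by (simp add: a_def b_def w_def inner_diff_left diff_divide_distrib)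
  have x1: "1 \<le> ?x" using s by simp
  have b01: "0 \<le> ?b" "?b \<le> 1" using s h by auto
  have "norm w \<le> norm y + norm (t *\<^sub>R h)" unfolding w_def by (rule norm_triangle_ineq4)
  also have "norm (t *\<^sub>R h) \<le> 1 * s" unfolding norm_scaleR using t h by (intro mult_mono) auto
  finally have "norm w / s \<le> ?x" using s by (simp add: field_simps)
  have "\<bar>w \<bullet> h\<bar> / s\<^sup>2 \<le> (norm w * norm h) / s\<^sup>2" by (intro divide_right_mono Cauchy_Schwarz_ineq2) simp
  also have "\<dots> = (norm w / s) * ?b" by (simp add: power2_eq_square)
  also have "\<dots> \<le> ?x * ?b" using \<open>norm w / s \<le> ?x\<close> b01 by (intro mult_right_mono)
  finally have abx: "\<bar>a - b * t\<bar> \<le> ?x * ?b" unfolding ab by simp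
  have bb: "b = ?b\<^sup>2" by (simp add: b_def power_divide power2_norm_eq_inner)
  have b0: "0 \<le> b" by (simp add: b_def)
  have "\<bar>(a - b * t) ^ 3 - 3 * b * (a - b * t)\<bar> \<le> \<bar>a - b * t\<bar> ^ 3 + 3 * b * \<bar>a - b * t\<bar>"
    using abs_triangle_ineq4[of "(a - b * t) ^ 3" "3 * b * (a - b * t)"] b0 by (simp add: power_abs abs_mult)
  also have "\<dots> \<le> (?x * ?b) ^ 3 + 3 * ?b\<^sup>2 * (?x * ?b)"
    unfolding bb using abx[unfolded bb] by (intro add_mono power_mono mult_left_mono) auto
  also have "\<dots> = ?b ^ 3 * (?x ^ 3 + 3 * ?x)"
  proof -
    have "(x * b) ^ 3 + 3 * b\<^sup>2 * (x * b) = b ^ 3 * (x ^ 3 + 3 * x)" for x b :: real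
      by (simp add: power2_eq_square power3_eq_cube algebra_simps)
    then show ?thesis .
  qed
  \<comment> \<open>Both powers are raised to the fourth so that a single absorption estimate serves
    all remainders.\<close>
  also have "\<dots> \<le> ?b ^ 3 * (?x ^ 4 + 3 * ?x ^ 4)"
    using x1 b01 power_increasing[of 3 4 ?x] power_increasing[of 1 4 ?x] by (intro mult_left_mono) auto
  finally have "\<bar>(a - b * t) ^ 3 - 3 * b * (a - b * t)\<bar> \<le> 4 * ?b ^ 3 * ?x ^ 4" by simp
  then have "\<bar>D 3 t\<bar> \<le> u t * (4 * ?b ^ 3 * ?x ^ 4)"
    unfolding D_def by (simp add: abs_mult mult_left_mono u_def)
  also have "\<dots> = 4 * ?b ^ 3 * (gd s (y - t *\<^sub>R h) * ?x ^ 4)" by (simp add: u)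
  also have "\<dots> \<le> 4 * ?b ^ 3 * (gdK TYPE('n) * gd (2 * s) y)"
    using gd_shift_bound[OF s h, of t y] t b01 unfolding gdK_def by (intro mult_left_mono) auto
  finally have "\<bar>D 3 t\<bar> \<le> 4 * gdK TYPE('n) * ?b ^ 3 * gd (2 * s) y" by (simp add: mult_ac)
  moreover have "u 1 = gd s (y - h)" "u 0 = gd s y" using u[of 1] u[of 0] by simp_all
  ultimately show ?thesis using eq' unfolding a_def[symmetric] b_def[symmetric] by (simp add: abs_if split: if_splits)
qed

text \<open>For shifts longer than s the expansion gives way to the triangle inequality: (norm h /
  s)^3 then exceeds 1 and dominates the mass of the shifted density as well as every term of the
  polynomial.\<close>

lemma gd_taylor3_L1:
  fixes h :: "real^'n" assumes s: "0 < s"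
  defines "R \<equiv> \<lambda>y. gd s (y - h) - gd s y * (1 + y \<bullet> h / s\<^sup>2 + ((y \<bullet> h / s\<^sup>2)\<^sup>2 - h \<bullet> h / s\<^sup>2) / 2)"
  shows "integrable lborel R" and "(\<integral>y. \<bar>R y\<bar> \<partial>lborel) \<le> (1 + 4 * gdK TYPE('n)) * (norm h / s) ^ 3"
proof -
  let ?b = "norm h / s" and ?K = "gdK TYPE('n)"
  have K: "?K > 0" by (rule gdK_pos)
  have [measurable]: "R \<in> borel_measurable borel" unfolding R_def by measurable
  define U where "U y = (if ?b \<le> 1 then 0 else gd s (y - h)) + 4 * ?K * ?b ^ 3 * gd (2 * s) y" for y
  have sh: "integrable lborel (\<lambda>y. gd s (y - h))" "(\<integral>y. gd s (y - h) \<partial>lborel) = 1"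
    using integrable_shift[OF integrable_gd[OF s], of "-h"] integral_shift[of "gd s" "-h"] s by auto
  have U0: "integrable lborel (\<lambda>y. if ?b \<le> 1 then 0 else gd s (y - h))"
    "(\<integral>y. (if ?b \<le> 1 then 0 else gd s (y - h)) \<partial>lborel) = (if ?b \<le> 1 then 0 else 1)"
    using sh by (cases "?b \<le> 1"; simp)+
  have U: "integrable lborel U" unfolding U_def using s U0 by (intro Bochner_Integration.integrable_add) auto
  have le: "\<bar>R y\<bar> \<le> U y" for y
  proof (cases "?b \<le> 1")
    case True
    then show ?thesis using gd_taylor3_pointwise[OF s, of h y] s by (simp add: R_def U_def)
  next
    case False
    let ?x = "norm y / s" and ?a = "y \<bullet> h / s\<^sup>2"
    have x0: "0 \<le> ?x" using s by simp
    have "\<bar>?a\<bar> \<le> (norm y * norm h) / s\<^sup>2" by (simp add: abs_divide) (intro divide_right_mono Cauchy_Schwarz_ineq2, simp)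
    then have a: "\<bar>?a\<bar> \<le> ?x * ?b" by (simp add: power2_eq_square)
    have bb: "h \<bullet> h / s\<^sup>2 = ?b\<^sup>2" by (simp add: power_divide power2_norm_eq_inner)
    have b3: "1 \<le> ?b ^ 3" "?b \<le> ?b ^ 3" "?b\<^sup>2 \<le> ?b ^ 3" using False power_increasing[of 1 3 ?b] power_increasing[of 2 3 ?b] by auto
    have x4: "1 \<le> (1 + ?x) ^ 4" "?x \<le> (1 + ?x) ^ 4" "?x\<^sup>2 \<le> (1 + ?x) ^ 4"
      using x0 power_increasing[of 1 4 "1 + ?x"] power_increasing[of 2 4 "1 + ?x"] order_trans[OF power_mono[of ?x "1 + ?x" 2]] by auto
    have p1: "?x * ?b \<le> (1 + ?x) ^ 4 * ?b ^ 3" using x4 b3 x0 False by (intro mult_mono) auto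
    have "?a\<^sup>2 \<le> (?x * ?b)\<^sup>2" using a by (metis abs_ge_zero power2_abs power_mono)
    also have "\<dots> = ?x\<^sup>2 * ?b\<^sup>2" by (rule power_mult_distrib)
    also have "\<dots> \<le> (1 + ?x) ^ 4 * ?b ^ 3" using x4 b3 x0 False by (intro mult_mono) auto
    finally have p2: "?a\<^sup>2 \<le> (1 + ?x) ^ 4 * ?b ^ 3" .
    have p3: "1 * ?b\<^sup>2 \<le> (1 + ?x) ^ 4 * ?b ^ 3" using x4 b3 x0 False by (intro mult_mono) auto
    have p4: "1 * 1 \<le> (1 + ?x) ^ 4 * ?b ^ 3" using x4 b3 x0 False by (intro mult_mono) auto
    have "\<bar>1 + ?a + (?a\<^sup>2 - h \<bullet> h / s\<^sup>2) / 2\<bar> \<le> 4 * ((1 + ?x) ^ 4 * ?b ^ 3)"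
      unfolding bb by (rule abs_taylor2_le2[OF a p1 p2 p3 _ _ p4]) auto
    then have "\<bar>gd s y * (1 + ?a + (?a\<^sup>2 - h \<bullet> h / s\<^sup>2) / 2)\<bar> \<le> gd s y * (4 * ((1 + ?x) ^ 4 * ?b ^ 3))"
      unfolding abs_mult by (simp only: abs_of_nonneg[OF gd_nonneg]) (rule mult_left_mono, simp_all)
    also have "\<dots> = 4 * ?b ^ 3 * (gd s y * (1 + ?x) ^ 4)" by simp
    also have "\<dots> \<le> 4 * ?b ^ 3 * (?K * gd (2 * s) y)"
      using b3 s by (intro mult_left_mono gd_poly_bound s) auto
    finally have "\<bar>gd s y * (1 + ?a + (?a\<^sup>2 - h \<bullet> h / s\<^sup>2) / 2)\<bar> \<le> 4 * ?K * ?b ^ 3 * gd (2 * s) y" by (simp add: mult_ac)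
    moreover have "\<bar>p - q\<bar> \<le> p + r" if "\<bar>q\<bar> \<le> r" "0 \<le> p" for p q r :: real using that by linarith
    ultimately show ?thesis unfolding R_def U_def using False gd_nonneg[of s "y - h"] by (simp only: if_False)
  qed
  show R: "integrable lborel R"
    by (rule Bochner_Integration.integrable_bound[OF U]) (use le in \<open>auto intro: order_trans[OF _ abs_ge_self]\<close>)
  have "(\<integral>y. \<bar>R y\<bar> \<partial>lborel) \<le> (\<integral>y. U y \<partial>lborel)"
    using U R le by (intro integral_mono) auto
  also have "\<dots> = (if ?b \<le> 1 then 0 else 1) + 4 * ?K * ?b ^ 3"
    unfolding U_def using s U0 by (subst Bochner_Integration.integral_add) auto
  also have "\<dots> \<le> ?b ^ 3 + 4 * ?K * ?b ^ 3"
    using s power_mono[of 1 ?b 3] by (auto simp: not_le)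
  finally show "(\<integral>y. \<bar>R y\<bar> \<partial>lborel) \<le> (1 + 4 * ?K) * ?b ^ 3" by (simp add: algebra_simps)
qed

text \<open>Total variation between Gaussian translates. For short shifts the third-order expansion
  is reused, its polynomial minus 1 being of order norm h / s; for long shifts the trivial bound 2
  is enough.\<close>

lemma gd_shift_L1:
  fixes h :: "real^'n" assumes s: "0 < s"
  shows "(\<integral>y. \<bar>gd s (y - h) - gd s y\<bar> \<partial>lborel) \<le> (3 + 8 * gdK TYPE('n)) * (norm h / s)"
proof -
  let ?b = "norm h / s" and ?K = "gdK TYPE('n)"
  have K: "?K > 0" by (rule gdK_pos)
  have sh: "integrable lborel (\<lambda>y. gd s (y - h))" "(\<integral>y. gd s (y - h) \<partial>lborel) = 1"
    using integrable_shift[OF integrable_gd[OF s], of "-h"] integral_shift[of "gd s" "-h"] s by auto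
  show ?thesis
  proof (cases "?b \<le> 1")
    case True
    let ?R = "\<lambda>y. gd s (y - h) - gd s y * (1 + y \<bullet> h / s\<^sup>2 + ((y \<bullet> h / s\<^sup>2)\<^sup>2 - h \<bullet> h / s\<^sup>2) / 2)"
    note R = gd_taylor3_L1[OF s, of h]
    have le: "\<bar>gd s (y - h) - gd s y\<bar> \<le> \<bar>?R y\<bar> + 2 * ?K * ?b * gd (2 * s) y" for y
    proof -
      let ?x = "norm y / s" and ?a = "y \<bullet> h / s\<^sup>2"
      have x0: "0 \<le> ?x" using s by simp
      have b0: "0 \<le> ?b" using s by simp
      have "\<bar>?a\<bar> \<le> (norm y * norm h) / s\<^sup>2" by (simp add: abs_divide) (intro divide_right_mono Cauchy_Schwarz_ineq2, simp)
      then have a: "\<bar>?a\<bar> \<le> ?x * ?b" by (simp add: power2_eq_square)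
      have bb: "h \<bullet> h / s\<^sup>2 = ?b\<^sup>2" by (simp add: power_divide power2_norm_eq_inner)
      have b2: "?b\<^sup>2 \<le> ?b" using True b0 unfolding power2_eq_square by (intro mult_left_le)
      have x4: "1 \<le> (1 + ?x) ^ 4" "?x \<le> (1 + ?x) ^ 4" "?x\<^sup>2 \<le> (1 + ?x) ^ 4"
        using x0 power_increasing[of 1 4 "1 + ?x"] power_increasing[of 2 4 "1 + ?x"] order_trans[OF power_mono[of ?x "1 + ?x" 2]] by auto
      have p1: "?x * ?b \<le> (1 + ?x) ^ 4 * ?b" using x4 b0 by (intro mult_right_mono) auto
      have "?a\<^sup>2 \<le> (?x * ?b)\<^sup>2" using a by (metis abs_ge_zero power2_abs power_mono)
      also have "\<dots> = ?x\<^sup>2 * ?b\<^sup>2" by (rule power_mult_distrib)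
      also have "\<dots> \<le> (1 + ?x) ^ 4 * ?b" using x4 b2 by (intro mult_mono) auto
      finally have p2: "?a\<^sup>2 \<le> (1 + ?x) ^ 4 * ?b" .
      have p3: "1 * ?b\<^sup>2 \<le> (1 + ?x) ^ 4 * ?b" using x4 b2 by (intro mult_mono) auto
      have "\<bar>?a + (?a\<^sup>2 - h \<bullet> h / s\<^sup>2) / 2\<bar> \<le> 2 * ((1 + ?x) ^ 4 * ?b)"
        unfolding bb by (rule abs_taylor2_le1[OF a p1 p2 p3]) auto
      then have "\<bar>gd s y * (?a + (?a\<^sup>2 - h \<bullet> h / s\<^sup>2) / 2)\<bar> \<le> gd s y * (2 * ((1 + ?x) ^ 4 * ?b))"
        unfolding abs_mult by (simp only: abs_of_nonneg[OF gd_nonneg]) (rule mult_left_mono, simp_all)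
      also have "\<dots> = 2 * ?b * (gd s y * (1 + ?x) ^ 4)" by simp
      also have "\<dots> \<le> 2 * ?b * (?K * gd (2 * s) y)"
        using b0 by (intro mult_left_mono gd_poly_bound s) auto
      finally have q: "\<bar>gd s y * (?a + (?a\<^sup>2 - h \<bullet> h / s\<^sup>2) / 2)\<bar> \<le> 2 * ?K * ?b * gd (2 * s) y" by (simp add: mult_ac)
      have e: "gd s y * (1 + ?a + (?a\<^sup>2 - h \<bullet> h / s\<^sup>2) / 2) = gd s y + gd s y * (?a + (?a\<^sup>2 - h \<bullet> h / s\<^sup>2) / 2)"
        by (simp add: distrib_left)
      have "\<bar>a - b\<bar> \<le> \<bar>a - (b + c)\<bar> + r" if "\<bar>c\<bar> \<le> r" for a b c r :: real using that by linarith
      then show ?thesis using q unfolding e .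
    qed
    have "(\<integral>y. \<bar>gd s (y - h) - gd s y\<bar> \<partial>lborel) \<le> (\<integral>y. \<bar>?R y\<bar> + 2 * ?K * ?b * gd (2 * s) y \<partial>lborel)"
      using R(1) s sh le by (intro integral_mono) auto
    also have "\<dots> = (\<integral>y. \<bar>?R y\<bar> \<partial>lborel) + 2 * ?K * ?b"
      using R(1) s by (subst Bochner_Integration.integral_add) auto
    also have "\<dots> \<le> (1 + 4 * ?K) * ?b ^ 3 + 2 * ?K * ?b" using R(2) by simp
    also have "?b ^ 3 \<le> ?b" using True s by (auto intro: power_le_one power_decreasing[of 1 3 ?b, simplified])
    finally have "(\<integral>y. \<bar>gd s (y - h) - gd s y\<bar> \<partial>lborel) \<le> (1 + 4 * ?K) * ?b + 2 * ?K * ?b" using K by simp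
    also have "\<dots> \<le> (3 + 8 * ?K) * ?b" using K s by (simp add: field_simps)
    finally show ?thesis .
  next
    case False
    have "(\<integral>y. \<bar>gd s (y - h) - gd s y\<bar> \<partial>lborel) \<le> (\<integral>y. gd s (y - h) + gd s y \<partial>lborel)"
    proof (intro integral_mono)
      show "\<bar>gd s (y - h) - gd s y\<bar> \<le> gd s (y - h) + gd s y" for y
        using gd_nonneg[of s "y - h"] gd_nonneg[of s y] by linarith
    qed (use s sh in auto)
    also have "\<dots> = 2" using s sh by simp
    also have "\<dots> \<le> 3 * ?b" using False by simp
    also have "\<dots> \<le> (3 + 8 * ?K) * ?b" using K False s by (intro mult_right_mono) auto
    finally show ?thesis .
  qed
qed

lemma DERIV_inverse_pos: assumes "(v::real) > 0" shows "(inverse has_real_derivative - (inverse v * inverse v)) (at v)"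
  by (rule DERIV_cong[OF DERIV_inverse]) (use assms in auto)

lemma DERIV_ln_2pi: assumes "(v::real) > 0" shows "((\<lambda>v. ln (2 * pi * v)) has_real_derivative inverse v) (at v)"
proof -
  have "((\<lambda>v. ln (2 * pi) + ln v) has_real_derivative (0 + inverse v)) (at v)"
    by (intro DERIV_add DERIV_const DERIV_ln assms)
  then have *: "((\<lambda>v. ln (2 * pi) + ln v) has_real_derivative inverse v) (at v)" by (simp only: add_0)
  have l: "ln (2 * pi) + ln x = ln (2 * pi * x)" if "x \<in> {0<..}" for x
    by (rule ln_mult_pos[symmetric]) (use that in auto)
  show ?thesis
    by (rule has_field_derivative_transform_within_open[OF * _ _ l, of "{0<..}"]) (use assms in auto)
qed

text \<open>The density as a function of its variance v in logarithmic form, n being the dimension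
  and r = y \<bullet> y. Powers of v are written with \<open>inverse\<close> so that the derivative
  rules compose.\<close>

lemma DERIV_gd_variance: assumes "(v::real) > 0" shows "((\<lambda>v. exp (- n / 2 * ln (2 * pi * v) - r / 2 * inverse v)) has_real_derivative (exp (- n / 2 * ln (2 * pi * v) - r / 2 * inverse v)) * (- n / 2 * inverse v + r / 2 * (inverse v * inverse v))) (at v)"
  by (rule DERIV_cong[OF DERIV_fun_exp[OF DERIV_diff[OF DERIV_cmult[OF DERIV_ln_2pi[OF assms]] DERIV_cmult[OF DERIV_inverse_pos[OF assms]]]]]) simp

lemma DERIV_gd_log_variance: assumes "(v::real) > 0" shows "((\<lambda>v. - n / 2 * inverse v + r / 2 * (inverse v * inverse v)) has_real_derivative (n / (2 * v\<^sup>2) - r / v ^ 3)) (at v)"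
proof -
  have 1: "n / (2 * v\<^sup>2) = n / 2 * (inverse v * inverse v)" using assms by (simp add: field_simps power2_eq_square)
  have 2: "r / v ^ 3 = r * (inverse v * inverse v * inverse v)" using assms by (simp add: field_simps power3_eq_cube)
  have 3: "- n / 2 * - (j * j) + r / 2 * (- (j * j) * j + - (j * j) * j) = n / 2 * (j * j) - r * (j * j * j)" for j :: real
    by (simp add: algebra_simps)
  show ?thesis unfolding 1 2 3[symmetric]
    by (rule DERIV_add[OF DERIV_cmult[OF DERIV_inverse_pos[OF assms]] DERIV_cmult[OF DERIV_mult[OF DERIV_inverse_pos[OF assms] DERIV_inverse_pos[OF assms]]]])
qed

text \<open>By the heat equation the first-order term in the variance is half the Laplacian, the
  same as the second-order term of the shift expansion averaged over an isotropic vector. This is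
  why the two expansions cancel in \<open>kap_L1\<close>.\<close>

lemma gd_variance_pointwise:
  fixes y :: "real^'n" assumes s: "1 \<le> s"
  shows "\<bar>gd (sqrt (s\<^sup>2 + 1)) y - gd s y * (1 + (y \<bullet> y / s ^ 4 - CARD('n) / s\<^sup>2) / 2)\<bar>
     \<le> (real CARD('n))\<^sup>2 * gdK TYPE('n) / s ^ 4 * gd (2 * s) y"
proof -
  define n where "n = real CARD('n)"
  have n1: "n \<ge> 1" unfolding n_def by (simp add: Suc_le_eq)
  define r where "r = y \<bullet> y"
  define N where "N v = exp (- n / 2 * ln (2 * pi * v) - r / 2 * inverse v)" for v :: real
  have N: "gd (sqrt v) y = N v" if "v > 0" for v
  proof -
    define l where "l = ln (2 * pi * v)"
    have "exp l = 2 * pi * v" unfolding l_def using that by (intro exp_ln) auto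
    then have "sqrt (2 * pi * v) = exp (l / 2)"
      by (intro real_sqrt_unique) (simp_all add: power2_eq_square exp_add[symmetric])
    then have c: "(1 / sqrt (2 * pi * v)) ^ CARD('n) = exp (- n / 2 * l)"
      by (simp add: exp_minus[symmetric] inverse_eq_divide[symmetric] exp_of_nat_mult[symmetric] n_def)
    have "(sqrt v)\<^sup>2 = v" using that by simp
    moreover have "- (y \<bullet> y) / (2 * v) = - (r / 2 * inverse v)" by (simp add: r_def inverse_eq_divide)
    ultimately show ?thesis unfolding gd_eq N_def l_def[symmetric] diff_conv_add_uminus exp_add by (simp only: c)
  qed
  define p where "p v = - n / 2 * inverse v + r / 2 * (inverse v * inverse v)" for v :: real
  have p_eq: "p v = - (n / (2 * v)) + r / (2 * v\<^sup>2)" for v by (simp add: p_def inverse_eq_divide power2_eq_square)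
  have dN: "(N has_real_derivative N v * p v) (at v)" if "v > 0" for v
    unfolding N_def p_def by (rule DERIV_gd_variance[OF that])
  define D where "D m t = (if m = 0 then N (s\<^sup>2 + t) else if m = 1 then N (s\<^sup>2 + t) * p (s\<^sup>2 + t)
     else N (s\<^sup>2 + t) * ((p (s\<^sup>2 + t))\<^sup>2 + (n / (2 * (s\<^sup>2 + t)\<^sup>2) - r / (s\<^sup>2 + t) ^ 3)))" for m :: nat and t
  have DD: "DERIV (D m) t :> D (Suc m) t" if "m < 2" "0 \<le> t" for m t
  proof -
    have pos: "s\<^sup>2 + t > 0" using s that by (simp add: add_pos_nonneg)
    have dN': "((\<lambda>t. N (s\<^sup>2 + t)) has_real_derivative N (s\<^sup>2 + t) * p (s\<^sup>2 + t)) (at t)"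
      using DERIV_shift[of N _ t "s\<^sup>2"] dN[OF pos] by (simp add: add.commute)
    have dp: "((\<lambda>t. p (s\<^sup>2 + t)) has_real_derivative (n / (2 * (s\<^sup>2 + t)\<^sup>2) - r / (s\<^sup>2 + t) ^ 3)) (at t)"
    proof -
      have "(p has_real_derivative (n / (2 * (s\<^sup>2 + t)\<^sup>2) - r / (s\<^sup>2 + t) ^ 3)) (at (s\<^sup>2 + t))"
        unfolding p_def by (rule DERIV_gd_log_variance[OF pos])
      then show ?thesis using DERIV_shift[of p _ t "s\<^sup>2"] by (simp add: add.commute)
    qed
    have "m = 0 \<or> m = 1" using that by linarith
    then show ?thesis
    proof
      assume "m = 0"
      moreover have "D 0 = (\<lambda>t. N (s\<^sup>2 + t))" by (simp add: D_def fun_eq_iff)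
      ultimately show ?thesis using dN' by (simp add: D_def)
    next
      assume "m = 1"
      moreover have "((\<lambda>t. N (s\<^sup>2 + t) * p (s\<^sup>2 + t)) has_real_derivative
        N (s\<^sup>2 + t) * ((p (s\<^sup>2 + t))\<^sup>2 + (n / (2 * (s\<^sup>2 + t)\<^sup>2) - r / (s\<^sup>2 + t) ^ 3))) (at t)"
        by (rule DERIV_cong[OF DERIV_mult[OF dN' dp]]) (simp add: algebra_simps power2_eq_square)
      moreover have "D 1 = (\<lambda>t. N (s\<^sup>2 + t) * p (s\<^sup>2 + t))" by (simp add: D_def fun_eq_iff)
      ultimately show ?thesis by (simp add: D_def)
    qed
  qed
  then obtain t where t: "0 < t" "t < 1" and eq: "D 0 1 = (\<Sum>m<2. D m 0 / fact m * 1 ^ m) + D 2 t / fact 2 * 1 ^ 2"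
    using Maclaurin[of 1 2 D "D 0"] by auto
  have s0: "s > 0" using s by simp
  have gN: "gd s y = N (s\<^sup>2)" "gd (sqrt (s\<^sup>2 + 1)) y = N (s\<^sup>2 + 1)"
    using N[of "s\<^sup>2"] N[of "s\<^sup>2 + 1"] s0 by (auto simp: add_pos_nonneg)
  have ps: "p (s\<^sup>2) = (y \<bullet> y / s ^ 4 - n / s\<^sup>2) / 2"
    unfolding p_eq r_def by (simp add: diff_divide_distrib)
  have diff: "gd (sqrt (s\<^sup>2 + 1)) y - gd s y * (1 + (y \<bullet> y / s ^ 4 - n / s\<^sup>2) / 2) = D 2 t / 2"
    using eq unfolding gN ps[symmetric] by (simp add: D_def numeral_2_eq_2 algebra_simps)
  define v where "v = s\<^sup>2 + t"
  \<comment> \<open>As t < 1 \<le> s^2 the intermediate variance at most doubles, which leaves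
    exactly the exponent required by \<open>gd_double_le\<close>.\<close>
  have v: "s\<^sup>2 \<le> v" "v \<le> 2 * s\<^sup>2" using t one_le_power[OF s, of 2] by (auto simp: v_def)
  have v0: "v > 0" using v s0 by (meson less_le_trans zero_less_power)
  define x where "x = norm y / s"
  have x0: "x \<ge> 0" using s0 by (simp add: x_def)
  have r: "r = x\<^sup>2 * s\<^sup>2" using s0 by (simp add: r_def x_def power_divide power2_norm_eq_inner)
  have r0: "r \<ge> 0" by (simp add: r_def)
  have v2: "s ^ 4 \<le> v\<^sup>2" using power_mono[OF v(1), of 2] by simp
  have v3: "s ^ 6 \<le> v ^ 3" using power_mono[OF v(1), of 3] by simp
  have b1: "n / (2 * v) \<le> n / (2 * s\<^sup>2)" using v n1 s0 v0 by (intro divide_left_mono) auto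
  have b2: "r / (2 * v\<^sup>2) \<le> r / (2 * s ^ 4)" using v2 r0 s0 v0 by (intro divide_left_mono) auto
  have b2': "r / (2 * s ^ 4) = x\<^sup>2 / (2 * s\<^sup>2)" using s0 unfolding r by (simp add: divide_simps power2_eq_square power4_eq_xxxx)
  have b3: "n / (2 * v\<^sup>2) \<le> n / (2 * s ^ 4)" using v2 n1 s0 v0 by (intro divide_left_mono) auto
  have b4: "r / v ^ 3 \<le> r / s ^ 6" using v3 r0 s0 v0 by (intro divide_left_mono) auto
  have b4': "r / s ^ 6 = x\<^sup>2 / s ^ 4" using s0 unfolding r by (simp add: divide_simps power_add[symmetric])
  have nn: "0 \<le> n / (2 * v)" "0 \<le> r / (2 * v\<^sup>2)" "0 \<le> n / (2 * v\<^sup>2)" "0 \<le> r / v ^ 3" using n1 v0 r0 by auto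
  have "\<bar>p v\<bar> \<le> (n + x\<^sup>2) / (2 * s\<^sup>2)"
    using b1 b2 b2' nn unfolding p_eq by (simp add: add_divide_distrib abs_le_iff)
  then have "(p v)\<^sup>2 \<le> ((n + x\<^sup>2) / (2 * s\<^sup>2))\<^sup>2" by (metis abs_ge_zero power2_abs power_mono)
  also have "\<dots> = (n + x\<^sup>2)\<^sup>2 / (4 * s ^ 4)" by (simp add: power_divide power_mult_distrib)
  also have "\<dots> \<le> (n * (1 + x)\<^sup>2)\<^sup>2 / (4 * s ^ 4)"
  proof (intro divide_right_mono power_mono)
    have "1 * x\<^sup>2 \<le> n * x\<^sup>2" using n1 by (intro mult_right_mono) auto
    moreover have "0 \<le> n * x" using n1 x0 by simp
    ultimately show "n + x\<^sup>2 \<le> n * (1 + x)\<^sup>2" by (simp add: power2_sum algebra_simps)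
  qed (use n1 in auto)
  also have "\<dots> = n\<^sup>2 * (1 + x) ^ 4 / (4 * s ^ 4)" by (simp add: power_mult_distrib)
  finally have p2: "(p v)\<^sup>2 \<le> n\<^sup>2 * (1 + x) ^ 4 / (4 * s ^ 4)" .
  have x4: "1 \<le> (1 + x) ^ 4" "x\<^sup>2 \<le> (1 + x) ^ 4"
    using x0 power_increasing[of 2 4 "1 + x"] order_trans[OF power_mono[of x "1 + x" 2]] by auto
  have "n * 1 \<le> n\<^sup>2 * (1 + x) ^ 4" using x4 n1 by (intro mult_mono) (auto simp: power2_eq_square)
  moreover have "1 * x\<^sup>2 \<le> n\<^sup>2 * (1 + x) ^ 4" using x4 n1 by (intro mult_mono) (auto simp: one_le_power)
  ultimately have "n / 2 + x\<^sup>2 \<le> 3 / 2 * (n\<^sup>2 * (1 + x) ^ 4)" by simp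
  then have "(n / 2 + x\<^sup>2) / s ^ 4 \<le> 3 / 2 * (n\<^sup>2 * (1 + x) ^ 4) / s ^ 4" using s0 by (intro divide_right_mono) auto
  moreover have "(n / 2 + x\<^sup>2) / s ^ 4 = n / (2 * s ^ 4) + x\<^sup>2 / s ^ 4" by (simp add: add_divide_distrib)
  ultimately have p3: "\<bar>n / (2 * v\<^sup>2) - r / v ^ 3\<bar> \<le> 3 / 2 * (n\<^sup>2 * (1 + x) ^ 4 / s ^ 4)"
    using b3 b4 b4' nn by (simp add: abs_le_iff)
  have "\<bar>(p v)\<^sup>2 + (n / (2 * v\<^sup>2) - r / v ^ 3)\<bar> \<le> (p v)\<^sup>2 + \<bar>n / (2 * v\<^sup>2) - r / v ^ 3\<bar>"
    using abs_triangle_ineq[of "(p v)\<^sup>2" "n / (2 * v\<^sup>2) - r / v ^ 3"] by simp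
  also have "\<dots> \<le> 2 * (n\<^sup>2 * (1 + x) ^ 4 / s ^ 4)"
  proof -
    have "n\<^sup>2 * (1 + x) ^ 4 / (4 * s ^ 4) = (1/4) * (n\<^sup>2 * (1 + x) ^ 4 / s ^ 4)" by simp
    moreover have "0 \<le> n\<^sup>2 * (1 + x) ^ 4 / s ^ 4" using x0 s0 by simp
    ultimately show ?thesis using p2 p3 by linarith
  qed
  finally have pp: "\<bar>(p v)\<^sup>2 + (n / (2 * v\<^sup>2) - r / v ^ 3)\<bar> \<le> 2 * (n\<^sup>2 * (1 + x) ^ 4 / s ^ 4)" .
  let ?c = "(1 / sqrt (2 * pi * s\<^sup>2)) ^ CARD('n)"
  have Nv: "N v \<le> ?c * exp (- (y \<bullet> y) / (4 * s\<^sup>2))"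
  proof -
    have "N v = gd (sqrt v) y" using N[OF v0] by simp
    also have "\<dots> = (1 / sqrt (2 * pi * v)) ^ CARD('n) * exp (- (y \<bullet> y) / (2 * v))" using v0 by (simp add: gd_eq)
    also have "\<dots> \<le> ?c * exp (- (y \<bullet> y) / (4 * s\<^sup>2))"
    proof (intro mult_mono power_mono)
      show "1 / sqrt (2 * pi * v) \<le> 1 / sqrt (2 * pi * s\<^sup>2)"
        using v s0 by (intro divide_left_mono real_sqrt_le_mono mult_left_mono mult_pos_pos) (auto simp: v0)
      have "(y \<bullet> y) / (4 * s\<^sup>2) \<le> (y \<bullet> y) / (2 * v)" using v v0 s0 by (intro divide_left_mono) auto
      then show "exp (- (y \<bullet> y) / (2 * v)) \<le> exp (- (y \<bullet> y) / (4 * s\<^sup>2))" by simp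
    qed (use v0 in auto)
    finally show ?thesis .
  qed
  have "\<bar>D 2 t\<bar> = N v * \<bar>(p v)\<^sup>2 + (n / (2 * v\<^sup>2) - r / v ^ 3)\<bar>" by (simp add: D_def v_def abs_mult N_def)
  also have "\<dots> \<le> (?c * exp (- (y \<bullet> y) / (4 * s\<^sup>2))) * (2 * (n\<^sup>2 * (1 + x) ^ 4 / s ^ 4))"
    using Nv pp by (intro mult_mono) (auto simp: N_def)
  also have "\<dots> = 2 * n\<^sup>2 / s ^ 4 * (?c * exp (- (y \<bullet> y) / (4 * s\<^sup>2)) * (1 + norm y / s) ^ 4)" by (simp add: x_def)
  also have "\<dots> \<le> 2 * n\<^sup>2 / s ^ 4 * (64 ^ 4 * 2 ^ CARD('n) * gd (2 * s) y)"
    using s0 by (intro mult_left_mono gd_double_le) auto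
  also have "\<dots> \<le> 2 * n\<^sup>2 / s ^ 4 * (gdK TYPE('n) * gd (2 * s) y)"
    unfolding gdK_def by (intro mult_left_mono mult_right_mono) auto
  finally have "\<bar>D 2 t / 2\<bar> \<le> n\<^sup>2 * gdK TYPE('n) / s ^ 4 * gd (2 * s) y" by (simp add: mult_ac)
  then show ?thesis unfolding diff[symmetric] n_def .
qed

section \<open>Replacing one standardised summand by a Gaussian\<close>

text \<open>A finitely supported random vector with mean zero and identity covariance, the latter
  stated as a quadratic form. The bound \<beta> enters through the third absolute moment, which is
  at most \<beta> times the dimension.\<close>

locale std_vectors =
  fixes I :: "'i set" and w :: "'i \<Rightarrow> real" and u :: "'i \<Rightarrow> real^'n" and \<beta> :: real
  assumes finI: "finite I" and w0: "\<And>a. a \<in> I \<Longrightarrow> 0 \<le> w a" and w1: "(\<Sum>a\<in>I. w a) = 1"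
    and mean0: "(\<Sum>a\<in>I. w a *\<^sub>R u a) = 0"
    and cov: "\<And>c. (\<Sum>a\<in>I. w a * (c \<bullet> u a)\<^sup>2) = c \<bullet> c"
    and bound: "\<And>a. a \<in> I \<Longrightarrow> norm (u a) \<le> \<beta>" and beta1: "1 \<le> \<beta>"
begin

text \<open>The signed density (law of \<open>u\<close> minus standard Gaussian) convolved with N(0,
  s^2 Id): the error of exchanging one summand under smoothing at scale s.\<close>

definition kap :: "real \<Rightarrow> real^'n \<Rightarrow> real" where
  "kap s y = (\<Sum>a\<in>I. w a * gd s (y - u a)) - gd (sqrt (s\<^sup>2 + 1)) y"

lemma kap_measurable[measurable]: "kap s \<in> borel_measurable borel"
  unfolding kap_def by measurable

lemma integrable_gd_shift[simp]: "s > 0 \<Longrightarrow> integrable lborel (\<lambda>y. gd s (y - h))" for h :: "real^'n"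
  using integrable_shift[OF integrable_gd[of s], of "-h"] by simp

lemma integrable_kap: "s > 0 \<Longrightarrow> integrable lborel (kap s)"
  unfolding kap_def by (auto intro!: integrable_gd simp: add_pos_nonneg)

lemma sum_norm2: "(\<Sum>a\<in>I. w a * (norm (u a))\<^sup>2) = CARD('n)"
proof -
  have nrm: "(norm x)\<^sup>2 = (\<Sum>i\<in>UNIV. (axis i 1 \<bullet> x)\<^sup>2)" for x :: "real^'n"
    by (simp add: power2_norm_eq_inner inner_axis') (simp add: inner_vec_def power2_eq_square)
  have "(\<Sum>a\<in>I. w a * (norm (u a))\<^sup>2) = (\<Sum>a\<in>I. w a * (\<Sum>i\<in>UNIV. (axis i 1 \<bullet> u a)\<^sup>2))"
    unfolding nrm ..
  also have "\<dots> = (\<Sum>i\<in>UNIV. \<Sum>a\<in>I. w a * (axis i 1 \<bullet> u a)\<^sup>2)"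
    unfolding sum_distrib_left by (rule sum.swap)
  also have "\<dots> = CARD('n)" unfolding cov by (simp add: inner_axis_axis)
  finally show ?thesis .
qed

text \<open>Matching of two moments leaves only remainders of third order, hence s^-3. That power is
  decisive: summed over n replacements with s^2 of order n it gives 1 / sqrt n.\<close>

lemma kap_L1:
  assumes s: "1 \<le> s"
  shows "(\<integral>y. \<bar>kap s y\<bar> \<partial>lborel) \<le> (CARD('n) * (1 + 4 * gdK TYPE('n)) + (real CARD('n))\<^sup>2 * gdK TYPE('n)) * \<beta> / s ^ 3"
proof -
  let ?n = "real CARD('n)" and ?K = "gdK TYPE('n)"
  have s0: "s > 0" using s by simp
  define R where "R h y = gd s (y - h) - gd s y * (1 + y \<bullet> h / s\<^sup>2 + ((y \<bullet> h / s\<^sup>2)\<^sup>2 - h \<bullet> h / s\<^sup>2) / 2)" for h y :: "real^'n"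
  define R2 where "R2 y = gd (sqrt (s\<^sup>2 + 1)) y - gd s y * (1 + (y \<bullet> y / s ^ 4 - ?n / s\<^sup>2) / 2)" for y :: "real^'n"
  have R: "integrable lborel (R h)" "(\<integral>y. \<bar>R h y\<bar> \<partial>lborel) \<le> (1 + 4 * ?K) * (norm h / s) ^ 3" for h
    unfolding R_def using gd_taylor3_L1[OF s0, of h] by auto
  \<comment> \<open>The mean kills the linear term, and the identity covariance turns the quadratic
    one into the first-order term of the variance expansion; only the remainders are left.\<close>
  have kap: "kap s y = (\<Sum>a\<in>I. w a * R (u a) y) - R2 y" for y
  proof -
    have m: "(\<Sum>a\<in>I. w a * (y \<bullet> u a)) = 0"
      using arg_cong[OF mean0, of "\<lambda>v. y \<bullet> v"] by (simp add: inner_sum_right)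
    have nn: "(\<Sum>a\<in>I. w a * (u a \<bullet> u a)) = ?n"
      using sum_norm2 by (simp add: power2_norm_eq_inner)
    have "(\<Sum>a\<in>I. w a * (1 + y \<bullet> u a / s\<^sup>2 + ((y \<bullet> u a / s\<^sup>2)\<^sup>2 - u a \<bullet> u a / s\<^sup>2) / 2))
      = (\<Sum>a\<in>I. w a) + (\<Sum>a\<in>I. w a * (y \<bullet> u a)) / s\<^sup>2 + ((\<Sum>a\<in>I. w a * (y \<bullet> u a)\<^sup>2) / s ^ 4 - (\<Sum>a\<in>I. w a * (u a \<bullet> u a)) / s\<^sup>2) / 2"
      unfolding sum_divide_distrib sum.distrib[symmetric] sum_subtractf[symmetric]
      by (intro sum.cong refl) (simp add: algebra_simps power_divide add_divide_distrib diff_divide_distrib)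
    also have "\<dots> = 1 + (y \<bullet> y / s ^ 4 - ?n / s\<^sup>2) / 2" by (simp add: w1 m nn cov)
    finally have e: "(\<Sum>a\<in>I. w a * (gd s y * (1 + y \<bullet> u a / s\<^sup>2 + ((y \<bullet> u a / s\<^sup>2)\<^sup>2 - u a \<bullet> u a / s\<^sup>2) / 2)))
      = gd s y * (1 + (y \<bullet> y / s ^ 4 - ?n / s\<^sup>2) / 2)"
      unfolding mult.left_commute[of _ "gd s y"] sum_distrib_left[symmetric] by simp
    show ?thesis unfolding kap_def R_def R2_def right_diff_distrib sum_subtractf e by simp
  qed
  have R2m: "R2 \<in> borel_measurable borel" unfolding R2_def by measurable
  have U: "integrable lborel (\<lambda>y. ?n\<^sup>2 * ?K / s ^ 4 * gd (2 * s) y)" using s0 by simp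
  have R2b: "\<bar>R2 y\<bar> \<le> ?n\<^sup>2 * ?K / s ^ 4 * gd (2 * s) y" for y
    unfolding R2_def using gd_variance_pointwise[OF s, of y] by simp
  have R2i: "integrable lborel R2"
  proof (rule Bochner_Integration.integrable_bound[OF U])
    show "AE y in lborel. norm (R2 y) \<le> norm (?n\<^sup>2 * ?K / s ^ 4 * gd (2 * s) y)"
      unfolding real_norm_def by (intro AE_I2 order_trans[OF R2b abs_ge_self])
  qed (use R2m in auto)
  have Ri: "integrable lborel (\<lambda>y. \<Sum>a\<in>I. w a * \<bar>R (u a) y\<bar>)" using R by auto
  have "(\<integral>y. \<bar>kap s y\<bar> \<partial>lborel) \<le> (\<integral>y. (\<Sum>a\<in>I. w a * \<bar>R (u a) y\<bar>) + ?n\<^sup>2 * ?K / s ^ 4 * gd (2 * s) y \<partial>lborel)"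
  proof (intro integral_mono)
    fix y
    have "\<bar>\<Sum>a\<in>I. w a * R (u a) y\<bar> \<le> (\<Sum>a\<in>I. w a * \<bar>R (u a) y\<bar>)"
      by (rule order_trans[OF sum_abs]) (auto intro!: sum_mono simp: abs_mult w0)
    then show "\<bar>kap s y\<bar> \<le> (\<Sum>a\<in>I. w a * \<bar>R (u a) y\<bar>) + ?n\<^sup>2 * ?K / s ^ 4 * gd (2 * s) y"
      using R2b[of y] unfolding kap by linarith
  qed (use U Ri integrable_kap[OF s0] in auto)
  also have "\<dots> = (\<Sum>a\<in>I. w a * (\<integral>y. \<bar>R (u a) y\<bar> \<partial>lborel)) + ?n\<^sup>2 * ?K / s ^ 4"
    using U Ri R s0 by (subst Bochner_Integration.integral_add) (auto simp: Bochner_Integration.integral_sum)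
  also have "\<dots> \<le> (\<Sum>a\<in>I. w a * ((1 + 4 * ?K) * (\<beta> * (norm (u a))\<^sup>2 / s ^ 3))) + ?n\<^sup>2 * ?K / s ^ 4"
  proof (intro add_right_mono sum_mono mult_left_mono)
    fix a assume a: "a \<in> I"
    have "(norm (u a) / s) ^ 3 = norm (u a) * (norm (u a))\<^sup>2 / s ^ 3" by (simp add: power_divide power2_eq_square power3_eq_cube)
    also have "\<dots> \<le> \<beta> * (norm (u a))\<^sup>2 / s ^ 3" using s0 bound[OF a] by (intro divide_right_mono mult_right_mono) auto
    finally have "(norm (u a) / s) ^ 3 \<le> \<beta> * (norm (u a))\<^sup>2 / s ^ 3" .
    then show "(\<integral>y. \<bar>R (u a) y\<bar> \<partial>lborel) \<le> (1 + 4 * ?K) * (\<beta> * (norm (u a))\<^sup>2 / s ^ 3)"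
      using gdK_pos[where 'n='n] by (intro order_trans[OF R(2)[of "u a"]] mult_left_mono) auto
  qed (use w0 in auto)
  also have "(\<Sum>a\<in>I. w a * ((1 + 4 * ?K) * (\<beta> * (norm (u a))\<^sup>2 / s ^ 3))) = (1 + 4 * ?K) * (\<beta> / s ^ 3) * (\<Sum>a\<in>I. w a * (norm (u a))\<^sup>2)"
    unfolding sum_distrib_left by (simp add: mult_ac)
  also have "\<dots> = (?n * (1 + 4 * ?K)) * \<beta> / s ^ 3" by (simp add: sum_norm2)
  also have "?n\<^sup>2 * ?K / s ^ 4 \<le> ?n\<^sup>2 * ?K * \<beta> / s ^ 3"
  proof -
    have "?n\<^sup>2 * ?K / s ^ 4 \<le> ?n\<^sup>2 * ?K / s ^ 3"
      using s gdK_pos[where 'n='n] power_increasing[of 3 4 s] by (intro divide_left_mono) auto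
    also have "\<dots> \<le> ?n\<^sup>2 * ?K * \<beta> / s ^ 3"
      using s0 beta1 gdK_pos[where 'n='n] mult_left_mono[of 1 \<beta> "?n\<^sup>2 * ?K"] by (intro divide_right_mono) auto
    finally show ?thesis .
  qed
  finally show ?thesis by (simp add: algebra_simps add_divide_distrib)
qed

end

section \<open>Gaussian measure of orthants\<close>

text \<open>Markov's inequality for the fourth power: outside the ball \<rho>^4 is at most (1 + norm
  y / s)^4.\<close>

lemma gd_ball_mass:
  fixes y :: "real^'n" assumes s: "0 < s" and \<rho>: "0 < \<rho>"
  shows "(\<integral>y. gd s (y::real^'n) * indicator {y. norm y \<le> \<rho> * s} y \<partial>lborel) \<ge> 1 - gdK TYPE('n) / \<rho> ^ 4"
proof -
  have le: "gd s y \<le> gd s y * indicator {y. norm y \<le> \<rho> * s} y + gdK TYPE('n) / \<rho> ^ 4 * gd (2 * s) y" for y :: "real^'n"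
  proof (cases "norm y \<le> \<rho> * s")
    case True then show ?thesis using gdK_pos[where 'n='n] \<rho> by simp
  next
    case False
    then have "\<rho> \<le> 1 + norm y / s" using s by (simp add: field_simps)
    then have "gd s y * \<rho> ^ 4 \<le> gd s y * (1 + norm y / s) ^ 4"
      using \<rho> by (intro mult_left_mono power_mono) auto
    also have "\<dots> \<le> gdK TYPE('n) * gd (2 * s) y" by (rule gd_poly_bound[OF s])
    finally show ?thesis using False \<rho> by (simp add: field_simps)
  qed
  have i: "integrable lborel (\<lambda>y::real^'n. gd s y * indicator {y. norm y \<le> \<rho> * s} y)"
    by (intro integrable_real_mult_indicator integrable_gd s) simp
  have "1 = (\<integral>y. gd s (y::real^'n) \<partial>lborel)" using s by simp
  also have "\<dots> \<le> (\<integral>y. gd s (y::real^'n) * indicator {y. norm y \<le> \<rho> * s} y + gdK TYPE('n) / \<rho> ^ 4 * gd (2 * s) y \<partial>lborel)"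
    using s i le by (intro integral_mono) auto
  also have "\<dots> = (\<integral>y. gd s (y::real^'n) * indicator {y. norm y \<le> \<rho> * s} y \<partial>lborel) + gdK TYPE('n) / \<rho> ^ 4"
    using s i by (subst Bochner_Integration.integral_add) auto
  finally show ?thesis by simp
qed

definition nonneg_ind :: "real^'m \<Rightarrow> real" where
  "nonneg_ind z = (if \<forall>i. 0 \<le> z $ i then 1 else 0)"

text \<open>The probability that s A G \<le> z for a standard Gaussian G. Integrating over the
  source space and not over the image gives a meaning to singular and non-square
  \<open>A\<close>.\<close>

definition gauss_orth :: "real^'n^'m \<Rightarrow> real \<Rightarrow> real^'m \<Rightarrow> real" where
  "gauss_orth A s z = (\<integral>y. gd s y * nonneg_ind (z - A *v y) \<partial>lborel)"

lemma nonneg_ind_bounds[simp]: "0 \<le> nonneg_ind z" "nonneg_ind z \<le> 1" "\<bar>nonneg_ind z\<bar> \<le> 1"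
  by (auto simp: nonneg_ind_def)

lemma nonneg_ind_mono: "(\<And>i. z $ i \<le> z' $ i) \<Longrightarrow> nonneg_ind z \<le> nonneg_ind z'"
  by (auto simp: nonneg_ind_def) (meson order_trans)

lemma nonneg_ind_measurable[measurable]: "(nonneg_ind :: real^'m \<Rightarrow> real) \<in> borel_measurable borel"
  unfolding nonneg_ind_def by measurable

lemma matrix_vector_measurable[measurable (raw)]:
  "f \<in> borel_measurable M \<Longrightarrow> (\<lambda>x. (A::real^'n^'m) *v f x) \<in> borel_measurable M"
  by (rule borel_measurable_continuous_on[OF linear_continuous_on]) (auto simp: linear_conv_bounded_linear[symmetric])

lemma integrable_gd_mult:
  fixes f :: "real^'n \<Rightarrow> real"
  assumes "integrable lborel g" "f \<in> borel_measurable borel" "\<And>y. \<bar>f y\<bar> \<le> 1"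
  shows "integrable lborel (\<lambda>y. g y * f y)"
proof (rule Bochner_Integration.integrable_bound[OF assms(1)])
  have "g \<in> borel_measurable borel" using assms(1) by (auto dest: borel_measurable_integrable)
  then show "(\<lambda>y. g y * f y) \<in> borel_measurable lborel" using assms(2) by simp
  show "AE y in lborel. norm (g y * f y) \<le> norm (g y)"
    using assms(3) by (auto simp: abs_mult intro!: mult_left_le)
qed

lemma abs_integral_mult_le:
  fixes f :: "real^'n \<Rightarrow> real"
  assumes "integrable lborel g" "f \<in> borel_measurable borel" "\<And>y. \<bar>f y\<bar> \<le> b" "0 \<le> b"
  shows "\<bar>\<integral>y. g y * f y \<partial>lborel\<bar> \<le> b * (\<integral>y. \<bar>g y\<bar> \<partial>lborel)"
proof -
  have gm: "g \<in> borel_measurable borel" using assms(1) by (auto dest: borel_measurable_integrable)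
  have le: "\<bar>g y * f y\<bar> \<le> b * \<bar>g y\<bar>" for y using mult_right_mono[OF assms(3)[of y] abs_ge_zero[of "g y"]] by (simp add: abs_mult mult.commute)
  have i: "integrable lborel (\<lambda>y. g y * f y)"
    by (rule Bochner_Integration.integrable_bound[of _ "\<lambda>y. b * \<bar>g y\<bar>"]) (use assms(1,2) gm le in \<open>auto simp: assms(4) abs_mult\<close>)
  have "\<bar>\<integral>y. g y * f y \<partial>lborel\<bar> \<le> (\<integral>y. \<bar>g y * f y\<bar> \<partial>lborel)" by (rule integral_abs_bound)
  also have "\<dots> \<le> (\<integral>y. b * \<bar>g y\<bar> \<partial>lborel)" using i assms(1) le by (intro integral_mono) auto
  finally show ?thesis by simp
qed

lemma gauss_orth_bounds:
  fixes A :: "real^'n^'m"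
  assumes s: "0 < s" shows "0 \<le> gauss_orth A s z" "gauss_orth A s z \<le> 1"
proof -
  show "0 \<le> gauss_orth A s z" unfolding gauss_orth_def by (intro integral_nonneg_AE) auto
  have "\<bar>\<integral>y. gd s y * nonneg_ind (z - A *v y) \<partial>lborel\<bar> \<le> 1 * (\<integral>y. \<bar>gd s (y::real^'n)\<bar> \<partial>lborel)"
    using s by (intro abs_integral_mult_le) auto
  then show "gauss_orth A s z \<le> 1" using s by (simp add: gauss_orth_def)
qed

lemma gauss_orth_mono:
  assumes s: "0 < s" and "\<And>i. z $ i \<le> z' $ i" shows "gauss_orth A s z \<le> gauss_orth A s z'"
  unfolding gauss_orth_def using assms
  by (intro integral_mono integrable_gd_mult mult_left_mono nonneg_ind_mono) auto

lemma gauss_orth_nn: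
  assumes s: "0 < s"
  shows "ennreal (gauss_orth A s z) = (\<integral>\<^sup>+y. ennreal (gd s y * nonneg_ind (z - A *v y)) \<partial>lborel)"
  unfolding gauss_orth_def using s by (intro nn_integral_eq_integral[symmetric] integrable_gd_mult) auto

lemma gauss_orth_measurable[measurable]: "gauss_orth (A::real^'n^'m) s \<in> borel_measurable borel"
  unfolding gauss_orth_def by measurable

text \<open>Independent Gaussian parts add their variances: after a translation of the inner
  integral, Tonelli reduces the claim to \<open>nn_integral_gd_conv\<close>.\<close>

lemma gauss_orth_conv:
  fixes A :: "real^'n^'m"
  assumes s: "0 < s" and t: "0 < t"
  shows "(\<integral>y. gd s y * gauss_orth A t (z - A *v y) \<partial>lborel) = gauss_orth A (sqrt (s\<^sup>2 + t\<^sup>2)) z"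
proof -
  have st: "0 < sqrt (s\<^sup>2 + t\<^sup>2)" using s by (simp add: add_pos_nonneg)
  have abs1: "\<bar>gauss_orth A t z\<bar> \<le> 1" for z using gauss_orth_bounds[OF t, of A z] by simp
  have inner: "(\<integral>\<^sup>+x. ennreal (gd t x * nonneg_ind (z - A *v y - A *v x)) \<partial>lborel)
      = (\<integral>\<^sup>+x. ennreal (gd t (x - y) * nonneg_ind (z - A *v x)) \<partial>lborel)" for y
  proof -
    have "(\<integral>\<^sup>+x. ennreal (gd t (x - y) * nonneg_ind (z - A *v x)) \<partial>lborel)
      = (\<integral>\<^sup>+x. ennreal (gd t (x - y) * nonneg_ind (z - A *v x)) \<partial>distr lborel borel (\<lambda>x. x + y))"
      by (simp add: lborel_shift)
    also have "\<dots> = (\<integral>\<^sup>+x. ennreal (gd t x * nonneg_ind (z - A *v y - A *v x)) \<partial>lborel)"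
      by (subst nn_integral_distr) (auto simp: matrix_vector_right_distrib algebra_simps)
    finally show ?thesis by simp
  qed
  have "ennreal (\<integral>y. gd s y * gauss_orth A t (z - A *v y) \<partial>lborel)
     = (\<integral>\<^sup>+y. ennreal (gd s y * gauss_orth A t (z - A *v y)) \<partial>lborel)"
    using s abs1 gauss_orth_bounds(1)[OF t]
    by (intro nn_integral_eq_integral[symmetric] integrable_gd_mult AE_I2 mult_nonneg_nonneg) auto
  also have "\<dots> = (\<integral>\<^sup>+y. ennreal (gd s y) * (\<integral>\<^sup>+x. ennreal (gd t x * nonneg_ind (z - A *v y - A *v x)) \<partial>lborel) \<partial>lborel)"
    unfolding gauss_orth_nn[OF t, symmetric]
    by (intro nn_integral_cong) (simp add: ennreal_mult gauss_orth_bounds(1)[OF t])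
  also have "\<dots> = (\<integral>\<^sup>+y. ennreal (gd s y) * (\<integral>\<^sup>+x. ennreal (gd t (x - y) * nonneg_ind (z - A *v x)) \<partial>lborel) \<partial>lborel)"
    by (simp only: inner)
  also have "\<dots> = (\<integral>\<^sup>+y. \<integral>\<^sup>+x. ennreal (gd s y * (gd t (x - y) * nonneg_ind (z - A *v x))) \<partial>lborel \<partial>lborel)"
    by (subst nn_integral_cmult[symmetric]) (auto simp: ennreal_mult)
  also have "\<dots> = (\<integral>\<^sup>+x. \<integral>\<^sup>+y. ennreal (gd s y * (gd t (x - y) * nonneg_ind (z - A *v x))) \<partial>lborel \<partial>lborel)"
    by (rule lborel_pair.Fubini') measurable
  also have "\<dots> = (\<integral>\<^sup>+x. ennreal (nonneg_ind (z - A *v x)) * (\<integral>\<^sup>+y. ennreal (gd t (x - y) * gd s y) \<partial>lborel) \<partial>lborel)"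
    by (subst nn_integral_cmult[symmetric]) (auto simp: ennreal_mult[symmetric] mult_ac)
  also have "\<dots> = (\<integral>\<^sup>+x. ennreal (gd (sqrt (s\<^sup>2 + t\<^sup>2)) x * nonneg_ind (z - A *v x)) \<partial>lborel)"
    unfolding nn_integral_gd_conv[OF t s] by (simp add: ennreal_mult mult.commute add.commute)
  also have "\<dots> = ennreal (gauss_orth A (sqrt (s\<^sup>2 + t\<^sup>2)) z)" by (rule gauss_orth_nn[OF st, symmetric])
  finally show ?thesis
    using gauss_orth_bounds(1)[OF st, of A z] gauss_orth_bounds(1)[OF t]
    by (subst (asm) ennreal_inj) (auto intro!: integral_nonneg_AE AE_I2 mult_nonneg_nonneg)
qed

lemma gauss_orth_shift:
  fixes A :: "real^'n^'m"
  shows "(\<integral>y. gd s (y - h) * nonneg_ind (z - A *v y) \<partial>lborel) = gauss_orth A s (z - A *v h)"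
  unfolding gauss_orth_def
  by (subst integral_shift[where c=h, symmetric]) (auto simp: matrix_vector_right_distrib algebra_simps)

text \<open>Thickening the i-th face by d * norm (A $ i) is a translation by a vector of length d in
  the source space, so each face costs one total variation distance between translates, whatever
  \<open>A\<close> is. Measuring in row norms is what makes the bound independent of the covariance;
  a vanishing row contributes nothing.\<close>

lemma gauss_orth_shell:
  fixes A :: "real^'n^'m" and z :: "real^'m"
  assumes s: "0 < s" and d: "0 \<le> d"
  shows "gauss_orth A s (z + (\<chi> i. d * norm (A $ i))) - gauss_orth A s z \<le> CARD('m) * (3 + 8 * gdK TYPE('n)) * d / s"
proof -
  define B where "B i c y = (if (A $ i) \<bullet> y \<le> c then 1 else 0 :: real)" for i c y
  let ?z = "z + (\<chi> i. d * norm (A $ i))"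
  have Bm: "B i c \<in> borel_measurable borel" for i c unfolding B_def by measurable
  have Bi: "integrable lborel (\<lambda>y. gd s (y - h) * B i c y)" for i c h
    using integrable_shift[OF integrable_gd[OF s], of "-h"] Bm by (intro integrable_gd_mult) (auto simp: B_def)
  have Bi0: "integrable lborel (\<lambda>y. gd s y * B i c y)" for i c using Bi[of 0] by simp
  have one: "(\<integral>y. gd s y * B i (z $ i + d * norm (A $ i)) y \<partial>lborel) - (\<integral>y. gd s y * B i (z $ i) y \<partial>lborel)
     \<le> (3 + 8 * gdK TYPE('n)) * d / s" for i
  proof (cases "A $ i = 0")
    case True then show ?thesis using s d gdK_pos[where 'n='n] by simp
  next
    case False
    \<comment> \<open>Translation by \<open>h\<close> takes the thickened half-space back to the
      original one.\<close>
    define h where "h = - (d / norm (A $ i)) *\<^sub>R A $ i"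
    have nh: "norm h = d" using False d by (simp add: h_def)
    have Ah: "(A $ i) \<bullet> h = - d * norm (A $ i)" using False
      by (simp add: h_def power2_norm_eq_inner[symmetric] power2_eq_square)
    have "(\<integral>y. gd s y * B i (z $ i + d * norm (A $ i)) y \<partial>lborel)
      = (\<integral>y. gd s (y - h) * B i (z $ i + d * norm (A $ i)) (y - h) \<partial>lborel)"
      by (subst integral_shift[where c="-h", symmetric]) (use Bm in auto)
    also have "\<dots> = (\<integral>y. gd s (y - h) * B i (z $ i) y \<partial>lborel)"
      by (intro Bochner_Integration.integral_cong) (auto simp: B_def inner_diff_right Ah)
    finally have "(\<integral>y. gd s y * B i (z $ i + d * norm (A $ i)) y \<partial>lborel) - (\<integral>y. gd s y * B i (z $ i) y \<partial>lborel)
      = (\<integral>y. (gd s (y - h) - gd s y) * B i (z $ i) y \<partial>lborel)"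
      using Bi Bi0 by (simp add: left_diff_distrib)
    also have "\<dots> \<le> 1 * (\<integral>y. \<bar>gd s (y - h) - gd s y\<bar> \<partial>lborel)"
      by (rule order_trans[OF abs_ge_self abs_integral_mult_le])
        (use integrable_shift[OF integrable_gd[OF s], of "-h"] s Bm in \<open>auto simp: B_def\<close>)
    also have "\<dots> \<le> (3 + 8 * gdK TYPE('n)) * (norm h / s)" using gd_shift_L1[OF s, of h] by simp
    finally show ?thesis unfolding nh by simp
  qed
  have c: "(A *v y) $ i = (A $ i) \<bullet> y" for y i by (simp add: matrix_vector_mul_component)
  \<comment> \<open>A point of the enlarged orthant outside the original one violates some original
    face, and lies in the slab of that face.\<close>
  have pt: "nonneg_ind (?z - A *v y) - nonneg_ind (z - A *v y)
     \<le> (\<Sum>i\<in>UNIV. B i (z $ i + d * norm (A $ i)) y - B i (z $ i) y)" for y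
  proof -
    have nn: "0 \<le> B i (z $ i + d * norm (A $ i)) y - B i (z $ i) y" for i
      using mult_nonneg_nonneg[OF d norm_ge_zero, of "A $ i"] unfolding B_def by (simp only: diff_ge_0_iff_ge split: if_splits) linarith
    show ?thesis
    proof (cases "nonneg_ind (?z - A *v y) = 1 \<and> nonneg_ind (z - A *v y) = 0")
      case True
      then obtain i where "\<not> (A $ i) \<bullet> y \<le> z $ i" "\<And>i. (A $ i) \<bullet> y \<le> z $ i + d * norm (A $ i)"
        by (auto simp: nonneg_ind_def c split: if_splits)
      then have "1 \<le> B i (z $ i + d * norm (A $ i)) y - B i (z $ i) y" by (simp add: B_def)
      also have "\<dots> \<le> (\<Sum>i\<in>UNIV. B i (z $ i + d * norm (A $ i)) y - B i (z $ i) y)"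
        by (rule member_le_sum) (use nn in auto)
      finally show ?thesis using True by simp
    next
      case False
      then have "nonneg_ind (?z - A *v y) - nonneg_ind (z - A *v y) \<le> 0" by (auto simp: nonneg_ind_def split: if_splits)
      also have "0 \<le> (\<Sum>i\<in>UNIV. B i (z $ i + d * norm (A $ i)) y - B i (z $ i) y)"
        by (intro sum_nonneg) (use nn in auto)
      finally show ?thesis .
    qed
  qed
  have "gauss_orth A s ?z - gauss_orth A s z = (\<integral>y. gd s y * (nonneg_ind (?z - A *v y) - nonneg_ind (z - A *v y)) \<partial>lborel)"
    unfolding gauss_orth_def right_diff_distrib using s
    by (intro Bochner_Integration.integral_diff[symmetric] integrable_gd_mult) auto
  also have "\<dots> \<le> (\<integral>y. (\<Sum>i\<in>UNIV. gd s y * B i (z $ i + d * norm (A $ i)) y - gd s y * B i (z $ i) y) \<partial>lborel)"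
  proof (rule integral_mono)
    fix y show "gd s y * (nonneg_ind (?z - A *v y) - nonneg_ind (z - A *v y))
      \<le> (\<Sum>i\<in>UNIV. gd s y * B i (z $ i + d * norm (A $ i)) y - gd s y * B i (z $ i) y)"
      using mult_left_mono[OF pt gd_nonneg[of s y]] by (simp add: sum_distrib_left right_diff_distrib)
  next
    show "integrable lborel (\<lambda>y. gd s y * (nonneg_ind (?z - A *v y) - nonneg_ind (z - A *v y)))"
      unfolding right_diff_distrib using s by (intro Bochner_Integration.integrable_diff integrable_gd_mult) auto
  qed (use Bi0 in auto)
  also have "\<dots> = (\<Sum>i\<in>UNIV. (\<integral>y. gd s y * B i (z $ i + d * norm (A $ i)) y \<partial>lborel) - (\<integral>y. gd s y * B i (z $ i) y \<partial>lborel))"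
    using Bi0 by simp
  also have "\<dots> \<le> (\<Sum>i\<in>(UNIV::'m set). (3 + 8 * gdK TYPE('n)) * d / s)" by (intro sum_mono one)
  finally show ?thesis by simp
qed

section \<open>A Berry--Esseen bound for orthants\<close>

text \<open>Esseen's smoothing inequality for monotone functions. Near a point where F - G is almost
  extremal, monotonicity of F and the shell bound for G keep the difference almost extremal on a
  whole ball of offsets; a kernel with mass 3/4 > 1/2 on that ball therefore sees a fixed fraction
  of the supremum.\<close>

lemma smoothing_bound:
  fixes A :: "real^'n^'m" and F G :: "real^'m \<Rightarrow> real" and r \<sigma> \<gamma> e :: real
  assumes e: "0 < e" and [measurable]: "F \<in> borel_measurable borel" "G \<in> borel_measurable borel"
    and F01: "\<And>z. 0 \<le> F z" "\<And>z. F z \<le> 1" and G01: "\<And>z. 0 \<le> G z" "\<And>z. G z \<le> 1"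
    and Fm: "\<And>z z'. (\<And>i. z $ i \<le> z' $ i) \<Longrightarrow> F z \<le> F z'"
    and Gm: "\<And>z z'. (\<And>i. z $ i \<le> z' $ i) \<Longrightarrow> G z \<le> G z'"
    and r: "0 \<le> r"
    and mass: "3 / 4 \<le> (\<integral>y. gd e (y::real^'n) * indicator {y. norm y \<le> r} y \<partial>lborel)"
    and shell: "\<And>z. G (z + (\<chi> i. 2 * r * norm (A $ i))) - G z \<le> \<sigma>"
    and smooth: "\<And>z. \<bar>\<integral>y. gd e y * (F (z - A *v y) - G (z - A *v y)) \<partial>lborel\<bar> \<le> \<gamma>"
  shows "\<bar>F z - G z\<bar> \<le> 2 * (\<gamma> + \<sigma>)"
proof -
  define g where "g z = F z - G z" for z
  have [measurable]: "g \<in> borel_measurable borel" unfolding g_def by measurable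
  have g1: "\<bar>g z\<bar> \<le> 1" for z using F01[of z] G01[of z] by (auto simp: g_def)
  define D where "D = (SUP z. \<bar>g z\<bar>)"
  have bdd: "bdd_above (range (\<lambda>z. \<bar>g z\<bar>))" by (rule bdd_aboveI2[of UNIV _ 1]) (rule g1)
  have gD: "\<bar>g z\<bar> \<le> D" for z unfolding D_def by (rule cSUP_upper[OF _ bdd]) simp
  have D0: "0 \<le> D" using gD[of 0] by linarith
  have s0: "0 \<le> \<sigma>" using shell[of 0] Gm[of 0 "(\<chi> i. 2 * r * norm (A $ i))"] r by simp
  have g0: "0 \<le> \<gamma>" using smooth[of 0] by linarith
  let ?w = "(\<chi> i. r * norm (A $ i)) :: real^'m"
  have w2: "(\<chi> i. 2 * r * norm (A $ i)) = ?w + ?w" by (simp add: vec_eq_iff)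
  define m where "m = (\<integral>y. gd e (y::real^'n) * indicator {y. norm y \<le> r} y \<partial>lborel)"
  have mi: "integrable lborel (\<lambda>y::real^'n. gd e y * indicator {y. norm y \<le> r} y)"
    by (intro integrable_real_mult_indicator integrable_gd e) simp
  have Ay: "\<bar>(A *v y) $ i\<bar> \<le> ?w $ i" if "norm y \<le> r" for y i
  proof -
    have "\<bar>(A *v y) $ i\<bar> \<le> norm (A $ i) * norm y" by (simp add: matrix_vector_mul_component Cauchy_Schwarz_ineq2)
    also have "\<dots> \<le> norm (A $ i) * r" using that by (intro mult_left_mono) auto
    finally show ?thesis by (simp add: mult.commute)
  qed
  \<comment> \<open>The sign c treats F above G and F below G together. The slack \<eta> is there
    because the supremum need not be attained.\<close>
  have key: "D \<le> 2 * \<gamma> + 3 / 2 * (\<eta> + \<sigma>)" if sgn: "c = 1 \<or> c = -1" and big: "D - \<eta> \<le> c * g z" and \<eta>: "0 \<le> \<eta>" for c z \<eta>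
  proof (cases "2 * D - \<eta> - \<sigma> \<ge> 0")
    case False
    then have "2 * D \<le> 4 * \<gamma> + 3 * (\<eta> + \<sigma>)" using D0 s0 g0 \<eta> by argo
    then show ?thesis by argo
  next
    case True
    \<comment> \<open>The base point is moved by the largest displacement that \<open>A\<close>
      produces on the ball, so that all arguments z + c w - A y lie on the favourable side of z and
      within twice that displacement.\<close>
    let ?z = "z + c *\<^sub>R ?w"
    have lo: "(2 * D - \<eta> - \<sigma>) * indicator {y. norm y \<le> r} y - D \<le> c * g (?z - A *v y)" for y :: "real^'n"
    proof (cases "norm y \<le> r")
      case False
      then show ?thesis using gD[of "?z - A *v y"] sgn by (auto simp: abs_le_iff)
    next
      case y: True
      have ay: "0 \<le> (A *v y) $ i + r * norm (A $ i)" and ay2: "(A *v y) $ i \<le> r * norm (A $ i)" for i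
        using Ay[OF y, of i] by (auto simp: abs_le_iff)
      show ?thesis using sgn
      proof
        assume c: "c = 1"
        have 1: "F z \<le> F (?z - A *v y)" by (rule Fm) (use ay ay2 in \<open>simp add: c algebra_simps\<close>)
        have 2: "G (?z - A *v y) \<le> G (z + (?w + ?w))"
          by (rule Gm) (use ay ay2 in \<open>simp add: c algebra_simps\<close>)
        have 3: "G (z + (?w + ?w)) - G z \<le> \<sigma>" using shell[of z] unfolding w2 .
        show ?thesis using 1 2 3 big y unfolding c g_def by simp
      next
        assume c: "c = -1"
        have 1: "F (?z - A *v y) \<le> F z"
          by (rule Fm) (use ay ay2 in \<open>simp add: c algebra_simps\<close>)
        have 2: "G (z - (?w + ?w)) \<le> G (?z - A *v y)"
          by (rule Gm) (use ay ay2 in \<open>simp add: c algebra_simps\<close>)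
        have 3: "G z - G (z - (?w + ?w)) \<le> \<sigma>" using shell[of "z - (?w + ?w)"] unfolding w2 by simp
        show ?thesis using 1 2 3 big y unfolding c g_def by simp
      qed
    qed
    have gi: "integrable lborel (\<lambda>y. gd e y * g (?z - A *v y))"
      using e g1 by (intro integrable_gd_mult) auto
    have "3 / 4 * (2 * D - \<eta> - \<sigma>) - D \<le> (2 * D - \<eta> - \<sigma>) * m - D"
      using mult_left_mono[OF mass True] by (simp add: m_def mult.commute)
    also have "\<dots> = (\<integral>y. (2 * D - \<eta> - \<sigma>) * (gd e y * indicator {y. norm y \<le> r} y) - D * gd e (y::real^'n) \<partial>lborel)"
      unfolding m_def using e mi by (subst Bochner_Integration.integral_diff) auto
    also have "\<dots> \<le> (\<integral>y. c * (gd e y * g (?z - A *v y)) \<partial>lborel)"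
    proof (rule integral_mono)
      show "(2 * D - \<eta> - \<sigma>) * (gd e y * indicator {y. norm y \<le> r} y) - D * gd e y \<le> c * (gd e y * g (?z - A *v y))" for y
        using mult_left_mono[OF lo[of y] gd_nonneg[of e y]] by (simp add: algebra_simps)
    qed (use e mi gi in auto)
    also have "\<dots> = c * (\<integral>y. gd e y * g (?z - A *v y) \<partial>lborel)" by simp
    also have "\<dots> \<le> \<gamma>" using smooth[of ?z] sgn unfolding g_def by (auto simp: abs_le_iff)
    finally show ?thesis by argo
  qed
  have "D \<le> 2 * \<gamma> + 3 / 2 * (\<eta> + \<sigma>)" if \<eta>: "0 < \<eta>" for \<eta>
  proof -
    have "D - \<eta> < (SUP z. \<bar>g z\<bar>)" using \<eta> by (simp add: D_def)
    then obtain z where "D - \<eta> < \<bar>g z\<bar>" using less_cSUP_iff[OF _ bdd] by auto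
    then have "D - \<eta> \<le> 1 * g z \<or> D - \<eta> \<le> -1 * g z" by (auto simp: abs_if split: if_splits)
    then show ?thesis using key[of 1 \<eta> z] key[of "-1" \<eta> z] \<eta> by auto
  qed
  then have "D \<le> 2 * \<gamma> + 3 / 2 * \<sigma> + e" if "0 < e" for e
    using that by (force dest: spec[of _ "e * 2 / 3"] simp: field_simps)
  then have "D \<le> 2 * \<gamma> + 3 / 2 * \<sigma>" by (rule field_le_epsilon)
  then show ?thesis using gD[of z] s0 unfolding g_def by (simp add: algebra_simps)
qed

text \<open>Comparison with the telescoping sum of 1 / sqrt v - 1 / sqrt (v + 1); the constant 6 is
  crude. The gain 1/e from starting at e^2 is what makes the Berry--Esseen induction
  contract.\<close>

lemma sum_inverse_sqrt_cube:
  fixes e :: real and n :: nat assumes e: "1 \<le> e"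
  shows "(\<Sum>j<n. 1 / sqrt (real j + e\<^sup>2) ^ 3) \<le> 6 / e"
proof -
  have step: "1 / sqrt v ^ 3 \<le> 6 * (1 / sqrt v - 1 / sqrt (v + 1))" if v: "1 \<le> v" for v :: real
  proof -
    define a b where "a = sqrt v" and "b = sqrt (v + 1)"
    have a1: "1 \<le> a" using v by (simp add: a_def)
    have ab: "a < b" unfolding a_def b_def by simp
    have sq: "a\<^sup>2 = v" "b\<^sup>2 = v + 1" using v by (simp_all add: a_def b_def)
    have b0: "0 < b" "0 < a" using a1 ab by auto
    have "b\<^sup>2 \<le> (3/2 * a)\<^sup>2" using sq v by (simp add: power_mult_distrib power2_eq_square)
    then have b2: "b \<le> 3 / 2 * a" by (rule power2_le_imp_le) (use b0 in simp)
    have "(b - a) * (b + a) = 1" using sq by (simp add: algebra_simps power2_eq_square)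
    then have ba: "b - a = 1 / (b + a)" using b0 by (simp add: field_simps)
    have "1 / a - 1 / b = (b - a) / (a * b)" using b0 by (simp add: field_simps)
    also have "\<dots> = 1 / (a * b * (b + a))" unfolding ba by (simp add: mult.commute)
    finally have "1 / a - 1 / b = 1 / (a * b * (b + a))" .
    moreover have "a * b * (b + a) \<le> 6 * a ^ 3"
    proof -
      have "a * b * (b + a) \<le> a * (3/2 * a) * (3/2 * a + a)" using b0 b2 by (intro mult_mono) auto
      also have "\<dots> \<le> 6 * a ^ 3" using b0 by (simp add: power3_eq_cube field_simps)
      finally show ?thesis .
    qed
    then have "1 / (6 * a ^ 3) \<le> 1 / (a * b * (b + a))" using b0 by (intro divide_left_mono) auto
    ultimately show ?thesis unfolding a_def[symmetric] b_def[symmetric] by simp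
  qed
  have "(\<Sum>j<n. 1 / sqrt (real j + e\<^sup>2) ^ 3) \<le> 6 * (1 / sqrt (e\<^sup>2) - 1 / sqrt (n + e\<^sup>2))"
  proof (induction n)
    case (Suc n)
    have "1 \<le> real n + e\<^sup>2" using one_le_power[OF e, of 2] by linarith
    from step[OF this] Suc show ?case by (simp add: algebra_simps)
  qed simp
  also have "\<dots> \<le> 6 * (1 / sqrt (e\<^sup>2))" by simp
  also have "\<dots> = 6 / e" using e by simp
  finally show ?thesis .
qed

context std_vectors
begin

text \<open>The distribution function of the sum of \<open>k\<close> independent copies of \<open>A *v u\<close>.\<close>
primrec orth_cdf :: "real^'n^'m \<Rightarrow> nat \<Rightarrow> real^'m \<Rightarrow> real" where
  "orth_cdf A 0 z = nonneg_ind z"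
| "orth_cdf A (Suc k) z = (\<Sum>a\<in>I. w a * orth_cdf A k (z - A *v u a))"

lemma orth_cdf_bounds: "0 \<le> orth_cdf A k z" "orth_cdf A k z \<le> 1"
proof -
  have "0 \<le> orth_cdf A k z \<and> orth_cdf A k z \<le> 1"
  proof (induction k arbitrary: z)
    case (Suc k)
    have "orth_cdf A (Suc k) z \<le> (\<Sum>a\<in>I. w a * 1)" unfolding orth_cdf.simps
      using Suc w0 by (intro sum_mono mult_left_mono) auto
    then show ?case using Suc w0 by (auto intro!: sum_nonneg simp: w1)
  qed auto
  then show "0 \<le> orth_cdf A k z" "orth_cdf A k z \<le> 1" by auto
qed

lemma orth_cdf_mono: "(\<And>i. z $ i \<le> z' $ i) \<Longrightarrow> orth_cdf A k z \<le> orth_cdf A k z'"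
proof (induction k arbitrary: z z')
  case (Suc k)
  then show ?case using w0 by (auto intro!: sum_mono mult_left_mono)
qed (auto intro: nonneg_ind_mono)

lemma orth_cdf_measurable[measurable]: "orth_cdf A k \<in> borel_measurable borel"
proof (induction k)
  case (Suc k)
  note [measurable] = Suc
  show ?case unfolding orth_cdf.simps by measurable
qed (simp_all add: orth_cdf.simps(1)[abs_def])

lemma abs_orth_cdf: "\<bar>orth_cdf A k z\<bar> \<le> 1" using orth_cdf_bounds[of A k z] by simp

text \<open>The shift by a summand is moved from the distribution function onto the smoothing
  density; both terms then integrate the same function \<open>orth_cdf A k\<close>, against
  densities whose difference is \<open>kap s\<close>.\<close>

lemma lindeberg_step:
  fixes A :: "real^'n^'m"
  assumes s: "0 < s"
  shows "(\<integral>y. gd s y * orth_cdf A (Suc k) (z - A *v y) \<partial>lborel) - (\<integral>y. gd (sqrt (s\<^sup>2 + 1)) y * orth_cdf A k (z - A *v y) \<partial>lborel)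
    = (\<integral>y. kap s y * orth_cdf A k (z - A *v y) \<partial>lborel)"
proof -
  have i1: "integrable lborel (\<lambda>y. gd s (y - h) * orth_cdf A k (z - A *v y))" for h
    using s abs_orth_cdf by (intro integrable_gd_mult) auto
  have i2: "integrable lborel (\<lambda>y. gd (sqrt (s\<^sup>2 + 1)) y * orth_cdf A k (z - A *v y))"
    using s abs_orth_cdf by (intro integrable_gd_mult integrable_gd) (auto simp: add_pos_nonneg)
  have sh: "gd s (y - h) * orth_cdf A k (z - A *v y) = (\<lambda>y. gd s y * orth_cdf A k (z - A *v y - A *v h)) (y - h)" for y h
    by (simp add: matrix_vector_mult_diff_distrib algebra_simps)
  have e: "(\<integral>y. gd s y * orth_cdf A k (z - A *v y - A *v h) \<partial>lborel) = (\<integral>y. gd s (y - h) * orth_cdf A k (z - A *v y) \<partial>lborel)" for h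
    unfolding sh using integral_shift[of "\<lambda>y. gd s y * orth_cdf A k (z - A *v y - A *v h)" "-h"] by simp
  have i3: "integrable lborel (\<lambda>y. gd s y * orth_cdf A k (z - A *v y - A *v h))" for h
    using s abs_orth_cdf by (intro integrable_gd_mult) auto
  have "(\<integral>y. gd s y * orth_cdf A (Suc k) (z - A *v y) \<partial>lborel) = (\<integral>y. (\<Sum>a\<in>I. w a * (gd s y * orth_cdf A k (z - A *v y - A *v u a))) \<partial>lborel)"
    by (simp add: sum_distrib_left mult_ac)
  also have "\<dots> = (\<Sum>a\<in>I. w a * (\<integral>y. gd s (y - u a) * orth_cdf A k (z - A *v y) \<partial>lborel))"
    using i3 by (simp add: e)
  also have "\<dots> = (\<integral>y. (\<Sum>a\<in>I. w a * (gd s (y - u a) * orth_cdf A k (z - A *v y))) \<partial>lborel)"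
    using i1 by simp
  also have "\<dots> = (\<integral>y. (\<Sum>a\<in>I. w a * gd s (y - u a)) * orth_cdf A k (z - A *v y) \<partial>lborel)"
    by (simp add: sum_distrib_right sum_distrib_left mult_ac)
  finally show ?thesis
    using i1 i2 unfolding kap_def left_diff_distrib
    by (subst Bochner_Integration.integral_diff) (auto simp: sum_distrib_right mult.assoc)
qed

text \<open>If the remaining summands are Gaussian they act as further smoothing: the error density
  at scale s is convolved up to scale sqrt (s^2 + t^2).\<close>

lemma kap_gauss:
  fixes A :: "real^'n^'m"
  assumes s: "0 < s" and t: "0 < t"
  shows "(\<integral>y. kap s y * gauss_orth A t (z - A *v y) \<partial>lborel)
    = (\<integral>y. kap (sqrt (s\<^sup>2 + t\<^sup>2)) y * nonneg_ind (z - A *v y) \<partial>lborel)"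
proof -
  let ?r = "sqrt (s\<^sup>2 + t\<^sup>2)"
  have st: "0 < ?r" "0 < sqrt (s\<^sup>2 + 1)" "0 < sqrt (?r\<^sup>2 + 1)" using s by (simp_all add: add_pos_nonneg)
  have abs1: "\<bar>gauss_orth A t z\<bar> \<le> 1" for z using gauss_orth_bounds[OF t, of A z] by simp
  have i1: "integrable lborel (\<lambda>y. gd s (y - h) * gauss_orth A t (z - A *v y))" for h
    using s abs1 by (intro integrable_gd_mult) auto
  have i2: "integrable lborel (\<lambda>y. gd (sqrt (s\<^sup>2 + 1)) y * gauss_orth A t (z - A *v y))"
    using st abs1 by (intro integrable_gd_mult integrable_gd) auto
  have sh: "gd s (y - h) * gauss_orth A t (z - A *v y) = (\<lambda>y. gd s y * gauss_orth A t ((z - A *v h) - A *v y)) (y - h)" for y h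
    by (simp add: matrix_vector_mult_diff_distrib algebra_simps)
  have e: "(\<integral>y. gd s (y - h) * gauss_orth A t (z - A *v y) \<partial>lborel) = gauss_orth A ?r (z - A *v h)" for h
    unfolding sh using integral_shift[of "\<lambda>y. gd s y * gauss_orth A t (z - A *v h - A *v y)" "-h"]
    by (simp add: gauss_orth_conv[OF s t])
  have j1: "integrable lborel (\<lambda>y. gd ?r (y - h) * nonneg_ind (z - A *v y))" for h
    using st by (intro integrable_gd_mult) auto
  have j2: "integrable lborel (\<lambda>y. gd (sqrt (?r\<^sup>2 + 1)) y * nonneg_ind (z - A *v y))"
    using st by (intro integrable_gd_mult integrable_gd) auto
  have "(\<integral>y. kap s y * gauss_orth A t (z - A *v y) \<partial>lborel)
    = (\<Sum>a\<in>I. w a * gauss_orth A ?r (z - A *v u a)) - gauss_orth A (sqrt ((sqrt (s\<^sup>2 + 1))\<^sup>2 + t\<^sup>2)) z"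
    using i1 i2 st unfolding kap_def left_diff_distrib
    by (subst Bochner_Integration.integral_diff) (auto simp: sum_distrib_right mult.assoc e gauss_orth_conv[OF _ t])
  also have "(sqrt (s\<^sup>2 + 1))\<^sup>2 + t\<^sup>2 = ?r\<^sup>2 + 1" by simp
  also have "(\<Sum>a\<in>I. w a * gauss_orth A ?r (z - A *v u a)) - gauss_orth A (sqrt (?r\<^sup>2 + 1)) z
    = (\<integral>y. kap ?r y * nonneg_ind (z - A *v y) \<partial>lborel)"
    unfolding gauss_orth_shift[symmetric] gauss_orth_def[of A "sqrt (?r\<^sup>2 + 1)" z] kap_def left_diff_distrib
    using j1 j2 by (subst Bochner_Integration.integral_diff) (auto simp: sum_distrib_right mult.assoc)
  finally show ?thesis .
qed

text \<open>Lindeberg replacement with Gaussian smoothing: once a constant fraction of the summands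
  has been replaced, the induction hypothesis controls the error against the Gaussian.\<close>
lemma lindeberg_sum:
  fixes A :: "real^'n^'m" and M C :: real
  assumes n: "1 \<le> n" and e: "1 \<le> e" and C: "0 \<le> C" and M: "0 \<le> M"
    and kap: "\<And>s. 1 \<le> s \<Longrightarrow> (\<integral>y. \<bar>kap s y\<bar> \<partial>lborel) \<le> C / s ^ 3"
    and IH: "\<And>k z. 1 \<le> k \<Longrightarrow> k < n \<Longrightarrow> \<bar>orth_cdf A k z - gauss_orth A (sqrt k) z\<bar> \<le> M / sqrt k"
  shows "\<bar>\<integral>y. gd e y * (orth_cdf A n (z - A *v y) - gauss_orth A (sqrt n) (z - A *v y)) \<partial>lborel\<bar>
    \<le> 4 * C / sqrt n + 12 * C * M / (e * sqrt n)"
proof -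
  have e0: "0 < e" using e by simp
  have n0: "0 < n" using n by simp
  \<comment> \<open>Hybrid with k original summands; the n - k replaced ones and the smoothing of
    variance e^2 form a single Gaussian.\<close>
  define \<psi> where "\<psi> k = (\<integral>y. gd (sqrt (real n - real k + e\<^sup>2)) y * orth_cdf A k (z - A *v y) \<partial>lborel)" for k
  have kapm: "integrable lborel (kap s)" if "1 \<le> s" for s using integrable_kap that by simp
  have step: "\<bar>\<psi> (Suc k) - \<psi> k\<bar> \<le> C * (1 / sqrt (n / 2) ^ 3 + 1 / sqrt (real (n - Suc k) + e\<^sup>2) ^ 3 * (M * 2 / sqrt n))"
    if k: "k < n" for k
  proof -
    define s where "s = sqrt (real (n - Suc k) + e\<^sup>2)"
    have s2: "s\<^sup>2 = real (n - Suc k) + e\<^sup>2" by (simp add: s_def)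
    have e2: "1 \<le> e\<^sup>2" using one_le_power[OF e, of 2] .
    have s1: "1 \<le> s" unfolding s_def using e2 by (simp add: add_increasing)
    have s0: "0 < s" using s1 by simp
    have "sqrt (real n - real (Suc k) + e\<^sup>2) = s" using k by (simp add: s_def of_nat_diff)
    moreover have "sqrt (real n - real k + e\<^sup>2) = sqrt (s\<^sup>2 + 1)" using k by (simp add: s2 of_nat_diff)
    ultimately have d: "\<psi> (Suc k) - \<psi> k = (\<integral>y. kap s y * orth_cdf A k (z - A *v y) \<partial>lborel)"
      unfolding \<psi>_def lindeberg_step[OF s0, symmetric] by simp
    have nn: "0 \<le> C * (1 / s ^ 3 * (M * 2 / sqrt n))" using C M s0 by simp
    show ?thesis
    proof (cases "2 * k < n")
      \<comment> \<open>More than half of the summands are Gaussian already: the smoothing scale is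
        of order sqrt n, and the bound 1 for the distribution function suffices.\<close>
      case True
      have "\<bar>\<psi> (Suc k) - \<psi> k\<bar> \<le> 1 * (\<integral>y. \<bar>kap s y\<bar> \<partial>lborel)" unfolding d
        by (intro abs_integral_mult_le kapm s1) (auto simp: abs_orth_cdf)
      also have "\<dots> \<le> C / s ^ 3" using kap[OF s1] by simp
      also have "\<dots> \<le> C / sqrt (n / 2) ^ 3"
      proof (intro divide_left_mono C power_mono)
        have "real n / 2 \<le> real (n - Suc k) + 1" using True k by (simp add: of_nat_diff field_simps)
        also have "\<dots> \<le> s\<^sup>2" unfolding s2 using e2 by simp
        finally have "sqrt (n / 2) \<le> sqrt (s\<^sup>2)" by (rule real_sqrt_le_mono)
        then show "sqrt (n / 2) \<le> s" using s0 by simp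
        show "0 < s ^ 3 * sqrt (n / 2) ^ 3" using s0 n0 by simp
      qed (use n0 in auto)
      finally show ?thesis using nn unfolding s_def[symmetric] by (simp add: algebra_simps)
    next
      \<comment> \<open>Here s may be as small as e, so the distribution function of the k \<ge> n/2
        remaining summands is compared with its Gaussian counterpart. The induction hypothesis
        bounds the difference by a multiple of 1 / sqrt n, and the Gaussian part lifts the scale to
        sqrt (n/2) again.\<close>
      case False
      then have k1: "1 \<le> k" using n by linarith
      define t where "t = sqrt k"
      have t0: "0 < t" using k1 by (simp add: t_def)
      let ?g = "\<lambda>y. gauss_orth A t (z - A *v y)" and ?f = "\<lambda>y. orth_cdf A k (z - A *v y)"
      have g1: "\<bar>?g y\<bar> \<le> 1" for y using gauss_orth_bounds[OF t0, of A "z - A *v y"] by simp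
      have i: "integrable lborel (\<lambda>y. kap s y * ?f y)" "integrable lborel (\<lambda>y. kap s y * ?g y)"
        using kapm[OF s1] abs_orth_cdf g1 by (intro integrable_gd_mult; auto)+
      have 1: "\<psi> (Suc k) - \<psi> k = (\<integral>y. kap s y * (?f y - ?g y) \<partial>lborel) + (\<integral>y. kap s y * ?g y \<partial>lborel)"
        unfolding d right_diff_distrib using i by simp
      have "\<bar>\<integral>y. kap s y * (?f y - ?g y) \<partial>lborel\<bar> \<le> M / t * (\<integral>y. \<bar>kap s y\<bar> \<partial>lborel)"
        using IH[OF k1 k] t0 M by (intro abs_integral_mult_le kapm s1) (auto simp: t_def)
      also have "\<dots> \<le> M / t * (C / s ^ 3)" using t0 M by (intro mult_left_mono kap[OF s1]) auto
      also have "\<dots> \<le> (M * 2 / sqrt n) * (C / s ^ 3)"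
      proof (intro mult_right_mono)
        have "sqrt n \<le> sqrt (4 * k)" using False by (intro real_sqrt_le_mono) linarith
        also have "\<dots> = 2 * t" by (simp add: t_def real_sqrt_mult)
        finally have "sqrt n \<le> 2 * t" .
        then have "M * sqrt n \<le> M * (2 * t)" using M by (intro mult_left_mono)
        then show "M / t \<le> M * 2 / sqrt n" using t0 n0 by (simp add: field_simps)
      qed (use C s0 in auto)
      finally have 2: "\<bar>\<integral>y. kap s y * (?f y - ?g y) \<partial>lborel\<bar> \<le> C * (1 / s ^ 3 * (M * 2 / sqrt n))" by (simp add: mult_ac)
      let ?r = "sqrt (s\<^sup>2 + t\<^sup>2)"
      have rn: "n / 2 \<le> s\<^sup>2 + t\<^sup>2" "1 \<le> s\<^sup>2 + t\<^sup>2"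
        unfolding s2 t_def using e2 k by (auto simp: of_nat_diff)
      have r1: "1 \<le> ?r" using rn by simp
      have "\<bar>\<integral>y. kap s y * ?g y \<partial>lborel\<bar> \<le> 1 * (\<integral>y. \<bar>kap ?r y\<bar> \<partial>lborel)"
        unfolding kap_gauss[OF s0 t0] by (intro abs_integral_mult_le kapm r1) auto
      also have "\<dots> \<le> C / ?r ^ 3" using kap[OF r1] by simp
      also have "\<dots> \<le> C / sqrt (n / 2) ^ 3"
        using rn n0 r1 by (intro divide_left_mono C power_mono real_sqrt_le_mono mult_pos_pos zero_less_power) (auto simp del: real_sqrt_ge_1_iff)
      finally have 3: "\<bar>\<integral>y. kap s y * ?g y \<partial>lborel\<bar> \<le> C * (1 / sqrt (n / 2) ^ 3)" by simp
      show ?thesis unfolding s_def[symmetric] distrib_left using 1 2 3 by linarith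
    qed
  qed
  have "\<psi> n - \<psi> 0 = (\<Sum>k<n. \<psi> (Suc k) - \<psi> k)" by (simp add: sum_lessThan_telescope)
  then have "\<bar>\<psi> n - \<psi> 0\<bar> \<le> (\<Sum>k<n. \<bar>\<psi> (Suc k) - \<psi> k\<bar>)" by simp
  also have "\<dots> \<le> (\<Sum>k<n. C * (1 / sqrt (n / 2) ^ 3 + 1 / sqrt (real (n - Suc k) + e\<^sup>2) ^ 3 * (M * 2 / sqrt n)))"
    by (intro sum_mono step) auto
  also have "\<dots> = C * (n * (1 / sqrt (n / 2) ^ 3) + (\<Sum>k<n. 1 / sqrt (real (n - Suc k) + e\<^sup>2) ^ 3) * (M * 2 / sqrt n))"
    unfolding sum_distrib_left[symmetric] sum.distrib sum_distrib_right[symmetric] by simp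
  also have "(\<Sum>k<n. 1 / sqrt (real (n - Suc k) + e\<^sup>2) ^ 3) = (\<Sum>j<n. 1 / sqrt (real j + e\<^sup>2) ^ 3)"
    by (rule sum.nat_diff_reindex)
  also have "C * (n * (1 / sqrt (n / 2) ^ 3) + (\<Sum>j<n. 1 / sqrt (real j + e\<^sup>2) ^ 3) * (M * 2 / sqrt n))
     \<le> C * (4 / sqrt n + 6 / e * (M * 2 / sqrt n))"
  proof (intro mult_left_mono add_mono mult_right_mono sum_inverse_sqrt_cube e C)
    have "sqrt (n / 2) ^ 3 = (n / 2) * sqrt (n / 2)" by (simp add: power3_eq_cube)
    then have c: "sqrt (n / 2) ^ 3 = (n / 2) * (sqrt n / sqrt 2)" by (simp only: real_sqrt_divide)
    have "n * (1 / sqrt (n / 2) ^ 3) = 2 * sqrt 2 / sqrt n" unfolding c using n0 by simp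
    also have "\<dots> \<le> 4 / sqrt n" using real_sqrt_le_mono[of 2 4] by (intro divide_right_mono) auto
    finally show "n * (1 / sqrt (n / 2) ^ 3) \<le> 4 / sqrt n" .
  qed (use M in auto)
  also have "\<dots> = 4 * C / sqrt n + 12 * C * M / (e * sqrt n)" by (simp add: algebra_simps)
  finally have fin: "\<bar>\<psi> n - \<psi> 0\<bar> \<le> 4 * C / sqrt n + 12 * C * M / (e * sqrt n)" .
  have sn0: "0 < sqrt n" using n0 by simp
  have g1: "\<bar>gauss_orth A (sqrt n) y\<bar> \<le> 1" for y using gauss_orth_bounds[OF sn0, of A y] by simp
  have i: "integrable lborel (\<lambda>y. gd e y * orth_cdf A n (z - A *v y))"
    "integrable lborel (\<lambda>y. gd e y * gauss_orth A (sqrt n) (z - A *v y))"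
    using e0 abs_orth_cdf g1 by (intro integrable_gd_mult; auto)+
  have p0: "\<psi> 0 = (\<integral>y. gd e y * gauss_orth A (sqrt n) (z - A *v y) \<partial>lborel)"
    unfolding gauss_orth_conv[OF e0 sn0] unfolding \<psi>_def gauss_orth_def by (simp add: add.commute)
  have pn: "\<psi> n = (\<integral>y. gd e y * orth_cdf A n (z - A *v y) \<partial>lborel)"
    unfolding \<psi>_def using e0 by simp
  show ?thesis using fin i unfolding p0 pn right_diff_distrib by simp
qed

text \<open>The bound for n contains the bound M for smaller k with the coefficient 24 C1 / b, which
  b = 1 + 48 C1 makes at most 1/2. The constant \<open>M\<close> is then the solution of M = 8 C1 +
  M/2 + 4 C2 \<rho> b.\<close>

lemma berry_esseen_bound:
  fixes A :: "real^'n^'m" and K C1 C2 \<rho> b M :: real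
  defines "K \<equiv> gdK TYPE('n)"
  defines "C1 \<equiv> CARD('n) * (1 + 4 * K) + (real CARD('n))\<^sup>2 * K"
    and "C2 \<equiv> CARD('m) * (3 + 8 * K)" and "\<rho> \<equiv> 1 + 4 * K"
  defines "b \<equiv> 1 + 48 * C1"
  defines "M \<equiv> 16 * C1 + 8 * C2 * \<rho> * b"
  assumes "1 \<le> n"
  shows "\<bar>orth_cdf A n z - gauss_orth A (sqrt n) z\<bar> \<le> M * \<beta> / sqrt n"
  using \<open>1 \<le> n\<close>
proof (induction n arbitrary: z rule: less_induct)
  case (less n)
  have K0: "0 < K" unfolding K_def by (rule gdK_pos)
  have C1: "0 \<le> C1" and C2: "0 \<le> C2" unfolding C1_def C2_def using K0 by auto
  have \<rho>: "1 \<le> \<rho>" "4 * K \<le> \<rho>" unfolding \<rho>_def using K0 by auto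
  have b: "1 \<le> b" "48 * C1 \<le> b" unfolding b_def using C1 by auto
  have M: "0 \<le> M" unfolding M_def using C1 C2 \<rho> b by auto
  have n0: "0 < sqrt n" using less.prems by simp
  \<comment> \<open>Smoothing at a multiple of the largest summand: wide enough to halve the
    recursive term, and costing only \<beta> / sqrt n in the shell.\<close>
  define e where "e = b * \<beta>"
  have e1: "1 \<le> e" unfolding e_def using b beta1 mult_mono[of 1 b 1 \<beta>] by simp
  have e0: "0 < e" using e1 by simp
  have 1: "\<bar>\<integral>y. gd e y * (orth_cdf A n (z - A *v y) - gauss_orth A (sqrt n) (z - A *v y)) \<partial>lborel\<bar>
    \<le> 4 * (C1 * \<beta>) / sqrt n + 12 * (C1 * \<beta>) * (M * \<beta>) / (e * sqrt n)" for z
  proof (rule lindeberg_sum[OF less.prems e1])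
    show "(\<integral>y. \<bar>kap s y\<bar> \<partial>lborel) \<le> C1 * \<beta> / s ^ 3" if "1 \<le> s" for s
      using kap_L1[OF that] unfolding C1_def K_def by simp
  qed (use C1 M beta1 less.IH in auto)
  have 2: "gauss_orth A (sqrt n) (z + (\<chi> i. 2 * (\<rho> * e) * norm (A $ i))) - gauss_orth A (sqrt n) z \<le> C2 * (2 * (\<rho> * e)) / sqrt n" for z
    unfolding C2_def K_def using \<rho> e0 by (intro gauss_orth_shell n0) auto
  \<comment> \<open>\<open>\<rho>\<close> is chosen for the mass 3/4 that
    \<open>smoothing_bound\<close> asks for.\<close>
  have "K / \<rho> ^ 4 \<le> 1 / 4"
  proof -
    have "4 * K \<le> \<rho> ^ 4" using \<rho> power_increasing[of 1 4 \<rho>] by simp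
    then show ?thesis using \<rho> by (simp add: field_simps)
  qed
  then have mass: "3 / 4 \<le> 1 - K / \<rho> ^ 4" by argo
  have 3: "3 / 4 \<le> (\<integral>y. gd e (y::real^'n) * indicator {y. norm y \<le> \<rho> * e} y \<partial>lborel)"
    by (rule order_trans[OF mass[unfolded K_def] gd_ball_mass[OF e0]]) (use \<rho> in simp)
  have "\<bar>orth_cdf A n z - gauss_orth A (sqrt n) z\<bar>
    \<le> 2 * ((4 * (C1 * \<beta>) / sqrt n + 12 * (C1 * \<beta>) * (M * \<beta>) / (e * sqrt n)) + C2 * (2 * (\<rho> * e)) / sqrt n)"
    by (rule smoothing_bound[where A=A, OF e0 _ _ _ _ _ _ _ _ _ 3 2 1])
      (use \<rho> e0 in \<open>auto intro: orth_cdf_bounds gauss_orth_bounds[OF n0] orth_cdf_mono gauss_orth_mono[OF n0]\<close>)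
  also have "\<dots> = (8 * C1 + 24 * C1 * M * \<beta> / e + 4 * C2 * \<rho> * b) * \<beta> / sqrt n"
  proof -
    have g: "2 * ((4 * x * t / s + 12 * y * t / s) + 2 * v * t / s) = (8 * x + 24 * y + 4 * v) * t / s" for x y v t s :: real
      by (simp add: add_divide_distrib distrib_right)
    have q1: "12 * (C1 * \<beta>) * (M * \<beta>) / (e * sqrt n) = 12 * (C1 * M * \<beta> / e) * \<beta> / sqrt n" by simp
    have q2: "C2 * (2 * (\<rho> * e)) / sqrt n = 2 * (C2 * \<rho> * b) * \<beta> / sqrt n" by (simp add: e_def)
    have q3: "4 * (C1 * \<beta>) / sqrt n = 4 * C1 * \<beta> / sqrt n" by simp
    show ?thesis unfolding q1 q2 q3 g by simp
  qed
  also have "24 * C1 * M * \<beta> / e = (24 * C1 / b) * M" unfolding e_def using beta1 by simp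
  also have "24 * C1 / b \<le> 1 / 2" using b by (simp add: field_simps)
  then have "(8 * C1 + (24 * C1 / b) * M + 4 * C2 * \<rho> * b) * \<beta> / sqrt n \<le> (8 * C1 + (1 / 2) * M + 4 * C2 * \<rho> * b) * \<beta> / sqrt n"
    using M beta1 C1 C2 \<rho> b by (intro divide_right_mono mult_right_mono add_mono) auto
  also have "8 * C1 + (1 / 2) * M + 4 * C2 * \<rho> * b = M" by (simp add: M_def)
  finally show ?case .
qed

end

lemma berry_esseen:
  "\<exists>M>0. \<forall>(I::'i set) w u \<beta> (A::real^'n^'m) k z. std_vectors I w u \<beta> \<longrightarrow> 1 \<le> k \<longrightarrow>
     \<bar>std_vectors.orth_cdf I w u A k z - gauss_orth A (sqrt (real k)) z\<bar> \<le> M * \<beta> / sqrt (real k)"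
proof -
  define K where "K = gdK TYPE('n)"
  define C1 where "C1 = CARD('n) * (1 + 4 * K) + (real CARD('n))\<^sup>2 * K"
  define C2 where "C2 = CARD('m) * (3 + 8 * K)"
  define M where "M = 16 * C1 + 8 * C2 * (1 + 4 * K) * (1 + 48 * C1)"
  have "0 < K" unfolding K_def by (rule gdK_pos)
  then have "0 < C1" "0 < C2" unfolding C1_def C2_def by (auto intro!: add_pos_pos)
  then have "0 < M" unfolding M_def using \<open>0 < K\<close> by (auto intro!: add_pos_pos)
  moreover have "\<bar>std_vectors.orth_cdf I w u A k z - gauss_orth A (sqrt (real k)) z\<bar> \<le> M * \<beta> / sqrt (real k)"
    if "std_vectors I w u \<beta>" "1 \<le> k" for I :: "'i set" and w u \<beta> and A :: "real^'n^'m" and k z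
    using std_vectors.berry_esseen_bound[OF that, of A z] unfolding M_def C1_def C2_def K_def .
  ultimately show ?thesis by blast
qed

section \<open>Anti-concentration for Gaussian orthants\<close>

lemma gd_tail:
  fixes f :: "real^'n \<Rightarrow> real"
  assumes s: "0 < s" and \<rho>: "0 < \<rho>" and [measurable]: "f \<in> borel_measurable borel"
    and f: "\<And>y. 0 \<le> f y" "\<And>y. f y \<le> 1" "\<And>y. norm y \<le> \<rho> * s \<Longrightarrow> f y = 0"
  shows "(\<integral>y. gd s y * f y \<partial>lborel) \<le> gdK TYPE('n) / \<rho> ^ 4"
proof -
  have i: "integrable lborel (\<lambda>y::real^'n. gd s y * indicator {y. norm y \<le> \<rho> * s} y)"
    by (intro integrable_real_mult_indicator integrable_gd s) simp
  have j: "integrable lborel (\<lambda>y. gd s y * f y)" using s f by (intro integrable_gd_mult) (auto simp: abs_le_iff intro: order_trans[of _ 0])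
  have "(\<integral>y. gd s y * f y \<partial>lborel) + (\<integral>y. gd s (y::real^'n) * indicator {y. norm y \<le> \<rho> * s} y \<partial>lborel)
    = (\<integral>y. gd s y * f y + gd s y * indicator {y. norm y \<le> \<rho> * s} y \<partial>lborel)" using i j by simp
  also have "\<dots> \<le> (\<integral>y. gd s (y::real^'n) \<partial>lborel)"
  proof (rule integral_mono)
    show "gd s y * f y + gd s y * indicator {y. norm y \<le> \<rho> * s} y \<le> gd s y" for y
      using f[of y] by (auto simp: indicator_def intro: mult_left_le)
  qed (use i j s in auto)
  also have "\<dots> = 1" using s by simp
  finally show ?thesis using gd_ball_mass[OF s \<rho>, where 'n='n] by simp
qed

text \<open>The logarithm of the ratio of densities is y \<bullet> h + |h|^2 / 2.\<close>

lemma gd_shift_le: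
  fixes y h :: "real^'n"
  assumes "norm y \<le> R" "norm h \<le> T"
  shows "gd 1 y \<le> exp (R * T + T\<^sup>2 / 2) * gd 1 (y + h)"
proof -
  have R: "0 \<le> R" "0 \<le> T" using assms norm_ge_zero order_trans by blast+
  have "y \<bullet> h \<le> norm y * norm h" by (rule norm_cauchy_schwarz)
  also have "\<dots> \<le> R * T" using assms R by (intro mult_mono) auto
  finally have 1: "y \<bullet> h \<le> R * T" .
  have 2: "h \<bullet> h \<le> T\<^sup>2" using assms R by (simp add: power2_norm_eq_inner[symmetric] power_mono)
  have "gd 1 y = gd 1 (y + h) * exp (y \<bullet> h + h \<bullet> h / 2)"
    unfolding gd_eq by (simp add: mult_exp_exp inner_add_left inner_add_right inner_commute field_simps)
  also have "\<dots> \<le> gd 1 (y + h) * exp (R * T + T\<^sup>2 / 2)"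
    using 1 2 by (intro mult_left_mono) auto
  finally show ?thesis by (simp add: mult.commute)
qed

text \<open>Walking in a direction normal to a violated constraint, in steps of length \<open>r\<close>, a point of
  the orthant must pass through the shell before leaving it; since translations by bounded vectors
  distort the Gaussian density by a bounded factor, the shell has measure of order \<open>r\<close>.\<close>
lemma gauss_orth_gain:
  assumes \<eta>: "0 < \<eta>"
  shows "\<exists>c>0. \<forall>(A::real^'n^'m) z \<sigma> t. 0 < \<sigma> \<longrightarrow> (\<forall>i. norm (A $ i) \<le> \<sigma>) \<longrightarrow> 0 \<le> t \<longrightarrow>
    \<eta> \<le> gauss_orth A 1 z \<longrightarrow> gauss_orth A 1 z \<le> 1 - \<eta> \<longrightarrow>
    gauss_orth A 1 z + c * min (t / \<sigma>) 1 \<le> gauss_orth A 1 (z + (\<chi> i. t))"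
proof -
  let ?K = "gdK TYPE('n)" and ?m = "real CARD('m)"
  have K0: "0 < ?K" by (rule gdK_pos)
  have m1: "1 \<le> ?m" by (simp add: Suc_le_eq)
  \<comment> \<open>Outside the ball of radius R the Gaussian has measure at most \<eta> / (2 m),
    hence less than half of the orthant and less than the share \<eta> / m of one violated
    constraint.\<close>
  define R where "R = 1 + 2 * ?m * ?K / \<eta>"
  have R1: "1 \<le> R" unfolding R_def using K0 \<eta> by simp
  have KR: "?K / R ^ 4 \<le> \<eta> / (2 * ?m)"
  proof -
    have "2 * ?m * ?K / \<eta> \<le> R" unfolding R_def by simp
    also have "R \<le> R ^ 4" using R1 power_increasing[of 1 4 R] by simp
    finally show ?thesis using \<eta> R1 m1 by (simp add: field_simps)
  qed
  have KR2: "?K / R ^ 4 \<le> \<eta> / 2" "?K / R ^ 4 < \<eta> / ?m"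
  proof -
    have "\<eta> / (2 * ?m) \<le> \<eta> / 2" using \<eta> m1 by (intro divide_left_mono) auto
    then show "?K / R ^ 4 \<le> \<eta> / 2" by (rule order_trans[OF KR])
    have "\<eta> / (2 * ?m) < \<eta> / ?m" using \<eta> m1 by (intro divide_strict_left_mono) auto
    then show "?K / R ^ 4 < \<eta> / ?m" by (rule le_less_trans[OF KR])
  qed
  \<comment> \<open>The walk has to cover the distance 3 R and may overshoot by one step of length
    at most 1.\<close>
  define T where "T = 3 * R + 1"
  define c where "c = \<eta> / (2 * T * exp (R * T + T\<^sup>2 / 2))"
  have T0: "0 < T" unfolding T_def using R1 by simp
  have c0: "0 < c" unfolding c_def using \<eta> T0 by simp
  have "gauss_orth A 1 z + c * min (t / \<sigma>) 1 \<le> gauss_orth A 1 (z + (\<chi> i. t))"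
    if \<sigma>: "0 < \<sigma>" and A: "\<And>i. norm (A $ i) \<le> \<sigma>" and t: "0 \<le> t"
      and lo: "\<eta> \<le> gauss_orth A 1 z" and hi: "gauss_orth A 1 z \<le> 1 - \<eta>"
    for A :: "real^'n^'m" and z \<sigma> t
  proof (cases "t = 0")
    case True
    have "(\<chi> i. t) = (0 :: real^'m)" using True by (simp add: vec_eq_iff)
    then show ?thesis using True by simp
  next
    case False
    \<comment> \<open>A step of length r changes every linear form by at most r \<sigma> \<le> t, so
      no step can jump over the shell.\<close>
    define r where "r = min (t / \<sigma>) 1"
    have r: "0 < r" "r \<le> 1" "r * \<sigma> \<le> t"
    proof -
      show "0 < r" "r \<le> 1" unfolding r_def using False t \<sigma> by auto
      have "r \<le> t / \<sigma>" by (simp add: r_def)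
      then show "r * \<sigma> \<le> t" using \<sigma> by (simp add: field_simps)
    qed
    define f where "f y = nonneg_ind (z - A *v y)" for y
    define l where "l y = nonneg_ind (z + (\<chi> i. t) - A *v y) - f y" for y
    have Ac: "(A *v y) $ i = (A $ i) \<bullet> y" for y i by (simp add: matrix_vector_mul_component)
    have [measurable]: "f \<in> borel_measurable borel" "l \<in> borel_measurable borel" unfolding l_def f_def by measurable
    have f01: "f y = 0 \<or> f y = 1" for y by (auto simp: f_def nonneg_ind_def)
    have fl: "f y \<le> nonneg_ind (z + (\<chi> i. t) - A *v y)" for y
      unfolding f_def using t by (intro nonneg_ind_mono) simp
    have l01: "0 \<le> l y" "l y \<le> 1" for y
    proof -
      show "0 \<le> l y" using fl[of y] by (simp add: l_def)
      have "0 \<le> f y" "nonneg_ind (z + (\<chi> i. t) - A *v y) \<le> 1" by (simp_all add: f_def)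
      then show "l y \<le> 1" unfolding l_def by argo
    qed
    define B where "B i y = (if (A $ i) \<bullet> y \<le> z $ i then 0 else 1 :: real)" for i y
    have [measurable]: "B i \<in> borel_measurable borel" for i unfolding B_def by measurable
    have Bi: "integrable lborel (\<lambda>y. gd 1 y * B i y)" for i by (intro integrable_gd_mult) (auto simp: B_def)
    have fi: "integrable lborel (\<lambda>y. gd 1 y * f y)" using f01 by (intro integrable_gd_mult) (auto, metis abs_0 abs_1 order_refl zero_le_one)
    have G: "gauss_orth A 1 z = (\<integral>y. gd 1 y * f y \<partial>lborel)" unfolding gauss_orth_def f_def ..
    \<comment> \<open>The complement of the orthant has measure at least \<eta>; by the union bound
      one constraint accounts for a share \<eta> / m.\<close>
    have "\<exists>i. \<eta> / ?m \<le> (\<integral>y. gd 1 y * B i y \<partial>lborel)"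
    proof (rule ccontr)
      assume "\<not> ?thesis"
      then have "(\<Sum>i\<in>UNIV. \<integral>y. gd 1 y * B i y \<partial>lborel) < (\<Sum>i\<in>(UNIV::'m set). \<eta> / ?m)"
        by (intro sum_strict_mono) (auto simp: not_le)
      also have "\<dots> = \<eta>" by simp
      finally have 1: "(\<Sum>i\<in>UNIV. \<integral>y. gd 1 y * B i y \<partial>lborel) < \<eta>" .
      have "1 = (\<integral>y. gd 1 (y::real^'n) \<partial>lborel)" by simp
      also have "\<dots> \<le> (\<integral>y. gd 1 y * f y + (\<Sum>i\<in>UNIV. gd 1 y * B i y) \<partial>lborel)"
      proof (rule integral_mono)
        fix y show "gd 1 y \<le> gd 1 y * f y + (\<Sum>i\<in>UNIV. gd 1 y * B i y)"
        proof (cases "f y = 1")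
          case True then show ?thesis by (auto intro!: sum_nonneg simp: B_def)
        next
          case False
          then obtain i where "\<not> (A $ i) \<bullet> y \<le> z $ i" unfolding f_def nonneg_ind_def by (auto simp: Ac split: if_splits)
          then have "gd 1 y = gd 1 y * B i y" by (simp add: B_def)
          also have "\<dots> \<le> (\<Sum>i\<in>UNIV. gd 1 y * B i y)" by (rule member_le_sum) (auto simp: B_def)
          finally show ?thesis using f01[of y] False by simp
        qed
      qed (use fi Bi in auto)
      also have "\<dots> = gauss_orth A 1 z + (\<Sum>i\<in>UNIV. \<integral>y. gd 1 y * B i y \<partial>lborel)" unfolding G using fi Bi by simp
      finally show False using 1 hi by simp
    qed
    then obtain i where i: "\<eta> / ?m \<le> (\<integral>y. gd 1 y * B i y \<partial>lborel)" by blast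
    have em: "0 < \<eta> / ?m" using \<eta> m1 by simp
    \<comment> \<open>A vanishing row is satisfied by all points or by none, and both contradict the
      measure bounds.\<close>
    have Ai: "A $ i \<noteq> 0"
    proof
      assume a: "A $ i = 0"
      show False
      proof (cases "0 \<le> z $ i")
        case True
        then have "B i y = 0" for y by (simp add: B_def a)
        then show False using i em by simp
      next
        case False
        then have "f y = 0" for y unfolding f_def nonneg_ind_def by (auto simp: Ac a intro!: exI[of _ i])
        then show False using lo \<eta> unfolding G by simp
      qed
    qed
    \<comment> \<open>Otherwise the constraint would hold on the whole ball of radius R and its
      violation would be too unlikely.\<close>
    have zi: "z $ i \<le> R * norm (A $ i)"
    proof (rule ccontr)
      assume z: "\<not> ?thesis"
      have "(\<integral>y. gd 1 y * B i y \<partial>lborel) \<le> ?K / R ^ 4"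
      proof (rule gd_tail)
        fix y :: "real^'n" assume y: "norm y \<le> R * 1"
        have "(A $ i) \<bullet> y \<le> norm (A $ i) * norm y" by (rule norm_cauchy_schwarz)
        also have "\<dots> \<le> norm (A $ i) * R" using y by (intro mult_left_mono) auto
        finally show "B i y = 0" using z by (simp add: B_def mult.commute)
      qed (use R1 in \<open>auto simp: B_def\<close>)
      then show False using i KR2 by simp
    qed
    define n where "n = (1 / norm (A $ i)) *\<^sub>R A $ i"
    have nn: "norm n = 1" unfolding n_def using Ai by simp
    have An: "(A $ i) \<bullet> n = norm (A $ i)" unfolding n_def using Ai by (simp add: power2_norm_eq_inner[symmetric] power2_eq_square)
    define N where "N = nat \<lceil>3 * R / r\<rceil>"
    have N: "3 * R \<le> N * r" "N * r \<le> T"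
    proof -
      have "3 * R / r \<le> N" unfolding N_def by linarith
      then show "3 * R \<le> N * r" using r by (simp add: field_simps)
      have "real N \<le> 3 * R / r + 1" 
      proof -
        have "0 \<le> 3 * R / r" using R1 r by simp
        then show ?thesis unfolding N_def by linarith
      qed
      then have "N * r \<le> (3 * R / r + 1) * r" using r by (intro mult_right_mono) auto
      also have "\<dots> \<le> T" unfolding T_def using r by (simp add: field_simps)
      finally show "N * r \<le> T" .
    qed
    \<comment> \<open>A point of the orthant in the ball starts at height at least -R norm (A $ i),
      and a climb of 3 R passes the level of the face; the first position outside the orthant lies
      in the shell \<open>l\<close>.\<close>
    have cover: "f y * indicator {y. norm y \<le> R} y \<le> (\<Sum>j\<in>{1..N}. l (y + (j * r) *\<^sub>R n) * indicator {y. norm y \<le> R} y)" for y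
    proof (cases "norm y \<le> R \<and> f y = 1")
      case False
      then show ?thesis using f01[of y] l01 by (auto intro!: sum_nonneg)
    next
      case True
      define P where "P j = (f (y + (real j * r) *\<^sub>R n) = 0)" for j
      have "P N"
      proof -
        have "\<bar>(A $ i) \<bullet> y\<bar> \<le> norm (A $ i) * norm y" by (rule Cauchy_Schwarz_ineq2)
        also have "\<dots> \<le> norm (A $ i) * R" using True by (intro mult_left_mono) auto
        finally have "- (norm (A $ i) * R) \<le> (A $ i) \<bullet> y" by (simp add: abs_le_iff)
        moreover have "(3 * R) * norm (A $ i) \<le> (N * r) * norm (A $ i)" using N by (intro mult_right_mono) auto
        moreover have "0 < R * norm (A $ i)" using R1 Ai by simp
        ultimately have "z $ i < (A $ i) \<bullet> (y + (N * r) *\<^sub>R n)" using zi by (simp add: inner_add_right An mult.commute mult.left_commute)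
        then show ?thesis unfolding P_def f_def nonneg_ind_def by (auto simp: Ac not_le intro!: exI[of _ i])
      qed
      moreover have "\<not> P 0" using True by (simp add: P_def)
      ultimately obtain j where j: "j < N" "\<not> P j" "P (Suc j)"
        using ex_least_nat_less[of P N] by (metis le_eq_less_or_eq lessI less_imp_le)
      have fj: "f (y + (real j * r) *\<^sub>R n) = 1" using j f01 unfolding P_def by blast
      have "nonneg_ind (z + (\<chi> i. t) - A *v (y + (real (Suc j) * r) *\<^sub>R n)) = 1"
      proof -
        have "(A $ k) \<bullet> (y + (real (Suc j) * r) *\<^sub>R n) \<le> z $ k + t" for k
        proof -
          have "(A $ k) \<bullet> (y + (real j * r) *\<^sub>R n) \<le> z $ k"
            using fj unfolding f_def nonneg_ind_def by (simp add: Ac split: if_splits)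
          moreover have "r * ((A $ k) \<bullet> n) \<le> t"
          proof -
            have "(A $ k) \<bullet> n \<le> norm (A $ k) * norm n" by (rule norm_cauchy_schwarz)
            also have "\<dots> \<le> \<sigma>" using A nn by simp
            finally have "r * ((A $ k) \<bullet> n) \<le> r * \<sigma>" using r by (intro mult_left_mono) auto
            then show ?thesis by (rule order_trans[OF _ r(3)])
          qed
          ultimately show ?thesis by (simp add: inner_add_right algebra_simps)
        qed
        then show ?thesis unfolding nonneg_ind_def by (simp add: Ac)
      qed
      then have "l (y + (real (Suc j) * r) *\<^sub>R n) = 1" using j unfolding l_def P_def by simp
      then have "1 = l (y + (real (Suc j) * r) *\<^sub>R n) * indicator {y. norm y \<le> R} y" using True by simp
      also have "\<dots> \<le> (\<Sum>j\<in>{1..N}. l (y + (j * r) *\<^sub>R n) * indicator {y. norm y \<le> R} y)"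
        by (rule member_le_sum) (use j l01 in auto)
      finally show ?thesis using True by simp
    qed
    define Lm where "Lm = (\<integral>y. gd 1 y * l y \<partial>lborel)"
    have li: "integrable lborel (\<lambda>y. gd 1 y * l y)" using l01 by (intro integrable_gd_mult) auto
    have Lm: "Lm = gauss_orth A 1 (z + (\<chi> i. t)) - gauss_orth A 1 z"
      unfolding Lm_def l_def f_def gauss_orth_def right_diff_distrib
      by (intro Bochner_Integration.integral_diff integrable_gd_mult) auto
    let ?X = "exp (R * T + T\<^sup>2 / 2)"
    have term_i: "integrable lborel (\<lambda>y. gd 1 y * (l (y + h) * indicator {y. norm y \<le> R} y))" for h
      using l01 by (intro integrable_gd_mult) (auto simp: indicator_def)
    have sh: "integrable lborel (\<lambda>y. gd 1 (y + h) * l (y + h))" "(\<integral>y. gd 1 (y + h) * l (y + h) \<partial>lborel) = Lm" for h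
      using integrable_shift[OF li, of h] integral_shift[of "\<lambda>y. gd 1 y * l y" h] by (auto simp: Lm_def)
    have shift: "(\<integral>y. gd 1 y * (l (y + h) * indicator {y. norm y \<le> R} y) \<partial>lborel) \<le> ?X * Lm" if h: "norm h \<le> T" for h
    proof -
      have "(\<integral>y. gd 1 y * (l (y + h) * indicator {y. norm y \<le> R} y) \<partial>lborel) \<le> (\<integral>y. ?X * (gd 1 (y + h) * l (y + h)) \<partial>lborel)"
      proof (rule integral_mono)
        fix y :: "real^'n"
        show "gd 1 y * (l (y + h) * indicator {y. norm y \<le> R} y) \<le> ?X * (gd 1 (y + h) * l (y + h))"
          using mult_right_mono[OF gd_shift_le[of y R h T] l01(1)[of "y + h"]] h l01(1)[of "y + h"]
          by (cases "norm y \<le> R") (auto simp: mult.assoc)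
      qed (use term_i sh in auto)
      then show ?thesis by (simp add: sh)
    qed
    have fRi: "integrable lborel (\<lambda>y. gd 1 y * (f y * indicator {y. norm y \<le> R} y))"
      using f01 by (intro integrable_gd_mult) (auto simp: indicator_def, metis abs_0 abs_1 order_refl zero_le_one)
    have tail: "(\<integral>y. gd 1 y * (f y * (1 - indicator {y. norm y \<le> R} y)) \<partial>lborel) \<le> ?K / R ^ 4"
      by (rule gd_tail) (use R1 f01 in \<open>auto simp: indicator_def f_def\<close>)
    have "gauss_orth A 1 z = (\<integral>y. gd 1 y * (f y * indicator {y. norm y \<le> R} y) \<partial>lborel) + (\<integral>y. gd 1 y * (f y * (1 - indicator {y. norm y \<le> R} y)) \<partial>lborel)"
    proof -
      have "(\<integral>y. gd 1 y * (f y * (1 - indicator {y. norm y \<le> R} y)) \<partial>lborel) = (\<integral>y. gd 1 y * f y - gd 1 y * (f y * indicator {y. norm y \<le> R} y) \<partial>lborel)"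
        by (simp add: right_diff_distrib)
      then show ?thesis unfolding G using fi fRi by simp
    qed
    \<comment> \<open>At least \<eta> / 2 of the orthant lies in the ball and is covered by N
      translates of the shell, each of measure at most \<open>?X * Lm\<close>; with N r \<le> T this
      is the lower bound c r.\<close>
    then have "\<eta> / 2 \<le> (\<integral>y. gd 1 y * (f y * indicator {y. norm y \<le> R} y) \<partial>lborel)" using tail KR2 lo by argo
    also have "\<dots> \<le> (\<integral>y. (\<Sum>j\<in>{1..N}. gd 1 y * (l (y + (j * r) *\<^sub>R n) * indicator {y. norm y \<le> R} y)) \<partial>lborel)"
    proof (rule integral_mono)
      show "gd 1 y * (f y * indicator {y. norm y \<le> R} y) \<le> (\<Sum>j\<in>{1..N}. gd 1 y * (l (y + (j * r) *\<^sub>R n) * indicator {y. norm y \<le> R} y))" for y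
        unfolding sum_distrib_left[symmetric] by (intro mult_left_mono cover) simp
    qed (intro fRi Bochner_Integration.integrable_sum term_i)+
    also have "\<dots> = (\<Sum>j\<in>{1..N}. \<integral>y. gd 1 y * (l (y + (j * r) *\<^sub>R n) * indicator {y. norm y \<le> R} y) \<partial>lborel)"
      using term_i by simp
    also have "\<dots> \<le> (\<Sum>j\<in>{1..N}. ?X * Lm)"
    proof (intro sum_mono shift)
      fix j assume "j \<in> {1..N}"
      then have "real j * r \<le> N * r" using r by (intro mult_right_mono) auto
      then show "norm ((real j * r) *\<^sub>R n) \<le> T" using order_trans[OF _ N(2)] r nn by simp
    qed
    finally have "\<eta> / 2 \<le> N * (?X * Lm)" by simp
    then have "\<eta> / 2 * r \<le> (N * r) * (?X * Lm)" using r mult_right_mono[of "\<eta> / 2" "N * (?X * Lm)" r] by (simp add: mult_ac)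
    also have "\<dots> \<le> T * (?X * Lm)"
    proof (intro mult_right_mono N)
      have "0 \<le> Lm" unfolding Lm_def using l01 by (intro integral_nonneg_AE) auto
      then show "0 \<le> ?X * Lm" by simp
    qed
    finally have "c * r \<le> Lm" unfolding c_def using T0 by (simp add: field_simps)
    then show ?thesis unfolding Lm r_def by simp
  qed
  then show ?thesis using c0 by blast
qed

section \<open>Sums of vectors with singular covariance\<close>

lemma parseval_orthonormal:
  fixes B :: "'a::euclidean_space set"
  assumes fin: "finite B" and orth: "pairwise orthogonal B" and nrm: "\<And>b. b \<in> B \<Longrightarrow> norm b = 1" and z: "z \<in> span B"
  shows "(\<Sum>b\<in>B. (z \<bullet> b)\<^sup>2) = z \<bullet> z"
proof -
  define z' where "z' = z - (\<Sum>b\<in>B. (z \<bullet> b) *\<^sub>R b)"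
  have o: "b \<bullet> z' = 0" if b: "b \<in> B" for b
  proof -
    have "(\<Sum>c\<in>B. (z \<bullet> c) * (b \<bullet> c)) = (\<Sum>c\<in>B. if c = b then z \<bullet> b else 0)"
      using orth nrm[OF b] b by (intro sum.cong refl) (auto simp: pairwise_def orthogonal_def norm_eq_1)
    then show ?thesis using fin b by (simp add: z'_def inner_diff_right inner_sum_right inner_commute)
  qed
  have "z' \<in> span B" unfolding z'_def by (intro span_diff z span_sum span_scale span_base)
  then have "orthogonal z' z'" using o by (intro orthogonal_to_span[of z' B z']) (auto simp: orthogonal_def inner_commute)
  then have "z = (\<Sum>b\<in>B. (z \<bullet> b) *\<^sub>R b)" by (simp add: orthogonal_def z'_def)
  then have "z \<bullet> z = z \<bullet> (\<Sum>b\<in>B. (z \<bullet> b) *\<^sub>R b)" by simp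
  then show ?thesis by (simp add: inner_sum_right power2_eq_square)
qed

primrec sum_cdf :: "'i set \<Rightarrow> ('i \<Rightarrow> real) \<Rightarrow> ('i \<Rightarrow> real^'m) \<Rightarrow> nat \<Rightarrow> real^'m \<Rightarrow> real" where
  "sum_cdf I p X 0 z = nonneg_ind z"
| "sum_cdf I p X (Suc k) z = (\<Sum>a\<in>I. p a * sum_cdf I p X k (z - X a))"

lemma (in std_vectors) orth_cdf_eq_sum_cdf: "orth_cdf A k z = sum_cdf I w (\<lambda>a. A *v u a) k z"
  by (induction k arbitrary: z) auto

text \<open>Auxiliary randomness j that does not influence the summand leaves the law of the sum
  unchanged.\<close>

lemma sum_cdf_product:
  assumes "finite I" "finite J" "(\<Sum>j\<in>J. v j) = 1" "\<And>a j. a \<in> I \<Longrightarrow> j \<in> J \<Longrightarrow> Y (a, j) = X a"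
  shows "sum_cdf (I \<times> J) (\<lambda>(a, j). p a * v j) Y k z = sum_cdf I p X k z"
proof (induction k arbitrary: z)
  case (Suc k)
  have "sum_cdf (I \<times> J) (\<lambda>(a, j). p a * v j) Y (Suc k) z = (\<Sum>a\<in>I. \<Sum>j\<in>J. p a * v j * sum_cdf I p X k (z - X a))"
    by (simp add: Suc sum.cartesian_product assms(4) cong: sum.cong) (intro sum.cong refl, auto simp: assms(4))
  also have "\<dots> = (\<Sum>a\<in>I. p a * (\<Sum>j\<in>J. v j) * sum_cdf I p X k (z - X a))"
    by (simp add: sum_distrib_left sum_distrib_right)
  finally show ?case by (simp add: assms(3))
qed simp

text \<open>Standardisation of a possibly degenerate vector \<open>X\<close>: write \<open>X = A *v u\<close> with \<open>u\<close> in the range of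
  the transpose of \<open>A\<close>, and fill up the missing directions with independent noise in the kernel of \<open>A\<close>.\<close>
lemma exists_std_vectors:
  fixes A :: "real^'n^'m" and X :: "'i \<Rightarrow> real^'m"
  assumes finI: "finite I" and p0: "\<And>a. a \<in> I \<Longrightarrow> 0 < p a" and p1: "(\<Sum>a\<in>I. p a) = 1"
    and mean: "(\<Sum>a\<in>I. p a *\<^sub>R X a) = 0"
    and cov: "\<And>s t. (A ** transpose A) $ s $ t = (\<Sum>a\<in>I. p a * X a $ s * X a $ t)"
    and \<gamma>: "1 \<le> \<gamma>" "\<And>a. a \<in> I \<Longrightarrow> 1 / p a \<le> \<gamma>\<^sup>2"
  shows "\<exists>(J :: ((real^'n) \<times> real) set) v U. finite J \<and> (\<Sum>j\<in>J. v j) = 1 \<and>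
    std_vectors (I \<times> J) (\<lambda>(a, j). p a * v j) U (\<gamma> + sqrt CARD('n)) \<and>
    (\<forall>a\<in>I. \<forall>j\<in>J. A *v U (a, j) = X a)"
proof -
  let ?n = "real CARD('n)" and ?At = "transpose A"
  have adj: "(?At *v d) \<bullet> c = d \<bullet> (A *v c)" for d c
    by (simp add: transpose_matrix_vector dot_lmul_matrix)
  define V where "V d = A *v (?At *v d)" for d
  have quad: "c \<bullet> V d = (\<Sum>a\<in>I. p a * (c \<bullet> X a) * (d \<bullet> X a))" for c d
  proof -
    have "c \<bullet> V d = (\<Sum>s\<in>UNIV. \<Sum>t\<in>UNIV. c $ s * (A ** ?At) $ s $ t * d $ t)"
      unfolding V_def matrix_vector_mul_assoc by (simp add: inner_vec_def matrix_vector_mult_def sum_distrib_left mult.assoc)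
    also have "\<dots> = (\<Sum>s\<in>UNIV. \<Sum>t\<in>UNIV. \<Sum>a\<in>I. p a * (c $ s * X a $ s) * (d $ t * X a $ t))"
      unfolding cov by (simp add: sum_distrib_left sum_distrib_right mult_ac)
    also have "\<dots> = (\<Sum>a\<in>I. \<Sum>s\<in>UNIV. \<Sum>t\<in>UNIV. p a * (c $ s * X a $ s) * (d $ t * X a $ t))"
      by (subst sum.swap, subst (2) sum.swap, subst sum.swap) (rule sum.cong[OF refl sum.swap])
    also have "\<dots> = (\<Sum>a\<in>I. p a * (c \<bullet> X a) * (d \<bullet> X a))"
    proof (intro sum.cong refl)
      fix a
      have "(c \<bullet> X a) * (d \<bullet> X a) = (\<Sum>s\<in>UNIV. \<Sum>t\<in>UNIV. (c $ s * X a $ s) * (d $ t * X a $ t))"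
        by (simp only: inner_vec_def inner_real_def sum_product)
      then show "(\<Sum>s\<in>UNIV. \<Sum>t\<in>UNIV. p a * (c $ s * X a $ s) * (d $ t * X a $ t)) = p a * (c \<bullet> X a) * (d \<bullet> X a)"
        by (simp add: sum_distrib_left mult.assoc)
    qed
    finally show ?thesis .
  qed
  have quad2: "c \<bullet> V c = (\<Sum>a\<in>I. p a * (c \<bullet> X a)\<^sup>2)" for c unfolding quad by (simp add: power2_eq_square mult.assoc)
  have linV: "linear V" unfolding V_def matrix_vector_mul_assoc by (rule matrix_vector_mul_linear)
  \<comment> \<open>The component of \<open>X a\<close> orthogonal to the range of the covariance
    has variance zero, and as p a > 0 it vanishes.\<close>
  have "\<exists>w. V w = X a" if a: "a \<in> I" for a
  proof -
    have sub: "subspace (range V)" by (rule linear_subspace_image[OF linV subspace_UNIV])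
    obtain y z where y: "y \<in> span (range V)" and z: "\<And>w. w \<in> span (range V) \<Longrightarrow> orthogonal z w" and eq: "X a = y + z"
      using orthogonal_subspace_decomp_exists[of "range V" "X a"] by metis
    have "z \<bullet> V z = 0" using z[OF span_base, of "V z"] by (simp add: orthogonal_def)
    then have "p a * (z \<bullet> X a)\<^sup>2 = 0"
      unfolding quad2 using finI a p0 by (subst (asm) sum_nonneg_eq_0_iff) (auto simp: less_imp_le)
    then have "z \<bullet> X a = 0" using p0[OF a] by simp
    then have "z = 0" using z[OF y] unfolding eq by (simp add: orthogonal_def inner_add_right)
    moreover have sp: "span (range V) = range V" using sub by (simp only: span_eq_iff)
    ultimately show ?thesis using y[unfolded sp] eq by auto
  qed
  then obtain w where w: "\<And>a. a \<in> I \<Longrightarrow> V (w a) = X a" by metis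
  define u where "u a = ?At *v w a" for a
  have Au: "A *v u a = X a" if "a \<in> I" for a using w[OF that] by (simp add: u_def V_def)
  \<comment> \<open>The leverage bound: with q = |u a|^2 = w a \<bullet> X a, the single term p a *
    q^2 is at most the variance of w a \<bullet> X, which is q itself. Hence q \<le> 1 / p a with no
    reference to eigenvalues.\<close>
  have unorm: "norm (u a) \<le> \<gamma>" if a: "a \<in> I" for a
  proof -
    define q where "q = w a \<bullet> X a"
    have q: "u a \<bullet> u a = q" unfolding u_def adj q_def using w[OF a] by (simp add: V_def)
    have "p a * q\<^sup>2 \<le> (\<Sum>a'\<in>I. p a' * (w a \<bullet> X a')\<^sup>2)" unfolding q_def
      by (rule member_le_sum[OF a _ finI]) (auto simp: less_imp_le p0)
    also have "\<dots> = q" unfolding quad2[symmetric] w[OF a] q_def ..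
    finally have "p a * q * q \<le> 1 * q" by (simp add: power2_eq_square mult.assoc)
    moreover have "0 \<le> q" using q inner_ge_zero[of "u a"] by simp
    ultimately have "q \<le> 1 / p a" using p0[OF a] by (cases "q = 0") (auto simp: field_simps)
    also have "\<dots> \<le> \<gamma>\<^sup>2" by (rule \<gamma>(2)[OF a])
    finally have "(norm (u a))\<^sup>2 \<le> \<gamma>\<^sup>2" using q by (simp add: power2_norm_eq_inner)
    then show ?thesis by (rule power2_le_imp_le) (use \<gamma> in simp)
  qed
  define N where "N = {x. A *v x = 0}"
  have subN: "subspace N" unfolding N_def by (auto simp: subspace_def matrix_vector_right_distrib matrix_vector_mult_scaleR)
  obtain B where B: "B \<subseteq> N" "pairwise orthogonal B" "\<And>x. x \<in> B \<Longrightarrow> norm x = 1" "independent B" "card B = dim N" "span B = N"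
    using orthonormal_basis_subspace[OF subN] by metis
  have finB: "finite B" using B(4) by (rule independent_imp_finite)
  have cardB: "real (card B) \<le> ?n" using dim_subset_UNIV[of N] B(5) by simp
  have n1: "1 \<le> ?n" by (simp add: Suc_le_eq)
  \<comment> \<open>The noise takes each direction of an orthonormal basis of the kernel with
    probability 1/n, random sign and length sqrt n, and is 0 with the remaining probability. Its
    covariance is the projection onto the kernel.\<close>
  define r where "r = sqrt ?n"
  have r0: "0 < r" "r\<^sup>2 = ?n" unfolding r_def using n1 by auto
  define J where "J = insert (0, 0) (B \<times> {r, - r})"
  define v where "v j = (if snd j = 0 then 1 - card B / ?n else 1 / (2 * ?n))" for j :: "(real^'n) \<times> real"
  have finJ: "finite J" unfolding J_def using finB by simp
  have sumJ: "(\<Sum>j\<in>J. v j *\<^sub>R f j) = (1 - card B / ?n) *\<^sub>R f (0, 0) + (1 / (2 * ?n)) *\<^sub>R (\<Sum>b\<in>B. f (b, r) + f (b, - r))"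
    for f :: "(real^'n) \<times> real \<Rightarrow> 'c::real_vector"
  proof -
    have "(\<Sum>j\<in>J. v j *\<^sub>R f j) = v (0, 0) *\<^sub>R f (0, 0) + (\<Sum>j\<in>B \<times> {r, - r}. v j *\<^sub>R f j)"
      unfolding J_def using finB r0 by (subst sum.insert) auto
    also have "(\<Sum>j\<in>B \<times> {r, - r}. v j *\<^sub>R f j) = (\<Sum>b\<in>B. \<Sum>s\<in>{r, -r}. v (b, s) *\<^sub>R f (b, s))"
      by (simp add: sum.cartesian_product)
    also have "\<dots> = (\<Sum>b\<in>B. (1 / (2 * ?n)) *\<^sub>R (f (b, r) + f (b, - r)))"
      using r0 by (intro sum.cong refl) (simp add: v_def scaleR_add_right)
    finally show ?thesis by (simp add: v_def scaleR_sum_right)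
  qed
  have v0: "0 \<le> v j" for j unfolding v_def using cardB n1 by (simp add: field_simps)
  have v1: "(\<Sum>j\<in>J. v j) = 1" using sumJ[of "\<lambda>_. 1::real"] n1 by (simp add: field_simps)
  define x where "x j = snd j *\<^sub>R fst j" for j :: "(real^'n) \<times> real"
  have xmean: "(\<Sum>j\<in>J. v j *\<^sub>R x j) = 0" unfolding sumJ x_def by simp
  have xcov: "(\<Sum>j\<in>J. v j * (c \<bullet> x j)\<^sup>2) = (\<Sum>b\<in>B. (c \<bullet> b)\<^sup>2)" for c
  proof -
    have "(\<Sum>j\<in>J. v j * (c \<bullet> x j)\<^sup>2) = (1 / (2 * ?n)) * (\<Sum>b\<in>B. (2 * ?n) * (c \<bullet> b)\<^sup>2)"
      using sumJ[of "\<lambda>j. (c \<bullet> x j)\<^sup>2"] by (simp add: x_def power_mult_distrib r0 mult.assoc)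
    also have "\<dots> = (\<Sum>b\<in>B. (c \<bullet> b)\<^sup>2)" unfolding sum_distrib_left[symmetric] using n1 by simp
    finally show ?thesis .
  qed
  have xN: "A *v x j = 0" if "j \<in> J" for j
    using that B(1) unfolding J_def x_def N_def by (auto simp: matrix_vector_mult_scaleR)
  have xnorm: "norm (x j) \<le> r" if "j \<in> J" for j
    using that B(3) r0 unfolding J_def x_def by auto
  define U where "U aj = u (fst aj) + x (snd aj)" for aj
  define W where "W = (\<lambda>(a, j). p a * v j)"
  have prod: "(\<Sum>aj\<in>I \<times> J. W aj *\<^sub>R g aj) = (\<Sum>a\<in>I. p a *\<^sub>R (\<Sum>j\<in>J. v j *\<^sub>R g (a, j)))" for g :: "_ \<Rightarrow> 'c::real_vector"
    by (simp add: W_def sum.cartesian_product scaleR_sum_right case_prod_unfold)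
  \<comment> \<open>The mean m is of the form \<open>?At *v k\<close> and is annihilated by
    \<open>A\<close>, hence orthogonal to itself.\<close>
  have umean: "(\<Sum>a\<in>I. p a *\<^sub>R u a) = 0"
  proof -
    define k where "k = (\<Sum>a\<in>I. p a *\<^sub>R w a)"
    define m where "m = (\<Sum>a\<in>I. p a *\<^sub>R u a)"
    have mk: "m = ?At *v k" unfolding m_def k_def u_def by (simp add: linear_sum[OF matrix_vector_mul_linear] matrix_vector_mult_scaleR)
    have "A *v m = (\<Sum>a\<in>I. p a *\<^sub>R (A *v u a))" unfolding m_def by (simp add: linear_sum[OF matrix_vector_mul_linear] matrix_vector_mult_scaleR)
    also have "\<dots> = 0" using mean Au by (simp cong: sum.cong)
    finally have "m \<bullet> m = 0" using adj[of k m] mk by simp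
    then show ?thesis by (simp add: m_def)
  qed
  have "std_vectors (I \<times> J) W U (\<gamma> + r)"
  proof
    show "finite (I \<times> J)" using finI finJ by simp
    show "0 \<le> W a" if "a \<in> I \<times> J" for a using that p0 v0 by (auto simp: W_def less_imp_le)
    show "(\<Sum>a\<in>I \<times> J. W a) = 1" using prod[of "\<lambda>_. 1::real"] by (simp add: v1 p1)
    show "(\<Sum>a\<in>I \<times> J. W a *\<^sub>R U a) = 0"
    proof -
      have "(\<Sum>j\<in>J. v j *\<^sub>R U (a, j)) = u a" for a
        by (simp add: U_def scaleR_add_right sum.distrib xmean scaleR_left.sum[symmetric] v1)
      then show ?thesis unfolding prod by (simp add: umean)
    qed
    show "norm (U a) \<le> \<gamma> + r" if "a \<in> I \<times> J" for a
      using that unorm xnorm unfolding U_def by (intro order_trans[OF norm_triangle_ineq add_mono]) auto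
    show "1 \<le> \<gamma> + r" using \<gamma> r0 by simp
    \<comment> \<open>Split c into y in the range of the transpose and z in the kernel of
      \<open>A\<close>: the standardised part contributes y \<bullet> y, the noise z \<bullet>
      z.\<close>
    show "(\<Sum>a\<in>I \<times> J. W a * (c \<bullet> U a)\<^sup>2) = c \<bullet> c" for c
    proof -
      have subR: "subspace (range (\<lambda>d. ?At *v d))" by (rule linear_subspace_image[OF matrix_vector_mul_linear subspace_UNIV])
      obtain y z where y: "y \<in> span (range (\<lambda>d. ?At *v d))" and z: "\<And>w. w \<in> span (range (\<lambda>d. ?At *v d)) \<Longrightarrow> orthogonal z w" and eq: "c = y + z"
        using orthogonal_subspace_decomp_exists[of "range (\<lambda>d. ?At *v d)" c] by metis
      have sp: "span (range (\<lambda>d. ?At *v d)) = range (\<lambda>d. ?At *v d)" using subR by (simp only: span_eq_iff)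
      obtain d where d: "y = ?At *v d" using y[unfolded sp] by auto
      have "(A *v z) \<bullet> (A *v z) = (?At *v (A *v z)) \<bullet> z" by (simp only: adj)
      also have "\<dots> = 0" using z[OF span_base, of "?At *v (A *v z)"] by (simp add: orthogonal_def inner_commute)
      finally have Az: "A *v z = 0" by simp
      have yz: "y \<bullet> z = 0" using z[OF y] by (simp add: orthogonal_def inner_commute)
      have zu: "z \<bullet> u a = 0" for a using adj[of "w a" z] by (simp add: u_def inner_commute Az)
      have yu: "y \<bullet> u a = d \<bullet> X a" if "a \<in> I" for a unfolding d adj Au[OF that] ..
      have cu: "(\<Sum>a\<in>I. p a * (c \<bullet> u a)\<^sup>2) = y \<bullet> y"
      proof -
        have "(\<Sum>a\<in>I. p a * (c \<bullet> u a)\<^sup>2) = (\<Sum>a\<in>I. p a * (d \<bullet> X a)\<^sup>2)"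
          by (intro sum.cong refl) (simp add: eq inner_add_left zu yu)
        also have "\<dots> = d \<bullet> V d" by (simp add: quad2)
        also have "\<dots> = y \<bullet> y" by (simp only: d adj V_def)
        finally show ?thesis .
      qed
      have cb: "c \<bullet> b = z \<bullet> b" if "b \<in> B" for b
      proof -
        have "A *v b = 0" using that B(1) by (auto simp: N_def)
        then have "y \<bullet> b = 0" by (simp only: d adj inner_zero_right)
        then show ?thesis by (simp add: eq inner_add_left)
      qed
      have cx: "(\<Sum>j\<in>J. v j * (c \<bullet> x j)\<^sup>2) = z \<bullet> z"
        unfolding xcov using parseval_orthonormal[OF finB B(2,3), of z] B(6) Az by (simp add: cb N_def cong: sum.cong)
      have cm: "(\<Sum>j\<in>J. v j * (c \<bullet> x j)) = 0" using arg_cong[OF xmean, of "\<lambda>t. c \<bullet> t"] by (simp add: inner_sum_right)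
      have "(\<Sum>j\<in>J. v j * (c \<bullet> U (a, j))\<^sup>2) = (c \<bullet> u a)\<^sup>2 + z \<bullet> z" for a
      proof -
        have "(\<Sum>j\<in>J. v j * (c \<bullet> U (a, j))\<^sup>2) = (\<Sum>j\<in>J. v j * (c \<bullet> u a)\<^sup>2 + 2 * (c \<bullet> u a) * (v j * (c \<bullet> x j)) + v j * (c \<bullet> x j)\<^sup>2)"
          by (intro sum.cong refl) (simp add: U_def inner_add_right power2_sum algebra_simps)
        also have "\<dots> = (c \<bullet> u a)\<^sup>2 + z \<bullet> z"
          by (simp add: sum.distrib sum_distrib_left[symmetric] sum_distrib_right[symmetric] cx cm v1)
        finally show ?thesis .
      qed
      then have "(\<Sum>a\<in>I \<times> J. W a * (c \<bullet> U a)\<^sup>2) = (\<Sum>a\<in>I. p a * ((c \<bullet> u a)\<^sup>2 + z \<bullet> z))"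
        using prod[of "\<lambda>a. (c \<bullet> U a)\<^sup>2"] by simp
      also have "\<dots> = y \<bullet> y + z \<bullet> z"
        by (simp add: distrib_left sum.distrib sum_distrib_right[symmetric] cu p1)
      also have "\<dots> = c \<bullet> c" unfolding eq using yz by (simp add: inner_add_left inner_add_right inner_commute)
      finally show ?thesis .
    qed
  qed
  moreover have "A *v U (a, j) = X a" if "a \<in> I" "j \<in> J" for a j
    using that by (simp add: U_def matrix_vector_right_distrib Au xN)
  ultimately show ?thesis using finJ v1 unfolding W_def r_def by (intro exI[of _ J] exI[of _ v] exI[of _ U]) auto
qed

text \<open>The error depends on the distribution through its smallest probability alone, which is
  the quantity that \<open>kappa\<close> controls; a covariance close to singular does no
  harm.\<close>

lemma berry_esseen_sum_cdf:
  "\<exists>M>0. \<forall>(I::'i set) p (X :: 'i \<Rightarrow> real^'m) (A::real^'n^'m) \<gamma> k z.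
     finite I \<longrightarrow> (\<forall>a\<in>I. 0 < p a) \<longrightarrow> (\<Sum>a\<in>I. p a) = 1 \<longrightarrow> (\<Sum>a\<in>I. p a *\<^sub>R X a) = 0 \<longrightarrow>
     (\<forall>s t. (A ** transpose A) $ s $ t = (\<Sum>a\<in>I. p a * X a $ s * X a $ t)) \<longrightarrow>
     1 \<le> \<gamma> \<longrightarrow> (\<forall>a\<in>I. 1 / p a \<le> \<gamma>\<^sup>2) \<longrightarrow> 1 \<le> k \<longrightarrow>
     \<bar>sum_cdf I p X k z - gauss_orth A (sqrt (real k)) z\<bar> \<le> M * \<gamma> / sqrt (real k)"
proof -
  obtain M where M: "0 < M" and be: "\<And>(I::('i \<times> ((real^'n) \<times> real)) set) w u \<beta> (A::real^'n^'m) k z. std_vectors I w u \<beta> \<Longrightarrow> 1 \<le> k \<Longrightarrow>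
     \<bar>std_vectors.orth_cdf I w u A k z - gauss_orth A (sqrt (real k)) z\<bar> \<le> M * \<beta> / sqrt (real k)"
    using berry_esseen[where 'i="'i \<times> ((real^'n) \<times> real)" and 'n='n and 'm='m] by blast
  have "\<bar>sum_cdf I p X k z - gauss_orth A (sqrt (real k)) z\<bar> \<le> M * (1 + sqrt CARD('n)) * \<gamma> / sqrt (real k)"
    if h: "finite I" "\<forall>a\<in>I. 0 < p a" "(\<Sum>a\<in>I. p a) = 1" "(\<Sum>a\<in>I. p a *\<^sub>R X a) = 0"
     "\<forall>s t. (A ** transpose A) $ s $ t = (\<Sum>a\<in>I. p a * X a $ s * X a $ t)"
     "1 \<le> \<gamma>" "\<forall>a\<in>I. 1 / p a \<le> \<gamma>\<^sup>2" "1 \<le> k"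
    for I :: "'i set" and p and X :: "'i \<Rightarrow> real^'m" and A :: "real^'n^'m" and \<gamma> k z
  proof -
    obtain J :: "((real^'n) \<times> real) set" and v U where J: "finite J" "(\<Sum>j\<in>J. v j) = 1"
      "std_vectors (I \<times> J) (\<lambda>(a, j). p a * v j) U (\<gamma> + sqrt CARD('n))" "\<forall>a\<in>I. \<forall>j\<in>J. A *v U (a, j) = X a"
      using exists_std_vectors[of I p X A \<gamma>] h by blast
    have "std_vectors.orth_cdf (I \<times> J) (\<lambda>(a, j). p a * v j) U A k z = sum_cdf I p X k z"
      unfolding std_vectors.orth_cdf_eq_sum_cdf[OF J(3)] using J h by (intro sum_cdf_product) auto
    then have "\<bar>sum_cdf I p X k z - gauss_orth A (sqrt (real k)) z\<bar> \<le> M * (\<gamma> + sqrt CARD('n)) / sqrt (real k)"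
      using be[OF J(3) h(8), of A z] by simp
    also have "\<dots> \<le> M * ((1 + sqrt CARD('n)) * \<gamma>) / sqrt (real k)"
      using M h(6) mult_right_mono[of 1 \<gamma> "sqrt CARD('n)"] by (intro divide_right_mono mult_left_mono) (auto simp: algebra_simps)
    finally show ?thesis by (simp add: mult.assoc)
  qed
  moreover have "0 < M * (1 + sqrt CARD('n))" using M by (intro mult_pos_pos add_pos_nonneg) auto
  ultimately show ?thesis by blast
qed

section \<open>Random coding\<close>

text \<open>Expectation over a random codebook with independent codewords of law \<open>P\<close>.
  Extensional functions make the set of codebooks finite.\<close>

definition codebook_mean :: "'m set \<Rightarrow> 'a set \<Rightarrow> ('a \<Rightarrow> real) \<Rightarrow> (('m \<Rightarrow> 'a) \<Rightarrow> real) \<Rightarrow> real" where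
  "codebook_mean M A P g = (\<Sum>f\<in>M \<rightarrow>\<^sub>E A. (\<Prod>k\<in>M. P (f k)) * g f)"

lemma codebook_mean_diff: "codebook_mean M A P (\<lambda>f. g f - h f) = codebook_mean M A P g - codebook_mean M A P h"
  by (simp add: codebook_mean_def right_diff_distrib sum_subtractf)

lemma codebook_mean_sum: "codebook_mean M A P (\<lambda>f. \<Sum>i\<in>I. g i f) = (\<Sum>i\<in>I. codebook_mean M A P (g i))"
  unfolding codebook_mean_def sum_distrib_left by (rule sum.swap)

lemma codebook_mean_const:
  assumes "finite M" "finite A" "(\<Sum>x\<in>A. P x) = 1"
  shows "codebook_mean M A P (\<lambda>_. c) = c"
proof -
  have "(\<Prod>k\<in>M. \<Sum>x\<in>A. P x) = (\<Sum>f\<in>M \<rightarrow>\<^sub>E A. \<Prod>k\<in>M. P (f k))"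
    using assms by (intro prod_sum_PiE) auto
  then show ?thesis using assms by (simp add: codebook_mean_def sum_distrib_right[symmetric])
qed

text \<open>Distinct codewords are independent. The values at \<open>m\<close> and \<open>m'\<close>
  are fixed by indicators attached to the factors, so that the sum over codebooks still
  factorises.\<close>

lemma codebook_mean_pair:
  fixes A :: "'a set"
  assumes fin: "finite M" "finite A" and P1: "(\<Sum>x\<in>A. P x) = 1" and m: "m \<in> M" "m' \<in> M" "m \<noteq> m'"
  shows "codebook_mean M A P (\<lambda>f. g (f m) (f m')) = (\<Sum>x\<in>A. \<Sum>x'\<in>A. P x * P x' * g x x')"
proof -
  define h where "h x x' k z = P z * (if k = m then of_bool (z = x) else if k = m' then of_bool (z = x') else 1)" for x x' :: 'a and k z
  have ind: "(\<Prod>k\<in>M. P (f k)) * g (f m) (f m') = (\<Sum>x\<in>A. \<Sum>x'\<in>A. g x x' * (\<Prod>k\<in>M. h x x' k (f k)))" if f: "f \<in> M \<rightarrow>\<^sub>E A" for f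
  proof -
    have pr: "(\<Prod>k\<in>M. h x x' k (f k)) = (\<Prod>k\<in>M. P (f k)) * (of_bool (f m = x) * of_bool (f m' = x'))" for x x'
    proof -
      have "(\<Prod>k\<in>M. if k = m then of_bool (f k = x) else if k = m' then of_bool (f k = x') else (1::real))
        = (\<Prod>k\<in>M. (if k = m then of_bool (f m = x) else 1) * (if k = m' then of_bool (f m' = x') else 1))"
        using m by (intro prod.cong) auto
      also have "\<dots> = of_bool (f m = x) * of_bool (f m' = x')"
        using fin m by (simp add: prod.distrib prod.delta)
      finally show ?thesis unfolding h_def prod.distrib by simp
    qed
    have fm: "f m \<in> A" "f m' \<in> A" using f m by auto
    have "(\<Sum>x\<in>A. \<Sum>x'\<in>A. g x x' * (\<Prod>k\<in>M. h x x' k (f k)))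
      = (\<Sum>x\<in>A. \<Sum>x'\<in>A. if x' = f m' then (if x = f m then g x x' * (\<Prod>k\<in>M. P (f k)) else 0) else 0)"
      unfolding pr by (intro sum.cong refl) auto
    also have "\<dots> = g (f m) (f m') * (\<Prod>k\<in>M. P (f k))" using fin fm by simp
    finally show ?thesis by simp
  qed
  have tot: "(\<Sum>f\<in>M \<rightarrow>\<^sub>E A. \<Prod>k\<in>M. h x x' k (f k)) = P x * P x'" if x: "x \<in> A" "x' \<in> A" for x x'
  proof -
    have "(\<Sum>f\<in>M \<rightarrow>\<^sub>E A. \<Prod>k\<in>M. h x x' k (f k)) = (\<Prod>k\<in>M. \<Sum>z\<in>A. h x x' k z)"
      using fin by (intro prod_sum_PiE[symmetric]) auto
    also have "\<dots> = (\<Prod>k\<in>M. (if k = m then P x else 1) * (if k = m' then P x' else 1))"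
    proof (intro prod.cong refl)
      fix k
      have "(\<Sum>z\<in>A. P z * of_bool (z = x)) = P x" "(\<Sum>z\<in>A. P z * of_bool (z = x')) = P x'"
        using fin x by (simp_all add: of_bool_def if_distrib[of "(*) _"] cong: if_cong)
      then show "(\<Sum>z\<in>A. h x x' k z) = (if k = m then P x else 1) * (if k = m' then P x' else 1)"
        using m P1 by (auto simp: h_def)
    qed
    also have "\<dots> = P x * P x'" using fin m by (simp add: prod.distrib prod.delta)
    finally show ?thesis .
  qed
  have "codebook_mean M A P (\<lambda>f. g (f m) (f m')) = (\<Sum>f\<in>M \<rightarrow>\<^sub>E A. \<Sum>x\<in>A. \<Sum>x'\<in>A. g x x' * (\<Prod>k\<in>M. h x x' k (f k)))"
    unfolding codebook_mean_def by (intro sum.cong refl ind)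
  also have "\<dots> = (\<Sum>x\<in>A. \<Sum>x'\<in>A. g x x' * (\<Sum>f\<in>M \<rightarrow>\<^sub>E A. \<Prod>k\<in>M. h x x' k (f k)))"
    by (subst sum.swap, intro sum.cong refl, subst sum.swap, simp add: sum_distrib_left)
  also have "\<dots> = (\<Sum>x\<in>A. \<Sum>x'\<in>A. P x * P x' * g x x')"
    by (intro sum.cong refl) (simp add: tot mult.commute)
  finally show ?thesis .
qed

lemma codebook_mean_single:
  fixes A :: "'a set"
  assumes fin: "finite M" "finite A" and P1: "(\<Sum>x\<in>A. P x) = 1" and m: "m \<in> M"
  shows "codebook_mean M A P (\<lambda>f. g (f m)) = (\<Sum>x\<in>A. P x * g x)"
proof -
  define h where "h x k z = P z * (if k = m then of_bool (z = x) else 1)" for x :: 'a and k z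
  have ind: "(\<Prod>k\<in>M. P (f k)) * g (f m) = (\<Sum>x\<in>A. g x * (\<Prod>k\<in>M. h x k (f k)))" if f: "f \<in> M \<rightarrow>\<^sub>E A" for f
  proof -
    have pr: "(\<Prod>k\<in>M. h x k (f k)) = (\<Prod>k\<in>M. P (f k)) * of_bool (f m = x)" for x
    proof -
      have "(\<Prod>k\<in>M. if k = m then of_bool (f k = x) else (1::real)) = (\<Prod>k\<in>M. if k = m then of_bool (f m = x) else 1)"
        using m by (intro prod.cong) auto
      then show ?thesis using fin m unfolding h_def prod.distrib by (simp add: prod.delta)
    qed
    have fm: "f m \<in> A" using f m by auto
    have "(\<Sum>x\<in>A. g x * (\<Prod>k\<in>M. h x k (f k))) = (\<Sum>x\<in>A. if x = f m then g x * (\<Prod>k\<in>M. P (f k)) else 0)"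
      unfolding pr by (intro sum.cong refl) auto
    also have "\<dots> = g (f m) * (\<Prod>k\<in>M. P (f k))" using fin fm by simp
    finally show ?thesis by simp
  qed
  have tot: "(\<Sum>f\<in>M \<rightarrow>\<^sub>E A. \<Prod>k\<in>M. h x k (f k)) = P x" if x: "x \<in> A" for x
  proof -
    have "(\<Sum>f\<in>M \<rightarrow>\<^sub>E A. \<Prod>k\<in>M. h x k (f k)) = (\<Prod>k\<in>M. \<Sum>z\<in>A. h x k z)"
      using fin by (intro prod_sum_PiE[symmetric]) auto
    also have "\<dots> = (\<Prod>k\<in>M. if k = m then P x else 1)"
    proof (intro prod.cong refl)
      fix k
      have "(\<Sum>z\<in>A. P z * of_bool (z = x)) = P x"
        using fin x by (simp_all add: of_bool_def if_distrib[of "(*) _"] cong: if_cong)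
      then show "(\<Sum>z\<in>A. h x k z) = (if k = m then P x else 1)" using P1 by (auto simp: h_def)
    qed
    also have "\<dots> = P x" using fin m by (simp add: prod.delta)
    finally show ?thesis .
  qed
  have "codebook_mean M A P (\<lambda>f. g (f m)) = (\<Sum>f\<in>M \<rightarrow>\<^sub>E A. \<Sum>x\<in>A. g x * (\<Prod>k\<in>M. h x k (f k)))"
    unfolding codebook_mean_def by (intro sum.cong refl ind)
  also have "\<dots> = (\<Sum>x\<in>A. g x * (\<Sum>f\<in>M \<rightarrow>\<^sub>E A. \<Prod>k\<in>M. h x k (f k)))"
    by (subst sum.swap) (simp add: sum_distrib_left)
  also have "\<dots> = (\<Sum>x\<in>A. P x * g x)" by (intro sum.cong refl) (simp add: tot mult.commute)
  finally show ?thesis .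
qed

text \<open>Some value reaches the average. The strict inequality in the contradiction comes from a
  codebook of positive weight, since individual weights may vanish.\<close>

lemma codebook_mean_le_obtain:
  assumes "finite M" "finite A" "\<And>x. x \<in> A \<Longrightarrow> 0 \<le> P x" "(\<Sum>x\<in>A. P x) = 1" "v \<le> codebook_mean M A P g"
  obtains f where "f \<in> M \<rightarrow>\<^sub>E A" "v \<le> g f"
proof -
  have "\<exists>f\<in>M \<rightarrow>\<^sub>E A. v \<le> g f"
  proof (rule ccontr)
    assume "\<not> ?thesis"
    then have lt: "\<And>f. f \<in> M \<rightarrow>\<^sub>E A \<Longrightarrow> g f < v" by auto
    let ?w = "\<lambda>f. \<Prod>k\<in>M. P (f k)"
    have w0: "0 \<le> ?w f" if "f \<in> M \<rightarrow>\<^sub>E A" for f using that assms(3) by (intro prod_nonneg) (auto simp: PiE_iff)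
    have c: "codebook_mean M A P (\<lambda>_. 1) = 1" using assms by (intro codebook_mean_const) auto
    have fin: "finite (M \<rightarrow>\<^sub>E A)" using assms by (intro finite_PiE) auto
    obtain f where f: "f \<in> M \<rightarrow>\<^sub>E A" "?w f \<noteq> 0"
    proof (rule ccontr)
      assume "\<not> thesis"
      then have "codebook_mean M A P (\<lambda>_. 1) = 0" using that unfolding codebook_mean_def by (intro sum.neutral) auto
      then show False using c by simp
    qed
    have "codebook_mean M A P g < codebook_mean M A P (\<lambda>_. v)"
      unfolding codebook_mean_def
    proof (rule sum_strict_mono_ex1[OF fin])
      show "\<forall>f\<in>M \<rightarrow>\<^sub>E A. ?w f * g f \<le> ?w f * v"
        by (intro ballI mult_left_mono) (auto intro: less_imp_le[OF lt] w0)
      have "0 < ?w f" using w0[OF f(1)] f(2) by (metis less_le)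
      then show "\<exists>f\<in>M \<rightarrow>\<^sub>E A. ?w f * g f < ?w f * v"
        using lt[OF f(1)] f(1) by (intro bexI[of _ f] mult_strict_left_mono)
    qed
    also have "\<dots> = v" using assms by (intro codebook_mean_const) auto
    finally show False using assms(5) by simp
  qed
  then show thesis using that by blast
qed

text \<open>The errors are split by which of the two messages of a competing pair is wrong; the
  factors \<open>card M - 1\<close> count the competitors of each kind. Within each kind the wrong
  codeword is independent of the sent one, which is what \<open>e1\<close>, \<open>e2\<close>,
  \<open>e3\<close> measure.\<close>

lemma random_coding_MAC:
  fixes W :: "'a \<Rightarrow> 'b \<Rightarrow> 'y \<Rightarrow> real" and T :: "'a \<Rightarrow> 'b \<Rightarrow> 'y \<Rightarrow> bool"
  assumes fin: "finite A1" "finite A2" "finite B" "finite M1" "finite M2" and ne: "M1 \<noteq> {}" "M2 \<noteq> {}"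
    and P1: "\<And>x. x \<in> A1 \<Longrightarrow> 0 \<le> P1 x" "(\<Sum>x\<in>A1. P1 x) = 1"
    and P2: "\<And>x. x \<in> A2 \<Longrightarrow> 0 \<le> P2 x" "(\<Sum>x\<in>A2. P2 x) = 1"
    and W0: "\<And>x1 x2 y. x1 \<in> A1 \<Longrightarrow> x2 \<in> A2 \<Longrightarrow> y \<in> B \<Longrightarrow> 0 \<le> W x1 x2 y"
    and W1: "\<And>x1 x2. x1 \<in> A1 \<Longrightarrow> x2 \<in> A2 \<Longrightarrow> (\<Sum>y\<in>B. W x1 x2 y) = 1"
  defines "G \<equiv> \<lambda>x1 x2 x1' x2'. \<Sum>y\<in>B. W x1 x2 y * of_bool (T x1' x2' y)"
  assumes e0: "(\<Sum>x1\<in>A1. \<Sum>x2\<in>A2. P1 x1 * P2 x2 * (\<Sum>y\<in>B. W x1 x2 y * of_bool (\<not> T x1 x2 y))) \<le> e0"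
    and e1: "(\<Sum>x1\<in>A1. \<Sum>x1'\<in>A1. P1 x1 * P1 x1' * (\<Sum>x2\<in>A2. P2 x2 * G x1 x2 x1' x2)) \<le> e1"
    and e2: "(\<Sum>x1\<in>A1. P1 x1 * (\<Sum>x2\<in>A2. \<Sum>x2'\<in>A2. P2 x2 * P2 x2' * G x1 x2 x1 x2')) \<le> e2"
    and e3: "(\<Sum>x1\<in>A1. \<Sum>x1'\<in>A1. P1 x1 * P1 x1' * (\<Sum>x2\<in>A2. \<Sum>x2'\<in>A2. P2 x2 * P2 x2' * G x1 x2 x1' x2')) \<le> e3"
  obtains f1 f2 dec where "f1 \<in> M1 \<rightarrow>\<^sub>E A1" "f2 \<in> M2 \<rightarrow>\<^sub>E A2" "\<And>y. dec y \<in> M1 \<times> M2"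
    "card M1 * card M2 * (1 - e0 - (real (card M1) - 1) * e1 - (real (card M2) - 1) * e2 - (real (card M1) - 1) * (real (card M2) - 1) * e3)
      \<le> (\<Sum>m1\<in>M1. \<Sum>m2\<in>M2. \<Sum>y\<in>B. if dec y = (m1, m2) then W (f1 m1) (f2 m2) y else 0)"
proof -
  let ?E1 = "codebook_mean M1 A1 P1" and ?E2 = "codebook_mean M2 A2 P2"
  define H where "H x1 x2 = (\<Sum>y\<in>B. W x1 x2 y * of_bool (\<not> T x1 x2 y))" for x1 x2
  \<comment> \<open>Union bound for the probability of correct decoding of (m1, m2) with a fixed
    pair of codebooks.\<close>
  define S where "S f1 f2 m1 m2 = 1 - H (f1 m1) (f2 m2) - (\<Sum>k1\<in>M1 - {m1}. G (f1 m1) (f2 m2) (f1 k1) (f2 m2))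
     - (\<Sum>k2\<in>M2 - {m2}. G (f1 m1) (f2 m2) (f1 m1) (f2 k2)) - (\<Sum>k1\<in>M1 - {m1}. \<Sum>k2\<in>M2 - {m2}. G (f1 m1) (f2 m2) (f1 k1) (f2 k2))"
    for f1 :: "'c \<Rightarrow> 'a" and f2 :: "'d \<Rightarrow> 'b" and m1 m2
  let ?v = "1 - e0 - (real (card M1) - 1) * e1 - (real (card M2) - 1) * e2 - (real (card M1) - 1) * (real (card M2) - 1) * e3"
  have c1: "real (card (M1 - {m})) = real (card M1) - 1" if "m \<in> M1" for m
    using fin ne that by (simp add: card_Diff_singleton card_gt_0_iff of_nat_diff Suc_le_eq)
  have c2: "real (card (M2 - {m})) = real (card M2) - 1" if "m \<in> M2" for m
    using fin ne that by (simp add: card_Diff_singleton card_gt_0_iff of_nat_diff Suc_le_eq)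
  have EH: "?E1 (\<lambda>f1. ?E2 (\<lambda>f2. H (f1 m1) (f2 m2))) \<le> e0" if m: "m1 \<in> M1" "m2 \<in> M2" for m1 m2
  proof -
    have i: "?E2 (\<lambda>f2. H x (f2 m2)) = (\<Sum>x2\<in>A2. P2 x2 * H x x2)" for x
      by (rule codebook_mean_single[OF fin(5,2) P2(2) m(2)])
    have "?E1 (\<lambda>f1. ?E2 (\<lambda>f2. H (f1 m1) (f2 m2))) = (\<Sum>x1\<in>A1. P1 x1 * (\<Sum>x2\<in>A2. P2 x2 * H x1 x2))"
      unfolding i by (rule codebook_mean_single[OF fin(4,1) P1(2) m(1), of "\<lambda>x1. \<Sum>x2\<in>A2. P2 x2 * H x1 x2"])
    then show ?thesis using e0 unfolding H_def by (simp add: sum_distrib_left mult.assoc)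
  qed
  have EG1: "?E1 (\<lambda>f1. ?E2 (\<lambda>f2. G (f1 m1) (f2 m2) (f1 k1) (f2 m2))) \<le> e1" if m: "m1 \<in> M1" "m2 \<in> M2" "k1 \<in> M1 - {m1}" for m1 m2 k1
  proof -
    have k: "k1 \<in> M1" "m1 \<noteq> k1" using m by auto
    have i: "?E2 (\<lambda>f2. G x (f2 m2) x' (f2 m2)) = (\<Sum>x2\<in>A2. P2 x2 * G x x2 x' x2)" for x x'
      by (rule codebook_mean_single[OF fin(5,2) P2(2) m(2), of "\<lambda>x2. G x x2 x' x2"])
    show ?thesis unfolding i using e1
      by (subst codebook_mean_pair[OF fin(4,1) P1(2) m(1) k, of "\<lambda>x x'. \<Sum>x2\<in>A2. P2 x2 * G x x2 x' x2"])
  qed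
  have EG2: "?E1 (\<lambda>f1. ?E2 (\<lambda>f2. G (f1 m1) (f2 m2) (f1 m1) (f2 k2))) \<le> e2" if m: "m1 \<in> M1" "m2 \<in> M2" "k2 \<in> M2 - {m2}" for m1 m2 k2
  proof -
    have k: "k2 \<in> M2" "m2 \<noteq> k2" using m by auto
    have i: "?E2 (\<lambda>f2. G x (f2 m2) x' (f2 k2)) = (\<Sum>x2\<in>A2. \<Sum>x2'\<in>A2. P2 x2 * P2 x2' * G x x2 x' x2')" for x x'
      by (rule codebook_mean_pair[OF fin(5,2) P2(2) m(2) k, of "\<lambda>x2 x2'. G x x2 x' x2'"])
    show ?thesis unfolding i using e2
      by (subst codebook_mean_single[OF fin(4,1) P1(2) m(1), of "\<lambda>x. \<Sum>x2\<in>A2. \<Sum>x2'\<in>A2. P2 x2 * P2 x2' * G x x2 x x2'"])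
  qed
  have EG3: "?E1 (\<lambda>f1. ?E2 (\<lambda>f2. G (f1 m1) (f2 m2) (f1 k1) (f2 k2))) \<le> e3"
    if m: "m1 \<in> M1" "m2 \<in> M2" "k1 \<in> M1 - {m1}" "k2 \<in> M2 - {m2}" for m1 m2 k1 k2
  proof -
    have k: "k1 \<in> M1" "m1 \<noteq> k1" "k2 \<in> M2" "m2 \<noteq> k2" using m by auto
    have i: "?E2 (\<lambda>f2. G x (f2 m2) x' (f2 k2)) = (\<Sum>x2\<in>A2. \<Sum>x2'\<in>A2. P2 x2 * P2 x2' * G x x2 x' x2')" for x x'
      by (rule codebook_mean_pair[OF fin(5,2) P2(2) m(2) k(3,4), of "\<lambda>x2 x2'. G x x2 x' x2'"])
    show ?thesis unfolding i using e3
      by (subst codebook_mean_pair[OF fin(4,1) P1(2) m(1) k(1,2), of "\<lambda>x x'. \<Sum>x2\<in>A2. \<Sum>x2'\<in>A2. P2 x2 * P2 x2' * G x x2 x' x2'"])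
  qed
  have ES: "?v \<le> ?E1 (\<lambda>f1. ?E2 (\<lambda>f2. S f1 f2 m1 m2))" if m: "m1 \<in> M1" "m2 \<in> M2" for m1 m2
  proof -
    have one: "?E2 (\<lambda>_. 1) = 1" "?E1 (\<lambda>_. 1) = 1" using fin P1 P2 by (auto intro!: codebook_mean_const)
    have "(\<Sum>k1\<in>M1 - {m1}. ?E1 (\<lambda>f1. ?E2 (\<lambda>f2. G (f1 m1) (f2 m2) (f1 k1) (f2 m2)))) \<le> (real (card M1) - 1) * e1"
      using sum_bounded_above[of "M1 - {m1}", OF EG1[OF m]] c1[OF m(1)] by simp
    moreover have "(\<Sum>k2\<in>M2 - {m2}. ?E1 (\<lambda>f1. ?E2 (\<lambda>f2. G (f1 m1) (f2 m2) (f1 m1) (f2 k2)))) \<le> (real (card M2) - 1) * e2"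
      using sum_bounded_above[of "M2 - {m2}", OF EG2[OF m]] c2[OF m(2)] by simp
    moreover have "(\<Sum>k1\<in>M1 - {m1}. \<Sum>k2\<in>M2 - {m2}. ?E1 (\<lambda>f1. ?E2 (\<lambda>f2. G (f1 m1) (f2 m2) (f1 k1) (f2 k2)))) \<le> (real (card M1) - 1) * ((real (card M2) - 1) * e3)"
    proof -
      have "(\<Sum>k2\<in>M2 - {m2}. ?E1 (\<lambda>f1. ?E2 (\<lambda>f2. G (f1 m1) (f2 m2) (f1 k1) (f2 k2)))) \<le> (real (card M2) - 1) * e3" if k: "k1 \<in> M1 - {m1}" for k1
        using sum_bounded_above[of "M2 - {m2}", OF EG3[OF m k]] c2[OF m(2)] by simp
      from sum_bounded_above[of "M1 - {m1}", OF this] show ?thesis using c1[OF m(1)] by simp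
    qed
    ultimately show ?thesis
      unfolding S_def codebook_mean_diff codebook_mean_sum one using EH[OF m] by simp
  qed
  have E1: "card M1 * card M2 * ?v \<le> ?E1 (\<lambda>f1. ?E2 (\<lambda>f2. \<Sum>m1\<in>M1. \<Sum>m2\<in>M2. S f1 f2 m1 m2))"
  proof -
    have c: "real (card M1 * card M2) * c = (\<Sum>m1\<in>M1. \<Sum>m2\<in>M2. c)" for c by (simp add: mult.assoc)
    have "card M1 * card M2 * ?v = (\<Sum>m1\<in>M1. \<Sum>m2\<in>M2. ?v)" by (rule c)
    also have "\<dots> \<le> (\<Sum>m1\<in>M1. \<Sum>m2\<in>M2. ?E1 (\<lambda>f1. ?E2 (\<lambda>f2. S f1 f2 m1 m2)))" by (intro sum_mono ES)
    finally show ?thesis unfolding codebook_mean_sum .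
  qed
  \<comment> \<open>Derandomisation one user at a time: first the codebook of user 1 while averaging
    over user 2, then the other.\<close>
  obtain f1 where f1: "f1 \<in> M1 \<rightarrow>\<^sub>E A1" "card M1 * card M2 * ?v \<le> ?E2 (\<lambda>f2. \<Sum>m1\<in>M1. \<Sum>m2\<in>M2. S f1 f2 m1 m2)"
    by (rule codebook_mean_le_obtain[OF fin(4,1) P1 E1])
  obtain f2 where f2: "f2 \<in> M2 \<rightarrow>\<^sub>E A2" "card M1 * card M2 * ?v \<le> (\<Sum>m1\<in>M1. \<Sum>m2\<in>M2. S f1 f2 m1 m2)"
    by (rule codebook_mean_le_obtain[OF fin(5,2) P2 f1(2)])
  obtain d1 d2 where d: "d1 \<in> M1" "d2 \<in> M2" using ne by blast
  define Q where "Q y p \<longleftrightarrow> p \<in> M1 \<times> M2 \<and> T (f1 (fst p)) (f2 (snd p)) y" for y p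
  \<comment> \<open>The unique pair passing the test is returned; the default (d1, d2) only has to
    be a legal message pair.\<close>
  define dec where "dec y = (if \<exists>!p. Q y p then THE p. Q y p else (d1, d2))" for y
  have decM: "dec y \<in> M1 \<times> M2" for y
  proof (cases "\<exists>!p. Q y p")
    case True
    then have "Q y (dec y)" using theI'[OF True] by (simp add: dec_def)
    then show ?thesis by (simp add: Q_def)
  qed (use d in \<open>simp add: dec_def\<close>)
  have "S f1 f2 m1 m2 \<le> (\<Sum>y\<in>B. if dec y = (m1, m2) then W (f1 m1) (f2 m2) y else 0)" if m: "m1 \<in> M1" "m2 \<in> M2" for m1 m2
  proof -
    have fA: "f1 m1 \<in> A1" "f2 m2 \<in> A2" using f1 f2 m by auto
    let ?w = "W (f1 m1) (f2 m2)"
    let ?b = "\<lambda>k1 k2 y. of_bool (T (f1 k1) (f2 k2) y) :: real"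
    \<comment> \<open>Decoding can fail only if the sent pair fails the test or a competitor passes
      it, and each of these events subtracts at least the full weight of y.\<close>
    have le: "?w y * 1 - ?w y * of_bool (\<not> T (f1 m1) (f2 m2) y) - (\<Sum>k1\<in>M1 - {m1}. ?w y * ?b k1 m2 y)
       - (\<Sum>k2\<in>M2 - {m2}. ?w y * ?b m1 k2 y) - (\<Sum>k1\<in>M1 - {m1}. \<Sum>k2\<in>M2 - {m2}. ?w y * ?b k1 k2 y)
       \<le> (if dec y = (m1, m2) then ?w y else 0)" if y: "y \<in> B" for y
    proof -
      have w0: "0 \<le> ?w y" using W0[OF fA y] .
      have s1: "0 \<le> (\<Sum>k1\<in>M1 - {m1}. ?w y * ?b k1 m2 y)" and s2: "0 \<le> (\<Sum>k2\<in>M2 - {m2}. ?w y * ?b m1 k2 y)"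
        and s3: "0 \<le> (\<Sum>k1\<in>M1 - {m1}. \<Sum>k2\<in>M2 - {m2}. ?w y * ?b k1 k2 y)"
        using w0 by (auto intro!: sum_nonneg)
      show ?thesis
      proof (cases "dec y = (m1, m2)")
        case True
        have "0 \<le> ?w y * of_bool (\<not> T (f1 m1) (f2 m2) y)" using w0 by simp
        then show ?thesis using True s1 s2 s3 by simp
      next
        case False
        show ?thesis
        proof (cases "T (f1 m1) (f2 m2) y")
          case False
          then show ?thesis using \<open>dec y \<noteq> (m1, m2)\<close> s1 s2 s3 by simp
        next
          case True
          have "\<exists>p. Q y p \<and> p \<noteq> (m1, m2)"
          proof (rule ccontr)
            assume n: "\<not> ?thesis"
            have Qm: "Q y (m1, m2)" using True m by (simp add: Q_def)
            have "Q y p \<longleftrightarrow> p = (m1, m2)" for p using n Qm by blast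
            then have "\<exists>!p. Q y p" "(THE p. Q y p) = (m1, m2)" by simp_all
            then show False using False by (simp add: dec_def)
          qed
          then obtain k1 k2 where k: "k1 \<in> M1" "k2 \<in> M2" "?b k1 k2 y = 1" "k1 \<noteq> m1 \<or> k2 \<noteq> m2"
            by (auto simp: Q_def)
          have "?w y \<le> (\<Sum>k1\<in>M1 - {m1}. ?w y * ?b k1 m2 y) + (\<Sum>k2\<in>M2 - {m2}. ?w y * ?b m1 k2 y)
            + (\<Sum>k1\<in>M1 - {m1}. \<Sum>k2\<in>M2 - {m2}. ?w y * ?b k1 k2 y)"
          proof (cases "k2 = m2")
            case True
            then have "k1 \<in> M1 - {m1}" using k by auto
            then have "?w y * ?b k1 m2 y \<le> (\<Sum>k1\<in>M1 - {m1}. ?w y * ?b k1 m2 y)"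
              by (rule member_le_sum) (use w0 fin in auto)
            then show ?thesis using k(3) True s2 s3 by simp
          next
            case k2: False
            show ?thesis
            proof (cases "k1 = m1")
              case True
              have "?w y * ?b m1 k2 y \<le> (\<Sum>k2\<in>M2 - {m2}. ?w y * ?b m1 k2 y)"
                by (rule member_le_sum) (use w0 fin k k2 in auto)
              then show ?thesis using k(3) True s1 s3 by simp
            next
              case k1: False
              have "?w y * ?b k1 k2 y \<le> (\<Sum>k2\<in>M2 - {m2}. ?w y * ?b k1 k2 y)"
                by (rule member_le_sum) (use w0 fin k k2 in auto)
              also have "\<dots> \<le> (\<Sum>k1\<in>M1 - {m1}. \<Sum>k2\<in>M2 - {m2}. ?w y * ?b k1 k2 y)"
                by (rule member_le_sum[of k1 _ "\<lambda>k1. \<Sum>k2\<in>M2 - {m2}. ?w y * ?b k1 k2 y"]) (use w0 fin k k1 in \<open>auto intro!: sum_nonneg\<close>)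
              finally show ?thesis using k(3) s1 s2 by simp
            qed
          qed
          then show ?thesis using True \<open>dec y \<noteq> (m1, m2)\<close> by simp
        qed
      qed
    qed
    have "S f1 f2 m1 m2 = (\<Sum>y\<in>B. ?w y * 1 - ?w y * of_bool (\<not> T (f1 m1) (f2 m2) y) - (\<Sum>k1\<in>M1 - {m1}. ?w y * ?b k1 m2 y)
       - (\<Sum>k2\<in>M2 - {m2}. ?w y * ?b m1 k2 y) - (\<Sum>k1\<in>M1 - {m1}. \<Sum>k2\<in>M2 - {m2}. ?w y * ?b k1 k2 y))"
    proof -
      have a: "(\<Sum>y\<in>B. \<Sum>k\<in>K. h k y) = (\<Sum>k\<in>K. \<Sum>y\<in>B. h k y)" for K :: "'z set" and h :: "'z \<Rightarrow> 'y \<Rightarrow> real" by (rule sum.swap)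
      show ?thesis unfolding S_def G_def H_def sum_subtractf a using W1[OF fA] by simp
    qed
    also have "\<dots> \<le> (\<Sum>y\<in>B. if dec y = (m1, m2) then ?w y else 0)" by (intro sum_mono le)
    finally show ?thesis .
  qed
  then have le: "(\<Sum>m1\<in>M1. \<Sum>m2\<in>M2. S f1 f2 m1 m2) \<le> (\<Sum>m1\<in>M1. \<Sum>m2\<in>M2. \<Sum>y\<in>B. if dec y = (m1, m2) then W (f1 m1) (f2 m2) y else 0)"
    by (intro sum_mono)
  show thesis by (rule that[OF f1(1) f2(1) decM order_trans[OF f2(2) le]])
qed

section \<open>The Hessian of the mutual information\<close>

text \<open>The marginal of \<open>r\<close> at the cell of \<open>i\<close>, for the partition of D
  given by the labelling \<open>c\<close>; all marginals in the mutual information are of this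
  kind.\<close>

definition csum :: "'i set \<Rightarrow> ('i \<Rightarrow> 'c) \<Rightarrow> ('i \<Rightarrow> real) \<Rightarrow> 'i \<Rightarrow> real" where
  "csum D c r i = (\<Sum>j\<in>{j\<in>D. c j = c i}. r j)"

text \<open>A basis vector. A constant of its own keeps perturbations folded during
  simplification.\<close>

definition unit_at :: "'i \<Rightarrow> 'i \<Rightarrow> real" where
  "unit_at a i = indicator {a} i"

lemma csum_shift:
  assumes "finite D" "a \<in> D"
  shows "csum D c (\<lambda>i. r i + t * unit_at a i) i = csum D c r i + (if c a = c i then t else 0)"
proof -
  have "(\<Sum>j\<in>{j\<in>D. c j = c i}. t * unit_at a j) = (\<Sum>j\<in>{j\<in>D. c j = c i}. if j = a then t else 0)"
    by (intro sum.cong refl) (auto simp: unit_at_def indicator_def)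
  also have "\<dots> = (if c a = c i then t else 0)" using assms by simp
  finally show ?thesis by (simp add: csum_def sum.distrib)
qed

lemma csum_ge:
  assumes "finite D" "i \<in> D" "\<And>j. j \<in> D \<Longrightarrow> 0 \<le> r j"
  shows "r i \<le> csum D c r i"
  unfolding csum_def by (rule member_le_sum) (use assms in auto)

text \<open>The conditional mutual information of \<open>d\<close> and \<open>e\<close> given \<open>c\<close>, if \<open>d\<close> and \<open>e\<close> refine \<open>c\<close>.\<close>
definition gmi :: "'i set \<Rightarrow> ('i \<Rightarrow> 'c) \<Rightarrow> ('i \<Rightarrow> 'd) \<Rightarrow> ('i \<Rightarrow> 'e) \<Rightarrow> ('i \<Rightarrow> real) \<Rightarrow> real" where
  "gmi D c d e r = (\<Sum>i\<in>D. r i * log 2 (r i * csum D c r i / (csum D d r i * csum D e r i)))"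

text \<open>Only the term at \<open>a\<close> has a weight that moves with \<open>t\<close>; it
  alone can be singular, so it is separated from the rest.\<close>

lemma gmi_shift:
  assumes "finite D" "a \<in> D"
  shows "gmi D c d e (\<lambda>i. r i + t * unit_at a i)
   = (r a + t) * log 2 ((r a + t) * (csum D c r a + t) / ((csum D d r a + t) * (csum D e r a + t)))
   + (\<Sum>i\<in>D - {a}. r i * log 2 (r i * (csum D c r i + (if c a = c i then t else 0)) /
        ((csum D d r i + (if d a = d i then t else 0)) * (csum D e r i + (if e a = e i then t else 0)))))"
proof -
  have "gmi D c d e (\<lambda>i. r i + t * unit_at a i) = (\<Sum>i\<in>D. (r i + t * unit_at a i) * log 2 ((r i + t * unit_at a i) * (csum D c r i + (if c a = c i then t else 0)) /
        ((csum D d r i + (if d a = d i then t else 0)) * (csum D e r i + (if e a = e i then t else 0)))))"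
    unfolding gmi_def csum_shift[OF assms] ..
  also have "\<dots> = (r a + t * unit_at a a) * log 2 ((r a + t * unit_at a a) * (csum D c r a + (if c a = c a then t else 0)) /
        ((csum D d r a + (if d a = d a then t else 0)) * (csum D e r a + (if e a = e a then t else 0))))
      + (\<Sum>i\<in>D - {a}. (r i + t * unit_at a i) * log 2 ((r i + t * unit_at a i) * (csum D c r i + (if c a = c i then t else 0)) /
        ((csum D d r i + (if d a = d i then t else 0)) * (csum D e r i + (if e a = e i then t else 0)))))"
    by (rule sum.remove[OF assms])
  also have "(\<Sum>i\<in>D - {a}. (r i + t * unit_at a i) * log 2 ((r i + t * unit_at a i) * (csum D c r i + (if c a = c i then t else 0)) /
        ((csum D d r i + (if d a = d i then t else 0)) * (csum D e r i + (if e a = e i then t else 0)))))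
     = (\<Sum>i\<in>D - {a}. r i * log 2 (r i * (csum D c r i + (if c a = c i then t else 0)) /
        ((csum D d r i + (if d a = d i then t else 0)) * (csum D e r i + (if e a = e i then t else 0)))))"
    by (intro sum.cong refl) (simp add: unit_at_def)
  finally show ?thesis by (simp add: unit_at_def)
qed

lemma DERIV_log_ratio:
  fixes x S U V s u v :: real
  assumes "0 < x" "0 < S" "0 < U" "0 < V"
  shows "((\<lambda>t. log 2 (x * (S + s * t) / ((U + u * t) * (V + v * t)))) has_real_derivative (s / S - u / U - v / V) / ln 2) (at 0)"
proof -
  have 1: "((\<lambda>t. ln (K + k * t)) has_real_derivative k / K) (at 0)" if "0 < K" for K k :: real
    using that by (auto intro!: derivative_eq_intros)
  have 2: "((\<lambda>t. (ln x + ln (S + s * t) - ln (U + u * t) - ln (V + v * t)) / ln 2) has_real_derivative (0 + s / S - u / U - v / V) / ln 2) (at 0)"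
    by (intro DERIV_cdivide DERIV_diff DERIV_add DERIV_const 1 assms)
  have pos: "eventually (\<lambda>t. 0 < K + k * t) (nhds 0)" if "0 < K" for K k :: real
  proof -
    have "((\<lambda>t. K + k * t) \<longlongrightarrow> K + k * 0) (nhds 0)" by (intro tendsto_intros filterlim_ident)
    then show ?thesis using order_tendstoD(1)[of _ K "nhds 0" 0] that by simp
  qed
  have ev: "eventually (\<lambda>t. log 2 (x * (S + s * t) / ((U + u * t) * (V + v * t))) = (ln x + ln (S + s * t) - ln (U + u * t) - ln (V + v * t)) / ln 2) (nhds 0)"
    using pos[OF assms(2), of s] pos[OF assms(3), of u] pos[OF assms(4), of v]
    by eventually_elim (use assms(1) in \<open>simp add: log_def ln_mult_pos ln_div\<close>)
  show ?thesis using 2 DERIV_cong_ev[OF refl ev refl] by simp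
qed

text \<open>Terms of zero weight vanish identically; for the others all marginals are positive and
  the logarithm is smooth.\<close>

lemma gmi_rest_DERIV:
  assumes fin: "finite D" "a \<in> D" and r: "\<And>i. i \<in> D \<Longrightarrow> 0 \<le> r i"
  shows "((\<lambda>t. \<Sum>i\<in>D - {a}. r i * log 2 (r i * (csum D c r i + (if c a = c i then t else 0)) /
        ((csum D d r i + (if d a = d i then t else 0)) * (csum D e r i + (if e a = e i then t else 0)))))
     has_real_derivative (\<Sum>i\<in>D - {a}. r i * ((of_bool (c a = c i) / csum D c r i - of_bool (d a = d i) / csum D d r i - of_bool (e a = e i) / csum D e r i) / ln 2))) (at 0)"
proof (intro DERIV_sum)
  fix i assume i: "i \<in> D - {a}"
  show "((\<lambda>t. r i * log 2 (r i * (csum D c r i + (if c a = c i then t else 0)) /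
        ((csum D d r i + (if d a = d i then t else 0)) * (csum D e r i + (if e a = e i then t else 0)))))
     has_real_derivative r i * ((of_bool (c a = c i) / csum D c r i - of_bool (d a = d i) / csum D d r i - of_bool (e a = e i) / csum D e r i) / ln 2)) (at 0)"
  proof (cases "r i = 0")
    case True then show ?thesis by simp
  next
    case False
    then have ri: "0 < r i" using r[of i] i by simp
    have pos: "0 < csum D c r i" "0 < csum D d r i" "0 < csum D e r i"
      using csum_ge[OF fin(1), of i r c] csum_ge[OF fin(1), of i r d] csum_ge[OF fin(1), of i r e] ri r i by fastforce+
    have b: "(if P then t else 0) = of_bool P * t" for P and t :: real by simp
    show ?thesis unfolding b by (intro DERIV_cmult DERIV_log_ratio ri pos)
  qed
qed

lemma csum_ratio_sum:
  assumes fin: "finite D" and "0 < csum D k r a"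
  shows "(\<Sum>i\<in>D. r i * (of_bool (k a = k i) / csum D k r i)) = 1"
proof -
  have "(\<Sum>i\<in>D. r i * (of_bool (k a = k i) / csum D k r i)) = (\<Sum>i\<in>{i\<in>D. k i = k a}. r i / csum D k r a)"
    by (rule sum.mono_neutral_cong_right) (use fin in \<open>auto simp: csum_def\<close>)
  also have "\<dots> = 1" using assms(2) by (simp add: sum_divide_distrib[symmetric]) (simp add: csum_def)
  finally show ?thesis .
qed

lemma gmi_DERIV_pos:
  assumes fin: "finite D" "a \<in> D" and r: "\<And>i. i \<in> D \<Longrightarrow> 0 \<le> r i" and ra: "0 < r a"
  shows "((\<lambda>t. gmi D c d e (\<lambda>i. r i + t * unit_at a i)) has_real_derivative
    log 2 (r a * csum D c r a / (csum D d r a * csum D e r a))) (at 0)"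
proof -
  have pos: "0 < csum D c r a" "0 < csum D d r a" "0 < csum D e r a"
    using csum_ge[OF fin, of r c] csum_ge[OF fin, of r d] csum_ge[OF fin, of r e] ra r by fastforce+
  define L where "L t = log 2 ((r a + t) * (csum D c r a + t) / ((csum D d r a + t) * (csum D e r a + t)))" for t
  have dL: "(L has_real_derivative (1 / r a + 1 / csum D c r a - 1 / csum D d r a - 1 / csum D e r a) / ln 2) (at 0)"
  proof -
    have 1: "((\<lambda>t. ln (K + t)) has_real_derivative 1 / K) (at 0)" if "0 < K" for K :: real
      using that by (auto intro!: derivative_eq_intros)
    have 2: "((\<lambda>t. (ln (r a + t) + ln (csum D c r a + t) - ln (csum D d r a + t) - ln (csum D e r a + t)) / ln 2)
      has_real_derivative (1 / r a + 1 / csum D c r a - 1 / csum D d r a - 1 / csum D e r a) / ln 2) (at 0)"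
      by (intro DERIV_cdivide DERIV_diff DERIV_add 1 pos ra)
    have ps: "eventually (\<lambda>t. 0 < K + t) (nhds 0)" if "0 < K" for K :: real
    proof -
      have "((\<lambda>t. K + t) \<longlongrightarrow> K + 0) (nhds 0)" by (intro tendsto_intros filterlim_ident)
      then show ?thesis using order_tendstoD(1)[of _ K "nhds 0" 0] that by simp
    qed
    have ev: "eventually (\<lambda>t. L t = (ln (r a + t) + ln (csum D c r a + t) - ln (csum D d r a + t) - ln (csum D e r a + t)) / ln 2) (nhds 0)"
      using ps[OF ra] ps[OF pos(1)] ps[OF pos(2)] ps[OF pos(3)]
      by eventually_elim (simp add: L_def log_def ln_mult_pos ln_div)
    show ?thesis using 2 DERIV_cong_ev[OF refl ev refl] by simp
  qed
  have d1: "((\<lambda>t. (r a + t) * L t) has_real_derivative (r a + 0) * ((1 / r a + 1 / csum D c r a - 1 / csum D d r a - 1 / csum D e r a) / ln 2) + (0 + 1) * L 0) (at 0)"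
    using DERIV_mult'[OF DERIV_add[OF DERIV_const DERIV_ident] dL, of "r a"] by simp
  note d2 = DERIV_add[OF d1 gmi_rest_DERIV[where r=r and c=c and d=d and e=e, OF fin r]]
  have "(r a + 0) * ((1 / r a + 1 / csum D c r a - 1 / csum D d r a - 1 / csum D e r a) / ln 2) + (0 + 1) * L 0
     + (\<Sum>i\<in>D - {a}. r i * ((of_bool (c a = c i) / csum D c r i - of_bool (d a = d i) / csum D d r i - of_bool (e a = e i) / csum D e r i) / ln 2))
    = L 0 + 1 / ln 2 + (\<Sum>i\<in>D. r i * ((of_bool (c a = c i) / csum D c r i - of_bool (d a = d i) / csum D d r i - of_bool (e a = e i) / csum D e r i) / ln 2))"
    unfolding sum.remove[OF fin] using ra by (simp add: field_simps)
  also have "(\<Sum>i\<in>D. r i * ((of_bool (c a = c i) / csum D c r i - of_bool (d a = d i) / csum D d r i - of_bool (e a = e i) / csum D e r i) / ln 2))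
    = ((\<Sum>i\<in>D. r i * (of_bool (c a = c i) / csum D c r i)) - (\<Sum>i\<in>D. r i * (of_bool (d a = d i) / csum D d r i)) - (\<Sum>i\<in>D. r i * (of_bool (e a = e i) / csum D e r i))) / ln 2"
    unfolding sum_subtractf[symmetric] sum_divide_distrib by (intro sum.cong refl) (simp add: right_diff_distrib)
  \<comment> \<open>Differentiating inside the logarithms contributes 1 for the weight itself, 1 for
    the marginal \<open>c\<close> and -1 for each of \<open>d\<close> and \<open>e\<close>. These
    cancel and leave the logarithmic ratio.\<close>
  also have "\<dots> = - 1 / ln 2" unfolding csum_ratio_sum[OF fin(1) pos(1)] csum_ratio_sum[OF fin(1) pos(2)] csum_ratio_sum[OF fin(1) pos(3)] by simp
  finally have eq: "(r a + 0) * ((1 / r a + 1 / csum D c r a - 1 / csum D d r a - 1 / csum D e r a) / ln 2) + (0 + 1) * L 0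
     + (\<Sum>i\<in>D - {a}. r i * ((of_bool (c a = c i) / csum D c r i - of_bool (d a = d i) / csum D d r i - of_bool (e a = e i) / csum D e r i) / ln 2))
    = L 0" by simp
  show ?thesis using DERIV_cong[OF d2 eq] unfolding gmi_shift[OF fin] L_def by simp
qed

text \<open>The difference quotient of the singular term is the logarithm of t (c + t) / ((d + t) (e
  + t)). It tends to minus infinity if d and e are positive and to plus infinity if both vanish;
  with exactly one of them zero it would converge, which is why \<open>de\<close> excludes that
  case.\<close>

lemma gmi_no_DERIV:
  assumes fin: "finite D" "a \<in> D" and r: "\<And>i. i \<in> D \<Longrightarrow> 0 \<le> r i" and ra: "r a = 0"
    and c: "0 < csum D c r a"
    and de: "0 < csum D d r a \<and> 0 < csum D e r a \<or> csum D d r a = 0 \<and> csum D e r a = 0"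
  shows "\<not> ((\<lambda>t. gmi D c d e (\<lambda>i. r i + t * unit_at a i)) has_real_derivative g) (at 0)"
proof
  assume f: "((\<lambda>t. gmi D c d e (\<lambda>i. r i + t * unit_at a i)) has_real_derivative g) (at 0)"
  define L where "L t = log 2 (t * (csum D c r a + t) / ((csum D d r a + t) * (csum D e r a + t)))" for t
  define g' where "g' = g - (\<Sum>i\<in>D - {a}. r i * ((of_bool (c a = c i) / csum D c r i - of_bool (d a = d i) / csum D d r i - of_bool (e a = e i) / csum D e r i) / ln 2))"
  have "((\<lambda>t. t * L t) has_real_derivative g') (at 0)"
    using DERIV_diff[OF f gmi_rest_DERIV[where r=r and c=c and d=d and e=e, OF fin r]] unfolding gmi_shift[OF fin] ra g'_def[symmetric] by (simp add: L_def)
  then have "((\<lambda>h. (h * L h - 0 * L 0) / h) \<longlongrightarrow> g') (at 0)" by (simp add: DERIV_def)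
  \<comment> \<open>Only positive perturbations are examined, where the argument of the logarithm is
    positive.\<close>
  then have lim: "((\<lambda>h. (h * L h - 0 * L 0) / h) \<longlongrightarrow> g') (at_right 0)" by (rule filterlim_mono) (auto simp: at_le)
  have ev: "eventually (\<lambda>h::real. 0 < h) (at_right 0)" by (simp add: eventually_at_right_less)
  have "eventually (\<lambda>h. (h * L h - 0 * L 0) / h = L h) (at_right 0)" using ev by eventually_elim simp
  with lim have L: "(L \<longlongrightarrow> g') (at_right 0)" by (rule Lim_transform_eventually)
  define cc dd ee where "cc = csum D c r a" and "dd = csum D d r a" and "ee = csum D e r a"
  have id: "((\<lambda>t::real. t) \<longlongrightarrow> 0) (at_right 0)" by (rule tendsto_ident_at)
  show False
  proof (cases "dd = 0")
    case False
    then have de': "0 < dd" "0 < ee" using de by (auto simp: dd_def ee_def)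
    have cpos: "0 < cc" using c by (simp add: cc_def)
    have "((\<lambda>t. 2 powr L t) \<longlongrightarrow> 2 powr g') (at_right 0)" by (intro tendsto_powr tendsto_const L) simp
    moreover have "eventually (\<lambda>t. 2 powr L t = t * (cc + t) / ((dd + t) * (ee + t))) (at_right 0)"
      using ev by eventually_elim (use de' cpos in \<open>simp add: L_def cc_def[symmetric] dd_def[symmetric] ee_def[symmetric] add_pos_pos\<close>)
    ultimately have "((\<lambda>t. t * (cc + t) / ((dd + t) * (ee + t))) \<longlongrightarrow> 2 powr g') (at_right 0)"
      by (rule Lim_transform_eventually)
    moreover have "((\<lambda>t. t * (cc + t) / ((dd + t) * (ee + t))) \<longlongrightarrow> 0 * (cc + 0) / ((dd + 0) * (ee + 0))) (at_right 0)"
      using de' by (intro tendsto_intros id) auto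
    ultimately have "2 powr g' = 0 * (cc + 0) / ((dd + 0) * (ee + 0))" by (rule tendsto_unique[rotated]) simp
    then show False by simp
  next
    case True
    then have de': "dd = 0" "ee = 0" using de by (auto simp: dd_def ee_def)
    have cpos: "0 < cc" using c by (simp add: cc_def)
    have "((\<lambda>t. 2 powr (- L t)) \<longlongrightarrow> 2 powr (- g')) (at_right 0)" by (intro tendsto_powr tendsto_const tendsto_minus L) simp
    moreover have "eventually (\<lambda>t. 2 powr (- L t) = t / (cc + t)) (at_right 0)"
      using ev
    proof eventually_elim
      case (elim t)
      have "L t = log 2 ((cc + t) / t)"
        using elim unfolding L_def cc_def[symmetric] dd_def[symmetric] ee_def[symmetric] de' by simp
      moreover have "0 < (cc + t) / t" using elim cpos by simp
      ultimately have "2 powr L t = (cc + t) / t" by simp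
      then show ?case unfolding powr_minus by simp
    qed
    ultimately have "((\<lambda>t. t / (cc + t)) \<longlongrightarrow> 2 powr (- g')) (at_right 0)"
      by (rule Lim_transform_eventually)
    moreover have "((\<lambda>t. t / (cc + t)) \<longlongrightarrow> 0 / (cc + 0)) (at_right 0)"
      using cpos by (intro tendsto_intros id) auto
    ultimately have "2 powr (- g') = 0 / (cc + 0)" by (rule tendsto_unique[rotated]) simp
    then show False by simp
  qed
qed

lemma second_partial_unit:
  "second_partial f p a b h \<longleftrightarrow> (\<exists>g. eventually (\<lambda>s.
      ((\<lambda>t. f (\<lambda>i. (p i + s * unit_at b i) + t * unit_at a i)) has_real_derivative g s) (at 0)) (nhds 0)
     \<and> (g has_real_derivative h) (at 0))"
  unfolding second_partial_def unit_at_def by (simp add: add_ac)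

lemma second_partial_unique:
  assumes "second_partial f p a b h" "second_partial f p a b h'" shows "h = h'"
proof -
  obtain g g' where g: "eventually (\<lambda>s. ((\<lambda>t. f (\<lambda>i. (p i + s * unit_at b i) + t * unit_at a i)) has_real_derivative g s) (at 0)) (nhds 0)"
      "(g has_real_derivative h) (at 0)"
    and g': "eventually (\<lambda>s. ((\<lambda>t. f (\<lambda>i. (p i + s * unit_at b i) + t * unit_at a i)) has_real_derivative g' s) (at 0)) (nhds 0)"
      "(g' has_real_derivative h') (at 0)"
    using assms unfolding second_partial_unit by blast
  have "eventually (\<lambda>s. g s = g' s) (nhds 0)" using g(1) g'(1) by eventually_elim (rule DERIV_unique)
  then have "(g has_real_derivative h') (at 0)" using g'(2) DERIV_cong_ev[of 0 0 g g' h' h'] by simp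
  then show ?thesis using g(2) DERIV_unique by blast
qed

lemma hessian_eqI: "second_partial f p a b h \<Longrightarrow> hessian f p a b = h"
  unfolding hessian_def by (rule the_equality) (auto intro: second_partial_unique)

lemma gmi_second_partial:
  assumes fin: "finite D" "a \<in> D" and p: "\<And>i. i \<in> D \<Longrightarrow> 0 \<le> p i" and pa: "0 < p a"
  shows "second_partial (gmi D c d e) p a a ((1 / p a + 1 / csum D c p a - 1 / csum D d p a - 1 / csum D e p a) / ln 2)"
proof -
  have pos: "0 < csum D c p a" "0 < csum D d p a" "0 < csum D e p a"
    using csum_ge[OF fin, of p c] csum_ge[OF fin, of p d] csum_ge[OF fin, of p e] pa p by fastforce+
  define g where "g s = log 2 ((p a + s) * (csum D c p a + s) / ((csum D d p a + s) * (csum D e p a + s)))" for s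
  have ps: "eventually (\<lambda>t. 0 < K + t) (nhds 0)" if "0 < K" for K :: real
  proof -
    have "((\<lambda>t. K + t) \<longlongrightarrow> K + 0) (nhds 0)" by (intro tendsto_intros filterlim_ident)
    then show ?thesis using order_tendstoD(1)[of _ K "nhds 0" 0] that by simp
  qed
  have "eventually (\<lambda>s. ((\<lambda>t. gmi D c d e (\<lambda>i. (p i + s * unit_at a i) + t * unit_at a i)) has_real_derivative g s) (at 0)) (nhds 0)"
    using ps[OF pa]
  proof eventually_elim
    case (elim s)
    let ?r = "\<lambda>i. p i + s * unit_at a i"
    have r: "0 \<le> ?r i" if "i \<in> D" for i using p[OF that] elim by (cases "i = a") (auto simp: unit_at_def)
    have ra: "?r a = p a + s" by (simp add: unit_at_def)
    show ?case using gmi_DERIV_pos[where r="?r" and c=c and d=d and e=e, OF fin r] elim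
      unfolding g_def ra csum_shift[OF fin] by simp
  qed
  moreover have "(g has_real_derivative (1 / p a + 1 / csum D c p a - 1 / csum D d p a - 1 / csum D e p a) / ln 2) (at 0)"
  proof -
    have 1: "((\<lambda>t. ln (K + t)) has_real_derivative 1 / K) (at 0)" if "0 < K" for K :: real
      using that by (auto intro!: derivative_eq_intros)
    have 2: "((\<lambda>t. (ln (p a + t) + ln (csum D c p a + t) - ln (csum D d p a + t) - ln (csum D e p a + t)) / ln 2)
      has_real_derivative (1 / p a + 1 / csum D c p a - 1 / csum D d p a - 1 / csum D e p a) / ln 2) (at 0)"
      by (intro DERIV_cdivide DERIV_diff DERIV_add 1 pos pa)
    have ev: "eventually (\<lambda>t. g t = (ln (p a + t) + ln (csum D c p a + t) - ln (csum D d p a + t) - ln (csum D e p a + t)) / ln 2) (nhds 0)"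
      using ps[OF pa] ps[OF pos(1)] ps[OF pos(2)] ps[OF pos(3)]
      by eventually_elim (simp add: g_def log_def ln_mult_pos ln_div)
    show ?thesis using 2 DERIV_cong_ev[OF refl ev refl] by simp
  qed
  ultimately show ?thesis unfolding second_partial_unit by blast
qed

text \<open>Test with the basis vector at \<open>a\<close>. Boundedness of the supremum has to be
  checked first and follows from finiteness of the entries.\<close>

lemma spec_norm_ge:
  assumes fin: "finite D" "a \<in> D" shows "\<bar>H a a\<bar> \<le> spec_norm D H"
proof -
  let ?f = "\<lambda>v. sqrt (\<Sum>a\<in>D. (\<Sum>b\<in>D. H a b * v b)\<^sup>2)"
  have bdd: "bdd_above {?f v | v. (\<Sum>b\<in>D. (v b)\<^sup>2) = 1}"
  proof (rule bdd_aboveI[of _ "sqrt (\<Sum>a\<in>D. (\<Sum>b\<in>D. \<bar>H a b\<bar>)\<^sup>2)"], safe)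
    fix v :: "_ \<Rightarrow> real" assume v: "(\<Sum>b\<in>D. (v b)\<^sup>2) = 1"
    have v1: "\<bar>v b\<bar> \<le> 1" if "b \<in> D" for b
    proof -
      have "(v b)\<^sup>2 \<le> 1" unfolding v[symmetric] by (rule member_le_sum[OF that]) (use fin in auto)
      then show ?thesis by (simp add: abs_square_le_1)
    qed
    have "(\<Sum>b\<in>D. H x b * v b)\<^sup>2 \<le> (\<Sum>b\<in>D. \<bar>H x b\<bar>)\<^sup>2" for x
    proof -
      have "\<bar>\<Sum>b\<in>D. H x b * v b\<bar> \<le> (\<Sum>b\<in>D. \<bar>H x b\<bar> * 1)"
        by (rule order_trans[OF sum_abs]) (unfold abs_mult, intro sum_mono mult_left_mono v1, auto)
      then show ?thesis by (simp add: power2_le_iff_abs_le sum_nonneg)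
    qed
    then show "?f v \<le> sqrt (\<Sum>a\<in>D. (\<Sum>b\<in>D. \<bar>H a b\<bar>)\<^sup>2)" by (intro real_sqrt_le_mono sum_mono)
  qed
  have e: "(\<Sum>b\<in>D. k b * unit_at a b) = k a" for k :: "_ \<Rightarrow> real"
  proof -
    have "(\<Sum>b\<in>D. k b * unit_at a b) = (\<Sum>b\<in>D. if b = a then k a else 0)"
      by (intro sum.cong refl) (auto simp: unit_at_def)
    then show ?thesis using fin by simp
  qed
  have "(\<Sum>b\<in>D. (unit_at a b)\<^sup>2) = 1"
    using e[of "unit_at a"] by (simp add: power2_eq_square) (simp add: unit_at_def)
  then have "?f (unit_at a) \<le> spec_norm D H" unfolding spec_norm_def by (intro cSup_upper bdd) blast
  moreover have "\<bar>H a a\<bar> \<le> ?f (unit_at a)"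
  proof -
    have "(H a a)\<^sup>2 \<le> (\<Sum>x\<in>D. (H x a)\<^sup>2)" by (rule member_le_sum) (use fin in auto)
    then show ?thesis unfolding e using real_sqrt_le_mono by fastforce
  qed
  ultimately show ?thesis by linarith
qed

section \<open>The mutual information at the joint distribution of the channel\<close>

lemma finite_jdom: "finite Q \<Longrightarrow> finite (jdom Q :: (nat \<times> 'a::finite \<times> 'b::finite \<times> 'c::finite) set)"
  by (simp add: jdom_def)

text \<open>With these labellings, by Q, by (Q, X1, X2) and by (Q, Y), \<open>gmi\<close> becomes
  the conditional mutual information of (X1, X2) and Y given Q.\<close>

definition cls_q :: "nat \<times> 'a \<times> 'b \<times> 'c \<Rightarrow> nat" where "cls_q = (\<lambda>(q, a, b, y). q)"

definition cls_x :: "nat \<times> 'a \<times> 'b \<times> 'c \<Rightarrow> nat \<times> 'a \<times> 'b" where "cls_x = (\<lambda>(q, a, b, y). (q, a, b))"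

definition cls_y :: "nat \<times> 'a \<times> 'b \<times> 'c \<Rightarrow> nat \<times> 'c" where "cls_y = (\<lambda>(q, a, b, y). (q, y))"

lemma csum_cls:
  fixes r :: "nat \<times> 'a::finite \<times> 'b::finite \<times> 'c::finite \<Rightarrow> real"
  assumes q: "q \<in> Q"
  shows "csum (jdom Q) cls_q r (q, x1, x2, y) = (\<Sum>a\<in>UNIV. \<Sum>b\<in>UNIV. \<Sum>c\<in>UNIV. r (q, a, b, c))"
    and "csum (jdom Q) cls_x r (q, x1, x2, y) = (\<Sum>c\<in>UNIV. r (q, x1, x2, c))"
    and "csum (jdom Q) cls_y r (q, x1, x2, y) = (\<Sum>a\<in>UNIV. \<Sum>b\<in>UNIV. r (q, a, b, y))"
proof -
  have 1: "{j \<in> jdom Q. cls_q j = cls_q (q, x1, x2, y)} = (\<lambda>(a, b, c). (q, a, b, c)) ` (UNIV::('a \<times> 'b \<times> 'c) set)"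
    using q by (auto simp: jdom_def cls_q_def)
  have "csum (jdom Q) cls_q r (q, x1, x2, y) = (\<Sum>(a, b, c)\<in>UNIV. r (q, a, b, c))"
    unfolding csum_def 1 by (subst sum.reindex) (auto simp: inj_on_def case_prod_unfold)
  then show "csum (jdom Q) cls_q r (q, x1, x2, y) = (\<Sum>a\<in>UNIV. \<Sum>b\<in>UNIV. \<Sum>c\<in>UNIV. r (q, a, b, c))"
    by (simp add: sum.cartesian_product)
  have 2: "{j \<in> jdom Q. cls_x j = cls_x (q, x1, x2, y)} = (\<lambda>c. (q, x1, x2, c)) ` (UNIV::'c set)"
    using q by (auto simp: jdom_def cls_x_def)
  show "csum (jdom Q) cls_x r (q, x1, x2, y) = (\<Sum>c\<in>UNIV. r (q, x1, x2, c))"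
    unfolding csum_def 2 by (subst sum.reindex) (auto simp: inj_on_def)
  have 3: "{j \<in> jdom Q. cls_y j = cls_y (q, x1, x2, y)} = (\<lambda>(a, b). (q, a, b, y)) ` (UNIV::('a \<times> 'b) set)"
    using q by (auto simp: jdom_def cls_y_def)
  have "csum (jdom Q) cls_y r (q, x1, x2, y) = (\<Sum>(a, b)\<in>UNIV. r (q, a, b, y))"
    unfolding csum_def 3 by (subst sum.reindex) (auto simp: inj_on_def case_prod_unfold)
  then show "csum (jdom Q) cls_y r (q, x1, x2, y) = (\<Sum>a\<in>UNIV. \<Sum>b\<in>UNIV. r (q, a, b, y))"
    by (simp add: sum.cartesian_product)
qed

text \<open>The third component supplies both the full support and the lower bound on
  \<open>kappa\<close>: its diagonal second derivatives see the probability of a single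
  cell.\<close>

lemma MI_fun_3_eq: "MI_fun Q 3 = gmi (jdom Q) cls_q cls_x cls_y"
proof
  fix r :: "nat \<times> 'a::finite \<times> 'b::finite \<times> 'c::finite \<Rightarrow> real"
  show "MI_fun Q 3 r = gmi (jdom Q) cls_q cls_x cls_y r"
    unfolding MI_fun_def gmi_def Let_def
    by (intro sum.cong refl) (auto simp: jdom_def csum_cls[unfolded jdom_def])
qed

lemma joint_simp: "joint W pQ p1 p2 (q, a, b, y) = pQ q * p1 q a * p2 q b * W a b y"
  by (simp add: joint_def)

lemma joint_nonneg:
  assumes "stochastic_MAC W" "valid_input Q pQ p1 p2" "i \<in> jdom Q"
  shows "0 \<le> joint W pQ p1 p2 i"
  using assms by (cases i) (auto simp: joint_simp stochastic_MAC_def valid_input_def jdom_def)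

lemma joint_csum:
  assumes W: "stochastic_MAC W" and v: "valid_input Q pQ p1 p2" and q: "q \<in> Q"
  shows "csum (jdom Q) cls_q (joint W pQ p1 p2) (q, x1, x2, y) = pQ q"
    and "csum (jdom Q) cls_x (joint W pQ p1 p2) (q, x1, x2, y) = pQ q * p1 q x1 * p2 q x2"
    and "csum (jdom Q) cls_y (joint W pQ p1 p2) (q, x1, x2, y) = pQ q * (\<Sum>a\<in>UNIV. \<Sum>b\<in>UNIV. p1 q a * p2 q b * W a b y)"
proof -
  have Ws: "(\<Sum>y\<in>UNIV. W a b y) = 1" for a b using W by (simp add: stochastic_MAC_def)
  have ps: "(\<Sum>a\<in>UNIV. p1 q a) = 1" "(\<Sum>b\<in>UNIV. p2 q b) = 1" using v q by (auto simp: valid_input_def)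
  have c: "(\<Sum>c\<in>UNIV. pQ q * p1 q a * p2 q b * W a b c) = pQ q * p1 q a * p2 q b" for a b
    by (simp add: sum_distrib_left[symmetric] Ws)
  show "csum (jdom Q) cls_x (joint W pQ p1 p2) (q, x1, x2, y) = pQ q * p1 q x1 * p2 q x2"
    unfolding csum_cls[OF q] joint_simp c ..
  have "(\<Sum>a\<in>UNIV. \<Sum>b\<in>UNIV. pQ q * p1 q a * p2 q b) = pQ q"
    by (simp add: sum_distrib_left[symmetric] ps)
  then show "csum (jdom Q) cls_q (joint W pQ p1 p2) (q, x1, x2, y) = pQ q"
    unfolding csum_cls[OF q] joint_simp c .
  show "csum (jdom Q) cls_y (joint W pQ p1 p2) (q, x1, x2, y) = pQ q * (\<Sum>a\<in>UNIV. \<Sum>b\<in>UNIV. p1 q a * p2 q b * W a b y)"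
    unfolding csum_cls[OF q] joint_simp by (simp add: sum_distrib_left mult.assoc)
qed

lemma kappa_ok_second_partial:
  assumes "kappa_ok W Q pQ p1 p2" "a \<in> jdom Q" "b \<in> jdom Q"
  shows "\<exists>h. second_partial (gmi (jdom Q) cls_q cls_x cls_y) (joint W pQ p1 p2) a b h"
  using assms unfolding kappa_ok_def hessian_exists_def MI_fun_3_eq[symmetric] by auto

lemma Vmat_eq_0:
  fixes W :: "'x1::finite \<Rightarrow> 'x2::finite \<Rightarrow> 'y::finite \<Rightarrow> real"
  assumes "\<And>i. i \<in> jdom Q \<Longrightarrow> joint W pQ p1 p2 i = 0 \<or> info_density W p1 p2 i = 0"
  shows "Vmat W Q pQ p1 p2 = 0"
proof -
  have I: "Ivec W Q pQ p1 p2 = 0" unfolding Ivec_def by (rule sum.neutral) (use assms in auto)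
  show ?thesis unfolding Vmat_def I using assms by (force simp: vec_eq_iff intro!: sum.neutral)
qed

lemma info_density_eq_0:
  assumes "(\<Sum>a\<in>UNIV. p1 q a * W a x2 y) = W x1 x2 y" "(\<Sum>b\<in>UNIV. p2 q b * W x1 b y) = W x1 x2 y"
    "(\<Sum>a\<in>UNIV. \<Sum>b\<in>UNIV. p1 q a * p2 q b * W a b y) = W x1 x2 y"
  shows "info_density W p1 p2 (q, x1, x2, y) = 0"
proof -
  show ?thesis
    \<comment> \<open>For a vanishing numerator the conventions 0 / 0 = 0 and ln 0 = 0 give the
      value 0 as well.\<close>
    by (cases "W x1 x2 y = 0") (simp_all add: info_density_def assms vec_eq_iff forall_3 log_def)
qed

text \<open>With a single possible output all information densities vanish. Together with
  \<open>Vmat_nonzero_inputs\<close> this is how the rank assumption is used.\<close>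

lemma Vmat_nonzero_outputs:
  fixes W :: "'x1::finite \<Rightarrow> 'x2::finite \<Rightarrow> 'y::finite \<Rightarrow> real"
  assumes W: "stochastic_MAC W" and v: "valid_input Q pQ p1 p2" and V: "Vmat W Q pQ p1 p2 \<noteq> 0"
  shows "\<exists>y. (\<exists>a b. W a b y \<noteq> 0) \<and> y \<noteq> y0"
proof (rule ccontr)
  assume n: "\<not> ?thesis"
  have W1: "W a b y0 = 1" for a b
  proof -
    have "(\<Sum>y\<in>UNIV. W a b y) = (\<Sum>y\<in>{y0}. W a b y)" by (rule sum.mono_neutral_right) (use n in auto)
    then show ?thesis using W by (simp add: stochastic_MAC_def)
  qed
  have "joint W pQ p1 p2 i = 0 \<or> info_density W p1 p2 i = 0" if ij: "i \<in> jdom Q" for i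
  proof -
    obtain q a b y where i: "i = (q, a, b, y)" and q: "q \<in> Q" using ij by (cases i) (auto simp: jdom_def)
    show ?thesis
    proof (cases "y = y0")
      case True
      have ps: "(\<Sum>a\<in>UNIV. p1 q a) = 1" "(\<Sum>b\<in>UNIV. p2 q b) = 1" using v q by (auto simp: valid_input_def)
      have "info_density W p1 p2 i = 0" unfolding i True
        by (rule info_density_eq_0) (simp_all add: W1 ps sum_distrib_left[symmetric])
      then show ?thesis ..
    next
      case False
      then show ?thesis using n by (auto simp: i joint_simp)
    qed
  qed
  from Vmat_eq_0[OF this] V show False by blast
qed

lemma Vmat_nonzero_inputs:
  fixes W :: "'x1::finite \<Rightarrow> 'x2::finite \<Rightarrow> 'y::finite \<Rightarrow> real"
  assumes v: "valid_input Q pQ p1 p2" and V: "Vmat W Q pQ p1 p2 \<noteq> 0"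
  shows "\<exists>x. x \<noteq> (x0 :: 'x1 \<times> 'x2)"
proof (rule ccontr)
  assume n: "\<not> ?thesis"
  have U: "UNIV = {fst x0}" "UNIV = {snd x0}" using n by (auto simp: prod_eq_iff)
  have "joint W pQ p1 p2 i = 0 \<or> info_density W p1 p2 i = 0" if ij: "i \<in> jdom Q" for i
  proof -
    obtain q a b y where i: "i = (q, a, b, y)" and q: "q \<in> Q" using ij by (cases i) (auto simp: jdom_def)
    have ps: "(\<Sum>a\<in>UNIV. p1 q a) = 1" "(\<Sum>b\<in>UNIV. p2 q b) = 1" using v q by (auto simp: valid_input_def)
    have ab: "a = fst x0" "b = snd x0" using U by auto
    have "info_density W p1 p2 i = 0" unfolding i
      by (rule info_density_eq_0) (use ps in \<open>simp_all add: U ab\<close>)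
    then show ?thesis ..
  qed
  from Vmat_eq_0[OF this] V show False by blast
qed

text \<open>A mixed second derivative in the directions a and b presupposes differentiability along
  a also at nearby points displaced along b. Such displacements make selected marginals positive and
  so reach the hypotheses of \<open>gmi_no_DERIV\<close>.\<close>

lemma kappa_ok_DERIV:
  assumes "kappa_ok W Q pQ p1 p2" "a \<in> jdom Q" "b \<in> jdom Q"
  shows "\<exists>s>0. \<exists>g. ((\<lambda>t. gmi (jdom Q) cls_q cls_x cls_y (\<lambda>i. (joint W pQ p1 p2 i + s * unit_at b i) + t * unit_at a i)) has_real_derivative g) (at 0)"
    and "\<exists>g. ((\<lambda>t. gmi (jdom Q) cls_q cls_x cls_y (\<lambda>i. joint W pQ p1 p2 i + t * unit_at a i)) has_real_derivative g) (at 0)"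
proof -
  obtain g where ev: "eventually (\<lambda>s. ((\<lambda>t. gmi (jdom Q) cls_q cls_x cls_y (\<lambda>i. (joint W pQ p1 p2 i + s * unit_at b i) + t * unit_at a i)) has_real_derivative g s) (at 0)) (nhds 0)"
    using kappa_ok_second_partial[OF assms] unfolding second_partial_unit by blast
  show "\<exists>g. ((\<lambda>t. gmi (jdom Q) cls_q cls_x cls_y (\<lambda>i. joint W pQ p1 p2 i + t * unit_at a i)) has_real_derivative g) (at 0)"
    using eventually_nhds_x_imp_x[OF ev] by auto
  obtain d where d: "0 < d" "\<And>s. dist s 0 < d \<Longrightarrow> ((\<lambda>t. gmi (jdom Q) cls_q cls_x cls_y (\<lambda>i. (joint W pQ p1 p2 i + s * unit_at b i) + t * unit_at a i)) has_real_derivative g s) (at 0)"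
    using ev unfolding eventually_nhds_metric by blast
  have "dist (d / 2) 0 < d" using d(1) by simp
  from d(2)[OF this] show "\<exists>s>0. \<exists>g. ((\<lambda>t. gmi (jdom Q) cls_q cls_x cls_y (\<lambda>i. (joint W pQ p1 p2 i + s * unit_at b i) + t * unit_at a i)) has_real_derivative g) (at 0)"
    using d(1) by (intro exI[of _ "d / 2"]) auto
qed

text \<open>A coordinate vanishing while its marginals do not makes the mutual information behave like
  \<open>t * ln t\<close> in that direction, so existence of the Hessian forces full support.\<close>
lemma full_support:
  fixes W :: "'x1::finite \<Rightarrow> 'x2::finite \<Rightarrow> 'y::finite \<Rightarrow> real"
  assumes W: "stochastic_MAC W" and v: "valid_input Q pQ p1 p2" and V: "Vmat W Q pQ p1 p2 \<noteq> 0"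
    and k: "kappa_ok W Q pQ p1 p2" and q: "q \<in> Q"
  shows "0 < pQ q" and "0 < p1 q x1" and "0 < p2 q x2" and "W x1' x2' y \<noteq> 0 \<Longrightarrow> 0 < W x1 x2 y"
proof -
  let ?J = "joint W pQ p1 p2" and ?D = "jdom Q :: (nat \<times> 'x1 \<times> 'x2 \<times> 'y) set"
  have fin: "finite ?D" using v by (intro finite_jdom) (simp add: valid_input_def)
  have mem: "(q, a, b, c) \<in> ?D" for a b c using q by (simp add: jdom_def)
  have r0: "0 \<le> ?J i + s * unit_at b i" if "i \<in> ?D" "0 < s" for i b s
    using joint_nonneg[OF W v that(1)] that(2) by (simp add: unit_at_def indicator_def)
  have nn: "0 \<le> pQ q" "0 \<le> p1 q a" "0 \<le> p2 q b" "0 \<le> W a b c" for a b c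
    using v q W by (auto simp: valid_input_def stochastic_MAC_def)
  have Ws: "(\<Sum>y\<in>UNIV. W a b y) = 1" for a b using W by (simp add: stochastic_MAC_def)
  have ps: "(\<Sum>a\<in>UNIV. p1 q a) = 1" "(\<Sum>b\<in>UNIV. p2 q b) = 1" using v q by (auto simp: valid_input_def)
  define P where "P y = (\<Sum>a\<in>UNIV. \<Sum>b\<in>UNIV. p1 q a * p2 q b * W a b y)" for y
  have P0: "0 \<le> P y" for y unfolding P_def by (intro sum_nonneg mult_nonneg_nonneg nn)
  have Psum: "(\<Sum>y\<in>UNIV. P y) = 1"
  proof -
    have "(\<Sum>y\<in>UNIV. P y) = (\<Sum>a\<in>UNIV. \<Sum>b\<in>UNIV. \<Sum>y\<in>UNIV. p1 q a * p2 q b * W a b y)"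
      unfolding P_def by (subst sum.swap, rule sum.cong[OF refl], rule sum.swap)
    also have "\<dots> = 1" by (simp add: sum_distrib_left[symmetric] Ws ps)
    finally show ?thesis .
  qed
  note cs = joint_csum[OF W v q, folded P_def]
  show pq: "0 < pQ q"
  proof (rule ccontr)
    assume "\<not> 0 < pQ q"
    then have pq: "pQ q = 0" using nn by (simp add: less_le)
    obtain x where x: "x \<noteq> (x1, x2)" using Vmat_nonzero_inputs[OF v V] by blast
    obtain y' where y': "y' \<noteq> y" using Vmat_nonzero_outputs[OF W v V] by blast
    \<comment> \<open>If q has probability 0, mass at a cell differing from \<open>?a\<close> in
      inputs and output makes the marginal of q positive and leaves both others at \<open>?a\<close>
      zero: the divergence to plus infinity.\<close>
    let ?a = "(q, x1, x2, y)" and ?b = "(q, fst x, snd x, y')"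
    obtain s g where s: "0 < s" and g: "((\<lambda>t. gmi ?D cls_q cls_x cls_y (\<lambda>i. (?J i + s * unit_at ?b i) + t * unit_at ?a i)) has_real_derivative g) (at 0)"
      using kappa_ok_DERIV(1)[OF k mem mem] by blast
    have "\<not> ((\<lambda>t. gmi ?D cls_q cls_x cls_y (\<lambda>i. (?J i + s * unit_at ?b i) + t * unit_at ?a i)) has_real_derivative g) (at 0)"
    proof (rule gmi_no_DERIV[OF fin mem r0[OF _ s]])
      show "?J ?a + s * unit_at ?b ?a = 0" using y' by (simp add: joint_simp pq unit_at_def)
      show "0 < csum ?D cls_q (\<lambda>i. ?J i + s * unit_at ?b i) ?a" unfolding csum_shift[OF fin mem] cs using pq s by (simp add: cls_q_def)
      show "0 < csum ?D cls_x (\<lambda>i. ?J i + s * unit_at ?b i) ?a \<and> 0 < csum ?D cls_y (\<lambda>i. ?J i + s * unit_at ?b i) ?a \<or>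
         csum ?D cls_x (\<lambda>i. ?J i + s * unit_at ?b i) ?a = 0 \<and> csum ?D cls_y (\<lambda>i. ?J i + s * unit_at ?b i) ?a = 0"
        unfolding csum_shift[OF fin mem] cs using pq y' x by (auto simp: cls_x_def cls_y_def prod_eq_iff)
    qed
    then show False using g by blast
  qed
  have pp: "0 < p1 q x1 * p2 q x2" for x1 x2
  proof (rule ccontr)
    assume "\<not> 0 < p1 q x1 * p2 q x2"
    then have pp: "p1 q x1 * p2 q x2 = 0" using mult_nonneg_nonneg[OF nn(2,3), of x1 x2] by linarith
    have "\<exists>y0. P y0 \<noteq> 0" using Psum by (metis sum.neutral zero_neq_one)
    then obtain y0 where "P y0 \<noteq> 0" by blast
    then have y0: "0 < P y0" using P0[of y0] by simp
    obtain y' where y': "y' \<noteq> y0" using Vmat_nonzero_outputs[OF W v V] by blast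
    \<comment> \<open>For an input pair of probability 0, mass at the same pair with another output
      makes its marginal positive, while that of y0 is positive already: the divergence to minus
      infinity.\<close>
    let ?a = "(q, x1, x2, y0)" and ?b = "(q, x1, x2, y')"
    obtain s g where s: "0 < s" and g: "((\<lambda>t. gmi ?D cls_q cls_x cls_y (\<lambda>i. (?J i + s * unit_at ?b i) + t * unit_at ?a i)) has_real_derivative g) (at 0)"
      using kappa_ok_DERIV(1)[OF k mem mem] by blast
    have "\<not> ((\<lambda>t. gmi ?D cls_q cls_x cls_y (\<lambda>i. (?J i + s * unit_at ?b i) + t * unit_at ?a i)) has_real_derivative g) (at 0)"
    proof (rule gmi_no_DERIV[OF fin mem r0[OF _ s]])
      have "?J ?a = 0" using pp by (auto simp: joint_simp)
      then show "?J ?a + s * unit_at ?b ?a = 0" using y' by (simp add: unit_at_def)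
      show "0 < csum ?D cls_q (\<lambda>i. ?J i + s * unit_at ?b i) ?a" unfolding csum_shift[OF fin mem] cs using pq s by (simp add: cls_q_def)
      have z: "pQ q * p1 q x1 * p2 q x2 = 0" using pp by auto
      show "0 < csum ?D cls_x (\<lambda>i. ?J i + s * unit_at ?b i) ?a \<and> 0 < csum ?D cls_y (\<lambda>i. ?J i + s * unit_at ?b i) ?a \<or>
         csum ?D cls_x (\<lambda>i. ?J i + s * unit_at ?b i) ?a = 0 \<and> csum ?D cls_y (\<lambda>i. ?J i + s * unit_at ?b i) ?a = 0"
        unfolding csum_shift[OF fin mem] cs z using pq y0 s y' by (simp add: cls_x_def cls_y_def)
    qed
    then show False using g by blast
  qed
  show p1: "0 < p1 q x1" and p2: "0 < p2 q x2" using pp[of x1 x2] nn(2)[of x1] nn(3)[of x2] by (auto simp: zero_less_mult_iff)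
  show "0 < W x1 x2 y" if W': "W x1' x2' y \<noteq> 0"
  proof (rule ccontr)
    assume "\<not> 0 < W x1 x2 y"
    then have w0: "W x1 x2 y = 0" using nn(4)[of x1 x2 y] by simp
    have "0 < p1 q x1' * p2 q x2' * W x1' x2' y" using pp[of x1' x2'] W' nn(4)[of x1' x2' y] by (simp add: less_le)
    also have "\<dots> \<le> (\<Sum>b\<in>UNIV. p1 q x1' * p2 q b * W x1' b y)"
      by (rule member_le_sum) (auto intro!: mult_nonneg_nonneg nn)
    also have "\<dots> \<le> P y" unfolding P_def
      by (rule member_le_sum[of _ _ "\<lambda>a. \<Sum>b\<in>UNIV. p1 q a * p2 q b * W a b y"]) (auto intro!: sum_nonneg mult_nonneg_nonneg nn)
    finally have Py: "0 < P y" .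
    \<comment> \<open>All marginals are positive by now, so a vanishing transition probability
      contradicts differentiability at the undisturbed point.\<close>
    let ?a = "(q, x1, x2, y)"
    obtain g where g: "((\<lambda>t. gmi ?D cls_q cls_x cls_y (\<lambda>i. ?J i + t * unit_at ?a i)) has_real_derivative g) (at 0)"
      using kappa_ok_DERIV(2)[OF k mem mem] by blast
    have "\<not> ((\<lambda>t. gmi ?D cls_q cls_x cls_y (\<lambda>i. ?J i + t * unit_at ?a i)) has_real_derivative g) (at 0)"
      by (rule gmi_no_DERIV[OF fin mem joint_nonneg[OF W v]]) (use pq Py pp[of x1 x2] in \<open>auto simp: cs joint_simp w0 mult.assoc\<close>)
    then show False using g by blast
  qed
qed

text \<open>With A = pQ q, B the probability of an input pair, C = W and E the output probability
  given q, the diagonal entry of the Hessian is ((1/C - 1)/B - (1/E - 1)) / A up to ln 2. It is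
  evaluated at the least likely pair, where B \<le> 1/2, and at an output with C \<le> E; there it
  is at least (1/C - 1) (1/B - 1) / A, hence w / (2 A B). Minimality of B extends the bound to all
  pairs.\<close>

lemma kappa_ge:
  fixes W :: "'x1::finite \<Rightarrow> 'x2::finite \<Rightarrow> 'y::finite \<Rightarrow> real"
  assumes W: "stochastic_MAC W" and v: "valid_input Q pQ p1 p2" and V: "Vmat W Q pQ p1 p2 \<noteq> 0"
    and k: "kappa_ok W Q pQ p1 p2"
    and w: "0 < w" "\<And>a b y. W a b y \<noteq> 0 \<Longrightarrow> w \<le> W a b y"
    and q: "q \<in> Q"
  shows "w / (2 * ln 2) / (pQ q * p1 q a * p2 q b) \<le> kappa W Q pQ p1 p2"
proof -
  let ?J = "joint W pQ p1 p2" and ?D = "jdom Q :: (nat \<times> 'x1 \<times> 'x2 \<times> 'y) set"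
  have fin: "finite ?D" using v by (intro finite_jdom) (simp add: valid_input_def)
  note fs = full_support[OF W v V k q]
  have Ws: "(\<Sum>y\<in>UNIV. W a b y) = 1" for a b using W by (simp add: stochastic_MAC_def)
  have W0: "0 \<le> W a b y" for a b y using W by (simp add: stochastic_MAC_def)
  have ps: "(\<Sum>a\<in>UNIV. p1 q a) = 1" "(\<Sum>b\<in>UNIV. p2 q b) = 1" using v q by (auto simp: valid_input_def)
  let ?pp = "\<lambda>x. p1 q (fst x) * p2 q (snd x)"
  have pps: "(\<Sum>x\<in>UNIV. ?pp x) = 1"
  proof -
    have "(\<Sum>x\<in>UNIV. ?pp x) = (\<Sum>a\<in>UNIV. \<Sum>b\<in>UNIV. p1 q a * p2 q b)" by (simp add: sum.cartesian_product case_prod_unfold)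
    then show ?thesis by (simp add: sum_distrib_left[symmetric] ps)
  qed
  have "\<exists>x. \<forall>x'. ?pp x \<le> ?pp x'"
    using ex_min_if_finite[of "range ?pp"] by (auto simp: not_less)
  then obtain x where "\<forall>x'. ?pp x \<le> ?pp x'" ..
  then have x: "?pp x \<le> ?pp x'" for x' ..
  have pp0: "0 < ?pp x'" for x' using fs(2,3) by simp
  have half: "?pp x \<le> 1 / 2"
  proof -
    obtain x' where x': "x' \<noteq> x" using Vmat_nonzero_inputs[OF v V] by blast
    have "?pp x + ?pp x' = (\<Sum>z\<in>{x, x'}. ?pp z)" using x' by simp
    also have "\<dots> \<le> (\<Sum>z\<in>UNIV. ?pp z)" by (rule sum_mono2) (use pp0 in \<open>auto intro: less_imp_le\<close>)
    finally show ?thesis using x[of x'] pps by simp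
  qed
  define P where "P y = (\<Sum>a\<in>UNIV. \<Sum>b\<in>UNIV. p1 q a * p2 q b * W a b y)" for y
  have Psum: "(\<Sum>y\<in>UNIV. P y) = 1"
  proof -
    have "(\<Sum>y\<in>UNIV. P y) = (\<Sum>a\<in>UNIV. \<Sum>b\<in>UNIV. \<Sum>y\<in>UNIV. p1 q a * p2 q b * W a b y)"
      unfolding P_def by (subst sum.swap, rule sum.cong[OF refl], rule sum.swap)
    also have "\<dots> = 1" by (simp add: sum_distrib_left[symmetric] Ws ps)
    finally show ?thesis .
  qed
  \<comment> \<open>Two probability vectors on the outputs cannot be strictly ordered on the support
    of the first one, given that off this support both vanish.\<close>
  have "\<exists>y. W (fst x) (snd x) y \<noteq> 0 \<and> W (fst x) (snd x) y \<le> P y"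
  proof (rule ccontr)
    assume n: "\<not> ?thesis"
    have le: "P y \<le> W (fst x) (snd x) y" for y
    proof (cases "W (fst x) (snd x) y = 0")
      case True
      then have "W a b y = 0" for a b using fs(4)[of a b y "fst x" "snd x"] by fastforce
      then show ?thesis by (simp add: P_def True)
    next
      case False then show ?thesis using n by (meson linear)
    qed
    obtain y where y: "W (fst x) (snd x) y \<noteq> 0" using Ws[of "fst x" "snd x"] by (metis sum.neutral zero_neq_one)
    have "(\<Sum>y\<in>UNIV. P y) < (\<Sum>y\<in>UNIV. W (fst x) (snd x) y)"
      by (rule sum_strict_mono_ex1) (use le n y in \<open>auto intro!: bexI[of _ y] simp: not_le\<close>)
    then show False using Psum Ws by simp
  qed
  then obtain y where y: "W (fst x) (snd x) y \<noteq> 0" "W (fst x) (snd x) y \<le> P y" by blast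
  let ?w = "W (fst x) (snd x) y"
  have w0: "0 < ?w" using y W0[of "fst x" "snd x" y] by simp
  \<comment> \<open>A second output of positive probability exists and takes at least w, so C stays
    away from 1.\<close>
  have w1: "w \<le> 1 - ?w"
  proof -
    obtain y' a b where y': "W a b y' \<noteq> 0" "y' \<noteq> y" using Vmat_nonzero_outputs[OF W v V] by blast
    have "W (fst x) (snd x) y' \<noteq> 0" using fs(4)[OF y'(1)] by (simp add: less_imp_neq[symmetric])
    from w(2)[OF this] have "w \<le> W (fst x) (snd x) y'" .
    moreover have "?w + W (fst x) (snd x) y' = (\<Sum>z\<in>{y, y'}. W (fst x) (snd x) z)" using y' by simp
    moreover have "\<dots> \<le> (\<Sum>z\<in>UNIV. W (fst x) (snd x) z)" by (rule sum_mono2) (use W0 in auto)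
    ultimately show ?thesis using Ws by simp
  qed
  let ?a = "(q, fst x, snd x, y)"
  have mem: "?a \<in> ?D" using q by (simp add: jdom_def)
  have Ja: "?J ?a = pQ q * ?pp x * ?w" by (simp add: joint_simp mult.assoc)
  have Ja0: "0 < ?J ?a" unfolding Ja using fs pp0 w0 by simp
  define h where "h = (1 / ?J ?a + 1 / csum ?D cls_q ?J ?a - 1 / csum ?D cls_x ?J ?a - 1 / csum ?D cls_y ?J ?a) / ln 2"
  have sp: "second_partial (MI_fun Q 3) ?J ?a ?a h"
    unfolding MI_fun_3_eq h_def by (rule gmi_second_partial[where p="?J", OF fin mem joint_nonneg[OF W v] Ja0])
  have "spec_norm ?D (hessian (MI_fun Q 3) ?J) \<le> kappa W Q pQ p1 p2" unfolding kappa_def by (rule Max_ge) auto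
  moreover have "\<bar>hessian (MI_fun Q 3) ?J ?a ?a\<bar> \<le> spec_norm ?D (hessian (MI_fun Q 3) ?J)"
    by (rule spec_norm_ge[OF fin mem])
  ultimately have hk: "h \<le> kappa W Q pQ p1 p2" unfolding hessian_eqI[OF sp] by linarith
  have cs: "csum ?D cls_q ?J ?a = pQ q" "csum ?D cls_x ?J ?a = pQ q * ?pp x" "csum ?D cls_y ?J ?a = pQ q * P y"
    using joint_csum[OF W v q, of "fst x" "snd x" y] by (simp_all add: P_def mult.assoc)
  have P0: "0 < P y" using y w0 by simp
  have "w / 2 / ?pp x \<le> (1 / ?w - 1) * (1 / ?pp x - 1)"
  proof -
    have w1': "?w \<le> 1" using w1 w by simp
    have "w \<le> 1 / ?w - 1"
    proof -
      have "(1 - ?w) * 1 \<le> (1 - ?w) * (1 / ?w)" using w0 w1' by (intro mult_left_mono) auto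
      also have "\<dots> = 1 / ?w - 1" using w0 by (simp add: field_simps)
      finally show ?thesis using w1 by simp
    qed
    moreover have "1 / (2 * ?pp x) \<le> 1 / ?pp x - 1" using half pp0[of x] by (simp add: field_simps)
    ultimately have "w * (1 / (2 * ?pp x)) \<le> (1 / ?w - 1) * (1 / ?pp x - 1)"
      using w(1) pp0[of x] by (intro mult_mono) auto
    then show ?thesis by simp
  qed
  also have "\<dots> \<le> (1 / ?w - 1) / ?pp x - (1 / P y - 1)"
  proof -
    have "1 / P y \<le> 1 / ?w" using y w0 P0 by (intro divide_left_mono) auto
    then show ?thesis by (simp add: right_diff_distrib)
  qed
  finally have br: "w / 2 / ?pp x \<le> (1 / ?w - 1) / ?pp x - (1 / P y - 1)" .
  have "h = ((1 / ?w - 1) / ?pp x - (1 / P y - 1)) / pQ q / ln 2"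
  proof -
    have "1 / (A * B * C) + 1 / A - 1 / (A * B) - 1 / (A * E) = ((1 / C - 1) / B - (1 / E - 1)) / A" for A B C E :: real
      by (simp add: diff_divide_distrib mult_ac)
    then show ?thesis unfolding h_def cs Ja by simp
  qed
  then have "w / 2 / ?pp x / pQ q / ln 2 \<le> h" using br fs(1) by (simp only:) (intro divide_right_mono, auto)
  moreover have "w / (2 * ln 2) / (pQ q * p1 q a * p2 q b) \<le> w / 2 / ?pp x / pQ q / ln 2"
  proof -
    have "?pp x \<le> p1 q a * p2 q b" using x[of "(a, b)"] by simp
    then have "pQ q * ?pp x \<le> pQ q * p1 q a * p2 q b" using fs(1) by (simp add: mult.assoc)
    then have "w / (2 * ln 2) / (pQ q * p1 q a * p2 q b) \<le> w / (2 * ln 2) / (pQ q * ?pp x)"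
      using w(1) fs(1) pp0[of x] by (intro divide_left_mono) (auto intro!: mult_pos_pos fs)
    then show ?thesis by (simp add: mult_ac)
  qed
  ultimately show ?thesis using hk by linarith
qed

section \<open>Achievability\<close>

text \<open>Change of measure: on the event T the output law with a wrong codeword averaged out is
  at most W / g, and W sums to 1. Hence an independent codeword passes the test with probability at
  most 1 / g.\<close>

lemma random_coding_threshold:
  fixes W :: "'a \<Rightarrow> 'b \<Rightarrow> 'y \<Rightarrow> real"
  assumes fin: "finite A1" "finite A2" "finite B" "finite M1" "finite M2" and ne: "M1 \<noteq> {}" "M2 \<noteq> {}"
    and P1: "\<And>x. x \<in> A1 \<Longrightarrow> 0 \<le> P1 x" "(\<Sum>x\<in>A1. P1 x) = 1"
    and P2: "\<And>x. x \<in> A2 \<Longrightarrow> 0 \<le> P2 x" "(\<Sum>x\<in>A2. P2 x) = 1"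
    and W0: "\<And>x1 x2 y. x1 \<in> A1 \<Longrightarrow> x2 \<in> A2 \<Longrightarrow> y \<in> B \<Longrightarrow> 0 \<le> W x1 x2 y"
    and W1: "\<And>x1 x2. x1 \<in> A1 \<Longrightarrow> x2 \<in> A2 \<Longrightarrow> (\<Sum>y\<in>B. W x1 x2 y) = 1"
    and g: "0 < g1" "0 < g2" "0 < g3"
  defines "T \<equiv> \<lambda>x1 x2 y. g1 * (\<Sum>a\<in>A1. P1 a * W a x2 y) \<le> W x1 x2 y
      \<and> g2 * (\<Sum>b\<in>A2. P2 b * W x1 b y) \<le> W x1 x2 y
      \<and> g3 * (\<Sum>a\<in>A1. \<Sum>b\<in>A2. P1 a * P2 b * W a b y) \<le> W x1 x2 y"
  assumes s: "s \<le> (\<Sum>x1\<in>A1. \<Sum>x2\<in>A2. P1 x1 * P2 x2 * (\<Sum>y\<in>B. W x1 x2 y * of_bool (T x1 x2 y)))"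
  obtains f1 f2 dec where "f1 \<in> M1 \<rightarrow>\<^sub>E A1" "f2 \<in> M2 \<rightarrow>\<^sub>E A2" "\<And>y. dec y \<in> M1 \<times> M2"
    "card M1 * card M2 * (s - (real (card M1) - 1) / g1 - (real (card M2) - 1) / g2 - (real (card M1) - 1) * (real (card M2) - 1) / g3)
      \<le> (\<Sum>m1\<in>M1. \<Sum>m2\<in>M2. \<Sum>y\<in>B. if dec y = (m1, m2) then W (f1 m1) (f2 m2) y else 0)"
proof -
  define G where "G x1 x2 x1' x2' = (\<Sum>y\<in>B. W x1 x2 y * of_bool (T x1' x2' y))" for x1 x2 x1' x2'
  have Wall: "(\<Sum>x1\<in>A1. \<Sum>x2\<in>A2. P1 x1 * P2 x2 * (\<Sum>y\<in>B. W x1 x2 y)) = 1"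
    using W1 P1(2) P2(2) by (simp add: sum_distrib_left[symmetric] cong: sum.cong)
  have e0: "(\<Sum>x1\<in>A1. \<Sum>x2\<in>A2. P1 x1 * P2 x2 * (\<Sum>y\<in>B. W x1 x2 y * of_bool (\<not> T x1 x2 y))) \<le> 1 - s"
  proof -
    have "(\<Sum>x1\<in>A1. \<Sum>x2\<in>A2. P1 x1 * P2 x2 * (\<Sum>y\<in>B. W x1 x2 y * of_bool (\<not> T x1 x2 y)))
      = (\<Sum>x1\<in>A1. \<Sum>x2\<in>A2. P1 x1 * P2 x2 * (\<Sum>y\<in>B. W x1 x2 y)) - (\<Sum>x1\<in>A1. \<Sum>x2\<in>A2. P1 x1 * P2 x2 * (\<Sum>y\<in>B. W x1 x2 y * of_bool (T x1 x2 y)))"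
      unfolding sum_subtractf[symmetric] right_diff_distrib[symmetric] by (intro sum.cong refl arg_cong2[where f="(*)"]) auto
    then show ?thesis using s Wall by simp
  qed
  \<comment> \<open>The sent codeword of user 1 is averaged, the competing one is fixed; the
    threshold for the competitor then bounds the averaged output law.\<close>
  have G1: "(\<Sum>x1\<in>A1. P1 x1 * G x1 x2 x1' x2) \<le> 1 / g1" if x: "x1' \<in> A1" "x2 \<in> A2" for x1' x2
  proof -
    have "(\<Sum>x1\<in>A1. P1 x1 * G x1 x2 x1' x2) = (\<Sum>y\<in>B. (\<Sum>a\<in>A1. P1 a * W a x2 y) * of_bool (T x1' x2 y))"
      unfolding G_def sum_distrib_left sum_distrib_right by (subst sum.swap) (simp add: mult.assoc)
    also have "\<dots> \<le> (\<Sum>y\<in>B. W x1' x2 y / g1)"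
    proof (rule sum_mono)
      fix y assume "y \<in> B"
      then show "(\<Sum>a\<in>A1. P1 a * W a x2 y) * of_bool (T x1' x2 y) \<le> W x1' x2 y / g1"
        using g W0[OF x] by (cases "T x1' x2 y") (auto simp: T_def field_simps)
    qed
    finally show ?thesis by (simp add: sum_divide_distrib[symmetric] W1 x)
  qed
  have G2: "(\<Sum>x2\<in>A2. P2 x2 * G x1 x2 x1 x2') \<le> 1 / g2" if x: "x1 \<in> A1" "x2' \<in> A2" for x1 x2'
  proof -
    have "(\<Sum>x2\<in>A2. P2 x2 * G x1 x2 x1 x2') = (\<Sum>y\<in>B. (\<Sum>b\<in>A2. P2 b * W x1 b y) * of_bool (T x1 x2' y))"
      unfolding G_def sum_distrib_left sum_distrib_right by (subst sum.swap) (simp add: mult.assoc)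
    also have "\<dots> \<le> (\<Sum>y\<in>B. W x1 x2' y / g2)"
    proof (rule sum_mono)
      fix y assume "y \<in> B"
      then show "(\<Sum>b\<in>A2. P2 b * W x1 b y) * of_bool (T x1 x2' y) \<le> W x1 x2' y / g2"
        using g W0[OF x] by (cases "T x1 x2' y") (auto simp: T_def field_simps)
    qed
    finally show ?thesis by (simp add: sum_divide_distrib[symmetric] W1 x)
  qed
  have G3: "(\<Sum>x1\<in>A1. \<Sum>x2\<in>A2. P1 x1 * P2 x2 * G x1 x2 x1' x2') \<le> 1 / g3" if x: "x1' \<in> A1" "x2' \<in> A2" for x1' x2'
  proof -
    have "(\<Sum>x1\<in>A1. \<Sum>x2\<in>A2. P1 x1 * P2 x2 * G x1 x2 x1' x2') = (\<Sum>x1\<in>A1. \<Sum>x2\<in>A2. \<Sum>y\<in>B. P1 x1 * P2 x2 * W x1 x2 y * of_bool (T x1' x2' y))"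
      unfolding G_def by (simp add: sum_distrib_left mult.assoc)
    also have "\<dots> = (\<Sum>x1\<in>A1. \<Sum>y\<in>B. \<Sum>x2\<in>A2. P1 x1 * P2 x2 * W x1 x2 y * of_bool (T x1' x2' y))"
      by (rule sum.cong[OF refl sum.swap])
    also have "\<dots> = (\<Sum>y\<in>B. \<Sum>x1\<in>A1. \<Sum>x2\<in>A2. P1 x1 * P2 x2 * W x1 x2 y * of_bool (T x1' x2' y))"
      by (rule sum.swap)
    also have "\<dots> = (\<Sum>y\<in>B. (\<Sum>a\<in>A1. \<Sum>b\<in>A2. P1 a * P2 b * W a b y) * of_bool (T x1' x2' y))"
      by (simp add: sum_distrib_right)
    also have "\<dots> \<le> (\<Sum>y\<in>B. W x1' x2' y / g3)"
    proof (rule sum_mono)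
      fix y assume "y \<in> B"
      then show "(\<Sum>a\<in>A1. \<Sum>b\<in>A2. P1 a * P2 b * W a b y) * of_bool (T x1' x2' y) \<le> W x1' x2' y / g3"
        using g W0[OF x] by (cases "T x1' x2' y") (auto simp: T_def field_simps)
    qed
    finally show ?thesis by (simp add: sum_divide_distrib[symmetric] W1 x)
  qed
  have e1: "(\<Sum>x1\<in>A1. \<Sum>x1'\<in>A1. P1 x1 * P1 x1' * (\<Sum>x2\<in>A2. P2 x2 * G x1 x2 x1' x2)) \<le> 1 / g1"
  proof -
    have "(\<Sum>x1\<in>A1. \<Sum>x1'\<in>A1. P1 x1 * P1 x1' * (\<Sum>x2\<in>A2. P2 x2 * G x1 x2 x1' x2))
      = (\<Sum>x1'\<in>A1. \<Sum>x1\<in>A1. \<Sum>x2\<in>A2. P1 x1' * (P2 x2 * (P1 x1 * G x1 x2 x1' x2)))"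
      by (subst sum.swap) (simp add: sum_distrib_left mult_ac)
    also have "\<dots> = (\<Sum>x1'\<in>A1. \<Sum>x2\<in>A2. \<Sum>x1\<in>A1. P1 x1' * (P2 x2 * (P1 x1 * G x1 x2 x1' x2)))"
      by (rule sum.cong[OF refl sum.swap])
    also have "\<dots> = (\<Sum>x1'\<in>A1. P1 x1' * (\<Sum>x2\<in>A2. P2 x2 * (\<Sum>x1\<in>A1. P1 x1 * G x1 x2 x1' x2)))"
      by (simp add: sum_distrib_left)
    also have "\<dots> \<le> (\<Sum>x1'\<in>A1. P1 x1' * (\<Sum>x2\<in>A2. P2 x2 * (1 / g1)))"
      using P1(1) P2(1) G1 by (intro sum_mono mult_left_mono) auto
    also have "\<dots> = 1 / g1" unfolding sum_distrib_right[symmetric] by (simp add: P1(2) P2(2))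
    finally show ?thesis .
  qed
  have e2: "(\<Sum>x1\<in>A1. P1 x1 * (\<Sum>x2\<in>A2. \<Sum>x2'\<in>A2. P2 x2 * P2 x2' * G x1 x2 x1 x2')) \<le> 1 / g2"
  proof -
    have "(\<Sum>x2\<in>A2. \<Sum>x2'\<in>A2. P2 x2 * P2 x2' * G x1 x2 x1 x2') = (\<Sum>x2'\<in>A2. P2 x2' * (\<Sum>x2\<in>A2. P2 x2 * G x1 x2 x1 x2'))" for x1
      by (subst sum.swap) (simp add: sum_distrib_left mult_ac)
    then have "(\<Sum>x1\<in>A1. P1 x1 * (\<Sum>x2\<in>A2. \<Sum>x2'\<in>A2. P2 x2 * P2 x2' * G x1 x2 x1 x2')) \<le> (\<Sum>x1\<in>A1. P1 x1 * (\<Sum>x2'\<in>A2. P2 x2' * (1 / g2)))"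
      using P1(1) P2(1) G2 by (simp only:) (intro sum_mono mult_left_mono; simp)
    also have "\<dots> = 1 / g2" unfolding sum_distrib_right[symmetric] by (simp add: P1(2) P2(2))
    finally show ?thesis .
  qed
  have e3: "(\<Sum>x1\<in>A1. \<Sum>x1'\<in>A1. P1 x1 * P1 x1' * (\<Sum>x2\<in>A2. \<Sum>x2'\<in>A2. P2 x2 * P2 x2' * G x1 x2 x1' x2')) \<le> 1 / g3"
  proof -
    have "(\<Sum>x1\<in>A1. \<Sum>x1'\<in>A1. P1 x1 * P1 x1' * (\<Sum>x2\<in>A2. \<Sum>x2'\<in>A2. P2 x2 * P2 x2' * G x1 x2 x1' x2'))
      = (\<Sum>x1'\<in>A1. \<Sum>x1\<in>A1. \<Sum>x2'\<in>A2. \<Sum>x2\<in>A2. P1 x1' * P2 x2' * (P1 x1 * P2 x2 * G x1 x2 x1' x2'))"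
      by (subst sum.swap, intro sum.cong refl, unfold sum_distrib_left, subst sum.swap) (simp add: mult_ac)
    also have "\<dots> = (\<Sum>x1'\<in>A1. \<Sum>x2'\<in>A2. \<Sum>x1\<in>A1. \<Sum>x2\<in>A2. P1 x1' * P2 x2' * (P1 x1 * P2 x2 * G x1 x2 x1' x2'))"
      by (rule sum.cong[OF refl sum.swap])
    also have "\<dots> = (\<Sum>x1'\<in>A1. \<Sum>x2'\<in>A2. P1 x1' * P2 x2' * (\<Sum>x1\<in>A1. \<Sum>x2\<in>A2. P1 x1 * P2 x2 * G x1 x2 x1' x2'))"
      by (simp add: sum_distrib_left)
    also have "\<dots> \<le> (\<Sum>x1'\<in>A1. \<Sum>x2'\<in>A2. P1 x1' * P2 x2' * (1 / g3))"
      using P1(1) P2(1) G3 by (intro sum_mono mult_left_mono) auto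
    also have "\<dots> = 1 / g3" unfolding sum_distrib_right[symmetric] sum_distrib_left[symmetric] by (simp add: P1(2) P2(2))
    finally show ?thesis .
  qed
  show thesis
  proof (rule random_coding_MAC[OF fin ne P1 P2 W0 W1 e0 e1[unfolded G_def] e2[unfolded G_def] e3[unfolded G_def]])
    fix f1 f2 dec assume h: "f1 \<in> M1 \<rightarrow>\<^sub>E A1" "f2 \<in> M2 \<rightarrow>\<^sub>E A2" "\<And>y. dec y \<in> M1 \<times> M2"
      "card M1 * card M2 * (1 - (1 - s) - (real (card M1) - 1) * (1 / g1) - (real (card M2) - 1) * (1 / g2) - (real (card M1) - 1) * (real (card M2) - 1) * (1 / g3))
      \<le> (\<Sum>m1\<in>M1. \<Sum>m2\<in>M2. \<Sum>y\<in>B. if dec y = (m1, m2) then W (f1 m1) (f2 m2) y else 0)"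
    show thesis by (rule that[OF h(1-3)]) (use h(4) in simp)
  qed
qed

section \<open>Words and the memoryless channel\<close>

abbreviation words :: "'a set \<Rightarrow> nat \<Rightarrow> 'a list set" where
  "words A n \<equiv> {xs. set xs \<subseteq> A \<and> length xs = n}"

lemma words_Suc: "words A (Suc n) = (\<lambda>(x, xs). x # xs) ` (A \<times> words A n)"
  by (auto simp: length_Suc_conv image_iff)

lemma words_0: "words A 0 = {[]}" by auto

lemma sum_words_Suc: "(\<Sum>xs\<in>words A (Suc n). f xs) = (\<Sum>x\<in>A. \<Sum>xs\<in>words A n. f (x # xs))"
  unfolding words_Suc by (subst sum.reindex) (auto simp: inj_on_def sum.cartesian_product case_prod_unfold)

lemma sum_words_prod:
  fixes f :: "nat \<Rightarrow> 'a \<Rightarrow> real"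
  shows "(\<Sum>xs\<in>words A n. \<Prod>k<n. f k (xs ! k)) = (\<Prod>k<n. \<Sum>x\<in>A. f k x)"
proof (induction n arbitrary: f)
  case (Suc n)
  have "(\<Sum>xs\<in>words A (Suc n). \<Prod>k<Suc n. f k (xs ! k)) = (\<Sum>x\<in>A. \<Sum>xs\<in>words A n. f 0 x * (\<Prod>k<n. f (Suc k) (xs ! k)))"
    unfolding sum_words_Suc prod.lessThan_Suc_shift by simp
  also have "\<dots> = (\<Sum>x\<in>A. f 0 x) * (\<Prod>k<n. \<Sum>x\<in>A. f (Suc k) x)"
    by (simp only: sum_distrib_left[symmetric] sum_distrib_right[symmetric] Suc[of "\<lambda>k. f (Suc k)"])
  finally show ?case unfolding prod.lessThan_Suc_shift .
next
  case 0
  show ?case unfolding words_0 by simp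
qed

lemma sum_words_prod2:
  fixes f :: "nat \<Rightarrow> 'a \<Rightarrow> 'b \<Rightarrow> real"
  shows "(\<Sum>xs\<in>words A n. \<Sum>zs\<in>words B n. \<Prod>k<n. f k (xs ! k) (zs ! k)) = (\<Prod>k<n. \<Sum>x\<in>A. \<Sum>z\<in>B. f k x z)"
  by (simp add: sum_words_prod[of "\<lambda>k. f k (_ ! k)"] sum_words_prod[of "\<lambda>k x. \<Sum>z\<in>B. f k x z"])

lemma sum_cdf_words:
  "sum_cdf I p X n z = (\<Sum>as\<in>words I n. (\<Prod>k<n. p (as ! k)) * nonneg_ind (z - (\<Sum>k<n. X (as ! k))))"
proof (induction n arbitrary: z)
  case (Suc n)
  show ?case
    unfolding sum_cdf.simps Suc sum_words_Suc prod.lessThan_Suc_shift sum.lessThan_Suc_shift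
    by (simp add: sum_distrib_left mult.assoc diff_diff_eq)
next
  case 0
  show ?case unfolding words_0 by simp
qed

text \<open>A word over quadruples is a quadruple of words. This turns the independent sum behind
  \<open>sum_cdf\<close> into an average over time-sharing sequence, two codewords and
  output.\<close>

lemma sum_words_zip4:
  fixes f :: "'q list \<Rightarrow> 'a list \<Rightarrow> 'b list \<Rightarrow> 'c list \<Rightarrow> real"
  shows "(\<Sum>as\<in>words (Q \<times> A \<times> B \<times> C) n. f (map fst as) (map (fst \<circ> snd) as) (map (fst \<circ> snd \<circ> snd) as) (map (snd \<circ> snd \<circ> snd) as))
    = (\<Sum>qs\<in>words Q n. \<Sum>xs\<in>words A n. \<Sum>zs\<in>words B n. \<Sum>ys\<in>words C n. f qs xs zs ys)"
proof (induction n arbitrary: f)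
  case (Suc n)
  have "(\<Sum>as\<in>words (Q \<times> A \<times> B \<times> C) (Suc n). f (map fst as) (map (fst \<circ> snd) as) (map (fst \<circ> snd \<circ> snd) as) (map (snd \<circ> snd \<circ> snd) as))
    = (\<Sum>a\<in>Q \<times> A \<times> B \<times> C. \<Sum>qs\<in>words Q n. \<Sum>xs\<in>words A n. \<Sum>zs\<in>words B n. \<Sum>ys\<in>words C n.
        f (fst a # qs) (fst (snd a) # xs) (fst (snd (snd a)) # zs) (snd (snd (snd a)) # ys))"
    unfolding sum_words_Suc list.map o_def
    by (intro sum.cong refl) (rule Suc[of "\<lambda>qs xs zs ys. f (_ # qs) (_ # xs) (_ # zs) (_ # ys)", unfolded o_def])
  also have "\<dots> = (\<Sum>q\<in>Q. \<Sum>a\<in>A. \<Sum>b\<in>B. \<Sum>c\<in>C. \<Sum>qs\<in>words Q n. \<Sum>xs\<in>words A n. \<Sum>zs\<in>words B n. \<Sum>ys\<in>words C n.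
        f (q # qs) (a # xs) (b # zs) (c # ys))"
  proof -
    have "(\<Sum>a\<in>Q \<times> A \<times> B \<times> C. h (fst a) (fst (snd a)) (fst (snd (snd a))) (snd (snd (snd a)))) = (\<Sum>q\<in>Q. \<Sum>a\<in>A. \<Sum>b\<in>B. \<Sum>c\<in>C. h q a b c)"
      for h :: "'q \<Rightarrow> 'a \<Rightarrow> 'b \<Rightarrow> 'c \<Rightarrow> real"
      by (simp add: sum.cartesian_product case_prod_unfold)
    from this[of "\<lambda>q a b c. \<Sum>qs\<in>words Q n. \<Sum>xs\<in>words A n. \<Sum>zs\<in>words B n. \<Sum>ys\<in>words C n. f (q # qs) (a # xs) (b # zs) (c # ys)"]
    show ?thesis .
  qed
  also have "\<dots> = (\<Sum>q\<in>Q. \<Sum>qs\<in>words Q n. \<Sum>a\<in>A. \<Sum>xs\<in>words A n. \<Sum>b\<in>B. \<Sum>zs\<in>words B n. \<Sum>c\<in>C. \<Sum>ys\<in>words C n.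
        f (q # qs) (a # xs) (b # zs) (c # ys))"
  proof -
    have 1: "(\<Sum>c\<in>C. \<Sum>qs\<in>words Q n. \<Sum>xs\<in>words A n. \<Sum>zs\<in>words B n. \<Sum>ys\<in>words C n. f (q # qs) (a # xs) (b # zs) (c # ys))
      = (\<Sum>qs\<in>words Q n. \<Sum>xs\<in>words A n. \<Sum>zs\<in>words B n. \<Sum>c\<in>C. \<Sum>ys\<in>words C n. f (q # qs) (a # xs) (b # zs) (c # ys))" for q a b
      by (subst sum.swap, rule sum.cong[OF refl], subst sum.swap, rule sum.cong[OF refl], rule sum.swap)
    have 2: "(\<Sum>b\<in>B. \<Sum>qs\<in>words Q n. \<Sum>xs\<in>words A n. \<Sum>zs\<in>words B n. h b qs xs zs)
      = (\<Sum>qs\<in>words Q n. \<Sum>xs\<in>words A n. \<Sum>b\<in>B. \<Sum>zs\<in>words B n. h b qs xs zs)" for h :: "'b \<Rightarrow> 'q list \<Rightarrow> 'a list \<Rightarrow> 'b list \<Rightarrow> real"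
      by (subst sum.swap, rule sum.cong[OF refl], rule sum.swap)
    show ?thesis unfolding 1 2 by (rule sum.cong[OF refl], rule sum.swap)
  qed
  also have "\<dots> = (\<Sum>qs\<in>words Q (Suc n). \<Sum>xs\<in>words A (Suc n). \<Sum>zs\<in>words B (Suc n). \<Sum>ys\<in>words C (Suc n). f qs xs zs ys)"
    unfolding sum_words_Suc ..
  finally show ?case .
next
  case 0
  show ?case unfolding words_0 by simp
qed

text \<open>The event that all information densities exceed their thresholds has, averaged over the
  time-sharing sequence, probability at least a value of the distribution function of the centred
  sum; hence some time-sharing sequence is good enough for random coding.\<close>
lemma achievability:
  fixes W :: "'x1::finite \<Rightarrow> 'x2::finite \<Rightarrow> 'y::finite \<Rightarrow> real"
  assumes W: "stochastic_MAC W" and v: "valid_input Q pQ p1 p2"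
    and g: "0 < g1" "0 < g2" "0 < g3"
    and S: "S = {i \<in> jdom Q. 0 < joint W pQ p1 p2 i}"
    and z: "z = (\<chi> t. n * Ivec W Q pQ p1 p2 $ t) - vector [log 2 g1, log 2 g2, log 2 g3]"
    and M: "M1 = real (msg_size n R1)" "M2 = real (msg_size n R2)"
    and err: "1 - sum_cdf S (joint W pQ p1 p2) (\<lambda>i. Ivec W Q pQ p1 p2 - info_density W p1 p2 i) n z
       + (M1 - 1) / g1 + (M2 - 1) / g2 + (M1 - 1) * (M2 - 1) / g3 \<le> eps"
  shows "(R1, R2) \<in> C_MAC W n eps"
proof -
  let ?J = "joint W pQ p1 p2" and ?I = "Ivec W Q pQ p1 p2" and ?i = "info_density W p1 p2"
  have finQ: "finite Q" using v by (simp add: valid_input_def)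
  have W0: "0 \<le> W a b y" and Ws: "(\<Sum>y\<in>UNIV. W a b y) = 1" for a b y using W by (auto simp: stochastic_MAC_def)
  have pQ0: "0 \<le> pQ q" and p10: "0 \<le> p1 q a" and p20: "0 \<le> p2 q b" if "q \<in> Q" for q a b using v that by (auto simp: valid_input_def)
  have ps: "(\<Sum>a\<in>UNIV. p1 q a) = 1" "(\<Sum>b\<in>UNIV. p2 q b) = 1" if "q \<in> Q" for q using v that by (auto simp: valid_input_def)
  have pQs: "(\<Sum>q\<in>Q. pQ q) = 1" using v by (simp add: valid_input_def)
  let ?A1 = "words (UNIV :: 'x1 set) n" and ?A2 = "words (UNIV :: 'x2 set) n" and ?B = "words (UNIV :: 'y set) n"
  define P1 where "P1 qs xs = (\<Prod>k<n. p1 (qs ! k) (xs ! k))" for qs xs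
  define P2 where "P2 qs zs = (\<Prod>k<n. p2 (qs ! k) (zs ! k))" for qs zs
  define w where "w = Wn W n"
  have wdef: "w xs zs ys = (\<Prod>k<n. W (xs ! k) (zs ! k) (ys ! k))" for xs zs ys by (simp add: w_def Wn_def)
  have fin: "finite (words A n)" if "finite A" for A :: "'z set" using finite_lists_length_eq[OF that] .
  define d1 where "d1 q b y = (\<Sum>a\<in>UNIV. p1 q a * W a b y)" for q b y
  define d2 where "d2 q a y = (\<Sum>b\<in>UNIV. p2 q b * W a b y)" for q a y
  define d3 where "d3 q y = (\<Sum>a\<in>UNIV. \<Sum>b\<in>UNIV. p1 q a * p2 q b * W a b y)" for q y
  define T where "T qs xs zs ys \<longleftrightarrow> g1 * (\<Sum>a\<in>?A1. P1 qs a * w a zs ys) \<le> w xs zs ys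
      \<and> g2 * (\<Sum>b\<in>?A2. P2 qs b * w xs b ys) \<le> w xs zs ys
      \<and> g3 * (\<Sum>a\<in>?A1. \<Sum>b\<in>?A2. P1 qs a * P2 qs b * w a b ys) \<le> w xs zs ys" for qs xs zs ys
  have D1: "(\<Sum>a\<in>?A1. P1 qs a * w a zs ys) = (\<Prod>k<n. d1 (qs ! k) (zs ! k) (ys ! k))" for qs zs ys
    unfolding P1_def wdef prod.distrib[symmetric] d1_def by (rule sum_words_prod[of "\<lambda>k a. p1 (qs ! k) a * W a (zs ! k) (ys ! k)"])
  have D2: "(\<Sum>b\<in>?A2. P2 qs b * w xs b ys) = (\<Prod>k<n. d2 (qs ! k) (xs ! k) (ys ! k))" for qs xs ys
    unfolding P2_def wdef prod.distrib[symmetric] d2_def by (rule sum_words_prod[of "\<lambda>k b. p2 (qs ! k) b * W (xs ! k) b (ys ! k)"])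
  have D3: "(\<Sum>a\<in>?A1. \<Sum>b\<in>?A2. P1 qs a * P2 qs b * w a b ys) = (\<Prod>k<n. d3 (qs ! k) (ys ! k))" for qs ys
    unfolding P1_def P2_def wdef prod.distrib[symmetric] d3_def
    by (rule sum_words_prod2[of "\<lambda>k a b. p1 (qs ! k) a * p2 (qs ! k) b * W a b (ys ! k)"])
  define succ where "succ qs = (\<Sum>xs\<in>?A1. \<Sum>zs\<in>?A2. P1 qs xs * P2 qs zs * (\<Sum>ys\<in>?B. w xs zs ys * of_bool (T qs xs zs ys)))" for qs
  define s where "s = sum_cdf S ?J (\<lambda>i. ?I - ?i i) n z"
  have jd: "jdom Q = Q \<times> (UNIV::'x1 set) \<times> (UNIV::'x2 set) \<times> (UNIV::'y set)" by (simp add: jdom_def)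
  have finJ: "finite (words (Q \<times> (UNIV::'x1 set) \<times> (UNIV::'x2 set) \<times> (UNIV::'y set)) n)" using finQ by (intro fin) simp
  have J0: "0 \<le> ?J i" if "i \<in> Q \<times> UNIV" for i using joint_nonneg[OF W v, of i] that by (simp add: jdom_def)
  have "s \<le> (\<Sum>qs\<in>words Q n. (\<Prod>k<n. pQ (qs ! k)) * succ qs)"
  proof -
    let ?q = "map fst" and ?x = "map (fst \<circ> snd)" and ?z = "map (fst \<circ> snd \<circ> snd)" and ?y = "map (snd \<circ> snd \<circ> snd)"
    have "s = (\<Sum>as\<in>words S n. (\<Prod>k<n. ?J (as ! k)) * nonneg_ind (z - (\<Sum>k<n. ?I - ?i (as ! k))))"
      unfolding s_def by (rule sum_cdf_words)
    also have "\<dots> \<le> (\<Sum>as\<in>words S n. (\<Prod>k<n. ?J (as ! k)) * of_bool (T (?q as) (?x as) (?z as) (?y as)))"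
    proof (intro sum_mono mult_left_mono)
      fix as assume as: "as \<in> words S n"
      then have mem: "as ! k \<in> S" if "k < n" for k using that nth_mem[of k as] by blast
      show "0 \<le> (\<Prod>k<n. ?J (as ! k))" using mem S by (intro prod_nonneg) (auto simp: less_imp_le)
      show "nonneg_ind (z - (\<Sum>k<n. ?I - ?i (as ! k))) \<le> of_bool (T (?q as) (?x as) (?z as) (?y as))"
      proof (cases "\<forall>t. 0 \<le> (z - (\<Sum>k<n. ?I - ?i (as ! k))) $ t")
        case False
        then show ?thesis unfolding nonneg_ind_def by simp
      next
        case True
        have len: "length as = n" using as by simp
        define q x b y where "q k = fst (as ! k)" and "x k = fst (snd (as ! k))" and "b k = fst (snd (snd (as ! k)))" and "y k = snd (snd (snd (as ! k)))" for k
        have ask: "as ! k = (q k, x k, b k, y k)" for k by (simp add: q_def x_def b_def y_def)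
        have qQ: "q k \<in> Q" if "k < n" for k using mem[OF that] S by (auto simp: ask jdom_def)
        \<comment> \<open>Restriction to the support \<open>S\<close> makes the arguments of all
          logarithms positive, so the information densities can be exponentiated.\<close>
        have pos: "0 < W (x k) (b k) (y k)" "0 < p1 (q k) (x k)" "0 < p2 (q k) (b k)" if k: "k < n" for k
        proof -
          have "?J (as ! k) \<noteq> 0" using mem[OF k] S by simp
          then show "0 < W (x k) (b k) (y k)" "0 < p1 (q k) (x k)" "0 < p2 (q k) (b k)"
            using W0[of "x k" "b k" "y k"] p10[OF qQ[OF k], of "x k"] p20[OF qQ[OF k], of "b k"] unfolding ask joint_simp by auto
        qed
        have dpos: "0 < d1 (q k) (b k) (y k)" "0 < d2 (q k) (x k) (y k)" "0 < d3 (q k) (y k)" if k: "k < n" for k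
        proof -
          note q = qQ[OF k] and p = pos[OF k]
          have "p1 (q k) (x k) * W (x k) (b k) (y k) \<le> d1 (q k) (b k) (y k)" unfolding d1_def
            by (rule member_le_sum) (auto intro!: mult_nonneg_nonneg p10 q W0)
          then show "0 < d1 (q k) (b k) (y k)" using mult_pos_pos[OF p(2,1)] by linarith
          have d2: "p2 (q k) (b k) * W (x k) (b k) (y k) \<le> d2 (q k) (x k) (y k)" unfolding d2_def
            by (rule member_le_sum) (auto intro!: mult_nonneg_nonneg p20 q W0)
          then show d2p: "0 < d2 (q k) (x k) (y k)" using mult_pos_pos[OF p(3,1)] by linarith
          have "p1 (q k) (x k) * d2 (q k) (x k) (y k) \<le> d3 (q k) (y k)" unfolding d3_def d2_def sum_distrib_left mult.assoc[symmetric]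
            by (rule member_le_sum[of _ _ "\<lambda>a. \<Sum>b\<in>UNIV. p1 (q k) a * p2 (q k) b * W a b (y k)"]) (auto intro!: sum_nonneg mult_nonneg_nonneg p10 p20 q W0)
          then show "0 < d3 (q k) (y k)" using mult_pos_pos[OF p(2) d2p] by linarith
        qed
        \<comment> \<open>A lower bound on the sum of logarithms is, after exponentiation, the
          product form of the threshold test.\<close>
        have key: "g0 * (\<Prod>k<n. e k) \<le> (\<Prod>k<n. W (x k) (b k) (y k))"
          if e: "\<And>k. k < n \<Longrightarrow> 0 < e k" and g0: "0 < g0" and i: "log 2 g0 \<le> (\<Sum>k<n. log 2 (W (x k) (b k) (y k) / e k))" for e g0
        proof -
          have "g0 = 2 powr (log 2 g0)" using g0 by simp
          also have "\<dots> \<le> 2 powr (\<Sum>k<n. log 2 (W (x k) (b k) (y k) / e k))" using i by simp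
          also have "\<dots> = (\<Prod>k<n. 2 powr (log 2 (W (x k) (b k) (y k) / e k)))" by (rule powr_sum) simp
          also have "\<dots> = (\<Prod>k<n. W (x k) (b k) (y k) / e k)" by (intro prod.cong refl powr_log_cancel) (use e pos in auto)
          also have "\<dots> = (\<Prod>k<n. W (x k) (b k) (y k)) / (\<Prod>k<n. e k)" by (rule prod_dividef)
          finally show ?thesis using prod_pos[of "{..<n}" e] e by (simp add: field_simps)
        qed
        have inf: "log 2 g1 \<le> (\<Sum>k<n. log 2 (W (x k) (b k) (y k) / d1 (q k) (b k) (y k)))"
          "log 2 g2 \<le> (\<Sum>k<n. log 2 (W (x k) (b k) (y k) / d2 (q k) (x k) (y k)))"
          "log 2 g3 \<le> (\<Sum>k<n. log 2 (W (x k) (b k) (y k) / d3 (q k) (y k)))"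
        proof -
          have c: "?i (as ! k) $ 1 = log 2 (W (x k) (b k) (y k) / d1 (q k) (b k) (y k))"
            "?i (as ! k) $ 2 = log 2 (W (x k) (b k) (y k) / d2 (q k) (x k) (y k))"
            "?i (as ! k) $ 3 = log 2 (W (x k) (b k) (y k) / d3 (q k) (y k))" for k
            unfolding ask info_density_def d1_def d2_def d3_def by (simp_all add: Let_def)
          have e: "0 \<le> (z - (\<Sum>k<n. ?I - ?i (as ! k))) $ t" for t using True by blast
          show "log 2 g1 \<le> (\<Sum>k<n. log 2 (W (x k) (b k) (y k) / d1 (q k) (b k) (y k)))"
            using e[of 1] by (simp add: z sum_subtractf c of_nat_index)
          show "log 2 g2 \<le> (\<Sum>k<n. log 2 (W (x k) (b k) (y k) / d2 (q k) (x k) (y k)))"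
            using e[of 2] by (simp add: z sum_subtractf c of_nat_index)
          show "log 2 g3 \<le> (\<Sum>k<n. log 2 (W (x k) (b k) (y k) / d3 (q k) (y k)))"
            using e[of 3] by (simp add: z sum_subtractf c of_nat_index)
        qed
        have nth: "?q as ! k = q k" "?x as ! k = x k" "?z as ! k = b k" "?y as ! k = y k" if "k < n" for k
          using that len by (simp_all add: q_def x_def b_def y_def)
        have wk: "w (?x as) (?z as) (?y as) = (\<Prod>k<n. W (x k) (b k) (y k))"
          unfolding wdef by (intro prod.cong refl) (simp only: nth lessThan_iff)
        have dn: "(\<Prod>k<n. d1 (?q as ! k) (?z as ! k) (?y as ! k)) = (\<Prod>k<n. d1 (q k) (b k) (y k))"
          "(\<Prod>k<n. d2 (?q as ! k) (?x as ! k) (?y as ! k)) = (\<Prod>k<n. d2 (q k) (x k) (y k))"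
          "(\<Prod>k<n. d3 (?q as ! k) (?y as ! k)) = (\<Prod>k<n. d3 (q k) (y k))"
          by (intro prod.cong refl; simp only: nth lessThan_iff)+
        have "T (?q as) (?x as) (?z as) (?y as)"
          unfolding T_def D1 D2 D3 wk dn
          using key[of "\<lambda>k. d1 (q k) (b k) (y k)" g1, OF dpos(1) g(1) inf(1)]
            key[of "\<lambda>k. d2 (q k) (x k) (y k)" g2, OF dpos(2) g(2) inf(2)]
            key[of "\<lambda>k. d3 (q k) (y k)" g3, OF dpos(3) g(3) inf(3)] by blast
        then show ?thesis by simp
      qed
    qed
    also have "\<dots> \<le> (\<Sum>as\<in>words (Q \<times> UNIV \<times> UNIV \<times> UNIV) n. (\<Prod>k<n. ?J (as ! k)) * of_bool (T (?q as) (?x as) (?z as) (?y as)))"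
    proof (rule sum_mono2[OF finJ])
      have SJ: "S \<subseteq> Q \<times> UNIV \<times> UNIV \<times> UNIV" unfolding S jd by (rule Collect_subset)
      show "words S n \<subseteq> words (Q \<times> UNIV \<times> UNIV \<times> UNIV) n"
      proof (rule subsetI)
        fix xs assume xs: "xs \<in> words S n"
        have "set xs \<subseteq> Q \<times> UNIV \<times> UNIV \<times> UNIV" by (rule subset_trans[OF _ SJ]) (use xs in simp)
        then show "xs \<in> words (Q \<times> UNIV \<times> UNIV \<times> UNIV) n" using xs by (simp only: mem_Collect_eq)
      qed
      fix as assume "as \<in> words (Q \<times> UNIV \<times> UNIV \<times> UNIV) n - words S n"
      then have as: "set as \<subseteq> Q \<times> UNIV \<times> UNIV \<times> UNIV" "length as = n" by (simp_all only: Diff_iff mem_Collect_eq)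
      have "as ! k \<in> Q \<times> UNIV" if "k < n" for k using subsetD[OF as(1) nth_mem[of k as]] that as(2) by (simp add: mem_Times_iff)
      then show "0 \<le> (\<Prod>k<n. ?J (as ! k)) * of_bool (T (?q as) (?x as) (?z as) (?y as))"
        using J0 by (intro mult_nonneg_nonneg prod_nonneg) auto
    qed
    also have "\<dots> = (\<Sum>as\<in>words (Q \<times> UNIV \<times> UNIV \<times> UNIV) n.
       (\<lambda>qs xs zs ys. (\<Prod>k<n. pQ (qs ! k)) * (P1 qs xs * P2 qs zs * (w xs zs ys * of_bool (T qs xs zs ys)))) (?q as) (?x as) (?z as) (?y as))"
    proof (intro sum.cong refl)
      fix as assume "as \<in> words (Q \<times> (UNIV::'x1 set) \<times> (UNIV::'x2 set) \<times> (UNIV::'y set)) n"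
      then have len: "length as = n" by simp
      have "(\<Prod>k<n. ?J (as ! k)) = (\<Prod>k<n. pQ (?q as ! k) * p1 (?q as ! k) (?x as ! k) * p2 (?q as ! k) (?z as ! k) * W (?x as ! k) (?z as ! k) (?y as ! k))"
        by (intro prod.cong refl) (simp add: len joint_def case_prod_unfold)
      also have "\<dots> = (\<Prod>k<n. pQ (?q as ! k)) * (P1 (?q as) (?x as) * P2 (?q as) (?z as) * w (?x as) (?z as) (?y as))"
        unfolding P1_def P2_def wdef prod.distrib by (simp only: mult.assoc)
      finally show "(\<Prod>k<n. ?J (as ! k)) * of_bool (T (?q as) (?x as) (?z as) (?y as))
        = (\<lambda>qs xs zs ys. (\<Prod>k<n. pQ (qs ! k)) * (P1 qs xs * P2 qs zs * (w xs zs ys * of_bool (T qs xs zs ys)))) (?q as) (?x as) (?z as) (?y as)"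
        by (simp only: mult.assoc)
    qed
    also have "\<dots> = (\<Sum>qs\<in>words Q n. \<Sum>xs\<in>?A1. \<Sum>zs\<in>?A2. \<Sum>ys\<in>?B. (\<Prod>k<n. pQ (qs ! k)) * (P1 qs xs * P2 qs zs * (w xs zs ys * of_bool (T qs xs zs ys))))"
      by (rule sum_words_zip4)
    also have "\<dots> = (\<Sum>qs\<in>words Q n. (\<Prod>k<n. pQ (qs ! k)) * succ qs)"
      unfolding succ_def sum_distrib_left ..
    finally show ?thesis .
  qed
  \<comment> \<open>The average over time-sharing sequences is at least s, so some sequence reaches
    it; it is fixed, and the letters of the codewords are then independent with the laws p1 (qs ! k)
    and p2 (qs ! k).\<close>
  then have "\<exists>qs\<in>words Q n. s \<le> succ qs"
  proof (rule contrapos_pp)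
    assume "\<not> ?thesis"
    then have lt: "succ qs < s" if "qs \<in> words Q n" for qs using that by (auto simp: not_le)
    have tot: "(\<Sum>qs\<in>words Q n. \<Prod>k<n. pQ (qs ! k)) = 1" unfolding sum_words_prod[of "\<lambda>_. pQ"] by (simp add: pQs)
    have w0: "0 \<le> (\<Prod>k<n. pQ (qs ! k))" if "qs \<in> words Q n" for qs
      using that pQ0 by (intro prod_nonneg) (auto simp: subset_iff)
    obtain qs where qs: "qs \<in> words Q n" "(\<Prod>k<n. pQ (qs ! k)) \<noteq> 0" using tot by (metis (no_types, lifting) sum.neutral zero_neq_one)
    have "(\<Sum>qs\<in>words Q n. (\<Prod>k<n. pQ (qs ! k)) * succ qs) < (\<Sum>qs\<in>words Q n. (\<Prod>k<n. pQ (qs ! k)) * s)"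
    proof (rule sum_strict_mono_ex1[OF fin[OF finQ]])
      show "\<forall>qs\<in>words Q n. (\<Prod>k<n. pQ (qs ! k)) * succ qs \<le> (\<Prod>k<n. pQ (qs ! k)) * s"
        using lt w0 by (intro ballI mult_left_mono) (auto intro: less_imp_le)
      have "0 < (\<Prod>k<n. pQ (qs ! k))" using w0[OF qs(1)] qs(2) by (metis less_le)
      then show "\<exists>qs\<in>words Q n. (\<Prod>k<n. pQ (qs ! k)) * succ qs < (\<Prod>k<n. pQ (qs ! k)) * s"
        using lt[OF qs(1)] qs(1) by (intro bexI[of _ qs] mult_strict_left_mono)
    qed
    then show "\<not> s \<le> (\<Sum>qs\<in>words Q n. (\<Prod>k<n. pQ (qs ! k)) * succ qs)" by (simp only: sum_distrib_right[symmetric] tot not_le mult_1)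
  qed
  then obtain qs where qs: "qs \<in> words Q n" "s \<le> succ qs" by blast
  have qk: "qs ! k \<in> Q" if "k < n" for k using qs(1) that by (auto simp: subset_iff)
  have ms: "0 < msg_size n R" for R unfolding msg_size_def by simp
  have card: "card (msg_set n R) = msg_size n R" for R by (simp add: msg_set_def)
  have finM: "finite (msg_set n R)" "msg_set n R \<noteq> {}" for R using ms[of R] by (auto simp: msg_set_def)
  have P1p: "0 \<le> P1 qs xs" "0 \<le> P2 qs zs" for xs zs unfolding P1_def P2_def using qk by (auto intro!: prod_nonneg p10 p20)
  have P1s: "(\<Sum>xs\<in>?A1. P1 qs xs) = 1" unfolding P1_def sum_words_prod[of "\<lambda>k. p1 (qs ! k)"] by (intro prod.neutral) (simp add: ps qk)
  have P2s: "(\<Sum>xs\<in>?A2. P2 qs xs) = 1" unfolding P2_def sum_words_prod[of "\<lambda>k. p2 (qs ! k)"] by (intro prod.neutral) (simp add: ps qk)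
  have ws: "(\<Sum>ys\<in>?B. w xs zs ys) = 1" for xs zs unfolding wdef sum_words_prod[of "\<lambda>k. W (xs ! k) (zs ! k)"] by (simp add: Ws)
  have w0: "0 \<le> w xs zs ys" for xs zs ys unfolding wdef by (intro prod_nonneg) (simp add: W0)
  obtain f1 f2 dec where f: "f1 \<in> msg_set n R1 \<rightarrow>\<^sub>E ?A1" "f2 \<in> msg_set n R2 \<rightarrow>\<^sub>E ?A2" and dec: "\<And>y. dec y \<in> msg_set n R1 \<times> msg_set n R2"
    and perf: "card (msg_set n R1) * card (msg_set n R2) * (s - (real (card (msg_set n R1)) - 1) / g1 - (real (card (msg_set n R2)) - 1) / g2
        - (real (card (msg_set n R1)) - 1) * (real (card (msg_set n R2)) - 1) / g3)
      \<le> (\<Sum>m1\<in>msg_set n R1. \<Sum>m2\<in>msg_set n R2. \<Sum>y\<in>?B. if dec y = (m1, m2) then w (f1 m1) (f2 m2) y else 0)"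
    by (rule random_coding_threshold[OF fin[OF finite] fin[OF finite] fin[OF finite] finM(1)[of R1] finM(1)[of R2] finM(2)[of R1] finM(2)[of R2] P1p(1) P1s P1p(2) P2s w0 ws g qs(2)[unfolded succ_def T_def]], rule that, assumption+)
  have B: "{ys :: 'y list. length ys = n} = ?B" by simp
  have "error_prob W n R1 R2 f1 f2 dec \<le> eps"
  proof -
    let ?E = "\<Sum>m1\<in>msg_set n R1. \<Sum>m2\<in>msg_set n R2. \<Sum>y\<in>?B. if dec y = (m1, m2) then w (f1 m1) (f2 m2) y else 0"
    have M0: "0 < M1 * M2" unfolding M using ms by simp
    have "M1 * M2 * (1 - eps) \<le> M1 * M2 * (s - (M1 - 1) / g1 - (M2 - 1) / g2 - (M1 - 1) * (M2 - 1) / g3)"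
      using M0 err unfolding s_def by (intro mult_left_mono) auto
    also have "\<dots> \<le> ?E" using perf unfolding card M by simp
    finally have "1 - eps \<le> ?E / (M1 * M2)" unfolding pos_le_divide_eq[OF M0] by (simp only: mult.commute)
    then show ?thesis unfolding error_prob_def B M w_def by simp
  qed
  then have "is_MAC_code W n R1 R2 eps f1 f2 dec"
    unfolding is_MAC_code_def using f dec by (auto simp: PiE_iff)
  then show ?thesis unfolding C_MAC_def by auto
qed

section \<open>Factorisation of the covariance and the Gaussian distribution function\<close>

lemma psd_factor2:
  fixes d e f :: real
  assumes psd: "\<And>y z. 0 \<le> d * y\<^sup>2 + 2 * e * y * z + f * z\<^sup>2"
  shows "\<exists>l m k. l * l = d \<and> l * m = e \<and> m * m + k * k = f"
proof (cases "d = 0")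
  case True
  have e0: "e = 0"
  proof (rule ccontr)
    assume "e \<noteq> 0"
    \<comment> \<open>At this point the form takes the value -1.\<close>
    then show False using psd[of "- (f + 1) / (2 * e)" 1] by (simp add: True)
  qed
  have "0 \<le> f" using psd[of 0 1] by simp
  then show ?thesis using True e0 by (intro exI[of _ 0] exI[of _ 0] exI[of _ "sqrt f"]) simp
next
  case False
  have d: "0 < d" using psd[of 1 0] False by simp
  have "0 \<le> d * (- e / d)\<^sup>2 + 2 * e * (- e / d) * 1 + f * 1\<^sup>2" by (rule psd)
  also have "\<dots> = f - e * e / d" using d by (simp add: power2_eq_square field_simps)
  finally have k: "0 \<le> f - e * e / d" .
  have "(e / sqrt d) * (e / sqrt d) = e * e / d" using d by simp
  then show ?thesis using d k by (intro exI[of _ "sqrt d"] exI[of _ "e / sqrt d"] exI[of _ "sqrt (f - e * e / d)"]) simp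
qed

text \<open>Cholesky factorisation with semidefinite pivots. It guarantees that the choice inside
  \<open>gauss_cdf\<close> really yields a factor of \<open>V\<close>.\<close>

lemma psd_factor3:
  fixes V :: "real^3^3"
  assumes sym: "\<And>i j. V $ i $ j = V $ j $ i" and psd: "\<And>x. 0 \<le> x \<bullet> (V *v x)"
  shows "\<exists>A :: real^3^3. A ** transpose A = V"
proof -
  define a b c d e f where "a = V$1$1" and "b = V$1$2" and "c = V$1$3" and "d = V$2$2" and "e = V$2$3" and "f = V$3$3"
  have V: "V$2$1 = b" "V$3$1 = c" "V$3$2 = e" using sym by (auto simp: b_def c_def e_def)
  have q: "0 \<le> a * x\<^sup>2 + 2 * b * x * y + 2 * c * x * z + d * y\<^sup>2 + 2 * e * y * z + f * z\<^sup>2" for x y z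
    using psd[of "vector [x, y, z]"] V
    by (simp add: inner_vec_def matrix_vector_mult_def sum_3 a_def[symmetric] b_def[symmetric] c_def[symmetric] d_def[symmetric] e_def[symmetric] f_def[symmetric] power2_eq_square algebra_simps)
  obtain l b' where lb: "l * l = a" "l * b' = b"
    using psd_factor2[of a b d] q[of _ _ 0] by (auto simp: power2_eq_square)
  obtain l' c' where lc: "l' * l' = a" "l' * c' = c"
    using psd_factor2[of a c f] q[of _ 0 _] by (auto simp: power2_eq_square)
  \<comment> \<open>For a zero pivot semidefiniteness forces b = c = 0, so the first column of the
    factor may be taken as zero.\<close>
  define b0 c0 where "b0 = (if l = 0 then 0 else b')" and "c0 = (if l = 0 then 0 else c / l)"
  have l: "l * l = a" "l * b0 = b" "l * c0 = c" using lb lc by (auto simp: b0_def c0_def)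
  have q2: "0 \<le> (d - b0 * b0) * y\<^sup>2 + 2 * (e - b0 * c0) * y * z + (f - c0 * c0) * z\<^sup>2" for y z
  proof (cases "l = 0")
    case True then show ?thesis using q[of 0 y z] by (simp add: b0_def c0_def)
  next
    case False
    \<comment> \<open>The minimiser of the form in its first variable; the minimum is the form of
      the Schur complement.\<close>
    define x where "x = - (b0 * y + c0 * z) / l"
    have lx: "l * x = - (b0 * y + c0 * z)" using False by (simp add: x_def)
    have "a * x\<^sup>2 + 2 * b * x * y + 2 * c * x * z = (l * x) * (l * x) + 2 * b0 * (l * x) * y + 2 * c0 * (l * x) * z"
      unfolding l[symmetric] by (simp add: power2_eq_square algebra_simps)
    also have "\<dots> = - (b0 * y + c0 * z) * (b0 * y + c0 * z)" unfolding lx by (simp add: algebra_simps)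
    finally show ?thesis using q[of x y z] by (simp add: power2_eq_square algebra_simps)
  qed
  obtain g m k where gmk: "g * g = d - b0 * b0" "g * m = e - b0 * c0" "m * m + k * k = f - c0 * c0"
    using psd_factor2[OF q2] by blast
  define A :: "real^3^3" where "A = vector [vector [l, 0, 0], vector [b0, g, 0], vector [c0, m, k]]"
  have "A ** transpose A = V"
    using gmk l V by (simp add: vec_eq_iff forall_3 matrix_matrix_mult_def transpose_def sum_3 A_def
      a_def[symmetric] b_def[symmetric] c_def[symmetric] d_def[symmetric] e_def[symmetric] f_def[symmetric] mult.commute)
  then show ?thesis by blast
qed

lemma gauss_orth_scale:
  fixes A :: "real^'n^'m"
  assumes s: "0 < s"
  shows "gauss_orth A s z = gauss_orth A 1 ((1 / s) *\<^sub>R z)"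
proof -
  have g: "gd s (s *\<^sub>R x) * s ^ CARD('n) = gd 1 x" for x :: "real^'n"
  proof -
    have "sqrt (2 * pi * s\<^sup>2) = sqrt (2 * pi) * s" using s by (simp add: real_sqrt_mult)
    then have c: "(1 / sqrt (2 * pi * s\<^sup>2)) ^ CARD('n) * s ^ CARD('n) = (1 / sqrt (2 * pi)) ^ CARD('n)"
      using s by (simp add: power_mult_distrib[symmetric])
    have e: "- ((s *\<^sub>R x) \<bullet> (s *\<^sub>R x)) / (2 * s\<^sup>2) = - (x \<bullet> x) / 2" using s by (simp add: power2_eq_square)
    have "gd s (s *\<^sub>R x) * s ^ CARD('n) = ((1 / sqrt (2 * pi * s\<^sup>2)) ^ CARD('n) * s ^ CARD('n)) * exp (- ((s *\<^sub>R x) \<bullet> (s *\<^sub>R x)) / (2 * s\<^sup>2))"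
      unfolding gd_eq by (simp only: mult_ac)
    then show ?thesis unfolding c e by (simp add: gd_eq)
  qed
  have n: "nonneg_ind (z - A *v (s *\<^sub>R x)) = nonneg_ind ((1 / s) *\<^sub>R z - A *v x)" for x
  proof -
    have "0 \<le> z $ i - s * (A *v x) $ i \<longleftrightarrow> 0 \<le> z $ i / s - (A *v x) $ i" for i using s by (simp add: field_simps)
    then show ?thesis unfolding nonneg_ind_def by (simp add: matrix_vector_mult_scaleR)
  qed
  have "ennreal (gauss_orth A s z) = (\<integral>\<^sup>+y. ennreal (gd s y * nonneg_ind (z - A *v y)) \<partial>lborel)" by (rule gauss_orth_nn[OF s])
  also have "\<dots> = (\<integral>\<^sup>+y. ennreal (gd s y * nonneg_ind (z - A *v y)) \<partial>density (distr lborel borel (\<lambda>x. 0 + s *\<^sub>R x)) (\<lambda>_. \<bar>s\<bar> ^ DIM(real^'n)))"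
    using s by (subst lborel_affine[of s 0]) auto
  also have "\<dots> = (\<integral>\<^sup>+x. ennreal (s ^ CARD('n)) * ennreal (gd s (s *\<^sub>R x) * nonneg_ind (z - A *v (s *\<^sub>R x))) \<partial>lborel)"
    using s by (subst nn_integral_density, simp, simp, subst nn_integral_distr) auto
  also have "\<dots> = (\<integral>\<^sup>+x. ennreal (gd 1 x * nonneg_ind ((1 / s) *\<^sub>R z - A *v x)) \<partial>lborel)"
    using s by (intro nn_integral_cong) (simp add: n g[symmetric] ennreal_mult[symmetric] mult_ac)
  also have "\<dots> = ennreal (gauss_orth A 1 ((1 / s) *\<^sub>R z))" by (rule gauss_orth_nn[symmetric]) simp
  finally show ?thesis using gauss_orth_bounds(1)[OF s] gauss_orth_bounds(1)[of 1 A] by (subst (asm) ennreal_inj) auto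
qed

text \<open>Stated for the very factor that \<open>gauss_cdf\<close> chooses; the coding argument is
  run with the same one.\<close>

lemma gauss_cdf_eq:
  assumes "A = (SOME A :: real^3^3. A ** transpose A = V)"
  shows "gauss_cdf V z = gauss_orth A 1 z"
proof -
  let ?B = "{g. \<forall>i. (A *v g) $ i \<le> z $ i}"
  have ind: "nonneg_ind (z - A *v y) = indicator ?B y" for y by (auto simp: nonneg_ind_def indicator_def)
  have "?B = (\<lambda>y. nonneg_ind (z - A *v y)) -` {1} \<inter> space borel" by (auto simp: nonneg_ind_def split: if_splits)
  also have "\<dots> \<in> sets borel" by measurable
  finally have B: "?B \<in> sets lborel" by simp
  have "emeasure std_normal3 ?B = (\<integral>\<^sup>+y. ennreal (gd 1 y) * indicator ?B y \<partial>lborel)"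
    unfolding std_normal3_def gd_def[symmetric] by (rule emeasure_density) (use B in auto)
  also have "\<dots> = ennreal (gauss_orth A 1 z)"
    by (subst gauss_orth_nn) (auto simp: ind ennreal_mult ennreal_indicator intro!: nn_integral_cong)
  finally show ?thesis unfolding gauss_cdf_def assms[symmetric] measure_def
    using gauss_orth_bounds(1)[of 1 A z] by simp
qed

text \<open>For a nonpositive rate the ceiling of 2 ^ (n R) is 1, and a single message is never
  decoded wrongly.\<close>

lemma trivial_code:
  fixes W :: "'x1::finite \<Rightarrow> 'x2::finite \<Rightarrow> 'y::finite \<Rightarrow> real"
  assumes W: "stochastic_MAC W" and R: "R1 \<le> 0" "R2 \<le> 0" and eps: "0 \<le> eps"
  shows "(R1, R2) \<in> C_MAC W n eps"
proof -
  have ms: "msg_size n R = 1" if "R \<le> 0" for R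
  proof -
    have "2 powr (real n * R) \<le> 2 powr 0" using that by (intro powr_mono) (auto simp: mult_nonneg_nonpos)
    moreover have "0 < 2 powr (real n * R)" by simp
    ultimately have "\<lceil>2 powr (real n * R)\<rceil> = 1" by (intro ceiling_unique) auto
    then show ?thesis by (simp add: msg_size_def)
  qed
  have set: "msg_set n R1 = {1}" "msg_set n R2 = {1}" unfolding msg_set_def ms[OF R(1)] ms[OF R(2)] by auto
  define f1 :: "nat \<Rightarrow> 'x1 list" where "f1 = (\<lambda>_. replicate n undefined)"
  define f2 :: "nat \<Rightarrow> 'x2 list" where "f2 = (\<lambda>_. replicate n undefined)"
  define dec :: "'y list \<Rightarrow> nat \<times> nat" where "dec = (\<lambda>_. (1, 1))"
  have "(\<Sum>ys\<in>{ys. length ys = n}. Wn W n (f1 1) (f2 1) ys) = (\<Sum>ys\<in>words UNIV n. \<Prod>k<n. W (f1 1 ! k) (f2 1 ! k) (ys ! k))"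
    by (simp add: Wn_def)
  also have "\<dots> = 1" unfolding sum_words_prod[of "\<lambda>k. W (f1 1 ! k) (f2 1 ! k)"] using W by (simp add: stochastic_MAC_def)
  finally have "error_prob W n R1 R2 f1 f2 dec = 0" unfolding error_prob_def set ms[OF R(1)] ms[OF R(2)] by (simp add: dec_def)
  then have "is_MAC_code W n R1 R2 eps f1 f2 dec" unfolding is_MAC_code_def set using eps by (simp add: f1_def f2_def dec_def)
  then show ?thesis unfolding C_MAC_def by auto
qed

lemma joint_sum:
  fixes W :: "'x1::finite \<Rightarrow> 'x2::finite \<Rightarrow> 'y::finite \<Rightarrow> real"
  assumes W: "stochastic_MAC W" and v: "valid_input Q pQ p1 p2"
  shows "(\<Sum>i\<in>jdom Q. joint W pQ p1 p2 i) = 1"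
proof -
  have Ws: "(\<Sum>y\<in>UNIV. W a b y) = 1" for a b using W by (simp add: stochastic_MAC_def)
  have ps: "(\<Sum>a\<in>UNIV. p1 q a) = 1" "(\<Sum>b\<in>UNIV. p2 q b) = 1" if "q \<in> Q" for q using v that by (auto simp: valid_input_def)
  have "(\<Sum>i\<in>jdom Q. joint W pQ p1 p2 i) = (\<Sum>q\<in>Q. \<Sum>a\<in>UNIV. \<Sum>b\<in>UNIV. \<Sum>y\<in>UNIV. pQ q * p1 q a * p2 q b * W a b y)"
    unfolding jdom_def joint_def by (simp add: sum.cartesian_product case_prod_unfold)
  also have "\<dots> = (\<Sum>q\<in>Q. pQ q)" by (intro sum.cong refl) (simp add: sum_distrib_left[symmetric] Ws ps)
  finally show ?thesis using v by (simp add: valid_input_def)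
qed

text \<open>Averages of \<open>W\<close> over the inputs stay in [w, 1], so all three ratios lie
  between w and 1 / w.\<close>

lemma info_density_bound:
  fixes W :: "'x1::finite \<Rightarrow> 'x2::finite \<Rightarrow> 'y::finite \<Rightarrow> real"
  assumes W: "stochastic_MAC W" and v: "valid_input Q pQ p1 p2" and q: "q \<in> Q"
    and w: "0 < w" "\<And>a b. w \<le> W a b y"
  shows "\<bar>info_density W p1 p2 (q, x1, x2, y) $ t\<bar> \<le> log 2 (1 / w)"
proof -
  have W1: "W a b y \<le> 1" for a b
  proof -
    have "W a b y \<le> (\<Sum>y\<in>UNIV. W a b y)" by (rule member_le_sum) (use W in \<open>auto simp: stochastic_MAC_def\<close>)
    then show ?thesis using W by (simp add: stochastic_MAC_def)
  qed
  have p: "0 \<le> p1 q a" "0 \<le> p2 q b" "(\<Sum>a\<in>UNIV. p1 q a) = 1" "(\<Sum>b\<in>UNIV. p2 q b) = 1" for a b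
    using v q by (auto simp: valid_input_def)
  have avg1: "w \<le> (\<Sum>a\<in>UNIV. p1 q a * f a) \<and> (\<Sum>a\<in>UNIV. p1 q a * f a) \<le> 1" if "\<And>a. w \<le> f a \<and> f a \<le> 1" for f
  proof -
    have "(\<Sum>a\<in>UNIV. p1 q a * w) \<le> (\<Sum>a\<in>UNIV. p1 q a * f a)" "(\<Sum>a\<in>UNIV. p1 q a * f a) \<le> (\<Sum>a\<in>UNIV. p1 q a * 1)"
      using that p by (auto intro!: sum_mono mult_left_mono simp del: mult_1_right)
    then show ?thesis by (simp add: sum_distrib_right[symmetric] p)
  qed
  have avg2: "w \<le> (\<Sum>a\<in>UNIV. p2 q a * f a) \<and> (\<Sum>a\<in>UNIV. p2 q a * f a) \<le> 1" if "\<And>a. w \<le> f a \<and> f a \<le> 1" for f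
  proof -
    have "(\<Sum>a\<in>UNIV. p2 q a * w) \<le> (\<Sum>a\<in>UNIV. p2 q a * f a)" "(\<Sum>a\<in>UNIV. p2 q a * f a) \<le> (\<Sum>a\<in>UNIV. p2 q a * 1)"
      using that p by (auto intro!: sum_mono mult_left_mono simp del: mult_1_right)
    then show ?thesis by (simp add: sum_distrib_right[symmetric] p)
  qed
  have Wb: "w \<le> W a b y \<and> W a b y \<le> 1" for a b using w W1 by blast
  have l: "\<bar>log 2 (W x1 x2 y / e)\<bar> \<le> log 2 (1 / w)" if e: "w \<le> e \<and> e \<le> 1" for e
  proof -
    have e0: "0 < e" "0 < W x1 x2 y" using e w(1) Wb[of x1 x2] by auto
    have "W x1 x2 y / e \<le> 1 / w" using e e0 w(1) Wb[of x1 x2] by (intro frac_le) auto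
    then have 1: "log 2 (W x1 x2 y / e) \<le> log 2 (1 / w)" using e0 w(1) by (subst log_le_cancel_iff) auto
    have "w / 1 \<le> W x1 x2 y / e" using e e0 w(1) Wb[of x1 x2] by (intro frac_le) auto
    then have "log 2 w \<le> log 2 (W x1 x2 y / e)" using e0 w(1) by (subst log_le_cancel_iff) auto
    then have 2: "- log 2 (W x1 x2 y / e) \<le> log 2 (1 / w)" using w(1) by (simp add: log_divide)
    show ?thesis using 1 2 by (simp add: abs_le_iff)
  qed
  have eq: "(\<Sum>a\<in>UNIV. \<Sum>b\<in>UNIV. p1 q a * p2 q b * W a b y) = (\<Sum>a\<in>UNIV. p1 q a * (\<Sum>b\<in>UNIV. p2 q b * W a b y))"
    by (simp add: sum_distrib_left mult.assoc)
  have "\<forall>t. \<bar>info_density W p1 p2 (q, x1, x2, y) $ t\<bar> \<le> log 2 (1 / w)"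
    unfolding forall_3 info_density_def Let_def prod.case vector_3 eq
    by (intro conjI l avg1 avg2 Wb)
  then show ?thesis by blast
qed

section \<open>Uniformity in the input distributions\<close>

lemma region_subset_C_MAC:
  fixes W :: "'x1::finite \<Rightarrow> 'x2::finite \<Rightarrow> 'y::finite \<Rightarrow> real"
  assumes W: "stochastic_MAC W" and eps: "0 < eps" "eps < 1"
  shows "\<exists>N. \<forall>n\<ge>N. \<forall>Q pQ (p1 :: nat \<Rightarrow> 'x1 \<Rightarrow> real) (p2 :: nat \<Rightarrow> 'x2 \<Rightarrow> real).
            valid_input Q pQ p1 p2 \<and> rank (Vmat W Q pQ p1 p2) \<ge> 1 \<longrightarrow>
            region W n eps Q pQ p1 p2 \<subseteq> C_MAC W n eps"
proof -
  have W0: "0 \<le> W a b y" for a b y using W by (simp add: stochastic_MAC_def)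
  have W1: "W a b y \<le> 1" for a b y
  proof -
    have "W a b y \<le> (\<Sum>y\<in>UNIV. W a b y)" by (rule member_le_sum) (use W0 in auto)
    then show ?thesis using W by (simp add: stochastic_MAC_def)
  qed
  \<comment> \<open>The smallest positive transition probability; inserting 1 keeps the set nonempty
    and gives w \<le> 1.\<close>
  define w where "w = Min (insert 1 ((\<lambda>(a, b, y). W a b y) ` {(a, b, y). W a b y \<noteq> 0}))"
  have fin: "finite (insert 1 ((\<lambda>(a, b, y). W a b y) ` {(a, b, y). W a b y \<noteq> 0}))" by simp
  have w0: "0 < w" unfolding w_def using fin by (subst Min_gr_iff) (use W0 in \<open>auto simp: less_le\<close>)
  have wle: "w \<le> W a b y" if "W a b y \<noteq> 0" for a b y unfolding w_def by (rule Min_le[OF fin]) (use that in force)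
  have w1: "w \<le> 1" unfolding w_def by (rule Min_le[OF fin]) simp
  define C where "C = log 2 (1 / w)"
  have C0: "0 \<le> C" unfolding C_def using w0 w1 by simp
  \<comment> \<open>The centred information density is at most 2 C in modulus, which bounds the row
    norms of the factor; the added 1 keeps \<sigma> positive.\<close>
  define \<sigma> where "\<sigma> = 2 * C + 1"
  have \<sigma>: "1 \<le> \<sigma>" unfolding \<sigma>_def using C0 by simp
  define \<kappa>0 where "\<kappa>0 = w / (2 * ln 2)"
  have \<kappa>0: "0 < \<kappa>0" unfolding \<kappa>0_def using w0 by simp
  \<comment> \<open>Anti-concentration is applied to orthants of measure between 1 - eps and 1 - eps
    / 2.\<close>
  define \<eta> where "\<eta> = min (1 - eps) (eps / 2)"
  have \<eta>: "0 < \<eta>" unfolding \<eta>_def using eps by simp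
  obtain c where c: "0 < c" and G: "\<forall>(A::real^3^3) z \<sigma> t. 0 < \<sigma> \<longrightarrow> (\<forall>i. norm (A $ i) \<le> \<sigma>) \<longrightarrow> 0 \<le> t \<longrightarrow>
    \<eta> \<le> gauss_orth A 1 z \<longrightarrow> gauss_orth A 1 z \<le> 1 - \<eta> \<longrightarrow>
    gauss_orth A 1 z + c * min (t / \<sigma>) 1 \<le> gauss_orth A 1 (z + (\<chi> i. t))"
    using gauss_orth_gain[OF \<eta>, where 'n=3 and 'm=3] by (elim exE conjE)
  have gain: "gauss_orth A 1 z + c * min (t / \<sigma>) 1 \<le> gauss_orth A 1 (z + (\<chi> i. t))"
    if "\<And>i. norm (A $ i) \<le> \<sigma>" "0 \<le> t" "\<eta> \<le> gauss_orth A 1 z" "gauss_orth A 1 z \<le> 1 - \<eta>" for A :: "real^3^3" and z t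
    by (rule G[rule_format]) (use that \<sigma> in auto)
  obtain M where M: "0 < M" and BE: "\<forall>(I::(nat \<times> 'x1 \<times> 'x2 \<times> 'y) set) p (X :: _ \<Rightarrow> real^3) (A::real^3^3) \<gamma> k z.
     finite I \<longrightarrow> (\<forall>a\<in>I. 0 < p a) \<longrightarrow> (\<Sum>a\<in>I. p a) = 1 \<longrightarrow> (\<Sum>a\<in>I. p a *\<^sub>R X a) = 0 \<longrightarrow>
     (\<forall>s t. (A ** transpose A) $ s $ t = (\<Sum>a\<in>I. p a * X a $ s * X a $ t)) \<longrightarrow>
     1 \<le> \<gamma> \<longrightarrow> (\<forall>a\<in>I. 1 / p a \<le> \<gamma>\<^sup>2) \<longrightarrow> 1 \<le> k \<longrightarrow>
     \<bar>sum_cdf I p X k z - gauss_orth A (sqrt (real k)) z\<bar> \<le> M * \<gamma> / sqrt (real k)"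
    using berry_esseen_sum_cdf[where 'i="nat \<times> 'x1 \<times> 'x2 \<times> 'y" and 'm=3 and 'n=3] by (elim exE conjE)
  note be = BE[rule_format]
  \<comment> \<open>The complement of the ball of radius \<rho> has measure below 1 - eps, so an
    orthant of measure at least 1 - eps meets the ball.\<close>
  define \<rho> where "\<rho> = 1 + gdK TYPE(3) / (1 - eps)"
  have \<rho>1: "1 \<le> \<rho>" unfolding \<rho>_def using eps gdK_pos[where 'n=3] by (simp add: less_imp_le)
  have \<rho>: "gdK TYPE(3) / \<rho> ^ 4 < 1 - eps"
  proof -
    have "gdK TYPE(3) / (1 - eps) < \<rho>" unfolding \<rho>_def by simp
    also have "\<rho> \<le> \<rho> ^ 4" using \<rho>1 power_increasing[of 1 4 \<rho>] by simp
    finally show ?thesis using eps \<rho>1 by (simp add: field_simps)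
  qed
  \<comment> \<open>An upper bound for I - z / sqrt n in every component, over all admissible
    z.\<close>
  define CA where "CA = C + \<sigma> * \<rho>"
  have CA: "0 < CA" unfolding CA_def using C0 \<sigma> \<rho>1 by (intro add_nonneg_pos) auto
  define c1 where "c1 = min 1 (\<kappa>0 * w)"
  have c1: "0 < c1" "c1 \<le> 1" "c1 \<le> \<kappa>0 * w" unfolding c1_def using \<kappa>0 w0 by auto
  define c' where "c' = min c (eps / 2)"
  have c': "0 < c'" "c' \<le> c" "c' \<le> eps / 2" unfolding c'_def using c eps by auto
  \<comment> \<open>With L = log 2 n, one summand for each of three demands: L \<ge> 1, the gain
    from the shift exceeds the loss (M + 3) u, and the loss is at most c'.\<close>
  define \<Lambda> where "\<Lambda> = 1 + \<sigma> * (M + 3) / (c * c1) + (M + 3)\<^sup>2 * CA / (c1 * c'\<^sup>2)"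
  have \<Lambda>p: "0 \<le> \<sigma> * (M + 3) / (c * c1)" "0 \<le> (M + 3)\<^sup>2 * CA / (c1 * c'\<^sup>2)" using \<sigma> M c c1 CA by auto
  have "region W n eps Q pQ p1 p2 \<subseteq> C_MAC W n eps"
    if n: "nat \<lceil>2 powr \<Lambda>\<rceil> \<le> n" and v: "valid_input Q pQ p1 p2" and rk: "rank (Vmat W Q pQ p1 p2) \<ge> 1"
    for n Q pQ and p1 :: "nat \<Rightarrow> 'x1 \<Rightarrow> real" and p2 :: "nat \<Rightarrow> 'x2 \<Rightarrow> real"
  proof
    fix R assume R: "R \<in> region W n eps Q pQ p1 p2"
    let ?V = "Vmat W Q pQ p1 p2" and ?I = "Ivec W Q pQ p1 p2" and ?J = "joint W pQ p1 p2" and ?i = "info_density W p1 p2"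
    let ?\<nu> = "nu W Q pQ p1 p2" and ?k = "kappa W Q pQ p1 p2"
    define L where "L = log 2 n"
    have n2: "2 powr \<Lambda> \<le> n" using n by linarith
    have n0: "0 < real n" by (rule less_le_trans[OF _ n2]) simp
    have n1: "1 \<le> n" using n0 by simp
    have L: "\<Lambda> \<le> L" unfolding L_def using n2 n0 by (simp add: le_log_iff)
    have L1: "1 \<le> L" and L2: "\<sigma> * (M + 3) / (c * c1) \<le> L" and L3: "(M + 3)\<^sup>2 * CA / (c1 * c'\<^sup>2) \<le> L"
      using L \<Lambda>p unfolding \<Lambda>_def by linarith+
    have V0: "?V \<noteq> 0"
    proof
      assume "?V = 0"
      then show False using rk by (simp add: rank_0)
    qed
    have finQ: "finite Q" using v by (simp add: valid_input_def)
    obtain R1 R2 z where R12: "R = (R1, R2)" and ok: "kappa_ok W Q pQ p1 p2" and z: "z \<in> S_set ?V eps"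
      and eq: "vector [R1, R2, R1 + R2] = ?I - (1 / sqrt (real n)) *\<^sub>R z - (?\<nu> * log 2 (real n) / real n) *\<^sub>R (1 :: real^3)"
      using R unfolding region_def by (auto split: if_splits)
    note fs = full_support[OF W v V0 ok]
    define S where "S = {i \<in> jdom Q. 0 < ?J i}"
    have finJ: "finite (jdom Q :: (nat \<times> 'x1 \<times> 'x2 \<times> 'y) set)" by (rule finite_jdom[OF finQ])
    have finS: "finite S" unfolding S_def using finJ by simp
    have sumS: "(\<Sum>i\<in>S. ?J i *\<^sub>R f i) = (\<Sum>i\<in>jdom Q. ?J i *\<^sub>R f i)" for f :: "_ \<Rightarrow> 'v::real_vector"
      by (rule sum.mono_neutral_left[OF finJ]) (use joint_nonneg[OF W v] in \<open>force simp: S_def not_less intro: antisym\<close>)+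
    have sumS': "(\<Sum>i\<in>S. ?J i * f i) = (\<Sum>i\<in>jdom Q. ?J i * f i)" for f
      by (rule sum.mono_neutral_left[OF finJ]) (use joint_nonneg[OF W v] in \<open>force simp: S_def not_less intro: antisym\<close>)+
    have JS: "(\<Sum>i\<in>S. ?J i) = 1" using sumS'[of "\<lambda>_. 1"] joint_sum[OF W v] by simp
    define X where "X i = ?I - ?i i" for i
    have Xmean: "(\<Sum>i\<in>S. ?J i *\<^sub>R X i) = 0"
    proof -
      have "(\<Sum>i\<in>S. ?J i *\<^sub>R X i) = (\<Sum>i\<in>S. ?J i *\<^sub>R ?I) - (\<Sum>i\<in>S. ?J i *\<^sub>R ?i i)"
        unfolding X_def scaleR_diff_right sum_subtractf ..
      also have "(\<Sum>i\<in>S. ?J i *\<^sub>R ?I) = ?I" unfolding scaleR_left.sum[symmetric] JS by simp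
      also have "(\<Sum>i\<in>S. ?J i *\<^sub>R ?i i) = ?I" unfolding sumS Ivec_def ..
      finally show ?thesis by simp
    qed
    have XV: "?V $ s $ t = (\<Sum>i\<in>S. ?J i * X i $ s * X i $ t)" for s t
    proof -
      have "?V $ s $ t = (\<Sum>i\<in>jdom Q. ?J i * (X i $ s * X i $ t))"
        unfolding Vmat_def X_def by (simp add: algebra_simps)
      also have "\<dots> = (\<Sum>i\<in>S. ?J i * (X i $ s * X i $ t))" by (rule sumS'[symmetric])
      finally show ?thesis by (simp add: mult.assoc)
    qed
    define A where "A = (SOME A :: real^3^3. A ** transpose A = ?V)"
    have "\<exists>A :: real^3^3. A ** transpose A = ?V"
    proof (rule psd_factor3)
      show "?V $ i $ j = ?V $ j $ i" for i j unfolding XV by (simp add: mult_ac)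
      fix x :: "real^3"
      have "x \<bullet> (?V *v x) = (\<Sum>s\<in>UNIV. \<Sum>t\<in>UNIV. \<Sum>i\<in>S. ?J i * ((x $ s * X i $ s) * (x $ t * X i $ t)))"
        by (simp add: inner_vec_def matrix_vector_mult_def XV sum_distrib_left sum_distrib_right mult_ac)
      also have "\<dots> = (\<Sum>s\<in>UNIV. \<Sum>i\<in>S. \<Sum>t\<in>UNIV. ?J i * ((x $ s * X i $ s) * (x $ t * X i $ t)))"
        by (rule sum.cong[OF refl sum.swap])
      also have "\<dots> = (\<Sum>i\<in>S. \<Sum>s\<in>UNIV. \<Sum>t\<in>UNIV. ?J i * ((x $ s * X i $ s) * (x $ t * X i $ t)))" by (rule sum.swap)
      also have "\<dots> = (\<Sum>i\<in>S. ?J i * (x \<bullet> X i)\<^sup>2)"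
      proof (intro sum.cong refl)
        fix i
        have "(x \<bullet> X i)\<^sup>2 = (\<Sum>s\<in>UNIV. \<Sum>t\<in>UNIV. (x $ s * X i $ s) * (x $ t * X i $ t))"
          unfolding power2_eq_square by (simp only: inner_vec_def inner_real_def sum_product)
        then show "(\<Sum>s\<in>UNIV. \<Sum>t\<in>UNIV. ?J i * ((x $ s * X i $ s) * (x $ t * X i $ t))) = ?J i * (x \<bullet> X i)\<^sup>2"
          by (simp only: sum_distrib_left)
      qed
      finally show "0 \<le> x \<bullet> (?V *v x)" by (auto intro!: sum_nonneg simp: S_def)
    qed
    then have A: "A ** transpose A = ?V" unfolding A_def by (rule someI_ex)
    \<comment> \<open>By full support the set of possible outputs is the same for all inputs, so w
      bounds \<open>W\<close> below at this y uniformly in the inputs.\<close>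
    have ib: "\<bar>?i i $ t\<bar> \<le> C" if i: "i \<in> S" for i t
    proof -
      obtain q a b y where iq: "i = (q, a, b, y)" by (cases i) auto
      have q: "q \<in> Q" and nz: "W a b y \<noteq> 0" using i by (auto simp: S_def iq jdom_def joint_simp)
      have "w \<le> W a' b' y" for a' b' using fs(4)[OF q nz, of a' b'] by (intro wle) simp
      then show ?thesis unfolding C_def iq by (rule info_density_bound[OF W v q w0])
    qed
    have avg: "\<bar>\<Sum>i\<in>S. ?J i * f i\<bar> \<le> K" if "\<And>i. i \<in> S \<Longrightarrow> \<bar>f i\<bar> \<le> K" for f K
    proof -
      have "\<bar>\<Sum>i\<in>S. ?J i * f i\<bar> \<le> (\<Sum>i\<in>S. ?J i * K)"
        by (rule order_trans[OF sum_abs]) (use that in \<open>auto intro!: sum_mono mult_left_mono simp: abs_mult S_def\<close>)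
      also have "\<dots> = K" unfolding sum_distrib_right[symmetric] JS by simp
      finally show ?thesis .
    qed
    have Ib: "\<bar>?I $ t\<bar> \<le> C" for t
    proof -
      have "?I $ t = (\<Sum>i\<in>S. ?J i * ?i i $ t)" unfolding Ivec_def sumS' by simp
      then show ?thesis using avg[of "\<lambda>i. ?i i $ t" C] ib by simp
    qed
    \<comment> \<open>The norm of a row is the standard deviation of that component.\<close>
    have An: "norm (A $ t) \<le> \<sigma>" for t
    proof -
      have "(norm (A $ t))\<^sup>2 = (A ** transpose A) $ t $ t"
        by (simp add: power2_norm_eq_inner inner_vec_def matrix_matrix_mult_def transpose_def)
      also have "\<dots> = (\<Sum>i\<in>S. ?J i * (X i $ t)\<^sup>2)" unfolding A XV by (simp add: power2_eq_square mult.assoc)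
      also have "\<dots> \<le> (2 * C)\<^sup>2"
      proof -
        have "\<bar>(X i $ t)\<^sup>2\<bar> \<le> (2 * C)\<^sup>2" if "i \<in> S" for i
        proof -
          have "\<bar>X i $ t\<bar> \<le> 2 * C" using Ib[of t] ib[OF that, of t] by (simp add: X_def)
          then show ?thesis using power_mono[OF _ abs_ge_zero, of "X i $ t" "2 * C" 2] by simp
        qed
        from avg[OF this] show ?thesis by (simp add: abs_le_iff)
      qed
      also have "\<dots> \<le> \<sigma>\<^sup>2" using C0 by (intro power_mono) (auto simp: \<sigma>_def)
      finally show ?thesis by (rule power2_le_imp_le) (use \<sigma> in simp)
    qed
    have kge: "\<kappa>0 / (pQ q * p1 q a * p2 q b) \<le> ?k" if "q \<in> Q" for q a b
      unfolding \<kappa>0_def by (rule kappa_ge[OF W v V0 ok w0 wle that])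
    obtain q0 where q0: "q0 \<in> Q" using v by (auto simp: valid_input_def)
    have k0: "0 \<le> ?k" using kge[OF q0, of undefined undefined] \<kappa>0 fs(1-3)[OF q0] by (meson divide_nonneg_nonneg less_imp_le mult_nonneg_nonneg order_trans)
    \<comment> \<open>By \<open>kappa_ge\<close> and the bound w on transitions this dominates 1 / p
      on the support, so it is the parameter of the Berry--Esseen bound; the added 1 gives \<gamma>
      \<ge> 1.\<close>
    define \<gamma> where "\<gamma> = sqrt (1 + ?k / (\<kappa>0 * w))"
    have \<gamma>2: "\<gamma>\<^sup>2 = 1 + ?k / (\<kappa>0 * w)" unfolding \<gamma>_def using k0 \<kappa>0 w0 by simp
    have \<gamma>1: "1 \<le> \<gamma>" unfolding \<gamma>_def using k0 \<kappa>0 w0 by simp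
    have pmin: "1 / ?J i \<le> \<gamma>\<^sup>2" if i: "i \<in> S" for i
    proof -
      obtain q a b y where iq: "i = (q, a, b, y)" by (cases i) auto
      have q: "q \<in> Q" and nz: "W a b y \<noteq> 0" using i by (auto simp: S_def iq jdom_def joint_simp)
      define m where "m = pQ q * p1 q a * p2 q b"
      have m: "0 < m" unfolding m_def using fs(1-3)[OF q] by simp
      have "m * w \<le> m * W a b y" using m wle[OF nz] by simp
      then have "1 / ?J i \<le> 1 / (m * w)" unfolding iq joint_simp m_def[symmetric] using m w0 by (intro divide_left_mono) (auto intro: mult_pos_pos less_le_trans)
      also have "\<dots> = (\<kappa>0 / m) / (\<kappa>0 * w)" using \<kappa>0 by simp
      also have "\<dots> \<le> ?k / (\<kappa>0 * w)" using kge[OF q, of a b] \<kappa>0 w0 unfolding m_def by (intro divide_right_mono) auto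
      finally show ?thesis unfolding \<gamma>2 by simp
    qed
    \<comment> \<open>The product of the alphabet sizes is at least 1, which together with 3/2
      leaves more than kappa + 1 after one unit has been set aside for the decoding
      thresholds.\<close>
    have \<nu>1: "c1 * \<gamma>\<^sup>2 \<le> ?\<nu> - 1"
    proof -
      have "card Q \<noteq> 0" using finQ q0 by auto
      then have "0 < card Q * CARD('x1) * CARD('x2) * CARD('y)" by simp
      moreover have "1 \<le> real m" if "0 < m" for m using that by (cases m) auto
      ultimately have "1 \<le> real (card Q * CARD('x1) * CARD('x2) * CARD('y))" by blast
      then have "?k + 1 \<le> ?\<nu> - 1" unfolding nu_def by simp
      moreover have "c1 * (?k / (\<kappa>0 * w)) \<le> (\<kappa>0 * w) * (?k / (\<kappa>0 * w))" using c1 k0 \<kappa>0 w0 by (intro mult_right_mono) auto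
      moreover have "(\<kappa>0 * w) * (?k / (\<kappa>0 * w)) = ?k" using \<kappa>0 w0 by simp
      ultimately show ?thesis using c1 unfolding \<gamma>2 distrib_left by simp
    qed
    have \<nu>0: "0 < ?\<nu> - 1" by (rule less_le_trans[OF _ \<nu>1]) (use c1 \<gamma>1 in simp)
    have Gz: "1 - eps \<le> gauss_orth A 1 z" using z unfolding S_set_def gauss_cdf_eq[OF A_def] by simp
    define Rt where "Rt = (vector [R1, R2, R1 + R2] :: real^3)"
    have Rt: "Rt $ t = ?I $ t - z $ t / sqrt n - ?\<nu> * L / n" for t
      unfolding Rt_def eq L_def by simp
    have sn: "1 \<le> sqrt n" "0 < sqrt n" using n1 by auto
    have "(R1, R2) \<in> C_MAC W n eps"
    \<comment> \<open>Either the backoff exceeds everything the information vector can offer, or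
      \<gamma>^2 / n is at most a constant over log n.\<close>
    proof (cases "n * CA \<le> ?\<nu> * L")
      case True
      \<comment> \<open>With a smaller component the orthant would miss the ball of radius
        \<rho>.\<close>
      have zt: "- (\<sigma> * \<rho>) \<le> z $ t" for t
      proof (rule ccontr)
        assume lt: "\<not> ?thesis"
        have "gauss_orth A 1 z \<le> gdK TYPE(3) / \<rho> ^ 4" unfolding gauss_orth_def
        proof (rule gd_tail)
          fix y :: "real^3" assume y: "norm y \<le> \<rho> * 1"
          have "\<bar>(A *v y) $ t\<bar> \<le> norm (A $ t) * norm y" by (simp add: matrix_vector_mul_component Cauchy_Schwarz_ineq2)
          also have "\<dots> \<le> \<sigma> * \<rho>" using An[of t] y \<sigma> by (intro mult_mono) auto
          finally have "z $ t < (A *v y) $ t" using lt by (simp add: abs_le_iff)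
          then show "nonneg_ind (z - A *v y) = 0" unfolding nonneg_ind_def by (auto simp: not_le intro!: exI[of _ t])
        qed (use \<rho>1 in auto)
        then show False using Gz \<rho> by simp
      qed
      have "Rt $ t \<le> 0" for t
      proof -
        have "- z $ t / sqrt n \<le> \<sigma> * \<rho> / sqrt n" using zt[of t] sn by (intro divide_right_mono) auto
        also have "\<dots> \<le> \<sigma> * \<rho> / 1" using sn \<sigma> \<rho>1 by (intro divide_left_mono) auto
      also have "\<dots> = \<sigma> * \<rho>" by simp
        finally have "- z $ t / sqrt n \<le> \<sigma> * \<rho>" .
        moreover have "CA \<le> ?\<nu> * L / n" using True n0 by (simp add: field_simps)
        moreover have "?I $ t \<le> C" using Ib[of t] by (simp add: abs_le_iff)
        ultimately show ?thesis unfolding Rt CA_def by simp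
      qed
      from this[of 1] this[of 2] have "R1 \<le> 0" "R2 \<le> 0" by (simp_all add: Rt_def)
      then show ?thesis using eps by (intro trivial_code[OF W]) auto
    next
      case False
      \<comment> \<open>The extra factor n over the number of competitors makes each confusion term
        at most 1 / n; it costs log 2 n in the threshold, that is one unit of \<nu>.\<close>
      define g where "g t = 2 powr (n * Rt $ t) * n" for t
      have g0: "0 < g t" for t unfolding g_def using n0 by simp
      have lg: "log 2 (g t) = n * Rt $ t + L" for t unfolding g_def L_def using n0 by (simp add: log_mult)
      define zn where "zn = (\<chi> t. n * ?I $ t) - vector [log 2 (g 1), log 2 (g 2), log 2 (g 3)]"
      \<comment> \<open>What remains of the backoff after normalisation by sqrt n.\<close>
      define t0 where "t0 = (?\<nu> - 1) * L / sqrt n"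
      have zn: "(1 / sqrt n) *\<^sub>R zn = z + (\<chi> i. t0)"
      proof -
        have znt: "zn $ t = n * ?I $ t - log 2 (g t)" for t
          using exhaust_3[of t] by (auto simp: zn_def of_nat_index)
        have "zn $ t = sqrt n * z $ t + (?\<nu> - 1) * L" for t
        proof -
          have "n * (z $ t / sqrt n) = sqrt n * z $ t" by (metis n0 real_div_sqrt less_imp_le times_divide_eq_left times_divide_eq_right)
          moreover have "n * (?\<nu> * L / n) = ?\<nu> * L" using n0 by simp
          ultimately show ?thesis unfolding znt lg Rt by (simp add: algebra_simps)
        qed
        then show ?thesis using sn by (simp add: vec_eq_iff t0_def field_simps)
      qed
      define u where "u = \<gamma> / sqrt n"
      have u0: "0 \<le> u" unfolding u_def using \<gamma>1 by simp
      have cdf: "gauss_orth A 1 (z + (\<chi> i. t0)) - M * u \<le> sum_cdf S ?J X n zn"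
      proof -
        have "\<bar>sum_cdf S ?J X n zn - gauss_orth A (sqrt (real n)) zn\<bar> \<le> M * \<gamma> / sqrt (real n)"
          by (rule be[OF finS _ JS Xmean _ \<gamma>1 _ n1]) (use A XV pmin in \<open>auto simp: S_def\<close>)
        then show ?thesis unfolding gauss_orth_scale[OF sn(2)] zn u_def by (simp add: abs_le_iff)
      qed
      \<comment> \<open>\<open>M\<close> stands for the Berry--Esseen loss, 3 for the confusion
        terms since 1 / n \<le> u. Smallness of u^2 comes from the failure of the case condition,
        divided by L.\<close>
      have Mu: "(M + 3) * u \<le> c'"
      proof -
        have a: "c1 * \<gamma>\<^sup>2 * L \<le> n * CA"
        proof -
          have "c1 * \<gamma>\<^sup>2 * L \<le> ?\<nu> * L" using \<nu>1 L1 by (intro mult_right_mono) auto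
          then show ?thesis using False by simp
        qed
        have "u\<^sup>2 * (c1 * L) \<le> CA"
        proof -
          have "u\<^sup>2 * (c1 * L) = c1 * \<gamma>\<^sup>2 * L / n" unfolding u_def by (simp add: power_divide)
          also have "\<dots> \<le> n * CA / n" using a n0 by (intro divide_right_mono) auto
          finally show ?thesis using n0 by simp
        qed
        moreover have "(M + 3)\<^sup>2 * CA \<le> c'\<^sup>2 * (c1 * L)" using L3 c1 c' by (simp add: field_simps)
        ultimately have "(M + 3)\<^sup>2 * (u\<^sup>2 * (c1 * L)) \<le> c'\<^sup>2 * (c1 * L)"
          by (meson mult_left_mono order_trans zero_le_power2)
        then have "((M + 3) * u)\<^sup>2 * (c1 * L) \<le> c'\<^sup>2 * (c1 * L)" by (simp add: power_mult_distrib mult.assoc)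
        moreover have "0 < c1 * L" using c1 L1 by simp
        ultimately have "((M + 3) * u)\<^sup>2 \<le> c'\<^sup>2" by (rule mult_right_le_imp_le)
        then show ?thesis by (rule power2_le_imp_le) (use c' in simp)
      qed
      have t0: "0 \<le> t0" unfolding t0_def using \<nu>0 L1 by simp
      have ct: "(M + 3) * u \<le> c * (t0 / \<sigma>)"
      proof -
        \<comment> \<open>The loss is linear in \<gamma> while the shift controls \<gamma>^2; the
          factor L absorbs all constants.\<close>
        have "\<gamma> \<le> \<gamma>\<^sup>2" using \<gamma>1 by (simp add: power2_eq_square)
        then have "c1 * \<gamma> \<le> ?\<nu> - 1" using \<nu>1 c1 mult_left_mono[of \<gamma> "\<gamma>\<^sup>2" c1] by linarith
        then have "c1 * \<gamma> * L / sqrt n \<le> t0" unfolding t0_def using L1 sn by (intro divide_right_mono mult_right_mono) auto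
        then have t: "c1 * L * u \<le> t0" unfolding u_def by (simp add: mult_ac)
        have "\<sigma> * (M + 3) \<le> c * c1 * L" using L2 c c1 by (simp add: field_simps)
        then have "(\<sigma> * (M + 3)) * u \<le> (c * c1 * L) * u" using u0 by (rule mult_right_mono)
        also have "\<dots> \<le> c * t0" using t c mult_left_mono[OF t, of c] by (simp add: mult_ac)
        finally show ?thesis using \<sigma> by (simp add: field_simps)
      qed
      \<comment> \<open>If the orthant is already larger than 1 - eps / 2, the reserve eps / 2
        covers the loss; otherwise the shift gains enough, through \<open>Mu\<close> where the gain
        is saturated and through \<open>ct\<close> where it is linear.\<close>
      have main: "1 - eps + (M + 3) * u \<le> gauss_orth A 1 (z + (\<chi> i. t0))"
      proof (cases "gauss_orth A 1 z \<le> 1 - eps / 2")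
        case True
        have "gauss_orth A 1 z + c * min (t0 / \<sigma>) 1 \<le> gauss_orth A 1 (z + (\<chi> i. t0))"
          by (rule gain[OF An t0]) (use Gz True in \<open>auto simp: \<eta>_def\<close>)
        moreover have "(M + 3) * u \<le> c * min (t0 / \<sigma>) 1"
          using ct Mu c' by (auto simp: min_def)
        ultimately show ?thesis using Gz by linarith
      next
        case False
        have "gauss_orth A 1 z \<le> gauss_orth A 1 (z + (\<chi> i. t0))" by (rule gauss_orth_mono) (use t0 in auto)
        then show ?thesis using False Mu c' by linarith
      qed
      have nu3: "3 / n \<le> 3 * u"
      proof -
        have "1 / n \<le> 1 / sqrt n" using sn n0 real_div_sqrt[of n] mult_left_mono[OF sn(1), of "sqrt n"] by (intro divide_left_mono) auto
        also have "\<dots> \<le> u" unfolding u_def using \<gamma>1 sn by (intro divide_right_mono) auto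
        finally show ?thesis by simp
      qed
      \<comment> \<open>The ceiling adds less than 1, and competitors are one fewer than messages,
        so their number is at most 2 ^ (n R) exactly.\<close>
      have ms: "real (msg_size n R) - 1 \<le> 2 powr (n * R)" "0 \<le> real (msg_size n R) - 1" for R :: real
      proof -
        have "0 < 2 powr (real n * R)" by simp
        then have "1 \<le> nat \<lceil>2 powr (real n * R)\<rceil>" by linarith
        with \<open>0 < 2 powr (real n * R)\<close> show "real (msg_size n R) - 1 \<le> 2 powr (n * R)" "0 \<le> real (msg_size n R) - 1"
          unfolding msg_size_def by linarith+
      qed
      have Rc: "Rt $ 1 = R1" "Rt $ 2 = R2" "Rt $ 3 = R1 + R2" by (simp_all add: Rt_def)
      have frac: "x / (2 powr r * n) \<le> 1 / n" if "x \<le> 2 powr r" for x r :: real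
      proof -
        have "x / (2 powr r * n) \<le> 2 powr r / (2 powr r * n)" using that n0 by (intro divide_right_mono) auto
        then show ?thesis by simp
      qed
      have e1: "(real (msg_size n R1) - 1) / g 1 \<le> 1 / n" "(real (msg_size n R2) - 1) / g 2 \<le> 1 / n"
        using ms(1)[of R1] ms(1)[of R2] unfolding g_def Rc by (blast intro: frac)+
      have e3: "(real (msg_size n R1) - 1) * (real (msg_size n R2) - 1) / g 3 \<le> 1 / n"
      proof -
        have "(real (msg_size n R1) - 1) * (real (msg_size n R2) - 1) \<le> 2 powr (n * R1) * 2 powr (n * R2)"
          using ms by (intro mult_mono) auto
        also have "\<dots> = 2 powr (n * (R1 + R2))" by (simp add: powr_add[symmetric] distrib_left)
        finally show ?thesis unfolding g_def Rc by (rule frac)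
      qed
      show ?thesis
      proof (rule achievability[OF W v g0 g0 g0 S_def zn_def refl refl])
        have "1 - sum_cdf S ?J (\<lambda>i. ?I - ?i i) n zn \<le> eps - 3 * u"
          using main cdf unfolding X_def by (simp add: algebra_simps)
        moreover have "1 / n + 1 / n + 1 / n = 3 / n" by simp
        ultimately show "1 - sum_cdf S ?J (\<lambda>i. ?I - ?i i) n zn + (real (msg_size n R1) - 1) / g 1 + (real (msg_size n R2) - 1) / g 2
          + (real (msg_size n R1) - 1) * (real (msg_size n R2) - 1) / g 3 \<le> eps"
          using e1 e3 nu3 by linarith
      qed
    qed
    then show "R \<in> C_MAC W n eps" by (simp add: R12)
  qed
  then show ?thesis by blast
qed

section \<open>Cardinality of the time-sharing alphabet\<close>

text \<open>If DIM + 1 points with positive weights l were unavoidable, compare the barycentric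
  coordinates of x with l. The sets where the ratio of one vertex strictly dominates are open,
  disjoint, each contains its own vertex, and together they cover S: a contradiction to
  connectedness.\<close>

lemma Fenchel_Bunt:
  fixes S :: "'a::euclidean_space set"
  assumes S: "connected S" and p: "p \<in> convex hull S"
  shows "\<exists>T. finite T \<and> T \<subseteq> S \<and> card T \<le> DIM('a) \<and> p \<in> convex hull T"
proof (rule ccontr)
  assume neg: "\<not> ?thesis"
  have no: False if "finite T" "T \<subseteq> S" "card T \<le> DIM('a)" "p \<in> convex hull T" for T using neg that by blast
  obtain T where T: "finite T" "T \<subseteq> S" "card T \<le> DIM('a) + 1" "p \<in> convex hull T"
    using p unfolding caratheodory[of S] by blast
  have cT: "card T = DIM('a) + 1" using no[OF T(1,2) _ T(4)] T(3) by (cases "card T \<le> DIM('a)") auto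
  have ai: "\<not> affine_dependent T"
  proof
    assume "affine_dependent T"
    then have ad: "aff_dim T + 1 \<le> DIM('a)" using aff_dim_le_card[OF T(1)] affine_independent_iff_card[of T] T(1) cT by simp
    obtain T' where "finite T'" "T' \<subseteq> T" "card T' \<le> aff_dim T + 1" "p \<in> convex hull T'"
      using T(4) unfolding caratheodory_aff_dim[of T] by blast
    then show False using no[of T'] T(2) ad by auto
  qed
  obtain l where l0: "\<forall>v\<in>T. 0 \<le> l v" and l1: "sum l T = 1" and lp: "(\<Sum>v\<in>T. l v *\<^sub>R v) = p"
    using T(4) unfolding convex_hull_finite[OF T(1)] by blast
  \<comment> \<open>A vertex of weight zero could be dropped, leaving DIM points.\<close>
  have lpos: "0 < l v" if v: "v \<in> T" for v
  proof (rule ccontr)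
    assume "\<not> 0 < l v"
    then have z: "l v = 0" using l0 v by force
    have "p \<in> convex hull (T - {v})" unfolding convex_hull_finite[OF finite_Diff[OF T(1)]]
      using l0 l1 lp z by (auto intro!: exI[of _ l] simp: sum_diff1 T(1))
    then show False using no[of "T - {v}"] T v cT by (auto simp: card_Diff_singleton)
  qed
  \<comment> \<open>Lifting to height 1 turns affine into linear independence; the dual basis of the
    lifted points gives the barycentric coordinates \<open>b\<close>, defined on the whole
    space.\<close>
  let ?B = "(\<lambda>v. (v, 1 :: real)) ` T"
  have inj: "inj_on (\<lambda>v. (v, 1 :: real)) T" by (auto simp: inj_on_def)
  have fst_sum: "fst (sum f A) = (\<Sum>a\<in>A. fst (f a))" and snd_sum: "snd (sum f A) = (\<Sum>a\<in>A. snd (f a))"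
    for f :: "_ \<Rightarrow> 'a \<times> real" and A by (induction A rule: infinite_finite_induct) auto
  have ind: "independent ?B"
  proof (rule independent_if_scalars_zero)
    show "finite ?B" using T by simp
    fix f x assume s: "(\<Sum>x\<in>?B. f x *\<^sub>R x) = 0" and x: "x \<in> ?B"
    have s': "(\<Sum>v\<in>T. f (v, 1) *\<^sub>R (v, 1 :: real)) = 0" using s by (simp add: sum.reindex[OF inj])
    have "(\<Sum>v\<in>T. f (v, 1) *\<^sub>R v) = 0" using arg_cong[OF s', of fst] by (simp add: fst_sum)
    moreover have "(\<Sum>v\<in>T. f (v, 1)) = 0" using arg_cong[OF s', of snd] by (simp add: snd_sum)
    ultimately show "f x = 0" using ai x unfolding affine_dependent_explicit_finite[OF T(1)] by auto
  qed
  have span: "span ?B = UNIV"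
    using dim_eq_card_independent[OF ind] card_image[OF inj] cT by (simp add: dim_eq_full[symmetric])
  have "\<forall>v. \<exists>g. linear g \<and> (\<forall>x\<in>?B. g x = (if x = (v, 1) then 1 else 0 :: real))"
    by (intro allI linear_independent_extend[OF ind])
  from choice[OF this] obtain g where g': "\<forall>v. linear (g v) \<and> (\<forall>x\<in>?B. g v x = (if x = (v, 1) then 1 else 0 :: real))"
    by (elim exE)
  have g: "linear (g v)" "x \<in> ?B \<Longrightarrow> g v x = (if x = (v, 1) then 1 else 0 :: real)" for v x
    by (rule conjunct1[OF spec[OF g']]) (rule bspec[OF conjunct2[OF spec[OF g']]])
  define b where "b v x = g v (x, 1)" for v x
  have bT: "b v x = (if x = v then 1 else 0)" if "x \<in> T" for v x using g(2)[of "(x, 1)" v] that by (auto simp: b_def)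
  have rep: "(\<Sum>v\<in>T. b v x *\<^sub>R v) = x" "(\<Sum>v\<in>T. b v x) = 1" for x
  proof -
    have "(\<Sum>v\<in>T. g v y *\<^sub>R (v, 1 :: real)) = id y" for y
    proof (rule linear_eq_on_span[where B="?B" and f="\<lambda>y. \<Sum>v\<in>T. g v y *\<^sub>R (v, 1 :: real)" and g=id])
      show "linear (\<lambda>y. \<Sum>v\<in>T. g v y *\<^sub>R (v, 1 :: real))" 
        unfolding linear_iff by (simp add: linear_add[OF g(1)] linear_cmul[OF g(1)] scaleR_left_distrib sum.distrib scaleR_sum_right del: scaleR_Pair)
      show "(\<Sum>v\<in>T. g v y *\<^sub>R (v, 1 :: real)) = id y" if y: "y \<in> ?B" for y
      proof -
        obtain v0 where v0: "v0 \<in> T" "y = (v0, 1)" using y by auto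
        have "(\<Sum>v\<in>T. g v y *\<^sub>R (v, 1 :: real)) = (\<Sum>v\<in>T. if v = v0 then (v, 1) else 0)"
          by (rule sum.cong) (auto simp: g(2)[OF y, unfolded v0(2)] v0(2) zero_prod_def)
        then show ?thesis using v0 T(1) by (simp add: sum.delta')
      qed
    qed (use span linear_id in auto)
    from this[of "(x, 1)"] have e: "(\<Sum>v\<in>T. b v x *\<^sub>R (v, 1 :: real)) = (x, 1)" by (simp add: b_def)
    show "(\<Sum>v\<in>T. b v x *\<^sub>R v) = x" using arg_cong[OF e, of fst] by (simp add: fst_sum)
    show "(\<Sum>v\<in>T. b v x) = 1" using arg_cong[OF e, of snd] by (simp add: snd_sum)
  qed
  have bc: "continuous_on UNIV (b v)" for v
    unfolding b_def by (intro continuous_on_compose2[OF linear_continuous_on[OF linear_conv_bounded_linear[THEN iffD1, OF g(1)]]] continuous_intros) auto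
  define r where "r v x = b v x / l v" for v x
  have rc: "continuous_on UNIV (r v)" for v unfolding r_def divide_inverse by (intro continuous_intros bc)
  define U where "U v = {x. \<forall>w\<in>T - {v}. r w x < r v x}" for v
  have Uo: "open (U v)" for v
  proof -
    have "U v = (\<Inter>w\<in>T - {v}. {x. r w x < r v x})" by (auto simp: U_def)
    moreover have "open (\<Inter>w\<in>T - {v}. {x. r w x < r v x})"
      using T(1) by (intro open_INT ballI open_Collect_less rc) auto
    ultimately show ?thesis by simp
  qed
  have TU: "v \<in> U v" if v: "v \<in> T" for v using lpos v by (auto simp: U_def r_def bT)
  \<comment> \<open>Trading \<open>x\<close> against the vertices with the largest ratio removes all of these from the convex
    combination; two of them cannot go at once, as this would leave at most \<open>DIM('a)\<close> points.\<close>
  have cov: "\<exists>v\<in>T. x \<in> U v" if x: "x \<in> S" for x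
  proof (rule ccontr)
    assume nU: "\<not> ?thesis"
    have ne: "T \<noteq> {}" using cT by auto
    have "Max ((\<lambda>w. r w x) ` T) \<in> (\<lambda>w. r w x) ` T" by (rule Max_in) (use T(1) ne in auto)
    then obtain v where v: "v \<in> T" and mv: "r v x = Max ((\<lambda>w. r w x) ` T)" by auto
    have mx: "r w x \<le> r v x" if "w \<in> T" for w unfolding mv by (rule Max_ge) (use T(1) that in auto)
    obtain w where w: "w \<in> T" "w \<noteq> v" "r v x \<le> r w x" using nU v by (auto simp: U_def not_less)
    have rw: "r w x = r v x" using mx[OF w(1)] w(3) by simp
    \<comment> \<open>Barycentric coordinates sum to 1, so the largest ratio is positive.\<close>
    have rpos: "0 < r v x"
    proof (rule ccontr)
      assume "\<not> ?thesis"
      then have nr: "r v x \<le> 0" by simp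
      have "b u x \<le> 0" if u: "u \<in> T" for u
      proof -
        have "b u x = r u x * l u" using lpos[OF u] by (simp add: r_def)
        then show ?thesis using order_trans[OF mx[OF u] nr] lpos[OF u] by (simp add: mult_nonpos_nonneg)
      qed
      then have "(\<Sum>v\<in>T. b v x) \<le> 0" by (rule sum_nonpos)
      then show False using rep(2)[of x] by simp
    qed
    \<comment> \<open>The largest multiple of x that can be subtracted from p with the coefficients
      \<open>c\<close> remaining nonnegative; both maximal vertices reach 0 there.\<close>
    define t where "t = 1 / r v x"
    define c where "c u = l u - t * b u x" for u
    have c0: "0 \<le> c u" if "u \<in> T" for u
    proof -
      have "r u x * t \<le> 1" using mx[OF that] rpos by (simp add: t_def)
      then show ?thesis using lpos[OF that] by (simp add: c_def r_def field_simps)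
    qed
    have cz: "c v = 0" "c w = 0" using rpos rw lpos[OF v] lpos[OF w(1)]
      by (auto simp: c_def t_def) (simp_all add: r_def field_simps)
    define T' where "T' = T - {v, w}"
    have fT': "finite T'" using T(1) by (simp add: T'_def)
    have s: "(\<Sum>u\<in>T'. c u) = 1 - t" "(\<Sum>u\<in>T'. c u *\<^sub>R u) = p - t *\<^sub>R x"
    proof -
      have "(\<Sum>u\<in>T'. c u) = (\<Sum>u\<in>T. c u)" unfolding T'_def by (rule sum.mono_neutral_left) (use T cz in auto)
      then show "(\<Sum>u\<in>T'. c u) = 1 - t" by (simp add: c_def sum_subtractf l1 sum_distrib_left[symmetric] rep)
      have "(\<Sum>u\<in>T'. c u *\<^sub>R u) = (\<Sum>u\<in>T. c u *\<^sub>R u)" unfolding T'_def by (rule sum.mono_neutral_left) (use T cz in auto)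
      also have "\<dots> = p - t *\<^sub>R (\<Sum>u\<in>T. b u x *\<^sub>R u)"
        by (simp add: c_def sum_subtractf lp scaleR_diff_left scaleR_sum_right)
      finally show "(\<Sum>u\<in>T'. c u *\<^sub>R u) = p - t *\<^sub>R x" unfolding rep .
    qed
    have hull: "p \<in> convex hull (insert x T')"
    proof -
      let ?H = "convex hull (insert x T')"
      have t0: "0 \<le> t" using rpos by (simp add: t_def)
      \<comment> \<open>The tagged index set keeps x apart from the vertices, so that no case
        distinction on x being one of them arises.\<close>
      have "(\<Sum>u\<in>Inl ` {()} \<union> Inr ` T'. (case u of Inl _ \<Rightarrow> t | Inr u \<Rightarrow> c u) *\<^sub>R (case u of Inl _ \<Rightarrow> x | Inr u \<Rightarrow> u)) \<in> ?H"
      proof (rule convex_sum)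
        have "sum (\<lambda>u. case u of Inl _ \<Rightarrow> t | Inr u \<Rightarrow> c u) (Inl ` {()} \<union> Inr ` T') = t + (\<Sum>u\<in>T'. c u)"
          using fT' by (subst sum.union_disjoint) (auto simp: sum.reindex)
        then show "sum (\<lambda>u. case u of Inl _ \<Rightarrow> t | Inr u \<Rightarrow> c u) (Inl ` {()} \<union> Inr ` T') = 1" by (simp add: s)
      qed (use fT' t0 c0 in \<open>auto simp: T'_def intro: hull_inc\<close>)
      also have "(\<Sum>u\<in>Inl ` {()} \<union> Inr ` T'. (case u of Inl _ \<Rightarrow> t | Inr u \<Rightarrow> c u) *\<^sub>R (case u of Inl _ \<Rightarrow> x | Inr u \<Rightarrow> u))
        = t *\<^sub>R x + (\<Sum>u\<in>T'. c u *\<^sub>R u)"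
        using fT' by (subst sum.union_disjoint) (auto simp: sum.reindex)
      finally show ?thesis by (simp add: s)
    qed
    have "card T' = card T - 2" unfolding T'_def using v w T(1) by (subst card_Diff_subset) auto
    then have "card (insert x T') \<le> DIM('a)" using cT fT' card_insert_le_m1[of "DIM('a)" T' x] by simp
    then show False using no[of "insert x T'"] hull fT' x T(2) by (auto simp: T'_def)
  qed
  have "card T \<noteq> 0" "card T \<noteq> 1" using cT by auto
  then obtain v where v: "v \<in> T" by fastforce
  have "card (T - {v}) \<noteq> 0" using v T(1) cT by simp
  then obtain w where w: "w \<in> T" "w \<noteq> v" by (metis DiffE card.empty ex_in_conv singletonI)
  have "open (\<Union>u\<in>T - {v}. U u)" using Uo by blast
  moreover have "S \<subseteq> U v \<union> (\<Union>u\<in>T - {v}. U u)" using cov by blast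
  moreover have "U v \<inter> (\<Union>u\<in>T - {v}. U u) \<inter> S = {}"
  proof -
    have False if "x \<in> U v" "x \<in> U u" "u \<in> T - {v}" for x u
    proof -
      have "r u x < r v x" "r v x < r u x" using that v by (auto simp: U_def)
      then show False by simp
    qed
    then show ?thesis by blast
  qed
  moreover have "U v \<inter> S \<noteq> {}" "(\<Union>u\<in>T - {v}. U u) \<inter> S \<noteq> {}" using TU v w T(2) by blast+
  ultimately show False using S Uo[of v] unfolding connected_def by blast
qed

text \<open>Where the cell probability v vanishes the logarithmic factors may blow up, but each only
  like v ^ (-1/4); the product with v is then at most K^2 sqrt v and tends to 0. The exponent 1/4
  leaves room for two such factors.\<close>

lemma continuous_on_entropy_term:
  fixes v f g :: "'a::t2_space \<Rightarrow> real"
  assumes v: "continuous_on D v" "\<And>x. x \<in> D \<Longrightarrow> 0 \<le> v x"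
    and f: "\<And>x. x \<in> D \<Longrightarrow> 0 < v x \<Longrightarrow> \<bar>f x\<bar> \<le> K * v x powr (- 1/4)" "\<And>x. x \<in> D \<Longrightarrow> 0 < v x \<Longrightarrow> continuous (at x within D) f"
    and g: "\<And>x. x \<in> D \<Longrightarrow> 0 < v x \<Longrightarrow> \<bar>g x\<bar> \<le> K * v x powr (- 1/4)" "\<And>x. x \<in> D \<Longrightarrow> 0 < v x \<Longrightarrow> continuous (at x within D) g"
  shows "continuous_on D (\<lambda>x. v x * f x * g x)"
  unfolding continuous_on_eq_continuous_within
proof
  fix x assume x: "x \<in> D"
  have vc: "continuous (at x within D) v" using v(1) x by (simp add: continuous_on_eq_continuous_within)
  show "continuous (at x within D) (\<lambda>x. v x * f x * g x)"
  proof (cases "0 < v x")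
    case True
    then show ?thesis by (intro continuous_intros vc f(2) g(2) x)
  next
    case False
    then have v0: "v x = 0" using v(2)[OF x] by simp
    have bd: "norm (v y * f y * g y) \<le> K\<^sup>2 * sqrt (v y)" if y: "y \<in> D" for y
    proof (cases "0 < v y")
      case True
      have K: "0 \<le> K"
      proof -
        have "0 \<le> K * v y powr (- 1/4)" using f(1)[OF y True] by linarith
        then show ?thesis using True by (simp add: zero_le_mult_iff)
      qed
      have "\<bar>f y\<bar> * \<bar>g y\<bar> \<le> (K * v y powr (- 1/4)) * (K * v y powr (- 1/4))"
        using f(1)[OF y True] g(1)[OF y True] K by (intro mult_mono) auto
      also have "\<dots> = K\<^sup>2 * v y powr (- 1/2)"
        by (simp add: power2_eq_square powr_add[symmetric] mult_ac)
      finally have "v y * (\<bar>f y\<bar> * \<bar>g y\<bar>) \<le> v y * (K\<^sup>2 * v y powr (- 1/2))" using True by (intro mult_left_mono) auto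
      also have "\<dots> = K\<^sup>2 * (v y powr 1 * v y powr (- 1/2))" using True by simp
      also have "\<dots> = K\<^sup>2 * sqrt (v y)" unfolding powr_add[symmetric] using True by (simp add: powr_half_sqrt)
      finally show ?thesis using True by (simp add: abs_mult mult.assoc)
    next
      case False
      then show ?thesis using v(2)[OF y] by simp
    qed
    have "((\<lambda>y. K\<^sup>2 * sqrt (v y)) \<longlongrightarrow> K\<^sup>2 * sqrt (v x)) (at x within D)"
      using vc unfolding continuous_within by (intro tendsto_intros)
    then have "((\<lambda>y. K\<^sup>2 * sqrt (v y)) \<longlongrightarrow> 0) (at x within D)" by (simp add: v0)
    then have "((\<lambda>x. v x * f x * g x) \<longlongrightarrow> 0) (at x within D)"
      by (rule Lim_null_comparison[rotated]) (use bd in \<open>auto simp: eventually_at_filter\<close>)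
    then show ?thesis by (simp add: continuous_within v0)
  qed
qed

text \<open>The ratio lies between v and 1 / v, and ln x \<le> x^a / a with a = 1/4.\<close>

lemma abs_log_ratio_le:
  assumes v: "0 < v" and d: "v \<le> d" "d \<le> 1" and w: "v \<le> w" "w \<le> 1"
  shows "\<bar>log 2 (w / d)\<bar> \<le> 4 / ln 2 * v powr (- 1/4)"
proof -
  have d0: "0 < d" and w0: "0 < w" using v d w by linarith+
  have v1: "v \<le> 1" using d by linarith
  have "v * d \<le> v * 1" using v d by (intro mult_left_mono) auto
  then have "v \<le> w / d" using w d0 by (simp add: field_simps)
  then have 1: "log 2 v \<le> log 2 (w / d)" using v w0 d0 by (subst log_le_cancel_iff) auto
  have "w / d \<le> 1 / v"
  proof -
    have "w * v \<le> 1 * d" using w v d by (intro mult_mono) auto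
    then show ?thesis using v d0 by (simp add: field_simps)
  qed
  then have 2: "log 2 (w / d) \<le> log 2 (1 / v)" using v w0 d0 by (subst log_le_cancel_iff) auto
  have 3: "log 2 (1 / v) = - log 2 v" using v by (simp add: log_divide)
  have "ln (1 / v) \<le> (1 / v) powr (1/4) / (1/4)" by (rule ln_powr_bound) (use v v1 in auto)
  then have "log 2 (1 / v) \<le> (1 / v) powr (1/4) / (1/4) / ln 2" unfolding log_def by (intro divide_right_mono) auto
  also have "\<dots> = 4 / ln 2 * v powr (- 1/4)" using v by (simp add: powr_divide powr_minus_divide)
  finally have "log 2 (1 / v) \<le> 4 / ln 2 * v powr (- 1/4)" .
  then show ?thesis using 1 2 unfolding 3 by (simp add: abs_le_iff)
qed

section \<open>Moments as continuous functions of the input distributions\<close>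

text \<open>Kept as pairs and not multiplied out: pairs form a convex, hence connected set, which
  product distributions in general do not.\<close>

definition input_dists :: "((real^'x1::finite) \<times> (real^'x2::finite)) set" where
  "input_dists = {(a, b). (\<forall>x. 0 \<le> a $ x) \<and> sum (($) a) UNIV = 1 \<and> (\<forall>x. 0 \<le> b $ x) \<and> sum (($) b) UNIV = 1}"

definition cell :: "('x1::finite \<Rightarrow> 'x2::finite \<Rightarrow> 'y::finite \<Rightarrow> real) \<Rightarrow> 'x1 \<times> 'x2 \<times> 'y \<Rightarrow> (real^'x1) \<times> (real^'x2) \<Rightarrow> real" where
  "cell W = (\<lambda>(x1, x2, y) (a, b). a $ x1 * b $ x2 * W x1 x2 y)"

text \<open>The letter 0 is a dummy: the information density sees the time-sharing letter only
  through the input distributions attached to it.\<close>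

definition cell_info :: "('x1::finite \<Rightarrow> 'x2::finite \<Rightarrow> 'y::finite \<Rightarrow> real) \<Rightarrow> 'x1 \<times> 'x2 \<times> 'y \<Rightarrow> (real^'x1) \<times> (real^'x2) \<Rightarrow> real^3" where
  "cell_info W i = (\<lambda>(a, b). info_density W (\<lambda>_. ($) a) (\<lambda>_. ($) b) (0, i))"

definition moment1 :: "('x1::finite \<Rightarrow> 'x2::finite \<Rightarrow> 'y::finite \<Rightarrow> real) \<Rightarrow> 3 \<Rightarrow> (real^'x1) \<times> (real^'x2) \<Rightarrow> real" where
  "moment1 W s x = (\<Sum>i\<in>UNIV. cell W i x * cell_info W i x $ s)"

definition moment2 :: "('x1::finite \<Rightarrow> 'x2::finite \<Rightarrow> 'y::finite \<Rightarrow> real) \<Rightarrow> 3 \<Rightarrow> 3 \<Rightarrow> (real^'x1) \<times> (real^'x2) \<Rightarrow> real" where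
  "moment2 W s t x = (\<Sum>i\<in>UNIV. cell W i x * cell_info W i x $ s * cell_info W i x $ t)"

lemma cell_denominators:
  fixes W :: "'x1::finite \<Rightarrow> 'x2::finite \<Rightarrow> 'y::finite \<Rightarrow> real" and x1 :: 'x1 and x2 :: 'x2 and y :: 'y
  assumes W: "stochastic_MAC W" and ab: "(a, b) \<in> input_dists"
  defines "v \<equiv> a $ x1 * b $ x2 * W x1 x2 y"
  shows "v \<le> (\<Sum>x\<in>UNIV. a $ x * W x x2 y)" "(\<Sum>x\<in>UNIV. a $ x * W x x2 y) \<le> 1"
    "v \<le> (\<Sum>x\<in>UNIV. b $ x * W x1 x y)" "(\<Sum>x\<in>UNIV. b $ x * W x1 x y) \<le> 1"
    "v \<le> (\<Sum>x\<in>UNIV. \<Sum>z\<in>UNIV. a $ x * b $ z * W x z y)" "(\<Sum>x\<in>UNIV. \<Sum>z\<in>UNIV. a $ x * b $ z * W x z y) \<le> 1"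
    "0 \<le> v" "v \<le> W x1 x2 y" "W x1 x2 y \<le> 1"
proof -
  have W0: "0 \<le> W a b y" for a b y using W by (simp add: stochastic_MAC_def)
  have W1: "W a b y \<le> 1" for a b y
  proof -
    have "W a b y \<le> (\<Sum>y\<in>UNIV. W a b y)" by (rule member_le_sum) (use W0 in auto)
    then show ?thesis using W by (simp add: stochastic_MAC_def)
  qed
  have p: "0 \<le> a $ x" "0 \<le> b $ z" "(\<Sum>x\<in>UNIV. a $ x) = 1" "(\<Sum>x\<in>UNIV. b $ x) = 1" for x z
    using ab by (auto simp: input_dists_def)
  have p1: "a $ x \<le> 1" "b $ z \<le> 1" for x z
    using member_le_sum[of x UNIV "($) a"] member_le_sum[of z UNIV "($) b"] p by auto
  have avg: "(\<Sum>x\<in>UNIV. c x * f x) \<le> 1" if "\<And>x. 0 \<le> c x" "sum c UNIV = 1" "\<And>x. f x \<le> 1" for c f :: "_::finite \<Rightarrow> real"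
  proof -
    have "(\<Sum>x\<in>UNIV. c x * f x) \<le> (\<Sum>x\<in>UNIV. c x * 1)" by (intro sum_mono mult_left_mono that)
    then show ?thesis by (simp add: that)
  qed
  have le: "a $ x1 * W x1 x2 y \<le> (\<Sum>x\<in>UNIV. a $ x * W x x2 y)" "b $ x2 * W x1 x2 y \<le> (\<Sum>x\<in>UNIV. b $ x * W x1 x y)"
    "b $ x2 * W x1 x2 y \<le> (\<Sum>z\<in>UNIV. b $ z * W x1 z y)"
    by (rule member_le_sum; use p W0 in \<open>auto\<close>)+
  have "v \<le> a $ x1 * 1 * W x1 x2 y" unfolding v_def using p p1 W0 by (intro mult_right_mono mult_left_mono) auto
  then show "v \<le> (\<Sum>x\<in>UNIV. a $ x * W x x2 y)" using le by simp
  have "v \<le> 1 * b $ x2 * W x1 x2 y" unfolding v_def using p p1 W0 by (intro mult_right_mono) auto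
  then show "v \<le> (\<Sum>x\<in>UNIV. b $ x * W x1 x y)" using le by simp
  have eq: "(\<Sum>x\<in>UNIV. \<Sum>z\<in>UNIV. a $ x * b $ z * W x z y) = (\<Sum>x\<in>UNIV. a $ x * (\<Sum>z\<in>UNIV. b $ z * W x z y))"
    by (simp add: sum_distrib_left mult.assoc)
  have "v = a $ x1 * (b $ x2 * W x1 x2 y)" by (simp add: v_def)
  also have "\<dots> \<le> a $ x1 * (\<Sum>z\<in>UNIV. b $ z * W x1 z y)" using le p by (intro mult_left_mono) auto
  also have "\<dots> \<le> (\<Sum>x\<in>UNIV. a $ x * (\<Sum>z\<in>UNIV. b $ z * W x z y))"
    by (rule member_le_sum) (use p W0 in \<open>auto intro!: mult_nonneg_nonneg sum_nonneg\<close>)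
  finally show "v \<le> (\<Sum>x\<in>UNIV. \<Sum>z\<in>UNIV. a $ x * b $ z * W x z y)" unfolding eq .
  show "(\<Sum>x\<in>UNIV. a $ x * W x x2 y) \<le> 1" "(\<Sum>x\<in>UNIV. b $ x * W x1 x y) \<le> 1" "(\<Sum>x\<in>UNIV. \<Sum>z\<in>UNIV. a $ x * b $ z * W x z y) \<le> 1"
    unfolding eq by (intro avg p W1)+
  show "0 \<le> v" using p W0 by (simp add: v_def)
  have "a $ x1 * b $ x2 \<le> 1 * 1" using p p1 by (intro mult_mono) auto
  then show "v \<le> W x1 x2 y" using mult_right_mono[of "a $ x1 * b $ x2" 1 "W x1 x2 y"] W0 by (simp add: v_def)
  show "W x1 x2 y \<le> 1" by (rule W1)
qed

lemma continuous_log_ratio: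
  fixes d :: "'a::t2_space \<Rightarrow> real"
  assumes "continuous (at x within D) d" "0 < w" "0 < d x"
  shows "continuous (at x within D) (\<lambda>x. log 2 (w / d x))"
  using assms unfolding continuous_within by (intro tendsto_log tendsto_divide tendsto_const) auto

lemma cell_info_props:
  assumes W: "stochastic_MAC W" and x: "x \<in> input_dists" and v: "0 < cell W i x"
  shows "\<bar>cell_info W i x $ s\<bar> \<le> 4 / ln 2 * cell W i x powr (- 1/4) \<and>
    continuous (at x within input_dists) (\<lambda>x. cell_info W i x $ s)"
proof -
  obtain x1 x2 y where i: "i = (x1, x2, y)" by (cases i) auto
  obtain a b where ab: "x = (a, b)" by (cases x)
  note d = cell_denominators[OF W x[unfolded ab]]
  have v': "0 < a $ x1 * b $ x2 * W x1 x2 y" using v by (simp add: cell_def i ab)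
  have w: "0 < W x1 x2 y" using v' d(8)[of x1 x2 y] by linarith
  note pos = less_le_trans[OF v' d(1)] less_le_trans[OF v' d(3)] less_le_trans[OF v' d(5)]
  have c: "continuous (at x within input_dists) (\<lambda>x. \<Sum>a\<in>UNIV. fst x $ a * W a x2 y)"
    "continuous (at x within input_dists) (\<lambda>x. \<Sum>b\<in>UNIV. snd x $ b * W x1 b y)"
    "continuous (at x within input_dists) (\<lambda>x. \<Sum>a\<in>UNIV. \<Sum>b\<in>UNIV. fst x $ a * snd x $ b * W a b y)"
    by (rule continuous_on_eq_continuous_within[THEN iffD1, rule_format, OF _ x]; intro continuous_intros)+
  have "\<forall>s. \<bar>cell_info W i x $ s\<bar> \<le> 4 / ln 2 * cell W i x powr (- 1/4)"
    unfolding forall_3 cell_info_def info_density_def Let_def prod.case vector_3 i ab cell_def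
    by (intro conjI abs_log_ratio_le v' d)
  moreover have "\<forall>s. continuous (at x within input_dists) (\<lambda>x. cell_info W i x $ s)"
    unfolding forall_3 cell_info_def info_density_def Let_def prod.case vector_3 i case_prod_beta
    by (intro conjI continuous_log_ratio) (use pos ab c w in simp_all)
  ultimately show ?thesis by blast
qed

lemma cell_props:
  assumes W: "stochastic_MAC W"
  shows "continuous_on input_dists (cell W i)" "x \<in> input_dists \<Longrightarrow> 0 \<le> cell W i x" "x \<in> input_dists \<Longrightarrow> cell W i x \<le> 1"
proof -
  obtain x1 x2 y where i: "i = (x1, x2, y)" by (cases i) auto
  show "continuous_on input_dists (cell W i)" unfolding cell_def i prod.case case_prod_beta by (intro continuous_intros)
  show "0 \<le> cell W i x" "cell W i x \<le> 1" if x: "x \<in> input_dists"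
  proof -
    obtain a b where ab: "x = (a, b)" by (cases x)
    show "0 \<le> cell W i x" "cell W i x \<le> 1"
      using cell_denominators(7)[OF W x[unfolded ab], of x1 x2 y] cell_denominators(8)[OF W x[unfolded ab], of x1 x2 y]
        cell_denominators(9)[OF W x[unfolded ab], of x1 x2 y] by (simp_all add: cell_def i ab)
  qed
qed

lemma continuous_on_moments:
  assumes W: "stochastic_MAC W"
  shows "continuous_on input_dists (moment1 W s)" "continuous_on input_dists (moment2 W s t)"
proof -
  \<comment> \<open>For the first moment the second factor is the constant 1, which has to satisfy
    the same growth bound.\<close>
  have one: "\<bar>1\<bar> \<le> 4 / ln 2 * cell W i x powr (- 1/4)" if x: "x \<in> input_dists" "0 < cell W i x" for i x
  proof -
    have "1 powr (1/4) \<le> (1 / cell W i x) powr (1/4)" using x cell_props(3)[OF W x(1), of i] by (intro powr_mono2) auto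
    then have "1 \<le> cell W i x powr (- 1/4)" using x by (simp add: powr_divide powr_minus_divide)
    moreover have "1 \<le> 4 / ln (2::real)" using ln_2_less_1 by (simp add: field_simps)
    ultimately have "1 * 1 \<le> 4 / ln 2 * cell W i x powr (- 1/4)" by (intro mult_mono) auto
    then show ?thesis by simp
  qed
  note b = conjunct1[OF cell_info_props[OF W]] and c = conjunct2[OF cell_info_props[OF W]]
  have "continuous_on input_dists (\<lambda>x. cell W i x * cell_info W i x $ s * 1)" for i
    by (rule continuous_on_entropy_term[OF cell_props(1,2)[OF W] b c one continuous_const])
  then show "continuous_on input_dists (moment1 W s)" unfolding moment1_def by (intro continuous_on_sum) simp
  have "continuous_on input_dists (\<lambda>x. cell W i x * cell_info W i x $ s * cell_info W i x $ t)" for i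
    by (rule continuous_on_entropy_term[OF cell_props(1,2)[OF W] b c b c])
  then show "continuous_on input_dists (moment2 W s t)" unfolding moment2_def by (intro continuous_on_sum)
qed

lemma convex_input_dists: "convex input_dists"
  by (rule convexI) (auto simp: input_dists_def sum.distrib sum_distrib_left[symmetric])

text \<open>The pairs \<open>{s, nxt3 s}\<close> are the three off-diagonal positions of a symmetric matrix.\<close>
definition nxt3 :: "3 \<Rightarrow> 3" where "nxt3 s = (if s = 1 then 2 else if s = 2 then 3 else 1)"

text \<open>Three means and six second moments. The codomain has dimension 9, and this is the bound
  on the alphabet.\<close>

definition moments :: "('x1::finite \<Rightarrow> 'x2::finite \<Rightarrow> 'y::finite \<Rightarrow> real) \<Rightarrow> (real^'x1) \<times> (real^'x2) \<Rightarrow> (real^3) \<times> (real^3) \<times> (real^3)" where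
  "moments W x = (\<chi> s. moment1 W s x, \<chi> s. moment2 W s s x, \<chi> s. moment2 W s (nxt3 s) x)"

lemma connected_moments:
  assumes W: "stochastic_MAC W"
  shows "connected (moments W ` input_dists)"
  by (rule connected_continuous_image[OF _ convex_connected[OF convex_input_dists]])
    (auto simp: moments_def[abs_def] intro!: continuous_on_Pair continuous_on_vec_lambda continuous_on_moments[OF W])

text \<open>The covariance is not an average over the time-sharing variable, but it becomes one
  after adding the product of means, which the first moments determine.\<close>

lemma Ivec_Vmat_moments:
  fixes W :: "'x1::finite \<Rightarrow> 'x2::finite \<Rightarrow> 'y::finite \<Rightarrow> real"
  assumes W: "stochastic_MAC W" and v: "valid_input Q pQ p1 p2"
  defines "A \<equiv> \<lambda>q. (vec_lambda (p1 q), vec_lambda (p2 q))"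
  shows "Ivec W Q pQ p1 p2 $ s = (\<Sum>q\<in>Q. pQ q * moment1 W s (A q))"
    and "Vmat W Q pQ p1 p2 $ s $ t = (\<Sum>q\<in>Q. pQ q * moment2 W s t (A q)) - Ivec W Q pQ p1 p2 $ s * Ivec W Q pQ p1 p2 $ t"
proof -
  let ?J = "joint W pQ p1 p2" and ?i = "info_density W p1 p2" and ?I = "Ivec W Q pQ p1 p2"
  have J: "?J (q, i) = pQ q * cell W i (A q)" for q i
    by (cases i) (simp add: joint_def cell_def A_def)
  have ii: "?i (q, i) = cell_info W i (A q)" for q i
    by (cases i) (simp add: info_density_def cell_info_def A_def)
  have jd: "(\<Sum>x\<in>jdom Q. f x) = (\<Sum>q\<in>Q. \<Sum>i\<in>UNIV. f (q, i))" for f :: "nat \<times> 'x1 \<times> 'x2 \<times> 'y \<Rightarrow> real"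
    unfolding jdom_def sum.cartesian_product by simp
  have I: "?I $ s = (\<Sum>x\<in>jdom Q. ?J x * ?i x $ s)" for s by (simp add: Ivec_def)
  show "?I $ s = (\<Sum>q\<in>Q. pQ q * moment1 W s (A q))"
    unfolding I jd J ii moment1_def sum_distrib_left mult.assoc ..
  have "Vmat W Q pQ p1 p2 $ s $ t = (\<Sum>x\<in>jdom Q. ?J x * ?i x $ s * ?i x $ t - ?I $ t * (?J x * ?i x $ s) - ?I $ s * (?J x * ?i x $ t) + ?I $ s * ?I $ t * ?J x)"
    unfolding Vmat_def by (simp add: algebra_simps)
  also have "\<dots> = (\<Sum>x\<in>jdom Q. ?J x * ?i x $ s * ?i x $ t) - ?I $ t * ?I $ s - ?I $ s * ?I $ t + ?I $ s * ?I $ t * 1"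
    unfolding sum.distrib sum_subtractf sum_distrib_left[symmetric] I[symmetric] joint_sum[OF W v] ..
  also have "(\<Sum>x\<in>jdom Q. ?J x * ?i x $ s * ?i x $ t) = (\<Sum>q\<in>Q. pQ q * moment2 W s t (A q))"
    unfolding jd J ii moment2_def sum_distrib_left mult.assoc ..
  finally show "Vmat W Q pQ p1 p2 $ s $ t = (\<Sum>q\<in>Q. pQ q * moment2 W s t (A q)) - ?I $ s * ?I $ t" by simp
qed

lemma time_sharing_cardinality:
  fixes W :: "'x1::finite \<Rightarrow> 'x2::finite \<Rightarrow> 'y::finite \<Rightarrow> real"
  assumes W: "stochastic_MAC W" and v: "valid_input Q pQ p1 p2"
  shows "\<exists>Q' pQ' (p1' :: nat \<Rightarrow> 'x1 \<Rightarrow> real) (p2' :: nat \<Rightarrow> 'x2 \<Rightarrow> real).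
    valid_input Q' pQ' p1' p2' \<and> card Q' \<le> 9 \<and>
    Ivec W Q' pQ' p1' p2' = Ivec W Q pQ p1 p2 \<and> Vmat W Q' pQ' p1' p2' = Vmat W Q pQ p1 p2"
proof -
  define A where "A q = (vec_lambda (p1 q), vec_lambda (p2 q))" for q
  let ?S = "moments W ` input_dists"
  have fin: "finite Q" "Q \<noteq> {}" "\<And>q. q \<in> Q \<Longrightarrow> 0 \<le> pQ q" "sum pQ Q = 1" using v by (auto simp: valid_input_def)
  have "A q \<in> input_dists" if "q \<in> Q" for q using v that by (auto simp: valid_input_def A_def input_dists_def)
  then have "(\<Sum>q\<in>Q. pQ q *\<^sub>R moments W (A q)) \<in> convex hull ?S"
    by (intro convex_sum fin hull_inc convex_convex_hull imageI)
  from Fenchel_Bunt[OF connected_moments[OF W] this]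
  obtain T where T: "finite T" "T \<subseteq> ?S" "card T \<le> DIM((real^3) \<times> (real^3) \<times> (real^3))"
    "(\<Sum>q\<in>Q. pQ q *\<^sub>R moments W (A q)) \<in> convex hull T" by (elim exE conjE)
  obtain u where u: "\<forall>x\<in>T. 0 \<le> u x" "sum u T = 1" "(\<Sum>x\<in>T. u x *\<^sub>R x) = (\<Sum>q\<in>Q. pQ q *\<^sub>R moments W (A q))"
    using T(4) unfolding convex_hull_finite[OF T(1)] mem_Collect_eq by (elim exE conjE)
  have "\<forall>x\<in>T. \<exists>z. z \<in> input_dists \<and> moments W z = x"
  proof
    fix x assume "x \<in> T"
    then have "x \<in> ?S" using T(2) by blast
    then obtain z where "x = moments W z" "z \<in> input_dists" by (rule imageE)
    then show "\<exists>z. z \<in> input_dists \<and> moments W z = x" by (intro exI[of _ z]) simp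
  qed
  from bchoice[OF this] obtain k where k: "\<forall>x\<in>T. k x \<in> input_dists \<and> moments W (k x) = x" by (elim exE)
  \<comment> \<open>The points found are matrices of moments; numbering them gives an alphabet of
    natural numbers, and \<open>k\<close> picks input distributions realising each.\<close>
  obtain h where h: "bij_betw h {0..<card T} T" using ex_bij_betw_nat_finite[OF T(1)] by (elim exE)
  define Q' where "Q' = {0..<card T}"
  define p1' where "p1' i = ($) (fst (k (h i)))" for i
  define p2' where "p2' i = ($) (snd (k (h i)))" for i
  have hT: "h i \<in> T" if "i \<in> Q'" for i using bij_betwE[OF h] that by (simp add: Q'_def)
  have sumT: "(\<Sum>i\<in>Q'. f (h i)) = sum f T" for f :: "_ \<Rightarrow> 'z::comm_monoid_add"
    unfolding Q'_def by (rule sum.reindex_bij_betw[OF h])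
  have ne: "T \<noteq> {}" using u(2) by auto
  have v': "valid_input Q' (\<lambda>i. u (h i)) p1' p2'"
    unfolding valid_input_def
  proof (intro conjI ballI allI)
    show "finite Q'" "Q' \<noteq> {}" using ne T(1) by (auto simp: Q'_def)
    show "(\<Sum>i\<in>Q'. u (h i)) = 1" unfolding sumT u(2) ..
    fix i assume i: "i \<in> Q'"
    have "k (h i) \<in> input_dists" using k hT[OF i] by blast
    then show "0 \<le> p1' i x" "sum (p1' i) UNIV = 1" "0 \<le> p2' i z" "sum (p2' i) UNIV = 1" for x z
      by (auto simp: input_dists_def p1'_def p2'_def)
    show "0 \<le> u (h i)" using u(1) hT[OF i] by blast
  qed
  have A': "(vec_lambda (p1' i), vec_lambda (p2' i)) = k (h i)" for i by (simp add: p1'_def p2'_def)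
  have "(\<Sum>i\<in>Q'. u (h i) *\<^sub>R moments W (k (h i))) = (\<Sum>x\<in>T. u x *\<^sub>R moments W (k x))" by (rule sumT)
  also have "\<dots> = (\<Sum>x\<in>T. u x *\<^sub>R x)" using k by (intro sum.cong) auto
  finally have eq: "(\<Sum>i\<in>Q'. u (h i) *\<^sub>R moments W (k (h i))) = (\<Sum>q\<in>Q. pQ q *\<^sub>R moments W (A q))" unfolding u(3) .
  have fst_sum: "fst (sum f B) = (\<Sum>a\<in>B. fst (f a))" and snd_sum: "snd (sum f B) = (\<Sum>a\<in>B. snd (f a))"
    for f :: "_ \<Rightarrow> 'b::comm_monoid_add \<times> 'c::comm_monoid_add" and B by (induction B rule: infinite_finite_induct) auto
  have m1: "(\<Sum>i\<in>Q'. u (h i) * moment1 W s (k (h i))) = (\<Sum>q\<in>Q. pQ q * moment1 W s (A q))" for s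
    using arg_cong[OF eq, of "\<lambda>z. fst z $ s"] by (simp add: fst_sum moments_def)
  have md: "(\<Sum>i\<in>Q'. u (h i) * moment2 W s s (k (h i))) = (\<Sum>q\<in>Q. pQ q * moment2 W s s (A q))" for s
    using arg_cong[OF eq, of "\<lambda>z. fst (snd z) $ s"] by (simp add: fst_sum snd_sum moments_def)
  have mo: "(\<Sum>i\<in>Q'. u (h i) * moment2 W s (nxt3 s) (k (h i))) = (\<Sum>q\<in>Q. pQ q * moment2 W s (nxt3 s) (A q))" for s
    using arg_cong[OF eq, of "\<lambda>z. snd (snd z) $ s"] by (simp add: snd_sum moments_def)
  have sym: "moment2 W s t z = moment2 W t s z" for s t z by (simp add: moment2_def mult_ac)
  have m2: "(\<Sum>i\<in>Q'. u (h i) * moment2 W s t (k (h i))) = (\<Sum>q\<in>Q. pQ q * moment2 W s t (A q))" for s t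
  proof -
    \<comment> \<open>Up to symmetry every position is diagonal or of the form (s, nxt3 s).\<close>
    have "s = t \<or> t = nxt3 s \<or> s = nxt3 t" using exhaust_3[of s] exhaust_3[of t] by (auto simp: nxt3_def)
    then show ?thesis
    proof (elim disjE)
      assume "s = nxt3 t"
      then show ?thesis using mo[of t] by (simp only: sym[of "nxt3 t"])
    qed (use md mo in auto)
  qed
  have I: "Ivec W Q' (\<lambda>i. u (h i)) p1' p2' = Ivec W Q pQ p1 p2"
    by (simp add: vec_eq_iff Ivec_Vmat_moments(1)[OF W v'] Ivec_Vmat_moments(1)[OF W v] A' m1 A_def[symmetric])
  moreover have "Vmat W Q' (\<lambda>i. u (h i)) p1' p2' = Vmat W Q pQ p1 p2"
    by (simp add: vec_eq_iff Ivec_Vmat_moments(2)[OF W v'] Ivec_Vmat_moments(2)[OF W v] I A' m2 A_def[symmetric])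
  moreover have "card Q' \<le> 9" using T(3) by (simp add: Q'_def)
  ultimately show ?thesis using v' by (intro exI conjI)
qed

theorem theorem4:
  fixes W :: "'x1::finite \<Rightarrow> 'x2::finite \<Rightarrow> 'y::finite \<Rightarrow> real" and eps :: real
  assumes "stochastic_MAC W" and "0 < eps" and "eps < 1"
  shows "(\<exists>N. \<forall>n\<ge>N. \<forall>Q pQ (p1 :: nat \<Rightarrow> 'x1 \<Rightarrow> real) (p2 :: nat \<Rightarrow> 'x2 \<Rightarrow> real).
            valid_input Q pQ p1 p2 \<and> rank (Vmat W Q pQ p1 p2) \<ge> 1 \<longrightarrow>
            region W n eps Q pQ p1 p2 \<subseteq> C_MAC W n eps)
       \<and> (\<forall>Q pQ (p1 :: nat \<Rightarrow> 'x1 \<Rightarrow> real) (p2 :: nat \<Rightarrow> 'x2 \<Rightarrow> real). valid_input Q pQ p1 p2 \<longrightarrow>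
            (\<exists>Q' pQ' (p1' :: nat \<Rightarrow> 'x1 \<Rightarrow> real) (p2' :: nat \<Rightarrow> 'x2 \<Rightarrow> real).
               valid_input Q' pQ' p1' p2' \<and> card Q' \<le> 9 \<and>
               Ivec W Q' pQ' p1' p2' = Ivec W Q pQ p1 p2 \<and>
               Vmat W Q' pQ' p1' p2' = Vmat W Q pQ p1 p2))"
  using region_subset_C_MAC[OF assms] time_sharing_cardinality[OF assms(1)] by blast

end
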